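(* Let $n\ge1$, let $S\in C^\infty(\mathbb{R}^n\times\mathbb{R}^n)$ be real-valued, let $\psi\in C^\infty_{\mathrm{comp}}(\mathbb{R}^n\times\mathbb{R}^n)$, and for $\lambda\ge1$ let $$U_\lambda u(x)=\int_{\mathbb{R}^n}e^{i\lambda S(x,\vartheta)}\psi(x,\vartheta)u(\vartheta)\,d\vartheta .$$ Assume that $\operatorname{rank}S_{x\vartheta}\ge n-1$ and that both projections $\pi_L$ and $\pi_R$ are of finite type (each is of type at most some integer). If the density $\psi$ vanishes on the critical variety $\{(x,\vartheta):\det S_{x\vartheta}(x,\vartheta)=0\}$ so that $$|\psi(x,\vartheta)|\le c\,|\det S_{x\vartheta}(x,\vartheta)|$$ for some constant $c$, then there is a constant $C$ independent of $\lambda$ such that $$\|U_\lambda\|_{L^p\to L^p}\le C\,\lambda^{-\frac n2+n\left|\frac1p-\frac12\right|},\qquad 1\le p\le\infty .$$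
   Context: $S_{x\vartheta}$ is the matrix of mixed second derivatives of $S$. The projections are $\pi_L:(x,\vartheta)\mapsto(x,S_x(x,\vartheta))$ and $\pi_R:(x,\vartheta)\mapsto(\vartheta,S_\vartheta(x,\vartheta))$. Type of a map: let $\pi:M\to N$ be a smooth map between smooth manifolds of the same dimension, of corank at most $1$, such that $\det d\pi$ vanishes simply on the critical set $\Sigma=\{\det d\pi=0\}\subset M$ (i.e. the differential of $\det d\pi$, computed in local coordinates, is nonzero at points of $\Sigma$). Let $V$ be any smooth vector field which locally generates the kernel of $d\pi$ on $\Sigma$: $V|_\Sigma\in\ker d\pi$, $V|_\Sigma\ne0$. The type of $\pi$ at $p_0\in\Sigma$ is the smallest integer $k$ such that $V^k\det d\pi|_{p_0}\ne0$; the type of $\pi$ at $p\notin\Sigma$ is $0$. A map is of type at most $k$ if its type at every point is at most $k$. It is part of the type assumption that $\det S_{x\vartheta}$ vanishes simply on $\{\det S_{x\vartheta}=0\}$. *)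

theory Defs
  imports "HOL-Probability.Essential_Supremum"
begin

text \<open>
  On a finite-dimensional space, \<open>C_k_on X f k\<close> for open \<open>X\<close> says that \<open>f\<close> is \<open>k\<close> times continuously
  differentiable on \<open>X\<close>: all iterated directional derivatives up to order \<open>k\<close> exist and are
  continuous.
\<close>

primrec C_k_on :: "'a::real_normed_vector set \<Rightarrow> ('a \<Rightarrow> 'b::real_normed_vector) \<Rightarrow> nat \<Rightarrow> bool" where
  "C_k_on X f 0 \<longleftrightarrow> continuous_on X f"
| "C_k_on X f (Suc k) \<longleftrightarrow>
     (\<forall>x\<in>X. f differentiable (at x)) \<and>
     (\<forall>v. C_k_on X (\<lambda>x. frechet_derivative f (at x) v) k)"

definition smooth_on :: "'a::real_normed_vector set \<Rightarrow> ('a \<Rightarrow> 'b::real_normed_vector) \<Rightarrow> bool" where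
  "smooth_on X f \<longleftrightarrow> (\<forall>k. C_k_on X f k)"

text \<open>
  The Leibniz formula for the determinant of an endomorphism, with respect to the standard
  orthonormal basis. It is stated for euclidean spaces so that it applies to products
  \<open>real^'n \<times> real^'n\<close>.
\<close>

definition det_endo :: "('a::euclidean_space \<Rightarrow> 'a) \<Rightarrow> real" where
  "det_endo f =
     (\<Sum>p | p permutes Basis. of_int (sign p) * (\<Prod>b\<in>Basis. f (p b) \<bullet> b))"

lemma det_endo_eq_det_matrix:
  fixes f :: "real^'n \<Rightarrow> real^'n"
  shows "det_endo f = det (matrix f)"
proof -
  let ?a = "\<lambda>i. axis i (1::real) :: real^'n"
  let ?m = "map_permutation UNIV ?a"
  have inj: "inj ?a" by (auto simp: inj_on_def axis_eq_axis)
  have B: "(Basis :: (real^'n) set) = range ?a" by (auto simp: Basis_vec_def)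
  have bij: "bij_betw ?a UNIV Basis" using inj B by (simp add: bij_betw_def)
  have inv: "bij_betw (inv_into UNIV ?a) Basis UNIV" by (rule bij_betw_inv_into[OF bij])
  have "det_endo f = (\<Sum>p | p permutes (UNIV::'n set).
          of_int (sign (?m p)) * (\<Prod>b\<in>Basis. f (?m p b) \<bullet> b))"
    unfolding det_endo_def
  proof (rule sum.reindex_bij_witness[where j = "map_permutation Basis (inv_into UNIV ?a)" and i = ?m], goal_cases)
    case (1 p)
    show ?case
      by (rule map_permutation_compose_inv[OF inv]) (use 1 bij_betw_inv_into_right[OF bij] in auto)
  next
    case (2 p)
    then show ?case using map_permutation_permutes[OF inv] by simp
  next
    case (3 p)
    show ?case
      by (rule map_permutation_compose_inv[OF bij]) (use 3 inv_f_f[OF inj] in auto)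
  next
    case (4 p)
    then show ?case using map_permutation_permutes[OF bij] by simp
  next
    case (5 p)
    have "?m (map_permutation Basis (inv_into UNIV ?a) p) = p"
      by (rule map_permutation_compose_inv[OF inv]) (use 5 bij_betw_inv_into_right[OF bij] in auto)
    then show ?case by simp
  qed
  also have "\<dots> = (\<Sum>p | p permutes (UNIV::'n set). of_int (sign p) * (\<Prod>i\<in>UNIV. matrix f $ i $ p i))"
  proof (rule sum.cong[OF refl], goal_cases)
    case (1 p)
    have "(\<Prod>b\<in>Basis. f (?m p b) \<bullet> b) = (\<Prod>i\<in>UNIV. matrix f $ i $ p i)"
      unfolding B by (subst prod.reindex[OF inj])
        (simp add: map_permutation_apply[OF inj] matrix_def inner_axis)
    moreover have "sign (?m p) = sign p"
      using 1 inj by (subst sign_map_permutation) auto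
    ultimately show ?case by simp
  qed
  finally show ?thesis by (simp add: det_def)
qed

definition det_deriv :: "('a::euclidean_space \<Rightarrow> 'a) \<Rightarrow> 'a \<Rightarrow> real" where
  "det_deriv \<pi> x = det_endo (frechet_derivative \<pi> (at x))"

definition critical_set :: "('a::euclidean_space \<Rightarrow> 'a) \<Rightarrow> 'a set" where
  "critical_set \<pi> = {x. det_deriv \<pi> x = 0}"

definition corank_le_1 :: "('a::euclidean_space \<Rightarrow> 'a) \<Rightarrow> bool" where
  "corank_le_1 \<pi> \<longleftrightarrow> (\<forall>x. DIM('a) \<le> dim (range (frechet_derivative \<pi> (at x))) + 1)"

definition vanishes_simply :: "('a::real_normed_vector \<Rightarrow> real) \<Rightarrow> bool" where
  "vanishes_simply g \<longleftrightarrow>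
     (\<forall>x. g x = 0 \<longrightarrow> g differentiable (at x) \<and> frechet_derivative g (at x) \<noteq> (\<lambda>_. 0))"

definition lie_deriv :: "('a::real_normed_vector \<Rightarrow> 'a) \<Rightarrow> ('a \<Rightarrow> real) \<Rightarrow> 'a \<Rightarrow> real" where
  "lie_deriv V g = (\<lambda>x. frechet_derivative g (at x) (V x))"

definition kernel_field_near :: "('a::euclidean_space \<Rightarrow> 'a) \<Rightarrow> 'a \<Rightarrow> ('a \<Rightarrow> 'a) \<Rightarrow> bool" where
  "kernel_field_near \<pi> x V \<longleftrightarrow>
     (\<exists>X. open X \<and> x \<in> X \<and> smooth_on X V \<and>
        (\<forall>y\<in>X \<inter> critical_set \<pi>. frechet_derivative \<pi> (at y) (V y) = 0 \<and> V y \<noteq> 0))"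

text \<open>
  For a smooth map of corank at most 1 whose Jacobian determinant vanishes simply, a kernel field
  exists near every critical point and the order below does not depend on its choice, so
  \<open>\<exists>V\<close> may be read as ``for any'' kernel field \<open>V\<close>.
\<close>

definition has_type_at :: "('a::euclidean_space \<Rightarrow> 'a) \<Rightarrow> 'a \<Rightarrow> nat \<Rightarrow> bool" where
  "has_type_at \<pi> x k \<longleftrightarrow>
     (if x \<in> critical_set \<pi>
      then \<exists>V. kernel_field_near \<pi> x V \<and>
               (lie_deriv V ^^ k) (det_deriv \<pi>) x \<noteq> 0 \<and>
               (\<forall>j<k. (lie_deriv V ^^ j) (det_deriv \<pi>) x = 0)
      else k = 0)"

definition type_at_most :: "('a::euclidean_space \<Rightarrow> 'a) \<Rightarrow> nat \<Rightarrow> bool" where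
  "type_at_most \<pi> k \<longleftrightarrow>
     smooth_on UNIV \<pi> \<and> corank_le_1 \<pi> \<and> vanishes_simply (det_deriv \<pi>) \<and>
     (\<forall>x. \<exists>j\<le>k. has_type_at \<pi> x j)"

definition grad_x :: "((real^'n) \<times> (real^'n) \<Rightarrow> real) \<Rightarrow> (real^'n) \<times> (real^'n) \<Rightarrow> real^'n" where
  "grad_x S q = (\<chi> i. frechet_derivative S (at q) (axis i 1, 0))"

definition grad_theta :: "((real^'n) \<times> (real^'n) \<Rightarrow> real) \<Rightarrow> (real^'n) \<times> (real^'n) \<Rightarrow> real^'n" where
  "grad_theta S q = (\<chi> j. frechet_derivative S (at q) (0, axis j 1))"

definition mixed_hessian :: "((real^'n) \<times> (real^'n) \<Rightarrow> real) \<Rightarrow> (real^'n) \<times> (real^'n) \<Rightarrow> real^'n^'n" where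
  "mixed_hessian S q =
     (\<chi> i j. frechet_derivative (\<lambda>r. grad_x S r $ i) (at q) (0, axis j 1))"

definition proj_L :: "((real^'n) \<times> (real^'n) \<Rightarrow> real) \<Rightarrow> (real^'n) \<times> (real^'n) \<Rightarrow> (real^'n) \<times> (real^'n)" where
  "proj_L S q = (fst q, grad_x S q)"

definition proj_R :: "((real^'n) \<times> (real^'n) \<Rightarrow> real) \<Rightarrow> (real^'n) \<times> (real^'n) \<Rightarrow> (real^'n) \<times> (real^'n)" where
  "proj_R S q = (snd q, grad_theta S q)"

definition osc_op ::
    "((real^'n) \<times> (real^'n) \<Rightarrow> real) \<Rightarrow> ((real^'n) \<times> (real^'n) \<Rightarrow> complex) \<Rightarrow> real
      \<Rightarrow> (real^'n \<Rightarrow> complex) \<Rightarrow> real^'n \<Rightarrow> complex" where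
  "osc_op S \<psi> lam u x =
     (\<integral>\<theta>. exp (\<i> * of_real (lam * S (x, \<theta>))) * \<psi> (x, \<theta>) * u \<theta> \<partial>lborel)"

text \<open>Exponents range over \<open>ennreal\<close>, so that \<open>p = \<infinity>\<close> is included.\<close>

definition Lp_norm :: "ennreal \<Rightarrow> 'a measure \<Rightarrow> ('a \<Rightarrow> 'b::real_normed_vector) \<Rightarrow> ennreal" where
  "Lp_norm p M f =
     (if p = \<infinity> then esssup M (\<lambda>x. ennreal (norm (f x)))
      else let I = (\<integral>\<^sup>+x. ennreal (norm (f x) powr enn2real p) \<partial>M)
           in if I = \<infinity> then \<infinity> else ennreal (enn2real I powr (1 / enn2real p)))"

definition Lp_space :: "ennreal \<Rightarrow> 'a measure \<Rightarrow> ('a \<Rightarrow> 'b::real_normed_vector) set" where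
  "Lp_space p M = {f \<in> borel_measurable M. Lp_norm p M f < \<infinity>}"

text \<open>The infimum is \<open>\<infinity>\<close> if \<open>T\<close> does not map \<open>L\<^sup>p\<close> into \<open>L\<^sup>p\<close>.\<close>

definition Lp_opnorm ::
    "ennreal \<Rightarrow> 'a measure \<Rightarrow> (('a \<Rightarrow> 'b::real_normed_vector) \<Rightarrow> 'a \<Rightarrow> 'b) \<Rightarrow> ennreal" where
  "Lp_opnorm p M T =
     Inf {K. \<forall>f\<in>Lp_space p M. T f \<in> Lp_space p M \<and> Lp_norm p M (T f) \<le> K * Lp_norm p M f}"

end

(*
Put h = lam^(-1/2), so that the mixed second differences of lam * S over cells of size h are O(1), and let
wt h x t = |det S_xt(x,t)| + h, which varies by bounded factors on such cells and dominates both psi and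
h times the derivatives of psi.

Finite type, together with the simple vanishing of the determinant, bounds the number of points in each
fibre of pi_L and pi_R over a compact set (Rolle along the kernel field). By the area formula the measure of
{t. |S_x(x,t) - xi| <= r} with density |det S_xt| is then O(r^n), and since the rank is at least n - 1 the
same holds for the density |det S_xt| + h as soon as r >= h.

Decompose u into pieces u_w supported in cells of size h. Integrating by parts in the kernel of T T^*
gains arbitrary powers of 1 + |S_theta(x,w) - S_theta(x',w)| / h, so the sublevel bound on the pi_R side and
Schur's test give the weighted bound: the integral of |T u_w|^2 / wt is O(h^(2n)) times the squared norm of u_w,
together with the same bound for derivatives. The pieces T u_w are then almost orthogonal on balls of
radius h, again by integration by parts, now in x, with the sublevel bound on the pi_L side summing the
interactions. This gives the L^2 bound O(h^n); the bounds on L^1 and L^infinity are trivial, and real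
interpolation with strong endpoints keeps the constants uniform in p.
*)
theory Submission
 imports Defs
begin

text \<open>The damping is spent twice. The two amplitudes in the kernel of T T^* bring one weight
  at x and one at x'. The weight at x' is the Jacobian that turns the integral over x' into a volume
  count for pi_R; the weight at x survives and is divided out in the norm of each packet. When the
  packets are recombined this division is paid back by the sum over cells, where the weight is the
  Jacobian of pi_L. The floor h keeps the division legitimate, and its size is natural: h times a
  derivative of psi is O(h) although it need not vanish on the critical set, and a sublevel set
  whose volume is only O(r^(n-1)), since the rank may drop by one, has h times its volume O(r^n) for
  r >= h.

  The obstacle in the fibre count is that the field of the type condition spans the kernel only on
  the critical set, so its integral curves need not follow a fibre. Rolle's theorem is therefore
  applied on coordinate lines that contain the fibres, and the type condition is carried over to
  them: otherwise the determinant and all its derivatives along the kernel field would be flat along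
  such a line.\<close>

abbreviation nn_lborel :: "('a::euclidean_space \<Rightarrow> ennreal) \<Rightarrow> ennreal"  (binder "NN " 10) where
 "nn_lborel f \<equiv> integral\<^sup>N lborel f"

abbreviation int_lborel :: "('a::euclidean_space \<Rightarrow> 'b::{banach, second_countable_topology}) \<Rightarrow> 'b"  (binder "LI " 10) where
 "int_lborel f \<equiv> integral\<^sup>L lborel f"

section \<open>Smooth functions\<close>

abbreviation FD where "FD f x \<equiv> frechet_derivative f (at x)"

abbreviation expi where "expi t \<equiv> exp (\<i> * complex_of_real t)"

lemma C_k_on_cong:
 assumes "open X" "\<And>x. x \<in> X \<Longrightarrow> f x = g x"
 shows "C_k_on X f k \<longleftrightarrow> C_k_on X g k"
 using assms(2)
proof (induction k arbitrary: f g)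
 case 0
 then show ?case by (auto intro: continuous_on_cong[THEN iffD1])
next
 case (Suc k)
 have hd: "(f has_derivative D) (at x) \<longleftrightarrow> (g has_derivative D) (at x)" if "x \<in> X" for x D
  using has_derivative_transform_within_open[of f D x UNIV X g]
   has_derivative_transform_within_open[of g D x UNIV X f] assms(1) that Suc.prems by fastforce
 have "FD f x = FD g x" if "x \<in> X" for x
  unfolding frechet_derivative_def using hd[OF that] by simp
 moreover have "f differentiable at x \<longleftrightarrow> g differentiable at x" if "x \<in> X" for x
  unfolding differentiable_def using hd[OF that] by simp
 ultimately show ?case
  using Suc.IH[of "\<lambda>x. FD f x v" "\<lambda>x. FD g x v" for v] by simp
qed

lemma C_k_on_SucI:
 assumes "open X" "\<And>x. x \<in> X \<Longrightarrow> (f has_derivative f' x) (at x)" "\<And>v. C_k_on X (\<lambda>x. f' x v) k"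
 shows "C_k_on X f (Suc k)"
proof -
 have "FD f x = f' x" if "x \<in> X" for x
  using frechet_derivative_at[OF assms(2)[OF that]] by simp
 then have "C_k_on X (\<lambda>x. FD f x v) k" for v
  using assms(3)[of v] C_k_on_cong[OF assms(1), of "\<lambda>x. FD f x v" "\<lambda>x. f' x v"] by simp
 then show ?thesis using assms(2) by (auto simp: differentiable_def)
qed

lemma C_k_on_Suc_D: "C_k_on X f (Suc k) \<Longrightarrow> C_k_on X f k"
proof (induction k arbitrary: f)
 case 0
 then show ?case by (auto intro!: continuous_at_imp_continuous_on differentiable_imp_continuous_within)
next
 case (Suc k)
 show ?case using Suc.prems Suc.IH by (metis C_k_on.simps(2))
qed

lemma C_k_on_const: "C_k_on X (\<lambda>x. c) k"
proof (induction k arbitrary: c)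
 case (Suc k)
 have "FD (\<lambda>x. c) x = (\<lambda>_. 0)" for x :: 'a
  using frechet_derivative_at[of "\<lambda>x. c" "\<lambda>_. 0" x] by simp
 then show ?case using Suc.IH by simp
qed simp

lemma C_k_on_linear:
 assumes "open X" "bounded_linear L" shows "C_k_on X L k"
proof (cases k)
 case 0
 then show ?thesis using assms by (simp add: linear_continuous_on)
next
 case (Suc j)
 then show ?thesis
  using C_k_on_SucI[OF assms(1) bounded_linear_imp_has_derivative[OF assms(2)]] C_k_on_const by blast
qed

lemma C_k_on_add:
 assumes "open X" shows "C_k_on X f k \<Longrightarrow> C_k_on X g k \<Longrightarrow> C_k_on X (\<lambda>x. f x + g x) k"
proof (induction k arbitrary: f g)
 case 0 then show ?case by (auto intro: continuous_on_add)
next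
 case (Suc k)
 show ?case
  by (rule C_k_on_SucI[OF assms, of _ "\<lambda>x v. FD f x v + FD g x v"])
   (use Suc in \<open>auto intro!: has_derivative_add simp: frechet_derivative_works\<close>)
qed

lemma C_k_on_bounded_linear:
 assumes "open X" "bounded_linear L" shows "C_k_on X f k \<Longrightarrow> C_k_on X (\<lambda>x. L (f x)) k"
proof (induction k arbitrary: f)
 case 0 then show ?case using assms(2) by (auto intro: bounded_linear.continuous_on)
next
 case (Suc k)
 show ?case
  by (rule C_k_on_SucI[OF assms(1), of _ "\<lambda>x v. L (FD f x v)"])
   (use Suc in \<open>auto intro!: bounded_linear.has_derivative[OF assms(2)] simp: frechet_derivative_works\<close>)
qed

lemma C_k_on_bilinear:
 assumes "open X" "bounded_bilinear P"
 shows "C_k_on X f k \<Longrightarrow> C_k_on X g k \<Longrightarrow> C_k_on X (\<lambda>x. P (f x) (g x)) k"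
proof (induction k arbitrary: f g)
 case 0 then show ?case using assms(2) by (auto intro: bounded_bilinear.continuous_on)
next
 case (Suc k)
 show ?case
 proof (rule C_k_on_SucI[OF assms(1), of _ "\<lambda>x v. P (f x) (FD g x v) + P (FD f x v) (g x)"])
  fix x assume "x \<in> X"
  then show "((\<lambda>x. P (f x) (g x)) has_derivative
     (\<lambda>v. P (f x) (FD g x v) + P (FD f x v) (g x))) (at x)"
   using Suc.prems by (intro bounded_bilinear.FDERIV[OF assms(2)]) (auto simp: frechet_derivative_works)
 next
  fix v
  show "C_k_on X (\<lambda>x. P (f x) (FD g x v) + P (FD f x v) (g x)) k"
   using Suc.prems by (intro C_k_on_add[OF assms(1)] Suc.IH) (auto dest: C_k_on_Suc_D simp del: C_k_on.simps(2), auto)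
 qed
qed

lemma C_k_on_compose_affine:
 assumes "bounded_linear L" "open Y"
 shows "\<lbrakk>C_k_on Y f k; open X; (\<And>x. x \<in> X \<Longrightarrow> L x + c \<in> Y)\<rbrakk> \<Longrightarrow> C_k_on X (\<lambda>x. f (L x + c)) k"
proof (induction k arbitrary: f)
 case 0
 have "continuous_on X (\<lambda>x. L x + c)"
  by (intro continuous_intros linear_continuous_on assms)
 then show ?case using 0 continuous_on_compose2[of Y f X "\<lambda>x. L x + c"] by auto
next
 case (Suc k)
 show ?case
 proof (rule C_k_on_SucI[OF Suc.prems(2), of _ "\<lambda>x v. FD f (L x + c) (L v)"])
  fix x assume x: "x \<in> X"
  have "((\<lambda>x. L x + c) has_derivative L) (at x)"
   by (rule has_derivative_eq_rhs[OF has_derivative_add[OF bounded_linear_imp_has_derivative[OF assms(1)] has_derivative_const]]) auto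
  then show "((\<lambda>x. f (L x + c)) has_derivative (\<lambda>v. FD f (L x + c) (L v))) (at x)"
   using diff_chain_at[of "\<lambda>x. L x + c" L x f "FD f (L x + c)"] Suc.prems(1) Suc.prems(3)[OF x]
   by (simp add: frechet_derivative_works o_def)
 next
  fix v show "C_k_on X (\<lambda>x. FD f (L x + c) (L v)) k"
   using Suc.prems by (intro Suc.IH[of "\<lambda>y. FD f y (L v)"]) auto
 qed
qed

named_theorems smooth_intros

lemma smooth_on_const [smooth_intros]: "smooth_on X (\<lambda>x. c)"
 by (simp add: smooth_on_def C_k_on_const)

lemma smooth_on_linear: "open X \<Longrightarrow> bounded_linear L \<Longrightarrow> smooth_on X L"
 by (simp add: smooth_on_def C_k_on_linear)

lemma smooth_on_add [smooth_intros]: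
 "\<lbrakk>open X; smooth_on X f; smooth_on X g\<rbrakk> \<Longrightarrow> smooth_on X (\<lambda>x. f x + g x)"
 by (simp add: smooth_on_def C_k_on_add)

lemma smooth_on_bounded_linear:
 "\<lbrakk>open X; bounded_linear L; smooth_on X f\<rbrakk> \<Longrightarrow> smooth_on X (\<lambda>x. L (f x))"
 by (simp add: smooth_on_def C_k_on_bounded_linear)

lemma smooth_on_bilinear:
 "\<lbrakk>open X; bounded_bilinear P; smooth_on X f; smooth_on X g\<rbrakk> \<Longrightarrow> smooth_on X (\<lambda>x. P (f x) (g x))"
 by (simp add: smooth_on_def C_k_on_bilinear)

lemmas smooth_on_mult [smooth_intros] = smooth_on_bilinear[OF _ bounded_bilinear_mult]
lemmas smooth_on_scaleR [smooth_intros] = smooth_on_bilinear[OF _ bounded_bilinear_scaleR]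
lemmas smooth_on_inner [smooth_intros] = smooth_on_bilinear[OF _ bounded_bilinear_inner]

lemma smooth_on_minus [smooth_intros]:
 "open X \<Longrightarrow> smooth_on X f \<Longrightarrow> smooth_on X (\<lambda>x. - f x)"
 using smooth_on_bounded_linear[of X "\<lambda>x. - x" f] bounded_linear_minus[OF bounded_linear_ident] by blast

lemma smooth_on_diff [smooth_intros]:
 "\<lbrakk>open X; smooth_on X f; smooth_on X g\<rbrakk> \<Longrightarrow> smooth_on X (\<lambda>x. f x - g x)"
 using smooth_on_add[of X f "\<lambda>x. - g x"] smooth_on_minus[of X g] by simp

lemma smooth_on_sum [smooth_intros]:
 "open X \<Longrightarrow> (\<And>i. i \<in> I \<Longrightarrow> smooth_on X (f i)) \<Longrightarrow> smooth_on X (\<lambda>x. \<Sum>i\<in>I. f i x)"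
 by (induction I rule: infinite_finite_induct) (auto intro: smooth_intros)

lemma smooth_on_prod [smooth_intros]:
 fixes f :: "'i \<Rightarrow> 'a::real_normed_vector \<Rightarrow> 'b::{real_normed_algebra,comm_ring_1}"
 shows "open X \<Longrightarrow> (\<And>i. i \<in> I \<Longrightarrow> smooth_on X (f i)) \<Longrightarrow> smooth_on X (\<lambda>x. \<Prod>i\<in>I. f i x)"
 by (induction I rule: infinite_finite_induct) (auto intro: smooth_intros)

lemma smooth_on_compose_affine:
 "bounded_linear L \<Longrightarrow> smooth_on UNIV f \<Longrightarrow> smooth_on UNIV (\<lambda>x. f (L x + c))"
 using C_k_on_compose_affine[of L UNIV f _ UNIV c] by (simp add: smooth_on_def)

lemma smooth_on_compose_linear: "bounded_linear L \<Longrightarrow> smooth_on UNIV f \<Longrightarrow> smooth_on UNIV (\<lambda>x. f (L x))"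
 using smooth_on_compose_affine[of L f 0] by simp

lemma smooth_on_frechet_derivative [smooth_intros]:
 "smooth_on X f \<Longrightarrow> smooth_on X (\<lambda>x. FD f x v)"
 unfolding smooth_on_def by (metis C_k_on.simps(2))

lemma smooth_on_continuous: "smooth_on X f \<Longrightarrow> continuous_on X f"
 unfolding smooth_on_def by (metis C_k_on.simps(1))

lemma smooth_on_has_derivative:
 "smooth_on X f \<Longrightarrow> x \<in> X \<Longrightarrow> (f has_derivative FD f x) (at x)"
 unfolding smooth_on_def frechet_derivative_works[symmetric] by (metis C_k_on.simps(2))

lemma smooth_on_cong: "open X \<Longrightarrow> (\<And>x. x \<in> X \<Longrightarrow> f x = g x) \<Longrightarrow> smooth_on X f \<longleftrightarrow> smooth_on X g"
 unfolding smooth_on_def using C_k_on_cong by metis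

lemma smooth_on_subset: "smooth_on Y f \<Longrightarrow> X \<subseteq> Y \<Longrightarrow> smooth_on X f"
proof -
 have "C_k_on Y f k \<Longrightarrow> X \<subseteq> Y \<Longrightarrow> C_k_on X f k" for k
  by (induction k arbitrary: f) (auto intro: continuous_on_subset)
 then show "smooth_on Y f \<Longrightarrow> X \<subseteq> Y \<Longrightarrow> smooth_on X f" by (auto simp: smooth_on_def)
qed

text \<open>Smoothness is defined by derivatives in fixed directions. Expanding \<open>V x\<close>
  in the basis reduces a variable direction to finitely many fixed ones, which makes iterated Lie
  derivatives smooth.\<close>

lemma smooth_on_frechet_derivative_field [smooth_intros]:
 fixes f :: "'a::euclidean_space \<Rightarrow> 'b::real_normed_vector"
 assumes "open X" "smooth_on X f" "smooth_on X V"
 shows "smooth_on X (\<lambda>x. FD f x (V x))"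
proof -
 have "FD f x (V x) = (\<Sum>b\<in>Basis. (V x \<bullet> b) *\<^sub>R FD f x b)" if "x \<in> X" for x
 proof -
  interpret linear "FD f x"
   using has_derivative_linear[OF smooth_on_has_derivative[OF assms(2) that]] .
  show ?thesis by (subst euclidean_representation[of "V x", symmetric]) (simp add: sum scaleR del: euclidean_representation)
 qed
 moreover have "smooth_on X (\<lambda>x. \<Sum>b\<in>Basis. (V x \<bullet> b) *\<^sub>R FD f x b)"
  using assms by (intro smooth_intros)
 ultimately show ?thesis
  using smooth_on_cong[OF assms(1), of "\<lambda>x. FD f x (V x)"
   "\<lambda>x. \<Sum>b\<in>Basis. (V x \<bullet> b) *\<^sub>R FD f x b"] by simp
qed

text \<open>Continuity in operator norm is what the inverse function theorem and mean value
  estimates on compact sets ask for; in finite dimension it follows from continuity on basis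
  vectors.\<close>

lemma frechet_derivative_continuous_blinfun:
 fixes f :: "'a::euclidean_space \<Rightarrow> 'b::real_normed_vector"
 assumes "open X" "smooth_on X f"
 shows "continuous_on X (\<lambda>x. Blinfun (FD f x))"
proof (rule continuous_on_blinfun_componentwise)
 fix i :: 'a assume "i \<in> Basis"
 have "bounded_linear (FD f x)" if "x \<in> X" for x
  using has_derivative_bounded_linear[OF smooth_on_has_derivative[OF assms(2) that]] .
 then have "blinfun_apply (Blinfun (FD f x)) i = FD f x i" if "x \<in> X" for x
  using that by (simp add: bounded_linear_Blinfun_apply)
 then show "continuous_on X (\<lambda>x. blinfun_apply (Blinfun (FD f x)) i)"
  using smooth_on_continuous[OF smooth_on_frechet_derivative[OF assms(2)], of i] by (simp cong: continuous_on_cong)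
qed

text \<open>The derivative of \<open>inverse f\<close> contains \<open>inverse f\<close> itself as a
  factor, so the order already reached for it is raised by one at each step of the
  induction.\<close>

lemma C_k_on_inverse:
 fixes f :: "'a::real_normed_vector \<Rightarrow> real"
 assumes "open X" "\<And>x. x \<in> X \<Longrightarrow> f x \<noteq> 0"
 shows "C_k_on X f k \<Longrightarrow> C_k_on X (\<lambda>x. inverse (f x)) k"
proof (induction k)
 case 0 then show ?case using assms by (auto intro: continuous_on_inverse)
next
 case (Suc k)
 have k: "C_k_on X (\<lambda>x. inverse (f x)) k" using Suc by (meson C_k_on_Suc_D)
 show ?case
 proof (rule C_k_on_SucI[OF assms(1), of _ "\<lambda>x v. (- 1) * (inverse (f x) * FD f x v * inverse (f x))"])
  fix x assume x: "x \<in> X"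
  have "(f has_derivative FD f x) (at x)"
   using Suc.prems x by (simp add: frechet_derivative_works)
  from Deriv.has_derivative_inverse[OF assms(2)[OF x] this]
  show "((\<lambda>x. inverse (f x)) has_derivative (\<lambda>v. (- 1) * (inverse (f x) * FD f x v * inverse (f x)))) (at x)"
   by simp
 next
  fix v
  show "C_k_on X (\<lambda>x. (- 1) * (inverse (f x) * FD f x v * inverse (f x))) k"
   using Suc.prems k by (intro C_k_on_bilinear[OF assms(1) bounded_bilinear_mult] C_k_on_const) auto
 qed
qed

lemma smooth_on_inverse [smooth_intros]:
 fixes f :: "'a::real_normed_vector \<Rightarrow> real"
 shows "\<lbrakk>open X; (\<And>x. x \<in> X \<Longrightarrow> f x \<noteq> 0); smooth_on X f\<rbrakk> \<Longrightarrow> smooth_on X (\<lambda>x. inverse (f x))"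
 by (simp add: smooth_on_def C_k_on_inverse)

section \<open>Determinants of endomorphisms\<close>

text \<open>The enumeration \<open>e\<close> of the basis is arbitrary because the maps to be
  studied live on a product space, whose basis is indexed by the sum type
  \<open>'n + 'n\<close>.\<close>

lemma det_endo_eq_det:
 fixes f :: "'a::euclidean_space \<Rightarrow> 'a" and e :: "'b::finite \<Rightarrow> 'a"
 assumes bij: "bij_betw e UNIV Basis"
 shows "det_endo f = det (\<chi> i j. f (e j) \<bullet> e i)"
proof -
 let ?m = "map_permutation UNIV e"
 have inj: "inj e" and B: "Basis = range e" using bij by (auto simp: bij_betw_def)
 have inv: "bij_betw (inv_into UNIV e) Basis UNIV" by (rule bij_betw_inv_into[OF bij])
 have "det_endo f = (\<Sum>p | p permutes (UNIV::'b set).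
     of_int (sign (?m p)) * (\<Prod>b\<in>Basis. f (?m p b) \<bullet> b))"
  unfolding det_endo_def
 proof (rule sum.reindex_bij_witness[where j = "map_permutation Basis (inv_into UNIV e)" and i = ?m], goal_cases)
  case (1 p)
  show ?case
   by (rule map_permutation_compose_inv[OF inv]) (use 1 bij_betw_inv_into_right[OF bij] in auto)
 next
  case (2 p)
  then show ?case using map_permutation_permutes[OF inv] by simp
 next
  case (3 p)
  show ?case
   by (rule map_permutation_compose_inv[OF bij]) (use 3 inv_f_f[OF inj] in auto)
 next
  case (4 p)
  then show ?case using map_permutation_permutes[OF bij] by simp
 next
  case (5 p)
  have "?m (map_permutation Basis (inv_into UNIV e) p) = p"
   by (rule map_permutation_compose_inv[OF inv]) (use 5 bij_betw_inv_into_right[OF bij] in auto)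
  then show ?case by simp
 qed
 also have "\<dots> = (\<Sum>p | p permutes (UNIV::'b set). of_int (sign p) * (\<Prod>i\<in>UNIV. (\<chi> i j. f (e j) \<bullet> e i) $ i $ p i))"
 proof (rule sum.cong[OF refl], goal_cases)
  case (1 p)
  have "(\<Prod>b\<in>Basis. f (?m p b) \<bullet> b) = (\<Prod>i\<in>UNIV. (\<chi> i j. f (e j) \<bullet> e i) $ i $ p i)"
   unfolding B by (subst prod.reindex[OF inj]) (simp add: map_permutation_apply[OF inj])
  moreover have "sign (?m p) = sign p"
   using 1 inj by (subst sign_map_permutation) auto
  ultimately show ?case by simp
 qed
 finally show ?thesis by (simp add: det_def)
qed

lemma matrix_of_endo_mult:
 fixes f :: "'a::euclidean_space \<Rightarrow> 'a" and e :: "'b::finite \<Rightarrow> 'a"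
 assumes bij: "bij_betw e UNIV Basis" and "linear f"
 shows "(\<chi> i j. f (e j) \<bullet> e i) *v (\<chi> i. v \<bullet> e i) = (\<chi> i. f v \<bullet> e i)"
proof -
 have inj: "inj e" and B: "Basis = range e" using bij by (auto simp: bij_betw_def)
 have "f v = (\<Sum>b\<in>Basis. (v \<bullet> b) *\<^sub>R f b)"
  using \<open>linear f\<close> by (subst euclidean_representation[of v, symmetric]) (simp add: linear_sum linear_scale del: euclidean_representation)
 also have "\<dots> = (\<Sum>j\<in>UNIV. (v \<bullet> e j) *\<^sub>R f (e j))"
  unfolding B by (simp add: sum.reindex[OF inj])
 finally show ?thesis
  by (simp add: vec_eq_iff matrix_vector_mult_def inner_sum_left mult.commute)
qed

text \<open>This is Cramer's rule without division by the determinant, so it also covers singular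
  \<open>f\<close>. Both the adjugate and the quantitative injectivity below come from it.\<close>

lemma cramer_det_endo:
 fixes f :: "'a::euclidean_space \<Rightarrow> 'a" and e :: "'b::finite \<Rightarrow> 'a"
 assumes bij: "bij_betw e UNIV Basis" and "linear f" "b \<in> Basis"
 shows "det_endo (f(b := f v)) = (v \<bullet> b) * det_endo f"
proof -
 obtain k where k: "b = e k" using bij \<open>b \<in> Basis\<close> by (auto simp: bij_betw_def)
 have inj: "inj e" using bij by (auto simp: bij_betw_def)
 let ?A = "\<chi> i j. f (e j) \<bullet> e i"
 have "(\<chi> i j. (f(b := f v)) (e j) \<bullet> e i) = (\<chi> i j. if j = k then (?A *v (\<chi> i. v \<bullet> e i)) $ i else ?A $ i $ j)"
  using inj by (simp add: vec_eq_iff matrix_of_endo_mult[OF bij \<open>linear f\<close>] k inj_eq)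
 then show ?thesis
  using cramer_lemma[of k ?A "\<chi> i. v \<bullet> e i"] by (simp add: det_endo_eq_det[OF bij] k)
qed

lemma det_endo_nonzero:
 fixes f :: "'a::euclidean_space \<Rightarrow> 'a" and e :: "'b::finite \<Rightarrow> 'a"
 assumes bij: "bij_betw e UNIV Basis" and "linear f" and inj: "\<And>v. f v = 0 \<Longrightarrow> v = 0"
 shows "det_endo f \<noteq> 0"
proof -
 let ?A = "\<chi> i j. f (e j) \<bullet> e i"
 have ie: "inj e" and B: "Basis = range e" using bij by (auto simp: bij_betw_def)
 have "x = 0" if "?A *v x = 0" for x
 proof -
  define v where "v = (\<Sum>j\<in>UNIV. (x $ j) *\<^sub>R e j)"
  have eb: "e i \<bullet> e j = (if i = j then 1 else 0)" for i j
   using inner_Basis[of "e i" "e j"] B inj_eq[OF ie, of i j] by (metis rangeI)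
  have ve: "v \<bullet> e i = x $ i" for i
   unfolding v_def inner_sum_left by (simp add: eb if_distrib cong: if_cong)
  have "(\<chi> i. f v \<bullet> e i) = 0"
   using matrix_of_endo_mult[OF bij \<open>linear f\<close>, of v] that by (simp add: ve)
  then have "f v \<bullet> b = 0" if "b \<in> Basis" for b
   using that B unfolding vec_eq_iff by (metis rangeE vec_lambda_beta zero_index)
  then have "v = 0" using inj by (metis euclidean_all_zero_iff)
  then show "x = 0" using ve by (auto simp: vec_eq_iff)
 qed
 then have "invertible ?A"
  using matrix_left_invertible_ker[of ?A] by (metis invertible_left_inverse)
 then show ?thesis by (simp add: det_endo_eq_det[OF bij] invertible_det_nz)
qed

lemma det_endo_bound:
 fixes f :: "'a::euclidean_space \<Rightarrow> 'a"
 shows "\<bar>det_endo f\<bar> \<le> fact DIM('a) * (\<Prod>b\<in>Basis. norm (f b))"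
proof -
 have "\<bar>det_endo f\<bar> \<le> (\<Sum>p | p permutes (Basis::'a set). \<bar>of_int (sign p) * (\<Prod>b\<in>Basis. f (p b) \<bullet> b)\<bar>)"
  unfolding det_endo_def by (rule sum_abs)
 also have "\<dots> \<le> (\<Sum>p | p permutes (Basis::'a set). (\<Prod>b\<in>Basis. norm (f b)))"
 proof (rule sum_mono)
  fix p assume p: "p \<in> {p. p permutes (Basis::'a set)}"
  have "\<bar>of_int (sign p) * (\<Prod>b\<in>Basis. f (p b) \<bullet> b)\<bar> = (\<Prod>b\<in>Basis. \<bar>f (p b) \<bullet> b\<bar>)"
   by (simp add: abs_mult abs_prod sign_def)
  also have "\<dots> \<le> (\<Prod>b\<in>Basis. norm (f (p b)))"
   by (intro prod_mono) (auto simp: Basis_le_norm)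
  also have "\<dots> = (\<Prod>b\<in>Basis. norm (f b))"
   using prod.permute[of p Basis "\<lambda>b. norm (f b)"] p by (simp add: o_def)
  finally show "\<bar>of_int (sign p) * (\<Prod>b\<in>Basis. f (p b) \<bullet> b)\<bar> \<le> (\<Prod>b\<in>Basis. norm (f b))" .
 qed
 also have "\<dots> = fact DIM('a) * (\<Prod>b\<in>Basis. norm (f b))"
  by (simp add: card_permutations)
 finally show ?thesis .
qed

text \<open>By Cramer's rule each coordinate of \<open>v\<close> times the determinant is a
  determinant with \<open>f v\<close> in one column, hence at most a product of column norms that
  contains \<open>norm (f v)\<close>. The estimate is used in both directions: a nearly annihilated
  vector forces a small determinant, and a determinant away from 0 controls
  \<open>v\<close>.\<close>

lemma det_endo_lower_bound:
 fixes f :: "'a::euclidean_space \<Rightarrow> 'a" and e :: "'b::finite \<Rightarrow> 'a" and K :: real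
 assumes bij: "bij_betw e UNIV Basis" and "linear f" and K: "\<And>b. b \<in> Basis \<Longrightarrow> norm (f b) \<le> K" "K \<ge> 1"
 shows "\<bar>det_endo f\<bar> * norm v \<le> DIM('a) * fact DIM('a) * K ^ DIM('a) * norm (f v)"
proof -
 have "\<bar>v \<bullet> b\<bar> * \<bar>det_endo f\<bar> \<le> fact DIM('a) * (K ^ DIM('a) * norm (f v))" if b: "b \<in> Basis" for b
 proof -
  have "\<bar>v \<bullet> b\<bar> * \<bar>det_endo f\<bar> = \<bar>det_endo (f(b := f v))\<bar>"
   by (simp add: cramer_det_endo[OF bij \<open>linear f\<close> b] abs_mult)
  also have "\<dots> \<le> fact DIM('a) * (\<Prod>c\<in>Basis. norm ((f(b := f v)) c))" by (rule det_endo_bound)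
  also have "(\<Prod>c\<in>Basis. norm ((f(b := f v)) c)) = norm (f v) * (\<Prod>c\<in>Basis - {b}. norm (f c))"
   using b by (subst prod.remove[of _ b]) (auto intro!: prod.cong)
  also have "\<dots> \<le> norm (f v) * (\<Prod>c\<in>Basis - {b}. K)"
   using K by (intro mult_left_mono prod_mono) auto
  also have "\<dots> \<le> norm (f v) * K ^ DIM('a)"
   using K(2) by (intro mult_left_mono) (auto simp: card_Diff_singleton[OF b] intro: power_increasing)
  finally show ?thesis by (simp add: mult.commute)
 qed
 then have "(\<Sum>b\<in>Basis. \<bar>v \<bullet> b\<bar> * \<bar>det_endo f\<bar>) \<le> (\<Sum>b\<in>(Basis::'a set). fact DIM('a) * (K ^ DIM('a) * norm (f v)))"
  by (rule sum_mono)
 moreover have "norm v * \<bar>det_endo f\<bar> \<le> (\<Sum>b\<in>Basis. \<bar>v \<bullet> b\<bar>) * \<bar>det_endo f\<bar>"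
  by (intro mult_right_mono norm_le_l1) auto
 ultimately show ?thesis by (simp add: sum_distrib_right sum_distrib_left mult_ac)
qed

lemma smooth_on_det_endo [smooth_intros]:
 fixes f :: "'c::euclidean_space \<Rightarrow> 'a::euclidean_space \<Rightarrow> 'a"
 assumes "open X" "\<And>b. b \<in> Basis \<Longrightarrow> smooth_on X (\<lambda>q. f q b)"
 shows "smooth_on X (\<lambda>q. det_endo (f q))"
 unfolding det_endo_def
 using assms by (intro smooth_intros) (auto simp: permutes_in_image)

text \<open>The adjugate of \<open>f\<close>, one Cramer determinant per coordinate. Being
  polynomial in the entries of \<open>f\<close>, it exhibits the inverse of an invertible family as
  a smooth function of the parameter.\<close>

definition adj_endo :: "('a::euclidean_space \<Rightarrow> 'a) \<Rightarrow> 'a \<Rightarrow> 'a" where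
 "adj_endo f w = (\<Sum>b\<in>Basis. det_endo (f(b := w)) *\<^sub>R b)"

lemma adj_endo_apply:
 fixes f :: "'a::euclidean_space \<Rightarrow> 'a" and e :: "'b::finite \<Rightarrow> 'a"
 assumes bij: "bij_betw e UNIV Basis" and "linear f"
 shows "adj_endo f (f v) = det_endo f *\<^sub>R v"
proof -
 have "adj_endo f (f v) = (\<Sum>b\<in>Basis. ((v \<bullet> b) * det_endo f) *\<^sub>R b)"
  unfolding adj_endo_def by (intro sum.cong) (auto simp: cramer_det_endo[OF bij \<open>linear f\<close>])
 also have "\<dots> = det_endo f *\<^sub>R (\<Sum>b\<in>Basis. (v \<bullet> b) *\<^sub>R b)"
  by (simp add: scaleR_sum_right mult.commute)
 finally show ?thesis by (simp add: euclidean_representation)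
qed

lemma smooth_on_adj_endo [smooth_intros]:
 fixes f :: "'c::euclidean_space \<Rightarrow> 'a::euclidean_space \<Rightarrow> 'a"
 assumes "open X" "\<And>b. b \<in> Basis \<Longrightarrow> smooth_on X (\<lambda>q. f q b)" "smooth_on X w"
 shows "smooth_on X (\<lambda>q. adj_endo (f q) (w q))"
proof -
 have "smooth_on X (\<lambda>q. ((f q)(b := w q)) c)" if "c \<in> Basis" for b c
  using assms(2)[OF that] assms(3) by (cases "c = b") auto
 then show ?thesis
  unfolding adj_endo_def using assms(1)
  by (intro smooth_on_sum smooth_on_scaleR smooth_on_det_endo smooth_on_const)
qed

section \<open>Flat functions and Rolle's theorem\<close>

text \<open>Vanishing to infinite order, expressed by size rather than by derivatives: in this form
  it passes to every function dominated by a flat one, even if that function is known only through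
  an inequality.\<close>

definition flat_at_0 :: "(real \<Rightarrow> 'a::real_normed_vector) \<Rightarrow> bool" where
 "flat_at_0 f \<longleftrightarrow> (\<forall>N. \<exists>C. eventually (\<lambda>s. norm (f s) \<le> C * \<bar>s\<bar> ^ N) (nhds 0))"

lemma flat_at_0_zero: "flat_at_0 f \<Longrightarrow> f 0 = 0"
 unfolding flat_at_0_def by (drule spec[of _ 1]) (auto dest: eventually_nhds_x_imp_x)

lemma flat_at_0_bound:
 assumes "flat_at_0 f" "eventually (\<lambda>s. norm (g s) \<le> K * norm (f s)) (nhds 0)"
 shows "flat_at_0 g"
 unfolding flat_at_0_def
proof
 fix N
 obtain C where C: "eventually (\<lambda>s. norm (f s) \<le> C * \<bar>s\<bar> ^ N) (nhds 0)"
  using assms(1) unfolding flat_at_0_def by blast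
 have "eventually (\<lambda>s. norm (g s) \<le> (\<bar>K\<bar> * C) * \<bar>s\<bar> ^ N) (nhds 0)"
  using C assms(2)
 proof eventually_elim
  case (elim s)
  have "norm (g s) \<le> \<bar>K\<bar> * norm (f s)" using elim(2) mult_right_mono[OF abs_ge_self[of K] norm_ge_zero[of "f s"]] by linarith
  also have "\<dots> \<le> \<bar>K\<bar> * (C * \<bar>s\<bar> ^ N)" by (rule mult_left_mono[OF elim(1)]) simp
  finally show ?case by simp
 qed
 then show "\<exists>C. eventually (\<lambda>s. norm (g s) \<le> C * \<bar>s\<bar> ^ N) (nhds 0)" by blast
qed

lemma flat_at_0_add:
 assumes "flat_at_0 f" "flat_at_0 g" shows "flat_at_0 (\<lambda>s. f s + g s)"
 unfolding flat_at_0_def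
proof
 fix N
 obtain C where C: "eventually (\<lambda>s. norm (f s) \<le> C * \<bar>s\<bar> ^ N) (nhds 0)"
  using assms(1) unfolding flat_at_0_def by blast
 obtain C' where C': "eventually (\<lambda>s. norm (g s) \<le> C' * \<bar>s\<bar> ^ N) (nhds 0)"
  using assms(2) unfolding flat_at_0_def by blast
 have "eventually (\<lambda>s. norm (f s + g s) \<le> (C + C') * \<bar>s\<bar> ^ N) (nhds 0)"
  using C C'
 proof eventually_elim
  case (elim s)
  then show ?case using norm_triangle_ineq[of "f s" "g s"] by (simp add: distrib_right)
 qed
 then show "\<exists>C. eventually (\<lambda>s. norm (f s + g s) \<le> C * \<bar>s\<bar> ^ N) (nhds 0)" by blast
qed

text \<open>Taylor's formula with Lagrange remainder works in both directions. Vanishing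
  coefficients leave only a remainder of high order, while a first nonzero coefficient of order
  \<open>m\<close> keeps \<open>d 0\<close> above a multiple of \<open>\<bar>s\<bar> ^ m\<close>,
  which excludes a bound by the next power.\<close>

lemma flat_at_0_iff_derivatives_zero:
 fixes d :: "nat \<Rightarrow> real \<Rightarrow> real"
 assumes "r > 0" and der: "\<And>m t. \<bar>t\<bar> < r \<Longrightarrow> DERIV (d m) t :> d (Suc m) t"
 shows "flat_at_0 (d 0) \<longleftrightarrow> (\<forall>m. d m 0 = 0)"
proof
 have ev: "eventually (\<lambda>s. \<bar>s\<bar> < r) (nhds 0)"
  using \<open>r > 0\<close> by (auto simp: eventually_nhds_metric dist_real_def)
 have taylor: "\<exists>t. \<bar>t\<bar> \<le> \<bar>s\<bar> \<and> d 0 s = (\<Sum>m<n. d m 0 / fact m * s ^ m) + d n t / fact n * s ^ n"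
  if "\<bar>s\<bar> < r" "s \<noteq> 0" "n > 0" for s n
 proof -
  \<comment> \<open>Taylor's theorem asks for derivatives on a closed interval, hence a radius
    strictly between \<open>\<bar>s\<bar>\<close> and \<open>r\<close>.\<close>
  define q where "q = (\<bar>s\<bar> + r) / 2"
  have "\<exists>t. (if s < 0 then s < t \<and> t < 0 else 0 < t \<and> t < s) \<and>
    d 0 s = (\<Sum>m<n. d m 0 / fact m * (s - 0) ^ m) + d n t / fact n * (s - 0) ^ n"
   by (rule Taylor[of n d "d 0" "-q" q 0 s]) (use that \<open>r > 0\<close> in \<open>auto intro!: der simp: q_def field_simps\<close>)
  then obtain t where "if s < 0 then s < t \<and> t < 0 else 0 < t \<and> t < s"
    "d 0 s = (\<Sum>m<n. d m 0 / fact m * (s - 0) ^ m) + d n t / fact n * (s - 0) ^ n" by blast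
  then show ?thesis by (intro exI[of _ t]) (auto split: if_splits)
 qed
 have cont: "isCont (d n) 0" for n
  using der[of 0 n] \<open>r > 0\<close> by (auto intro: DERIV_isCont)
 {
  assume z: "\<forall>m. d m 0 = 0"
  show "flat_at_0 (d 0)"
   unfolding flat_at_0_def
  proof
   fix N
   have "eventually (\<lambda>t. \<bar>d (Suc N) t\<bar> < 1) (nhds 0)"
   proof -
    have "(d (Suc N) \<longlongrightarrow> 0) (nhds 0)" using cont[of "Suc N"] z tendsto_at_iff_tendsto_nhds[of "d (Suc N)" 0] by (simp add: isCont_def)
    from tendstoD[OF this, of 1] show ?thesis by (simp add: dist_real_def)
   qed
   then obtain e where e: "e > 0" "\<And>t. \<bar>t\<bar> < e \<Longrightarrow> \<bar>d (Suc N) t\<bar> < 1"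
    by (auto simp: eventually_nhds_metric dist_real_def)
   have "norm (d 0 s) \<le> 1 * \<bar>s\<bar> ^ N" if "\<bar>s\<bar> < min (min e r) 1" for s
   proof (cases "s = 0")
    case False
    have sr: "\<bar>s\<bar> < r" using that by simp
    obtain t where t: "\<bar>t\<bar> \<le> \<bar>s\<bar>" "d 0 s = d (Suc N) t / fact (Suc N) * s ^ Suc N"
     using taylor[of s "Suc N"] False z sr by (auto simp del: fact_Suc power_Suc)
    have "\<bar>d (Suc N) t\<bar> / fact (Suc N) \<le> 1"
     using e(2)[of t] t(1) that order_trans[OF less_imp_le fact_ge_1[of "Suc N", where 'a = real], of "\<bar>d (Suc N) t\<bar>"]
     by (simp add: divide_le_eq del: fact_Suc)
    then have "\<bar>d 0 s\<bar> \<le> 1 * \<bar>s\<bar> ^ Suc N"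
     unfolding t(2) abs_mult power_abs abs_divide by (intro mult_mono) (auto simp del: fact_Suc)
    also have "\<dots> \<le> 1 * \<bar>s\<bar> ^ N" using that by (simp add: mult_left_le_one_le)
    finally show ?thesis by simp
   qed (use z in simp)
   then show "\<exists>C. eventually (\<lambda>s. norm (d 0 s) \<le> C * \<bar>s\<bar> ^ N) (nhds 0)"
    using e(1) \<open>r > 0\<close> unfolding eventually_nhds_metric dist_real_def
    by (intro exI[of _ 1] exI[of _ "min (min e r) 1"]) auto
  qed
 next
  assume fl: "flat_at_0 (d 0)"
  show "\<forall>m. d m 0 = 0"
  proof (rule ccontr)
   assume "\<not> (\<forall>m. d m 0 = 0)"
   then obtain m where m: "d m 0 \<noteq> 0" "\<And>i. i < m \<Longrightarrow> d i 0 = 0"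
    using exists_least_iff[of "\<lambda>m. d m 0 \<noteq> 0"] by auto
   obtain C where C: "eventually (\<lambda>s. norm (d 0 s) \<le> C * \<bar>s\<bar> ^ Suc m) (nhds 0)"
    using fl unfolding flat_at_0_def by blast
   have "m \<noteq> 0" using flat_at_0_zero[OF fl] m(1) by (metis)
   have "eventually (\<lambda>t. \<bar>d m t\<bar> > \<bar>d m 0\<bar> / 2) (nhds 0)"
   proof -
    have "((\<lambda>t. \<bar>d m t\<bar>) \<longlongrightarrow> \<bar>d m 0\<bar>) (nhds 0)"
     using cont[of m] tendsto_at_iff_tendsto_nhds[of "d m" 0] by (intro tendsto_rabs) (simp add: isCont_def)
    from order_tendstoD(1)[OF this, of "\<bar>d m 0\<bar> / 2"] m(1) show ?thesis by simp
   qed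
   then obtain e where e: "e > 0" "\<And>t. \<bar>t\<bar> < e \<Longrightarrow> \<bar>d m t\<bar> > \<bar>d m 0\<bar> / 2"
    by (auto simp: eventually_nhds_metric dist_real_def)
   obtain e' where e': "e' > 0" "\<And>s. \<bar>s\<bar> < e' \<Longrightarrow> \<bar>d 0 s\<bar> \<le> C * \<bar>s\<bar> ^ Suc m"
    using C by (auto simp: eventually_nhds_metric dist_real_def)
   define K where "K = \<bar>d m 0\<bar> / 2 / fact m"
   have K: "K > 0" using m(1) by (simp add: K_def)
   \<comment> \<open>The last entry makes \<open>(\<bar>C\<bar> + 1) * s\<close> at most half of
     \<open>K\<close>, the lower bound for the leading Taylor coefficient.\<close>
   define s where "s = min (min (e/2) (e'/2)) (min (r/2) (K / (2 * (\<bar>C\<bar> + 1))))"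
   have s: "s > 0" "s < e" "s < e'" "s < r" "s \<le> K / (2 * (\<bar>C\<bar> + 1))"
    unfolding s_def using e(1) e'(1) K \<open>r > 0\<close> by (auto simp: min_less_iff_disj)
   obtain t where t: "\<bar>t\<bar> \<le> \<bar>s\<bar>" "d 0 s = d m t / fact m * s ^ m"
    using taylor[of s m] s \<open>m \<noteq> 0\<close> m(2) by auto
   have "K * s ^ m \<le> (\<bar>d m t\<bar> / fact m) * s ^ m"
    unfolding K_def using e(2)[of t] t(1) s by (intro mult_right_mono divide_right_mono) auto
   also have "\<dots> = \<bar>d 0 s\<bar>" unfolding t(2) abs_mult abs_divide using s by simp
   also have "\<dots> \<le> (C * s) * s ^ m" using e'(2)[of s] s by (simp add: mult_ac)
   finally have "K \<le> C * s" using s(1) by simp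
   also have "\<dots> \<le> (\<bar>C\<bar> + 1) * s" using s(1) by (intro mult_right_mono) auto
   also have "\<dots> \<le> (\<bar>C\<bar> + 1) * (K / (2 * (\<bar>C\<bar> + 1)))" by (intro mult_left_mono s(5)) auto
   also have "\<dots> = K / 2" by (simp add: field_simps)
   finally show False using K by simp
  qed
 }
qed

text \<open>The clause on \<open>Max Z\<close> drives the induction: after the largest point is
  removed, the zeros already found lie below the new maximum, and Rolle's theorem on the last gap
  supplies one more beyond it.\<close>

lemma Rolle_card:
 fixes f :: "real \<Rightarrow> real"
 assumes "convex L" and der: "\<And>s. s \<in> L \<Longrightarrow> DERIV f s :> f' s"
 shows "\<lbrakk>finite Z; card Z = Suc m; Z \<subseteq> L; (\<And>s. s \<in> Z \<Longrightarrow> f s = c)\<rbrakk> \<Longrightarrow>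
  \<exists>Z'. finite Z' \<and> card Z' = m \<and> Z' \<subseteq> L \<and> (\<forall>s\<in>Z'. f' s = 0 \<and> s < Max Z)"
proof (induction m arbitrary: Z)
 case 0
 show ?case by (intro exI[of _ "{}"]) auto
next
 case (Suc m)
 define M where "M = Max Z"
 define Z0 where "Z0 = Z - {M}"
 have M: "M \<in> Z" unfolding M_def using Suc.prems by (intro Max_in) auto
 have Z0: "finite Z0" "card Z0 = Suc m" "Z0 \<subseteq> L" "\<And>s. s \<in> Z0 \<Longrightarrow> f s = c"
  unfolding Z0_def using Suc.prems M by auto
 have Z0ne: "Z0 \<noteq> {}" using Z0(2) by auto
 obtain Z' where Z': "finite Z'" "card Z' = m" "Z' \<subseteq> L" "\<And>s. s \<in> Z' \<Longrightarrow> f' s = 0 \<and> s < Max Z0"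
  using Suc.IH[OF Z0] by blast
 have N: "Max Z0 \<in> Z0" using Z0(1) Z0ne by (rule Max_in)
 then have lt: "Max Z0 < M"
  unfolding M_def Z0_def using Suc.prems(1) by (metis DiffD1 DiffD2 Max_ge M_def insertI1 order_le_less)
 have sub: "{Max Z0..M} \<subseteq> L"
  using \<open>convex L\<close> N M Z0(3) Suc.prems(3) by (metis closed_segment_eq_real_ivl convex_contains_segment lt order_less_imp_le subsetD)
 have "\<exists>t>Max Z0. t < M \<and> f' t = 0"
 proof -
  have "\<exists>z. Max Z0 < z \<and> z < M \<and> DERIV f z :> 0"
  proof (rule Rolle[OF lt])
   show "f (Max Z0) = f M" using Z0(4)[OF N] Suc.prems(4)[OF M] by simp
   show "continuous_on {Max Z0..M} f"
    using der sub by (intro continuous_at_imp_continuous_on ballI) (blast intro: DERIV_isCont)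
   show "f differentiable at x" if "Max Z0 < x" "x < M" for x
    using der[of x] sub that by (meson atLeastAtMost_iff less_imp_le real_differentiable_def subsetD)
  qed
  then obtain z where z: "Max Z0 < z" "z < M" "DERIV f z :> 0" by blast
  then have "f' z = 0" using DERIV_unique[OF z(3) der[of z]] subsetD[OF sub, of z] by auto
  then show ?thesis using z by blast
 qed
 then obtain t where t: "Max Z0 < t" "t < M" "f' t = 0" by blast
 have "t \<notin> Z'" using Z'(4)[of t] t by auto
 moreover have "t \<in> L" using sub t by auto
 ultimately show ?case
  using Z' t lt by (intro exI[of _ "insert t Z'"]) (fastforce simp: M_def)
qed

text \<open>Each differentiation costs one point. The level \<open>c\<close> matters only in the
  first application; afterwards the points are zeros and the level is 0.\<close>

lemma Rolle_iterate:
 fixes d :: "nat \<Rightarrow> real \<Rightarrow> real"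
 assumes "convex L"
 shows "\<lbrakk>(\<And>m s. s \<in> L \<Longrightarrow> DERIV (d m) s :> d (Suc m) s); finite Z; card Z = Suc (Suc m); Z \<subseteq> L;
  (\<And>s. s \<in> Z \<Longrightarrow> d 0 s = c)\<rbrakk> \<Longrightarrow> \<exists>s\<in>L. d (Suc m) s = 0"
proof (induction m arbitrary: d c Z)
 case (0 d Z)
 obtain Z' where "card Z' = 1" "Z' \<subseteq> L" "\<forall>s\<in>Z'. d 1 s = 0"
  using Rolle_card[OF assms, of "d 0" "d 1" Z 1] 0 by (metis One_nat_def)
 then show ?case by (auto simp: card_1_singleton_iff)
next
 case (Suc m d Z)
 obtain Z' where Z': "finite Z'" "card Z' = Suc (Suc m)" "Z' \<subseteq> L" "\<And>s. s\<in>Z' \<Longrightarrow> d (Suc 0) s = 0"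
  using Rolle_card[OF assms, of "d 0" "d (Suc 0)" Z "Suc (Suc m)"] Suc.prems by metis
 show ?case
  using Suc.IH[of "\<lambda>m. d (Suc m)" Z' 0] Suc.prems Z' by auto
qed

lemma continuous_on_tendsto_nhds:
 fixes f :: "'a::metric_space \<Rightarrow> 'b::metric_space"
 shows "\<lbrakk>open X; p \<in> X; continuous_on X f\<rbrakk> \<Longrightarrow> (f \<longlongrightarrow> f p) (nhds p)"
 unfolding tendsto_at_iff_tendsto_nhds[symmetric] by (metis continuous_on_eq_continuous_at isCont_def)

text \<open>Near \<open>p\<close> the function \<open>D\<close> grows at rate at least 1/2 along a
  suitable direction \<open>u\<close>, so its zero set is met within a distance from
  \<open>q\<close> comparable to \<open>\<bar>D q\<bar>\<close>. There \<open>W\<close> vanishes,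
  and the mean value inequality carries this back to \<open>q\<close>. The result plays the part of
  Hadamard division by \<open>D\<close>.\<close>

lemma simply_vanishing_divides:
 fixes D :: "'a::euclidean_space \<Rightarrow> real" and W :: "'a \<Rightarrow> 'b::real_normed_vector"
 assumes X: "open X" "p \<in> X" and D: "smooth_on X D" "D p = 0" "FD D p \<noteq> (\<lambda>_. 0)"
  and W: "smooth_on X W" "\<And>q. q \<in> X \<Longrightarrow> D q = 0 \<Longrightarrow> W q = 0"
 obtains C where "eventually (\<lambda>q. norm (W q) \<le> C * \<bar>D q\<bar>) (nhds p)"
proof -
 have lin: "linear (FD D p)"
  using has_derivative_linear[OF smooth_on_has_derivative[OF D(1) X(2)]] .
 obtain u0 where u0: "FD D p u0 \<noteq> 0" using D(3) by auto
 define u where "u = u0 /\<^sub>R FD D p u0"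
 have u: "FD D p u = 1" unfolding u_def using u0 lin by (simp add: linear_scale)
 have "continuous_on X (\<lambda>q. FD D q u)"
  by (intro smooth_on_continuous smooth_on_frechet_derivative D)
 then have "((\<lambda>q. FD D q u) \<longlongrightarrow> 1) (nhds p)"
  using continuous_on_tendsto_nhds[OF X, of "\<lambda>q. FD D q u"] u by simp
 then have ev1: "eventually (\<lambda>q. FD D q u > 1/2) (nhds p)" by (rule order_tendstoD) simp
 define K where "K = norm (FD W p u) + 1"
 have "continuous_on X (\<lambda>q. norm (FD W q u))"
  by (intro continuous_on_norm smooth_on_continuous smooth_on_frechet_derivative W)
 then have "((\<lambda>q. norm (FD W q u)) \<longlongrightarrow> norm (FD W p u)) (nhds p)"
  by (rule continuous_on_tendsto_nhds[OF X])
 then have ev2: "eventually (\<lambda>q. norm (FD W q u) < K) (nhds p)"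
  by (rule order_tendstoD) (simp add: K_def)
 have "eventually (\<lambda>q. q \<in> X) (nhds p)" using X by (rule eventually_nhds_in_open)
 with ev1 ev2 have "eventually (\<lambda>q. q \<in> X \<and> FD D q u > 1/2 \<and> norm (FD W q u) < K) (nhds p)"
  by eventually_elim auto
 then obtain r where r: "r > 0" "\<And>q. dist q p < r \<Longrightarrow> q \<in> X \<and> FD D q u > 1/2 \<and> norm (FD W q u) < K"
  by (auto simp: eventually_nhds_metric)
 have "(D \<longlongrightarrow> 0) (nhds p)"
  using continuous_on_tendsto_nhds[OF X smooth_on_continuous[OF D(1)]] D(2) by simp
 \<comment> \<open>This smallness keeps the segment of parameters up to
   \<open>2 * \<bar>D q\<bar>\<close> around \<open>q\<close> inside the ball on which the slope of
   \<open>D\<close> and the derivative of \<open>W\<close> are controlled.\<close>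
 from tendstoD[OF this, of "r / (8 * (norm u + 1))"] r(1)
 have ev3: "eventually (\<lambda>q. \<bar>D q\<bar> < r / (8 * (norm u + 1))) (nhds p)"
  using norm_ge_zero[of u] by (simp add: dist_real_def zero_less_divide_iff add_nonneg_pos)
 have ev4: "eventually (\<lambda>q. dist q p < r / 2) (nhds p)"
  using r(1) unfolding eventually_nhds_metric by (intro exI[of _ "r/2"]) auto
 have "eventually (\<lambda>q. norm (W q) \<le> (2 * K) * \<bar>D q\<bar>) (nhds p)"
  using ev3 ev4
 proof eventually_elim
  case (elim q)
  \<comment> \<open>At slope 1/2 a step of this length changes \<open>D\<close> by at least
    \<open>\<bar>D q\<bar>\<close>, enough for a change of sign on one of the two sides.\<close>
  define \<sigma> where "\<sigma> = 2 * \<bar>D q\<bar>"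
  have near: "dist (q + s *\<^sub>R u) p < r" if "\<bar>s\<bar> \<le> \<sigma>" for s
  proof -
   have "\<sigma> * norm u \<le> \<sigma> * (norm u + 1)" unfolding \<sigma>_def by (intro mult_left_mono) auto
   also have "\<dots> \<le> r / 4" using elim(1) norm_ge_zero[of u] unfolding \<sigma>_def by (simp add: field_simps)
   finally have "norm (s *\<^sub>R u) \<le> r / 4" using mult_right_mono[OF that norm_ge_zero[of u]] by simp
   then show ?thesis using elim(2) r(1) norm_triangle_ineq[of "q - p" "s *\<^sub>R u"] by (simp add: dist_norm algebra_simps)
  qed
  have line: "((\<lambda>s. q + s *\<^sub>R u) has_derivative (\<lambda>t. t *\<^sub>R u)) (at s)" for s
   by (auto intro!: derivative_eq_intros)
  have derD: "DERIV (\<lambda>s. D (q + s *\<^sub>R u)) s :> FD D (q + s *\<^sub>R u) u" if "\<bar>s\<bar> \<le> \<sigma>" for s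
  proof -
   have hd: "(D has_derivative FD D (q + s *\<^sub>R u)) (at (q + s *\<^sub>R u))"
    using r(2)[OF near[OF that]] D(1) by (intro smooth_on_has_derivative) auto
   from diff_chain_at[OF line this] have "((\<lambda>s. D (q + s *\<^sub>R u)) has_derivative (\<lambda>t. FD D (q + s *\<^sub>R u) (t *\<^sub>R u))) (at s)"
    by (simp add: o_def)
   moreover have "(\<lambda>t. FD D (q + s *\<^sub>R u) (t *\<^sub>R u)) = (*) (FD D (q + s *\<^sub>R u) u)"
    using linear_scale[OF has_derivative_linear[OF hd]] by (auto simp: fun_eq_iff)
   ultimately show ?thesis by (simp add: has_field_derivative_def)
  qed
  have slope: "FD D (q + s *\<^sub>R u) u > 1/2" if "\<bar>s\<bar> \<le> \<sigma>" for s using r(2)[OF near[OF that]] by auto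
  have dec: "D (q + b *\<^sub>R u) - D (q + a *\<^sub>R u) \<ge> (b - a) / 2" if "a \<le> b" "-\<sigma> \<le> a" "b \<le> \<sigma>" for a b
  proof (cases "a = b")
   case False
   have "\<exists>z>a. z < b \<and> D (q + b *\<^sub>R u) - D (q + a *\<^sub>R u) = (b - a) * FD D (q + z *\<^sub>R u) u"
    using that False by (intro MVT2) (auto intro!: derD)
   then obtain z where "z > a" "z < b" "D (q + b *\<^sub>R u) - D (q + a *\<^sub>R u) = (b - a) * FD D (q + z *\<^sub>R u) u"
    by blast
   moreover have "(b - a) * FD D (q + z *\<^sub>R u) u \<ge> (b - a) * (1/2)"
    using less_imp_le[OF slope[of z]] that \<open>z > a\<close> \<open>z < b\<close> by (intro mult_left_mono) linarith+
   ultimately show ?thesis by simp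
  qed simp
  have "\<sigma> \<ge> 0" by (simp add: \<sigma>_def)
  have "\<exists>s. - \<sigma> \<le> s \<and> s \<le> \<sigma> \<and> D (q + s *\<^sub>R u) = 0"
  proof (rule IVT)
   show "D (q + (- \<sigma>) *\<^sub>R u) \<le> 0" using dec[of "-\<sigma>" 0] \<open>\<sigma> \<ge> 0\<close> by (simp add: \<sigma>_def)
   show "0 \<le> D (q + \<sigma> *\<^sub>R u)" using dec[of 0 \<sigma>] \<open>\<sigma> \<ge> 0\<close> by (simp add: \<sigma>_def)
   show "- \<sigma> \<le> \<sigma>" using \<open>\<sigma> \<ge> 0\<close> by simp
   show "\<forall>x. - \<sigma> \<le> x \<and> x \<le> \<sigma> \<longrightarrow> isCont (\<lambda>s. D (q + s *\<^sub>R u)) x"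
    by (intro allI impI DERIV_isCont[OF derD]) auto
  qed
  then obtain s where s: "\<bar>s\<bar> \<le> \<sigma>" "D (q + s *\<^sub>R u) = 0" by (metis abs_le_iff minus_le_iff)
  have Ws: "W (q + s *\<^sub>R u) = 0" using W(2) r(2)[OF near[OF s(1)]] s(2) by auto
  have "norm (W (q + 0 *\<^sub>R u) - W (q + s *\<^sub>R u)) \<le> K * norm (0 - s)"
  proof (rule differentiable_bound[where S = "{-\<sigma>..\<sigma>}" and f' = "\<lambda>a t. t *\<^sub>R FD W (q + a *\<^sub>R u) u"])
   fix a assume a: "a \<in> {-\<sigma>..\<sigma>}"
   have hd: "(W has_derivative FD W (q + a *\<^sub>R u)) (at (q + a *\<^sub>R u))"
    using r(2)[OF near[of a]] a W(1) by (intro smooth_on_has_derivative) auto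
   from diff_chain_at[OF line this] have "((\<lambda>s. W (q + s *\<^sub>R u)) has_derivative (\<lambda>t. FD W (q + a *\<^sub>R u) (t *\<^sub>R u))) (at a)"
    by (simp add: o_def)
   then show "((\<lambda>s. W (q + s *\<^sub>R u)) has_derivative (\<lambda>t. t *\<^sub>R FD W (q + a *\<^sub>R u) u)) (at a within {-\<sigma>..\<sigma>})"
    by (simp add: linear_scale[OF has_derivative_linear[OF hd]] has_derivative_at_withinI)
   have "norm (FD W (q + a *\<^sub>R u) u) \<le> K"
    using conjunct2[OF conjunct2[OF r(2)[OF near[of a]]]] a by (simp add: abs_le_iff)
   then show "onorm (\<lambda>t. t *\<^sub>R FD W (q + a *\<^sub>R u) u) \<le> K"
    by (intro onorm_le) (metis abs_ge_zero mult.commute mult_left_mono norm_scaleR real_norm_def)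
  qed (use s \<open>\<sigma> \<ge> 0\<close> in auto)
  then have "norm (W q) \<le> K * \<bar>s\<bar>" using Ws by simp
  also have "\<dots> \<le> K * \<sigma>" using s by (intro mult_left_mono) (auto simp: K_def)
  finally show ?case by (simp add: \<sigma>_def)
 qed
 then show ?thesis using that by blast
qed

section \<open>Maps of finite type have bounded fibres\<close>

text \<open>The derivative of the inverse is recorded at every point of \<open>V\<close>, because
  functions will be differentiated along lines in the target of the chart.\<close>

lemma local_diffeo:
 fixes f :: "'a::euclidean_space \<Rightarrow> 'a"
 assumes "open X" "p \<in> X" "smooth_on X f" and inj: "\<And>v. FD f p v = 0 \<Longrightarrow> v = 0"
 obtains U V g where "open U" "U \<subseteq> X" "p \<in> U" "open V" "f p \<in> V" "homeomorphism U V f g"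
  "\<And>y. y \<in> V \<Longrightarrow> (g has_derivative inv (FD f (g y))) (at y)"
  "\<And>y. y \<in> V \<Longrightarrow> bij (FD f (g y))"
proof -
 let ?F = "\<lambda>x. FD f x"
 have bl: "bounded_linear (?F x)" if "x \<in> X" for x
  using has_derivative_bounded_linear[OF smooth_on_has_derivative[OF assms(3) that]] .
 then have app: "blinfun_apply (Blinfun (?F x)) = ?F x" if "x \<in> X" for x
  using that by (simp add: bounded_linear_Blinfun_apply)
 have "inj (?F p)"
  using inj linear_injective_0[of "?F p"] bl[OF assms(2)] by (auto simp: bounded_linear.linear)
 then have bli: "bounded_linear (inv (?F p))"
  using bl[OF assms(2)] by (intro inj_linear_imp_inv_bounded_linear)
 have inv1: "Blinfun (inv (?F p)) o\<^sub>L Blinfun (?F p) = id_blinfun"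
  using \<open>inj (?F p)\<close> by (intro blinfun_eqI) (simp add: app[OF assms(2)] bounded_linear_Blinfun_apply[OF bli])
 have der: "\<And>x. x \<in> X \<Longrightarrow> (f has_derivative blinfun_apply (Blinfun (?F x))) (at x)"
  using smooth_on_has_derivative[OF assms(3)] app by simp
 obtain U V g g' where *: "open U" "U \<subseteq> X" "p \<in> U" "open V" "f p \<in> V" "homeomorphism U V f g"
  "\<And>y. y \<in> V \<Longrightarrow> (g has_derivative (g' y)) (at y)"
  "\<And>y. y \<in> V \<Longrightarrow> g' y = inv (blinfun_apply (Blinfun (?F (g y))))"
  "\<And>y. y \<in> V \<Longrightarrow> bij (blinfun_apply (Blinfun (?F (g y))))"
  by (rule inverse_function_theorem[OF \<open>open X\<close> der frechet_derivative_continuous_blinfun[OF assms(1,3)] assms(2) inv1]) (assumption | rule that)+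
 have "g y \<in> X" if "y \<in> V" for y using *(2,6) that by (auto simp: homeomorphism_def)
 then show ?thesis using * app that[of U V g] by metis
qed

text \<open>Two orthogonal nonzero kernel vectors would leave an orthogonal complement whose
  dimension is smaller by 2 and on which \<open>A\<close> already attains its whole range, against
  the rank bound.\<close>

lemma corank_1_kernel:
 fixes A :: "'a::euclidean_space \<Rightarrow> 'a"
 assumes lin: "linear A" and rank: "DIM('a) \<le> dim (range A) + 1"
  and v0: "A v0 = 0" "norm v0 = 1" and v: "A v = 0" "v0 \<bullet> v = 0"
 shows "v = 0"
proof (rule ccontr)
 assume "v \<noteq> 0"
 have "v \<noteq> v0" using v v0 by (metis norm_eq_1 zero_neq_one)
 have ind: "independent {v, v0}"
  using v \<open>v \<noteq> 0\<close> v0 by (intro pairwise_orthogonal_independent) (auto simp: pairwise_def orthogonal_def inner_commute)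
 define W where "W = {y. \<forall>x\<in>span {v, v0}. orthogonal x y}"
 have "range A \<subseteq> A ` W"
 proof
  fix y assume "y \<in> range A"
  then obtain x where x: "y = A x" by blast
  obtain a b where ab: "a \<in> span {v, v0}" "\<And>w. w \<in> span {v, v0} \<Longrightarrow> orthogonal b w" "x = a + b"
   using orthogonal_subspace_decomp_exists[of "{v, v0}" x] by metis
  have "A a = 0" using linear_eq_0_on_span[OF lin _ ab(1)] v v0 by auto
  then have "y = A b" using x ab(3) by (simp add: linear_add[OF lin])
  then show "y \<in> A ` W" using ab(2) by (auto simp: W_def orthogonal_commute)
 qed
 then have "dim (range A) \<le> dim W"
  using dim_subset[of "range A" "A ` W"] dim_image_le[OF lin, of W] by linarith
 moreover have "dim W + dim (span {v, v0}) = DIM('a)"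
  using dim_subspace_orthogonal_to_vectors[of "span {v, v0}" UNIV] by (simp add: W_def)
 moreover have "dim (span {v, v0}) = 2"
  using ind \<open>v \<noteq> v0\<close> by (simp add: dim_span_eq_card_independent del: dim_span)
 ultimately show False using rank by linarith
qed

text \<open>The columns are bounded near \<open>p\<close>, which makes the constant of the pointwise
  estimate locally uniform.\<close>

lemma eventually_det_endo_lower_bound:
 fixes f :: "'c::metric_space \<Rightarrow> 'a::euclidean_space \<Rightarrow> 'a" and e :: "'b::finite \<Rightarrow> 'a"
 assumes bij: "bij_betw e UNIV Basis" and lin: "\<And>q. linear (f q)"
  and cont: "\<And>b. b \<in> Basis \<Longrightarrow> ((\<lambda>q. f q b) \<longlongrightarrow> f p b) (nhds p)"
 obtains C where "eventually (\<lambda>q. \<forall>v. \<bar>det_endo (f q)\<bar> * norm v \<le> C * norm (f q v)) (nhds p)"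
proof -
 define K where "K = (\<Sum>b\<in>Basis. norm (f p b)) + 1"
 have "eventually (\<lambda>q. norm (f q b) < K) (nhds p)" if b: "b \<in> Basis" for b
 proof -
  have "norm (f p b) < K" unfolding K_def using member_le_sum[OF b, of "\<lambda>b. norm (f p b)"] by simp
  then show ?thesis by (rule order_tendstoD[OF tendsto_norm[OF cont[OF b]]])
 qed
 then have "eventually (\<lambda>q. \<forall>b\<in>Basis. norm (f q b) < K) (nhds p)"
  by (simp add: eventually_ball_finite)
 then have "eventually (\<lambda>q. \<forall>v. \<bar>det_endo (f q)\<bar> * norm v \<le> (DIM('a) * fact DIM('a) * K ^ DIM('a)) * norm (f q v)) (nhds p)"
 proof eventually_elim
  case (elim q)
  have "K \<ge> 1" unfolding K_def by (simp add: sum_nonneg)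
  then show ?case using elim by (intro allI det_endo_lower_bound[OF bij lin]) (auto intro: less_imp_le)
 qed
 then show ?thesis using that by blast
qed

lemma lie_deriv_smooth:
 fixes Z :: "'a::euclidean_space \<Rightarrow> 'a"
 shows "\<lbrakk>open U; smooth_on U Z; smooth_on U H\<rbrakk> \<Longrightarrow> smooth_on U ((lie_deriv Z ^^ m) H)"
 by (induction m) (auto simp: lie_deriv_def intro!: smooth_on_frechet_derivative_field)

text \<open>At a critical point the component of \<open>\<pi>\<close> along the cokernel direction
  \<open>w0\<close> is replaced by the coordinate along the kernel direction \<open>v0\<close>. The
  resulting \<open>G\<close> is a chart in which every fibre of \<open>\<pi>\<close> lies on a line
  parallel to \<open>w0\<close>, and on that line only the scalar function \<open>F\<close>, the
  replaced component, still has to be examined. If some derivative of \<open>F\<close> along these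
  lines is nonzero at \<open>p\<close>, it is nonzero nearby and Rolle's theorem bounds the fibre.
  Otherwise the first derivative of \<open>F\<close> is flat along the line through
  \<open>p\<close>; comparing the coordinate field \<open>Z\<close> with the kernel field
  \<open>Y\<close> transfers flatness to all derivatives of the determinant along \<open>Y\<close>,
  which contradicts finite type.\<close>

lemma type_at_most_locally_bounded_fibres:
 fixes \<pi> :: "'a::euclidean_space \<Rightarrow> 'a" and e :: "'b::finite \<Rightarrow> 'a"
 assumes bij: "bij_betw e UNIV Basis" and type: "type_at_most \<pi> k"
 obtains U m where "open U" "p \<in> U" "\<And>z. finite {q \<in> U. \<pi> q = z} \<and> card {q \<in> U. \<pi> q = z} \<le> m"
proof (cases "\<forall>v. FD \<pi> p v = 0 \<longrightarrow> v = 0")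
 case True
 have "smooth_on UNIV \<pi>" using type by (simp add: type_at_most_def)
 then obtain U V g where U: "open U" "p \<in> U" "homeomorphism U V \<pi> g"
  by (rule local_diffeo[OF open_UNIV UNIV_I]) (use True in auto)
 have "{q \<in> U. \<pi> q = z} \<subseteq> {g z}" for z using U(3) by (auto simp: homeomorphism_def)
 then have "finite {q \<in> U. \<pi> q = z} \<and> card {q \<in> U. \<pi> q = z} \<le> 1" for z
  by (metis card_1_singleton_iff card_mono finite.emptyI finite.insertI finite_subset One_nat_def)
 then show ?thesis using that[of U 1] U by blast
next
 case False
 define A where "A q = FD \<pi> q" for q
 have smooth: "smooth_on UNIV \<pi>" and simple: "vanishes_simply (det_deriv \<pi>)"
  and rank: "DIM('a) \<le> dim (range (A p)) + 1"
  using type by (auto simp: type_at_most_def corank_le_1_def A_def)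
 have hdA: "(\<pi> has_derivative A q) (at q)" for q
  unfolding A_def using smooth_on_has_derivative[OF smooth] by simp
 have linA: "linear (A q)" for q using has_derivative_linear[OF hdA] .
 define D where "D = det_deriv \<pi>"
 have D: "D q = det_endo (A q)" for q by (simp add: D_def det_deriv_def A_def)
 obtain v1 where v1: "A p v1 = 0" "v1 \<noteq> 0" using False by (auto simp: A_def)
 have Dp: "D p = 0"
 proof -
  obtain C where "eventually (\<lambda>q. \<forall>v. \<bar>det_endo (A p)\<bar> * norm v \<le> C * norm (A p v)) (nhds p)"
   by (rule eventually_det_endo_lower_bound[OF bij, of "\<lambda>_. A p" p]) (auto simp: linA)
  then have "\<bar>det_endo (A p)\<bar> * norm v1 \<le> C * norm (A p v1)" by (auto dest: eventually_nhds_x_imp_x)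
  then show ?thesis using v1 by (simp add: D mult_le_0_iff)
 qed
 have D_smooth: "smooth_on UNIV D"
  unfolding D_def det_deriv_def using smooth by (intro smooth_intros) auto
 define v0 where "v0 = v1 /\<^sub>R norm v1"
 have v0: "A p v0 = 0" "norm v0 = 1" using v1 by (auto simp: v0_def linear_scale[OF linA])
 have ker1: "v = 0" if "A p v = 0" "v0 \<bullet> v = 0" for v
  using corank_1_kernel[OF linA rank v0 that] .
 have "range (A p) \<noteq> UNIV"
 proof
  assume "range (A p) = UNIV"
  then have "inj (A p)" by (metis linA linear_surjective_imp_injective)
  then show False using v1 linear_injective_0[OF linA, of p] by blast
 qed
 moreover have "span (range (A p)) = range (A p)"
  unfolding span_eq_iff by (rule linear_subspace_image[OF linA subspace_UNIV])
 ultimately have "span (range (A p)) \<noteq> UNIV" by metis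
 then obtain w1 where w1: "w1 \<noteq> 0" "\<And>x. x \<in> span (range (A p)) \<Longrightarrow> w1 \<bullet> x = 0"
  using span_not_UNIV_orthogonal by blast
 define w0 where "w0 = w1 /\<^sub>R norm w1"
 have w0: "norm w0 = 1" "w0 \<bullet> w0 = 1" "w0 \<bullet> A p v = 0" for v
  using w1 span_base[of "A p v" "range (A p)"] by (auto simp: w0_def dot_square_norm power2_eq_square)
 \<comment> \<open>\<open>B\<close> is the differential of \<open>G\<close>. It is injective at
   \<open>p\<close>: its \<open>w0\<close> component reads off \<open>v0 \<bullet> v\<close>,
   because \<open>w0\<close> is orthogonal to the range of \<open>A p\<close>, and the rest is
   \<open>A p\<close> itself, injective on the complement of \<open>v0\<close>.\<close>
 define B where "B q v = A q v - (w0 \<bullet> A q v) *\<^sub>R w0 + (v0 \<bullet> v) *\<^sub>R w0" for q v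
 define G where "G q = \<pi> q - (w0 \<bullet> \<pi> q) *\<^sub>R w0 + (v0 \<bullet> q) *\<^sub>R w0" for q
 have linB: "linear (B q)" for q
  unfolding B_def using linear_add[OF linA] linear_scale[OF linA]
  by (auto intro!: linearI simp: inner_add_right algebra_simps)
 have hdG: "(G has_derivative B q) (at q)" for q
  unfolding G_def[abs_def] B_def[abs_def] by (auto intro!: derivative_eq_intros hdA)
 have frG: "FD G q = B q" for q using frechet_derivative_at[OF hdG] by simp
 have smG: "smooth_on UNIV G" unfolding G_def[abs_def]
  by (intro smooth_intros smooth smooth_on_linear) (auto simp: bounded_linear_ident)
 have Bp: "v = 0" if "B p v = 0" for v
 proof -
  have "w0 \<bullet> B p v = v0 \<bullet> v" using w0 by (simp add: B_def inner_add_right inner_diff_right)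
  then have "v0 \<bullet> v = 0" using that by simp
  moreover from this have "A p v = 0" using that w0(3)[of v] by (simp add: B_def)
  ultimately show ?thesis using ker1 by blast
 qed
 obtain j Y where j: "kernel_field_near \<pi> p Y" "(lie_deriv Y ^^ j) D p \<noteq> 0"
 proof -
  obtain j where "has_type_at \<pi> p j" using type unfolding type_at_most_def by blast
  then show ?thesis using that Dp unfolding has_type_at_def by (auto simp: critical_set_def D_def)
 qed
 obtain X where X: "open X" "p \<in> X" "smooth_on X Y" "\<And>y. y \<in> X \<Longrightarrow> D y = 0 \<Longrightarrow> A y (Y y) = 0"
  using j(1) unfolding kernel_field_near_def by (auto simp: critical_set_def D_def A_def)
 obtain U V g where U: "open U" "U \<subseteq> X" "p \<in> U" "open V" "G p \<in> V" and hom: "homeomorphism U V G g"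
  and dg: "\<And>y. y \<in> V \<Longrightarrow> (g has_derivative inv (B (g y))) (at y)" and bijB: "\<And>y. y \<in> V \<Longrightarrow> bij (B (g y))"
  using local_diffeo[OF X(1,2) smooth_on_subset[OF smG subset_UNIV]] Bp by (auto simp: frG)
 have gG: "g (G q) = q" if "q \<in> U" for q using hom that by (auto simp: homeomorphism_def)
 have GV: "G q \<in> V" if "q \<in> U" for q using hom that by (auto simp: homeomorphism_def)
 have gU: "g y \<in> U" if "y \<in> V" for y using hom that by (auto simp: homeomorphism_def)
 have bijB': "bij (B q)" if "q \<in> U" for q using bijB[OF GV[OF that]] gG[OF that] by simp
 have detB: "det_endo (B q) \<noteq> 0" if "q \<in> U" for q
  using bijB'[OF that] linear_injective_0[OF linB] by (intro det_endo_nonzero[OF bij linB]) (auto simp: bij_def)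
 \<comment> \<open>This is \<open>inv (B q) w0\<close>, the coordinate field of the chart in
   direction \<open>w0\<close>, written with the adjugate to make its smoothness visible.\<close>
 define Z where "Z q = inverse (det_endo (B q)) *\<^sub>R adj_endo (B q) w0" for q
 have smAv: "smooth_on UNIV (\<lambda>q. A q v)" for v unfolding A_def by (intro smooth_intros smooth)
 have smBv: "smooth_on UNIV (\<lambda>q. B q v)" for v unfolding B_def by (intro smooth_intros smAv) auto
 have smU: "smooth_on U f" if "smooth_on UNIV f" for f :: "'a \<Rightarrow> 'c::real_normed_vector"
  using smooth_on_subset[OF that] by simp
 have smZ: "smooth_on U Z"
  unfolding Z_def using U detB by (intro smooth_intros smU[OF smBv]) auto
 have invB: "inv (B q) w0 = Z q" and BZ: "B q (Z q) = w0" if "q \<in> U" for q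
 proof -
  have e: "B q (inv (B q) w0) = w0" using bijB'[OF that] by (simp add: bij_def surj_f_inv_f)
  show "inv (B q) w0 = Z q"
   using adj_endo_apply[OF bij linB, of q "inv (B q) w0"] detB[OF that] by (simp add: Z_def e)
  then show "B q (Z q) = w0" using e by simp
 qed
 \<comment> \<open>Lines parallel to \<open>w0\<close> in the chart are integral curves of
   \<open>Z\<close>, so differentiating along them iterates the Lie derivative.\<close>
 have along: "DERIV (\<lambda>s. H (g (y + s *\<^sub>R w0))) s :> lie_deriv Z H (g (y + s *\<^sub>R w0))"
  if "y + s *\<^sub>R w0 \<in> V" "smooth_on U H" for H y s
 proof -
  let ?q = "g (y + s *\<^sub>R w0)"
  have "((\<lambda>s. y + s *\<^sub>R w0) has_derivative (\<lambda>t. t *\<^sub>R w0)) (at s)" by (auto intro!: derivative_eq_intros)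
  from diff_chain_at[OF this dg[OF that(1)]]
  have "((\<lambda>s. g (y + s *\<^sub>R w0)) has_derivative (\<lambda>t. inv (B ?q) (t *\<^sub>R w0))) (at s)" by (simp add: o_def)
  from diff_chain_at[OF this smooth_on_has_derivative[OF that(2) gU[OF that(1)]]]
  have 1: "((\<lambda>s. H (g (y + s *\<^sub>R w0))) has_derivative (\<lambda>t. FD H (?q) (inv (B ?q) (t *\<^sub>R w0)))) (at s)"
   by (simp add: o_def)
  have "FD H (?q) (inv (B ?q) (t *\<^sub>R w0)) = FD H (?q) (Z ?q) * t" for t
   using linear_scale[OF has_derivative_linear[OF dg[OF that(1)]]] invB[OF gU[OF that(1)]]
    linear_scale[OF has_derivative_linear[OF smooth_on_has_derivative[OF that(2) gU[OF that(1)]]]] by simp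
  then show ?thesis using 1 by (simp add: has_field_derivative_def lie_deriv_def mult_commute_abs)
 qed
 have along_m: "DERIV (\<lambda>s. (lie_deriv Z ^^ m) H (g (y + s *\<^sub>R w0))) s :> (lie_deriv Z ^^ Suc m) H (g (y + s *\<^sub>R w0))"
  if "y + s *\<^sub>R w0 \<in> V" "smooth_on U H" for H y s m
  using along[OF that(1) lie_deriv_smooth[OF U(1) smZ that(2)]] by simp
 define F where "F q = w0 \<bullet> \<pi> q" for q
 have smF: "smooth_on U F" unfolding F_def by (intro smU smooth_intros smooth) auto
 have "\<exists>m. (lie_deriv Z ^^ Suc m) F p \<noteq> 0"
 proof (rule ccontr)
  assume "\<not> (\<exists>m. (lie_deriv Z ^^ Suc m) F p \<noteq> 0)"
  then have van: "(lie_deriv Z ^^ m) (lie_deriv Z F) p = 0" for m by (metis funpow_Suc_right o_apply)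
  obtain r where r: "r > 0" "ball (G p) r \<subseteq> V" using U by (meson open_contains_ball)
  define \<gamma> where "\<gamma> s = g (G p + s *\<^sub>R w0)" for s
  have inV: "G p + s *\<^sub>R w0 \<in> V" if "\<bar>s\<bar> < r" for s using r(2) that w0(1) by (auto simp: dist_norm subset_iff)
  have g0: "\<gamma> 0 = p" using gG[OF U(3)] by (simp add: \<gamma>_def)
  have "isCont g (G p)" using dg[OF U(5)] has_derivative_continuous by blast
  then have c2: "isCont g (G p + 0 *\<^sub>R w0)" by simp
  have c1: "isCont (\<lambda>s. G p + s *\<^sub>R w0) 0" by (intro continuous_intros)
  have "isCont \<gamma> 0" unfolding \<gamma>_def[abs_def] by (rule isCont_o2[OF c1 c2])
  then have "(\<gamma> \<longlongrightarrow> \<gamma> 0) (nhds 0)"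
   unfolding tendsto_at_iff_tendsto_nhds[symmetric] isCont_def .
  then have \<gamma>: "filterlim \<gamma> (nhds p) (nhds 0)" unfolding g0 .
  have ev\<gamma>: "eventually (\<lambda>s. P (\<gamma> s)) (nhds 0)" if "eventually P (nhds p)" for P
   using eventually_compose_filterlim[OF that \<gamma>] .
  have evU: "eventually (\<lambda>q. q \<in> U) (nhds p)" using U by (intro eventually_nhds_in_open)
  have flat_iff: "flat_at_0 (\<lambda>s. H (\<gamma> s)) \<longleftrightarrow> (\<forall>m. (lie_deriv Z ^^ m) H p = 0)" if "smooth_on U H" for H
   using flat_at_0_iff_derivatives_zero[OF r(1), of "\<lambda>m s. (lie_deriv Z ^^ m) H (\<gamma> s)"] along_m[OF inV that] g0
   by (simp add: \<gamma>_def)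
  have smH1: "smooth_on U (lie_deriv Z F)" using lie_deriv_smooth[OF U(1) smZ smF, of 1] by simp
  have flat_H1: "flat_at_0 (\<lambda>s. lie_deriv Z F (\<gamma> s))" using flat_iff[OF smH1] van by simp
  have frF: "FD F q v = w0 \<bullet> A q v" for q v
  proof -
   have "(F has_derivative (\<lambda>v. w0 \<bullet> A q v)) (at q)" unfolding F_def[abs_def] by (auto intro!: derivative_eq_intros hdA)
   then show ?thesis using frechet_derivative_at by metis
  qed
  \<comment> \<open>Along \<open>Z\<close> the chart moves in direction \<open>w0\<close> only,
    hence every component of \<open>\<pi>\<close> other than the one along \<open>w0\<close> is
    stationary.\<close>
  have AZ: "A q (Z q) = lie_deriv Z F q *\<^sub>R w0" if "q \<in> U" for q
  proof -
   have "w0 \<bullet> B q (Z q) = 1" using BZ[OF that] w0 by simp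
   then have "v0 \<bullet> Z q = 1" using w0 by (simp add: B_def inner_add_right inner_diff_right)
   then show ?thesis using BZ[OF that] by (simp add: B_def lie_deriv_def frF)
  qed
  have tend: "(f \<longlongrightarrow> f p) (nhds p)" if "smooth_on U f" for f :: "'a \<Rightarrow> 'c::{real_normed_vector}"
   using continuous_on_tendsto_nhds[OF U(1,3) smooth_on_continuous[OF that]] .
  have evbd: "eventually (\<lambda>q. norm (f q) < norm (f p) + 1) (nhds p)" if "smooth_on U f" for f :: "'a \<Rightarrow> 'c::{real_normed_vector}"
   using order_tendstoD(2)[OF tendsto_norm[OF tend[OF that]], of "norm (f p) + 1"] by simp
  have evlow: "eventually (\<lambda>q. norm (f q) > norm (f p) / 2) (nhds p)" if "smooth_on U f" "f p \<noteq> 0" for f :: "'a \<Rightarrow> 'c::{real_normed_vector}"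
   using order_tendstoD(1)[OF tendsto_norm[OF tend[OF that(1)]], of "norm (f p) / 2"] that(2) by simp
  have Zp: "Z p \<noteq> 0" using BZ[OF U(3)] linear_0[OF linB] w0(1) by fastforce
  \<comment> \<open>\<open>Z\<close> stays bounded below in length while \<open>A\<close> shrinks it
    to the size of \<open>lie_deriv Z F\<close>. The determinant is therefore dominated by that
    derivative and inherits its flatness.\<close>
  have flat_D: "flat_at_0 (\<lambda>s. D (\<gamma> s))"
  proof -
   obtain C where C: "eventually (\<lambda>q. \<forall>v. \<bar>det_endo (A q)\<bar> * norm v \<le> C * norm (A q v)) (nhds p)"
    using eventually_det_endo_lower_bound[OF bij linA tend[OF smU[OF smAv]]] .
   have "eventually (\<lambda>q. norm (D q) \<le> (2 * \<bar>C\<bar> / norm (Z p)) * norm (lie_deriv Z F q)) (nhds p)"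
    using C evlow[OF smZ Zp] evU
   proof eventually_elim
    case (elim q)
    have "\<bar>D q\<bar> * (norm (Z p) / 2) \<le> \<bar>D q\<bar> * norm (Z q)" using elim(2) by (intro mult_left_mono) auto
    also have "\<dots> \<le> C * norm (A q (Z q))" using elim(1) by (simp add: D)
    also have "\<dots> \<le> \<bar>C\<bar> * norm (A q (Z q))" by (intro mult_right_mono) auto
    also have "norm (A q (Z q)) = \<bar>lie_deriv Z F q\<bar>" using AZ[OF elim(3)] w0(1) by simp
    finally show ?case using Zp by (simp add: field_simps)
   qed
   from flat_at_0_bound[OF flat_H1 ev\<gamma>[OF this]] show ?thesis .
  qed
  have smY: "smooth_on U Y" using smooth_on_subset[OF X(3) U(2)] .
  \<comment> \<open>\<open>A q (Y q)\<close> vanishes on the critical set, and simple vanishing of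
    the determinant turns this into divisibility by \<open>D\<close>.\<close>
  obtain C1 where C1: "eventually (\<lambda>q. norm (A q (Y q)) \<le> C1 * \<bar>D q\<bar>) (nhds p)"
  proof (rule simply_vanishing_divides[OF U(1,3) smU[OF D_smooth] Dp])
   show "FD D p \<noteq> (\<lambda>_. 0)" using simple Dp unfolding vanishes_simply_def D_def by blast
   show "smooth_on U (\<lambda>q. A q (Y q))"
    unfolding A_def by (intro smooth_intros U smU[OF smooth] smY)
   show "A q (Y q) = 0" if "q \<in> U" "D q = 0" for q using X(4) that U(2) by auto
  qed
  obtain C2 where C2: "eventually (\<lambda>q. \<forall>v. \<bar>det_endo (B q)\<bar> * norm v \<le> C2 * norm (B q v)) (nhds p)"
   using eventually_det_endo_lower_bound[OF bij linB tend[OF smU[OF smBv]]] .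
  \<comment> \<open>\<open>f\<close> is the component of \<open>Y\<close> along \<open>Z\<close>.
    The difference of \<open>Y\<close> and \<open>f\<close> times \<open>Z\<close> is mapped by
    \<open>B\<close> to the part of \<open>A q (Y q)\<close> orthogonal to \<open>w0\<close>, so it
    is itself O(\<open>D\<close>).\<close>
  define f where "f q = v0 \<bullet> Y q" for q
  have smf: "smooth_on U f" unfolding f_def using U(1) smY by (intro smooth_intros)
  have smdet: "smooth_on U (\<lambda>q. det_endo (B q))" using U(1) by (intro smooth_intros smU[OF smBv])
  define C3 where "C3 = 2 * (\<bar>C2\<bar> * (2 * \<bar>C1\<bar>)) / \<bar>det_endo (B p)\<bar>"
  have C3: "eventually (\<lambda>q. norm (Y q - f q *\<^sub>R Z q) \<le> C3 * \<bar>D q\<bar>) (nhds p)"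
   using C1 C2 evlow[OF smdet detB[OF U(3)]] evU
  proof eventually_elim
   case (elim q)
   have "B q (Y q - f q *\<^sub>R Z q) = A q (Y q) - (w0 \<bullet> A q (Y q)) *\<^sub>R w0"
    using linear_diff[OF linB] linear_scale[OF linB] BZ[OF elim(4)] by (simp add: B_def[of q "Y q"] f_def)
   also have "norm \<dots> \<le> norm (A q (Y q)) + \<bar>w0 \<bullet> A q (Y q)\<bar> * norm w0"
    by (rule order_trans[OF norm_triangle_ineq4]) simp
   also have "\<dots> \<le> 2 * norm (A q (Y q))" using Cauchy_Schwarz_ineq2[of w0 "A q (Y q)"] w0(1) by simp
   also have "\<dots> \<le> 2 * (C1 * \<bar>D q\<bar>)" using elim(1) by simp
   also have "\<dots> \<le> 2 * (\<bar>C1\<bar> * \<bar>D q\<bar>)" by (intro mult_left_mono mult_right_mono) auto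
   finally have 1: "norm (B q (Y q - f q *\<^sub>R Z q)) \<le> 2 * \<bar>C1\<bar> * \<bar>D q\<bar>" by simp
   have "(\<bar>det_endo (B p)\<bar> / 2) * norm (Y q - f q *\<^sub>R Z q) \<le> \<bar>det_endo (B q)\<bar> * norm (Y q - f q *\<^sub>R Z q)"
    using elim(3) by (intro mult_right_mono) auto
   also have "\<dots> \<le> C2 * norm (B q (Y q - f q *\<^sub>R Z q))" using elim(2) by blast
   also have "\<dots> \<le> \<bar>C2\<bar> * norm (B q (Y q - f q *\<^sub>R Z q))" by (intro mult_right_mono) auto
   also have "\<dots> \<le> \<bar>C2\<bar> * (2 * \<bar>C1\<bar> * \<bar>D q\<bar>)" using 1 by (intro mult_left_mono) auto
   finally show ?case using detB[OF U(3)] by (simp add: C3_def field_simps)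
  qed
  \<comment> \<open>Along the curve \<open>Y\<close> is a multiple of the tangent field
    \<open>Z\<close> plus a term O(\<open>D\<close>). The first part preserves flatness since
    derivatives of flat smooth functions along the curve are flat, the second since \<open>D\<close>
    is flat.\<close>
  have step: "flat_at_0 (\<lambda>s. lie_deriv Y H (\<gamma> s))" if smH: "smooth_on U H" and fl: "flat_at_0 (\<lambda>s. H (\<gamma> s))" for H
  proof -
   define K where "K = norm (Blinfun (FD H p)) + 1"
   have "((\<lambda>q. Blinfun (FD H q)) \<longlongrightarrow> Blinfun (FD H p)) (nhds p)"
    using continuous_on_tendsto_nhds[OF U(1,3) frechet_derivative_continuous_blinfun[OF U(1) smH]] .
   from order_tendstoD(2)[OF tendsto_norm[OF this], of K]
   have K: "eventually (\<lambda>q. norm (Blinfun (FD H q)) < K) (nhds p)" by (simp add: K_def)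
   have "flat_at_0 (\<lambda>s. lie_deriv Z H (\<gamma> s))"
   proof -
    have "smooth_on U (lie_deriv Z H)" using lie_deriv_smooth[OF U(1) smZ smH, of 1] by simp
    moreover have "(lie_deriv Z ^^ m) (lie_deriv Z H) p = 0" for m
     using fl unfolding flat_iff[OF smH] by (metis funpow_Suc_right o_apply)
    ultimately show ?thesis using flat_iff by blast
   qed
   then have fl1: "flat_at_0 (\<lambda>s. f (\<gamma> s) * lie_deriv Z H (\<gamma> s))"
   proof (rule flat_at_0_bound)
    show "eventually (\<lambda>s. norm (f (\<gamma> s) * lie_deriv Z H (\<gamma> s)) \<le> (norm (f p) + 1) * norm (lie_deriv Z H (\<gamma> s))) (nhds 0)"
     using ev\<gamma>[OF evbd[OF smf]] by eventually_elim (auto simp: abs_mult intro!: mult_right_mono)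
   qed
   have "eventually (\<lambda>q. norm (FD H q (Y q - f q *\<^sub>R Z q)) \<le> (K * C3) * norm (D q)) (nhds p)"
    using K C3 evU
   proof eventually_elim
    case (elim q)
    have "bounded_linear (FD H q)"
     using has_derivative_bounded_linear[OF smooth_on_has_derivative[OF smH elim(3)]] .
    then have "norm (FD H q (Y q - f q *\<^sub>R Z q)) \<le> norm (Blinfun (FD H q)) * norm (Y q - f q *\<^sub>R Z q)"
     by (metis bounded_linear_Blinfun_apply norm_blinfun)
    also have "\<dots> \<le> K * (C3 * \<bar>D q\<bar>)" using elim by (intro mult_mono) (auto simp: K_def)
    finally show ?case by simp
   qed
   from flat_at_0_bound[OF flat_D ev\<gamma>[OF this]]
   have fl2: "flat_at_0 (\<lambda>s. FD H (\<gamma> s) (Y (\<gamma> s) - f (\<gamma> s) *\<^sub>R Z (\<gamma> s)))" .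
   have "eventually (\<lambda>q. norm (lie_deriv Y H q) \<le> 1 * norm (f q * lie_deriv Z H q + FD H q (Y q - f q *\<^sub>R Z q))) (nhds p)"
    using evU
   proof eventually_elim
    case (elim q)
    have lin: "linear (FD H q)"
     using has_derivative_linear[OF smooth_on_has_derivative[OF smH elim]] .
    show ?case by (simp add: lie_deriv_def linear_diff[OF lin] linear_scale[OF lin])
   qed
   from flat_at_0_bound[OF flat_at_0_add[OF fl1 fl2] ev\<gamma>[OF this]] show ?thesis .
  qed
  have "smooth_on U ((lie_deriv Y ^^ i) D) \<and> flat_at_0 (\<lambda>s. (lie_deriv Y ^^ i) D (\<gamma> s))" for i
  proof (induction i)
   case 0 then show ?case using flat_D smU[OF D_smooth] by simp
  next
   case (Suc i)
   then show ?case using step lie_deriv_smooth[OF U(1) smY smU[OF D_smooth], of "Suc i"] by simp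
  qed
  then have "(lie_deriv Y ^^ j) D (\<gamma> 0) = 0" using flat_at_0_zero by blast
  then show False using j(2) g0 by simp
 qed
 then obtain m where m: "(lie_deriv Z ^^ Suc m) F p \<noteq> 0" by blast
 define H where "H = (lie_deriv Z ^^ Suc m) F"
 have smH: "smooth_on U H" unfolding H_def by (rule lie_deriv_smooth[OF U(1) smZ smF])
 have contg: "continuous_on V g" using hom by (auto simp: homeomorphism_def)
 have "continuous_on V (\<lambda>y. H (g y))"
  using continuous_on_compose2[OF smooth_on_continuous[OF smH] contg] gU by auto
 then have "open (V \<inter> (\<lambda>y. H (g y)) -` (- {0}))"
  using U(4) by (intro continuous_open_preimage) auto
 moreover have "G p \<in> V \<inter> (\<lambda>y. H (g y)) -` (- {0})" using U(5) gG[OF U(3)] m by (simp add: H_def)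
 ultimately obtain r where r: "r > 0" "ball (G p) r \<subseteq> V \<inter> (\<lambda>y. H (g y)) -` (- {0})" by (meson open_contains_ball)
 define U1 where "U1 = U \<inter> G -` ball (G p) r"
 have "open U1" unfolding U1_def
  using smooth_on_continuous[OF smU[OF smG]] U(1) by (intro continuous_open_preimage) auto
 moreover have "p \<in> U1" using U(3) r(1) by (simp add: U1_def)
 \<comment> \<open>With one point more than \<open>Suc m\<close> on a line, iterated Rolle would
   produce a zero of \<open>H\<close> inside the ball where it does not vanish. Convexity of the
   ball makes the parameter set of the line an interval.\<close>
 moreover have "finite {q \<in> U1. \<pi> q = z} \<and> card {q \<in> U1. \<pi> q = z} \<le> Suc m" for z
 proof (rule ccontr)
  let ?Q = "{q \<in> U1. \<pi> q = z}"
  assume "\<not> (finite ?Q \<and> card ?Q \<le> Suc m)"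
  then have "infinite ?Q \<or> Suc (Suc m) \<le> card ?Q" by auto
  then obtain Q0 where Q0: "Q0 \<subseteq> ?Q" "finite Q0" "card Q0 = Suc (Suc m)"
  proof
   assume "infinite ?Q"
   then show ?thesis using infinite_arbitrarily_large[of ?Q "Suc (Suc m)"] that by blast
  next
   assume "Suc (Suc m) \<le> card ?Q"
   then show ?thesis by (rule obtain_subset_with_card_n) (rule that)
  qed
  define y where "y = z - (w0 \<bullet> z) *\<^sub>R w0"
  have Gq: "G q = y + (v0 \<bullet> q) *\<^sub>R w0" if "q \<in> Q0" for q using that Q0(1) by (auto simp: G_def y_def)
  have q: "q = g (y + (v0 \<bullet> q) *\<^sub>R w0)" if "q \<in> Q0" for q
   using gG[of q] that Q0(1) Gq[OF that] by (auto simp: U1_def)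
  define L where "L = {s. y + s *\<^sub>R w0 \<in> ball (G p) r}"
  have "convex L"
  proof -
   have "L = (\<lambda>s. s *\<^sub>R w0) -` ((\<lambda>x. x - y) ` ball (G p) r)" unfolding L_def
    by (force simp: image_iff algebra_simps)
   then show ?thesis
    by (simp add: convex_linear_vimage convex_translation_subtract linear_scaleR_left)
  qed
  have "inj_on (\<lambda>q. v0 \<bullet> q) Q0" using q by (intro inj_onI) metis
  then have cardZ: "card ((\<lambda>q. v0 \<bullet> q) ` Q0) = Suc (Suc m)" using Q0 by (simp add: card_image)
  have ZL: "(\<lambda>q. v0 \<bullet> q) ` Q0 \<subseteq> L" unfolding L_def using Gq Q0(1) by (fastforce simp: U1_def)
  have "\<exists>s\<in>L. (lie_deriv Z ^^ Suc m) F (g (y + s *\<^sub>R w0)) = 0"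
  proof (rule Rolle_iterate[OF \<open>convex L\<close> _ _ cardZ ZL, where c = "w0 \<bullet> z"])
   show "DERIV (\<lambda>s. (lie_deriv Z ^^ m) F (g (y + s *\<^sub>R w0))) s :> (lie_deriv Z ^^ Suc m) F (g (y + s *\<^sub>R w0))"
    if "s \<in> L" for m s
    using that r(2) by (intro along_m smF) (auto simp: L_def)
   show "finite ((\<lambda>q. v0 \<bullet> q) ` Q0)" using Q0 by simp
   show "(lie_deriv Z ^^ 0) F (g (y + s *\<^sub>R w0)) = w0 \<bullet> z" if "s \<in> (\<lambda>q. v0 \<bullet> q) ` Q0" for s
   proof -
    obtain q' where q': "q' \<in> Q0" "s = v0 \<bullet> q'" using \<open>s \<in> (\<lambda>q. v0 \<bullet> q) ` Q0\<close> by blast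
    have "F (g (y + s *\<^sub>R w0)) = F q'" using q[OF q'(1)] unfolding q'(2) by (rule arg_cong[of _ _ F, symmetric])
    then show ?thesis using q'(1) Q0(1) by (auto simp: F_def)
   qed
  qed
  then show False using r(2) unfolding L_def H_def by auto
 qed
 ultimately show ?thesis using that by blast
qed

lemma type_at_most_bounded_fibres:
 fixes \<pi> :: "'a::euclidean_space \<Rightarrow> 'a" and e :: "'b::finite \<Rightarrow> 'a"
 assumes bij: "bij_betw e UNIV Basis" and type: "type_at_most \<pi> k" and "compact K"
 obtains N where "\<And>z. finite {q \<in> K. \<pi> q = z}" "\<And>z. card {q \<in> K. \<pi> q = z} \<le> N"
proof -
 have "\<exists>U m. open U \<and> p \<in> U \<and> (\<forall>z. finite {q \<in> U. \<pi> q = z} \<and> card {q \<in> U. \<pi> q = z} \<le> m)" for p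
 proof (rule type_at_most_locally_bounded_fibres[OF bij type, of p])
  fix U m assume "open U" "p \<in> U" "\<And>z. finite {q \<in> U. \<pi> q = z} \<and> card {q \<in> U. \<pi> q = z} \<le> m"
  then show ?thesis by (intro exI[of _ U] exI[of _ m]) simp
 qed
 then have "\<forall>p. \<exists>U m. open U \<and> p \<in> U \<and> (\<forall>z. finite {q \<in> U. \<pi> q = z} \<and> card {q \<in> U. \<pi> q = z} \<le> m)" by blast
 from choice[OF this] obtain U where
  "\<forall>p. \<exists>m. open (U p) \<and> p \<in> U p \<and> (\<forall>z. finite {q \<in> U p. \<pi> q = z} \<and> card {q \<in> U p. \<pi> q = z} \<le> m)" by blast
 from choice[OF this] obtain m where
  Um: "\<forall>p. open (U p) \<and> p \<in> U p \<and> (\<forall>z. finite {q \<in> U p. \<pi> q = z} \<and> card {q \<in> U p. \<pi> q = z} \<le> m p)" by blast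
 have U: "\<And>p. open (U p)" "\<And>p. p \<in> U p"
  "\<And>p z. finite {q \<in> U p. \<pi> q = z} \<and> card {q \<in> U p. \<pi> q = z} \<le> m p"
  using Um by blast+
 obtain P where P: "finite P" "K \<subseteq> (\<Union>p\<in>P. U p)"
 proof (rule compactE_image[OF \<open>compact K\<close>, of K U])
  show "K \<subseteq> (\<Union>p\<in>K. U p)" using U(2) by blast
 qed (use U(1) that in auto)
 have sub: "{q \<in> K. \<pi> q = z} \<subseteq> (\<Union>p\<in>P. {q \<in> U p. \<pi> q = z})" for z using P by blast
 have fin: "finite (\<Union>p\<in>P. {q \<in> U p. \<pi> q = z})" for z using P U(3) by blast
 have "card {q \<in> K. \<pi> q = z} \<le> (\<Sum>p\<in>P. m p)" for z
 proof -
  have "card {q \<in> K. \<pi> q = z} \<le> card (\<Union>p\<in>P. {q \<in> U p. \<pi> q = z})" by (rule card_mono[OF fin sub])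
  also have "\<dots> \<le> (\<Sum>p\<in>P. card {q \<in> U p. \<pi> q = z})" by (rule card_UN_le[OF P(1)])
  also have "\<dots> \<le> (\<Sum>p\<in>P. m p)" using U(3) by (intro sum_mono) auto
  finally show ?thesis .
 qed
 then show ?thesis using that[of "\<Sum>p\<in>P. m p"] finite_subset[OF sub fin] by blast
qed

section \<open>An area formula with multiplicity\<close>

text \<open>The change of variables theorem of the library is stated for vectors indexed by a finite
 well-ordered type. An arbitrary finite index type is transferred to an ordered copy of itself.\<close>

typedef 'a ord_copy = "UNIV :: 'a set" by simp

instance ord_copy :: (finite) finite
proof
 have "(UNIV :: 'a ord_copy set) \<subseteq> range Abs_ord_copy" by (metis Abs_ord_copy_cases rangeI subsetI)
 then show "finite (UNIV :: 'a ord_copy set)" by (rule finite_surj[OF finite])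
qed

definition ord_key :: "'a::finite \<Rightarrow> nat" where
 "ord_key = (SOME f. inj f)"

lemma inj_ord_key: "inj (ord_key :: 'a::finite \<Rightarrow> nat)"
proof -
 have "\<exists>f :: 'a \<Rightarrow> nat. inj f" using finite_imp_inj_to_nat_seg[OF finite, of "UNIV :: 'a set"] by blast
 then show ?thesis unfolding ord_key_def by (rule someI_ex)
qed

instantiation ord_copy :: (finite) wellorder
begin

definition less_eq_ord_copy :: "'a ord_copy \<Rightarrow> 'a ord_copy \<Rightarrow> bool" where
 "less_eq_ord_copy x y \<longleftrightarrow> ord_key (Rep_ord_copy x) \<le> ord_key (Rep_ord_copy y)"

definition less_ord_copy :: "'a ord_copy \<Rightarrow> 'a ord_copy \<Rightarrow> bool" where
 "less_ord_copy x y \<longleftrightarrow> ord_key (Rep_ord_copy x) < ord_key (Rep_ord_copy y)"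

instance
proof
 fix P :: "'a ord_copy \<Rightarrow> bool" and a :: "'a ord_copy"
 assume step: "\<And>x. (\<And>y. y < x \<Longrightarrow> P y) \<Longrightarrow> P x"
 show "P a"
  by (induction a rule: measure_induct_rule[where f = "\<lambda>x. ord_key (Rep_ord_copy x)"])
   (rule step, simp add: less_ord_copy_def)
qed (auto simp: less_eq_ord_copy_def less_ord_copy_def inj_eq[OF inj_ord_key] Rep_ord_copy_inject)

end

section \<open>Relabelling of coordinates: Lebesgue measure and determinants\<close>

definition to_ord :: "real^'n \<Rightarrow> real^('n::finite ord_copy)" where
 "to_ord x = (\<chi> i. x $ Rep_ord_copy i)"

definition of_ord :: "real^('n::finite ord_copy) \<Rightarrow> real^'n" where
 "of_ord y = (\<chi> i. y $ Abs_ord_copy i)"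

lemma of_ord_to_ord [simp]: "of_ord (to_ord x) = x" and to_ord_of_ord [simp]: "to_ord (of_ord y) = y"
 by (simp_all add: of_ord_def to_ord_def vec_eq_iff Abs_ord_copy_inverse Rep_ord_copy_inverse)

lemma linear_to_ord: "linear to_ord" and linear_of_ord: "linear of_ord"
 by (auto intro!: linearI simp: to_ord_def of_ord_def vec_eq_iff)

lemma bij_Rep_ord_copy: "bij Rep_ord_copy"
 by (metis Abs_ord_copy_inverse Rep_ord_copy_inverse UNIV_I bijI')

lemma measurable_to_ord [measurable]: "to_ord \<in> borel_measurable borel"
 by (intro borel_measurable_continuous_onI linear_continuous_on linear_conv_bounded_linear[THEN iffD1] linear_to_ord)

lemma measurable_of_ord [measurable]: "of_ord \<in> borel_measurable borel"
 by (intro borel_measurable_continuous_onI linear_continuous_on linear_conv_bounded_linear[THEN iffD1] linear_of_ord)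

lemma prod_Basis_vec: "(\<Prod>b\<in>(Basis :: (real^'n) set). x \<bullet> b) = (\<Prod>i\<in>UNIV. x $ i)"
proof -
 have inj: "inj (\<lambda>i. axis i (1::real) :: real^'n)" by (auto simp: inj_on_def axis_eq_axis)
 have "(Basis :: (real^'n) set) = range (\<lambda>i. axis i 1)" by (auto simp: Basis_vec_def)
 then have "(\<Prod>b\<in>(Basis :: (real^'n) set). x \<bullet> b) = (\<Prod>i\<in>UNIV. x \<bullet> axis i 1)"
  using prod.reindex[OF inj, of "\<lambda>b. x \<bullet> b"] by (simp add: o_def)
 then show ?thesis by (simp add: inner_axis)
qed

text \<open>Lebesgue measure is determined by the volumes of boxes, and relabelling coordinates only
  permutes the factors of such a volume.\<close>

lemma distr_to_ord: "distr lborel borel (to_ord :: real^'n \<Rightarrow> _) = lborel"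
proof (rule lborel_eqI[symmetric])
 fix l u :: "real^'n ord_copy" assume le: "\<And>b. b \<in> Basis \<Longrightarrow> l \<bullet> b \<le> u \<bullet> b"
 have le': "l $ i \<le> u $ i" for i using le[of "axis i 1"] by (simp add: inner_axis axis_in_Basis_iff)
 have "to_ord -` box l u = (box (of_ord l) (of_ord u) :: (real^'n) set)"
 proof (rule set_eqI)
  fix x :: "real^'n"
  have "x \<in> to_ord -` box l u \<longleftrightarrow> (\<forall>i. l $ i < x $ Rep_ord_copy i \<and> x $ Rep_ord_copy i < u $ i)"
   by (simp add: mem_box_cart to_ord_def)
  also have "\<dots> \<longleftrightarrow> (\<forall>j. l $ Abs_ord_copy j < x $ j \<and> x $ j < u $ Abs_ord_copy j)"
   by (metis Abs_ord_copy_inverse Rep_ord_copy_inverse UNIV_I)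
  also have "\<dots> \<longleftrightarrow> x \<in> box (of_ord l) (of_ord u)" by (simp add: mem_box_cart of_ord_def)
  finally show "x \<in> to_ord -` box l u \<longleftrightarrow> x \<in> box (of_ord l) (of_ord u)" .
 qed
 then have "emeasure (distr lborel borel (to_ord :: real^'n \<Rightarrow> _)) (box l u) = emeasure lborel (box (of_ord l) (of_ord u) :: (real^'n) set)"
  by (simp add: emeasure_distr)
 also have "\<dots> = ennreal (\<Prod>b\<in>Basis. (of_ord u - of_ord l :: real^'n) \<bullet> b)"
 proof (rule emeasure_lborel_box)
  fix b :: "real^'n" assume "b \<in> Basis"
  then obtain i where "b = axis i 1" by (auto simp: Basis_vec_def)
  then show "of_ord l \<bullet> b \<le> of_ord u \<bullet> b" using le' by (simp add: inner_axis of_ord_def)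
 qed
 also have "(\<Prod>b\<in>Basis. (of_ord u - of_ord l :: real^'n) \<bullet> b) = (\<Prod>j\<in>UNIV. (u - l) $ Abs_ord_copy j)"
  by (simp add: prod_Basis_vec of_ord_def)
 also have "\<dots> = (\<Prod>i\<in>UNIV. (u - l) $ i)"
  by (rule prod.reindex_bij_witness[of _ Rep_ord_copy Abs_ord_copy]) (auto simp: Abs_ord_copy_inverse Rep_ord_copy_inverse)
 also have "\<dots> = (\<Prod>b\<in>Basis. (u - l) \<bullet> b)" by (simp only: prod_Basis_vec)
 finally show "emeasure (distr lborel borel (to_ord :: real^'n \<Rightarrow> _)) (box l u) = ennreal (\<Prod>b\<in>Basis. (u - l) \<bullet> b)" .
qed simp

lemma nn_integral_to_ord:
 assumes "f \<in> borel_measurable borel"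
 shows "(NN x. f (to_ord (x :: real^'n))) = (NN y. f y)"
proof -
 have "(NN y. f y) = (\<integral>\<^sup>+y. f y \<partial>distr lborel borel (to_ord :: real^'n \<Rightarrow> _))"
  by (simp only: distr_to_ord)
 then show ?thesis by (simp add: nn_integral_distr assms)
qed

lemma emeasure_to_ord_vimage:
 assumes "A \<in> sets borel"
 shows "emeasure lborel (to_ord -` A :: (real^'n) set) = emeasure lborel A"
proof -
 have "emeasure lborel A = emeasure (distr lborel borel (to_ord :: real^'n \<Rightarrow> _)) A"
  by (simp only: distr_to_ord)
 then show ?thesis using assms by (simp add: emeasure_distr)
qed

lemma det_ord_conj:
 fixes f :: "real^'n \<Rightarrow> real^'n"
 shows "det (matrix (\<lambda>y. to_ord (f (of_ord y)))) = det (matrix f)"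
proof -
 let ?e = "\<lambda>i :: 'n ord_copy. axis (Rep_ord_copy i) (1::real)"
 have ax: "of_ord (axis j 1) = axis (Rep_ord_copy j) (1::real)" for j :: "'n ord_copy"
  by (auto simp: of_ord_def axis_def vec_eq_iff Abs_ord_copy_inverse Rep_ord_copy_inverse)
 have "bij_betw ?e UNIV Basis"
  unfolding bij_betw_def
 proof
  show "inj ?e" by (auto simp: inj_on_def axis_eq_axis Rep_ord_copy_inject)
  show "range ?e = Basis"
   using bij_Rep_ord_copy[where 'a = 'n] by (auto simp: Basis_vec_def) (metis bij_pointE rangeI)
 qed
 then have "det_endo f = det (\<chi> i j. f (?e j) \<bullet> ?e i)" by (rule det_endo_eq_det)
 also have "(\<chi> i j. f (?e j) \<bullet> ?e i) = matrix (\<lambda>y. to_ord (f (of_ord y)))"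
  by (simp add: matrix_def vec_eq_iff to_ord_def ax inner_axis)
 finally show ?thesis by (simp add: det_endo_eq_det_matrix)
qed

text \<open>The change of variables theorem is applied to the copy \<open>G\<close> of
  \<open>g\<close> on ordered indices and carried back; relabelling changes neither measure nor
  determinant. Boundedness of the image makes its measure a finite number, as the theorem equates
  real values.\<close>

lemma nn_integral_det_homeomorphism:
 fixes g :: "real^'n \<Rightarrow> real^'n"
 assumes hom: "homeomorphism U V g h" and "open U" "open V" and smooth: "smooth_on UNIV g"
  and S: "S \<in> sets borel" "S \<subseteq> U" and bdd: "bounded (g ` S)"
 shows "g ` S \<in> sets borel"
  and "(NN x. ennreal \<bar>det (matrix (FD g x))\<bar> * indicator S x) = emeasure lborel (g ` S)"
proof -
 have contg: "continuous_on V h" using hom by (simp add: homeomorphism_def)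
 have eq: "g ` S = V \<inter> h -` S"
 proof
  show "g ` S \<subseteq> V \<inter> h -` S" using hom S(2) by (auto simp: homeomorphism_def)
  show "V \<inter> h -` S \<subseteq> g ` S" using hom by (force simp: homeomorphism_def)
 qed
 have "V \<inter> h -` S \<in> sets borel"
  using borel_measurable_continuous_on_restrict[OF contg] S(1) \<open>open V\<close>
  by (auto simp: measurable_def sets_restrict_space_iff space_restrict_space Int_commute dest!: bspec[of _ _ S])
 then show bo: "g ` S \<in> sets borel" using eq by simp
 define G where "G = (\<lambda>y. to_ord (g (of_ord y)))"
 define T where "T = of_ord -` S"
 define G' where "G' y = (\<lambda>v. to_ord (FD g (of_ord y) (of_ord v)))" for y
 have T: "T \<in> sets borel" unfolding T_def using S(1) measurable_sets[OF measurable_of_ord S(1)] by simp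
 have GT: "G ` T = of_ord -` (g ` S)"
 proof
  show "of_ord -` (g ` S) \<subseteq> G ` T"
  proof
   fix y assume "y \<in> of_ord -` (g ` S)"
   then obtain x where "of_ord y = g x" "x \<in> S" by auto
   then have "y = G (to_ord x)" "to_ord x \<in> T" by (simp_all add: G_def T_def) (metis to_ord_of_ord)
   then show "y \<in> G ` T" by blast
  qed
 qed (auto simp: G_def T_def)
 have bGT: "G ` T \<in> sets borel" unfolding GT using measurable_sets[OF measurable_of_ord bo] by simp
 have der: "(G has_derivative G' y) (at y within T)" for y
 proof -
  have 1: "(of_ord has_derivative of_ord) (at y)" "(to_ord has_derivative to_ord) (at z)" for z :: "real^'n"
   by (intro linear_imp_has_derivative linear_of_ord linear_to_ord)+
  have 2: "(g has_derivative FD g (of_ord y)) (at (of_ord y))"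
   using smooth_on_has_derivative[OF smooth] by simp
  show ?thesis
   using diff_chain_at[OF diff_chain_at[OF 1(1) 2] 1(2)] unfolding G_def G'_def
   by (simp add: o_def has_derivative_at_withinI)
 qed
 have inj: "inj_on G T"
 proof (rule inj_onI)
  fix x y assume xy: "x \<in> T" "y \<in> T" "G x = G y"
  then have "g (of_ord x) = g (of_ord y)" unfolding G_def by (metis of_ord_to_ord)
  then have "of_ord x = of_ord y" using hom xy(1,2) S(2) unfolding T_def homeomorphism_def by (metis subsetD vimageE)
  then show "x = y" by (metis to_ord_of_ord)
 qed
 have bd: "bounded (G ` T)"
 proof -
  have "bounded (to_ord ` (g ` S))" 
   by (rule bounded_linear_image[OF bdd linear_conv_bounded_linear[THEN iffD1, OF linear_to_ord]])
  moreover have "G ` T \<subseteq> to_ord ` (g ` S)" unfolding G_def T_def by auto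
  ultimately show ?thesis by (rule bounded_subset)
 qed
 have lm: "G ` T \<in> lmeasurable" using bd bGT by (intro bounded_set_imp_lmeasurable) auto
 have "((\<lambda>x. \<bar>det (matrix (G' x))\<bar>) has_integral measure lebesgue (G ` T)) T"
  using has_measure_differentiable_image[of T G G' "measure lebesgue (G ` T)"] T der inj lm by auto
 then have "(NN x. ennreal \<bar>det (matrix (G' x))\<bar> * indicator T x) = ennreal (measure lebesgue (G ` T))"
  by (intro nn_integral_has_integral_lebesgue') auto
 also have "\<dots> = emeasure lborel (G ` T)"
  using emeasure_eq_measure2[OF lm] bGT by (simp add: )
 also have "\<dots> = emeasure lborel (g ` S)"
  unfolding emeasure_to_ord_vimage[OF bGT, symmetric] by (rule arg_cong[of _ _ "emeasure lborel"]) (auto simp: GT)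
 finally have 1: "(NN x. ennreal \<bar>det (matrix (G' x))\<bar> * indicator T x) = emeasure lborel (g ` S)" .
 let ?f = "\<lambda>x. ennreal \<bar>det (matrix (FD g x))\<bar> * indicator S x"
 have detm: "(\<lambda>x. det (matrix (FD g x))) \<in> borel_measurable borel"
 proof -
  have "continuous_on UNIV (\<lambda>x. det_endo (FD g x))"
   using smooth by (intro smooth_on_continuous smooth_intros) auto
  then show ?thesis unfolding det_endo_eq_det_matrix by (rule borel_measurable_continuous_onI)
 qed
 have fm: "?f \<in> borel_measurable borel" using detm S(1) by measurable
 have "(NN x. ?f x) = (NN x. ?f (of_ord (to_ord x)))" by simp
 also have "\<dots> = (NN y. ?f (of_ord y))"
  using fm by (intro nn_integral_to_ord measurable_compose[OF measurable_of_ord])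
 also have "\<dots> = (NN x. ennreal \<bar>det (matrix (G' x))\<bar> * indicator T x)"
  unfolding G'_def det_ord_conj T_def by (intro nn_integral_cong) (simp add: indicator_def)
 finally show "(NN x. ?f x) = emeasure lborel (g ` S)" using 1 by simp
qed

text \<open>Critical points contribute nothing to the left-hand side. The remaining points are
  covered by countably many open sets on which \<open>g\<close> is a homeomorphism; after these are
  made disjoint, a value \<open>y\<close> lies in at most as many images as it has preimages in
  \<open>A\<close>, hence in at most \<open>N\<close>.\<close>

lemma area_formula_le:
 fixes g :: "real^'n \<Rightarrow> real^'n"
 assumes smooth: "smooth_on UNIV g" and A: "A \<in> sets borel" and B: "B \<in> sets borel" "bounded B"
  and mult: "\<And>y. finite {x \<in> A. g x = y}" "\<And>y. card {x \<in> A. g x = y} \<le> N"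
 shows "(NN x. ennreal \<bar>det (matrix (FD g x))\<bar> * indicator (A \<inter> g -` B) x)
  \<le> of_nat N * emeasure lborel B"
proof -
 define J where "J x = det (matrix (FD g x))" for x
 have "continuous_on UNIV (\<lambda>x. det_endo (FD g x))"
  using smooth by (intro smooth_on_continuous smooth_intros) auto
 then have contJ: "continuous_on UNIV J" unfolding J_def det_endo_eq_det_matrix .
 then have [measurable]: "J \<in> borel_measurable borel" by (rule borel_measurable_continuous_onI)
 have gm [measurable]: "g \<in> borel_measurable borel" by (rule borel_measurable_continuous_onI[OF smooth_on_continuous[OF smooth]])
 define F where "F = {U. open U \<and> (\<exists>V h. open V \<and> homeomorphism U V g h)}"
 have cov: "\<exists>U\<in>F. x \<in> U" if "J x \<noteq> 0" for x
 proof -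
  have lin: "linear (FD g x)"
   using has_derivative_linear[OF smooth_on_has_derivative[OF smooth]] by simp
  have inv: "invertible (matrix (FD g x))" using that by (simp add: J_def invertible_det_nz)
  have "v = 0" if "FD g x v = 0" for v
  proof -
   have "matrix (FD g x) *v v = 0" using that lin by (simp add: matrix_works)
   then show ?thesis using inv by (metis invertible_left_inverse matrix_left_invertible_ker)
  qed
  then obtain U V h where "open U" "x \<in> U" "open V" "homeomorphism U V g h"
   using local_diffeo[OF open_UNIV UNIV_I smooth, of x] by metis
  then show ?thesis unfolding F_def by blast
 qed
 obtain F' where F': "F' \<subseteq> F" "countable F'" "\<Union>F' = \<Union>F"
  using Lindelof[of F] unfolding F_def by blast
 define U where "U = from_nat_into (insert {} F')"
 have Uin: "U i \<in> insert {} F'" for i unfolding U_def by (rule from_nat_into) simp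
 have rangeU: "range U = insert {} F'" unfolding U_def using F'(2) by (intro range_from_nat_into) auto
 have Uhom: "open (U i)" "\<exists>V h. open V \<and> homeomorphism (U i) V g h" for i
 proof -
  have "U i \<in> insert {} F" using Uin[of i] F'(1) by blast
  then show "open (U i)" "\<exists>V h. open V \<and> homeomorphism (U i) V g h"
   by (auto simp: F_def intro: exI[of _ "{}"] simp: homeomorphism_def)
 qed
 define T where "T = A \<inter> g -` B"
 \<comment> \<open>Each point is assigned to the first chart that contains it.\<close>
 define S where "S i = (T \<inter> U i) - (\<Union>j<i. U j)" for i
 have Tb: "T \<in> sets borel" unfolding T_def using A measurable_sets[OF gm B(1)] by auto
 have Sb [measurable]: "S i \<in> sets borel" for i unfolding S_def using Tb Uhom(1) by (intro sets.Diff sets.Int sets.finite_UN) auto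
 have bdS: "bounded (g ` S i)" for i
  by (rule bounded_subset[OF B(2)]) (auto simp: S_def T_def)
 have piece: "g ` S i \<in> sets borel"
  "(NN x. ennreal \<bar>J x\<bar> * indicator (S i) x) = emeasure lborel (g ` S i)" for i
 proof -
  obtain V h where Vh: "open V" "homeomorphism (U i) V g h" using Uhom(2) by blast
  have "S i \<subseteq> U i" unfolding S_def by blast
  from nn_integral_det_homeomorphism[OF Vh(2) Uhom(1) Vh(1) smooth Sb this bdS]
  show "g ` S i \<in> sets borel" "(NN x. ennreal \<bar>J x\<bar> * indicator (S i) x) = emeasure lborel (g ` S i)"
   unfolding J_def by auto
 qed
 have disj: "i = j" if "x \<in> S i" "x \<in> S j" for x i j
  using that unfolding S_def by (metis (no_types, lifting) DiffD1 DiffD2 IntD2 UN_I lessThan_iff linorder_neqE_nat)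
 have "(NN x. ennreal \<bar>J x\<bar> * indicator T x) = (NN x. (\<Sum>i. ennreal \<bar>J x\<bar> * indicator (S i) x))"
 proof (rule nn_integral_cong)
  fix x
  show "ennreal \<bar>J x\<bar> * indicator T x = (\<Sum>i. ennreal \<bar>J x\<bar> * indicator (S i) x)"
  proof (cases "J x \<noteq> 0 \<and> x \<in> T")
   case True
   then have "\<exists>i. x \<in> U i" using cov[of x] F'(3) rangeU by (metis UN_iff UnionE UnionI insertCI rangeE)
   then obtain i where i: "x \<in> U i" "\<And>j. j < i \<Longrightarrow> x \<notin> U j" using exists_least_iff[of "\<lambda>i. x \<in> U i"] by blast
   have xi: "x \<in> S i" using True i by (auto simp: S_def)
   have "(\<lambda>k. ennreal \<bar>J x\<bar> * indicator (S k) x) sums (\<Sum>k\<in>{i}. ennreal \<bar>J x\<bar> * indicator (S k) x)"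
    using disj[OF xi] by (intro sums_finite) (auto simp: indicator_def)
   then show ?thesis using True xi by (simp add: sums_iff)
  next
   case False
   then have "ennreal \<bar>J x\<bar> * indicator (S i) x = 0" for i by (auto simp: S_def indicator_def)
   moreover have "ennreal \<bar>J x\<bar> * indicator T x = 0" using False by (auto simp: indicator_def)
   ultimately show ?thesis by (simp only: suminf_zero)
  qed
 qed
 also have "\<dots> = (\<Sum>i. (NN x. ennreal \<bar>J x\<bar> * indicator (S i) x))"
  by (intro nn_integral_suminf) measurable
 also have "\<dots> = (\<Sum>i. (NN y. indicator (g ` S i) y))" using piece by simp
 also have "\<dots> = (NN y. (\<Sum>i. indicator (g ` S i) y))"
  by (intro nn_integral_suminf[symmetric] borel_measurable_indicator) (simp add: piece(1))
 also have "\<dots> \<le> (NN y. of_nat N * indicator B y)"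
 proof (rule nn_integral_mono)
  fix y
  define I where "I = {i. y \<in> g ` S i}"
  show "(\<Sum>i. indicator (g ` S i) y) \<le> (of_nat N * indicator B y :: ennreal)"
  proof (cases "y \<in> B")
   case True
   \<comment> \<open>One preimage is picked in every piece whose image contains \<open>y\<close>; as
     the pieces are disjoint, these are distinct points of the fibre.\<close>
   define x where "x i = (SOME x. x \<in> S i \<and> g x = y)" for i
   have x: "x i \<in> S i" "g (x i) = y" if "i \<in> I" for i
    using that someI_ex[of "\<lambda>x. x \<in> S i \<and> g x = y"] unfolding I_def x_def by blast+
   have "inj_on x I" using x(1) disj by (metis inj_onI)
   moreover have "x ` I \<subseteq> {x \<in> A. g x = y}" using x by (auto simp: S_def T_def)
   ultimately have fin: "finite I" and "card I \<le> card {x \<in> A. g x = y}"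
    using mult(1)[of y] by (auto intro: inj_on_finite card_inj_on_le)
   then have "card I \<le> N" using mult(2)[of y] by linarith
   have "(\<lambda>i. indicator (g ` S i) y :: ennreal) sums (\<Sum>i\<in>I. indicator (g ` S i) y)"
    by (rule sums_finite[OF fin]) (auto simp: I_def indicator_def)
   then have "(\<Sum>i. indicator (g ` S i) y) = (\<Sum>i\<in>I. indicator (g ` S i) y :: ennreal)" by (simp add: sums_iff)
   also have "\<dots> = (\<Sum>i\<in>I. 1)" by (intro sum.cong) (auto simp: I_def)
   also have "\<dots> \<le> of_nat N" using \<open>card I \<le> N\<close> by (simp add: )
   finally show ?thesis using True by simp
  next
   case False
   then have "indicator (g ` S i) y = (0::ennreal)" for i by (auto simp: S_def T_def indicator_def)
   then show ?thesis by simp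
  qed
 qed
 also have "\<dots> = of_nat N * emeasure lborel B" using B(1) by (simp add: nn_integral_cmult_indicator)
 finally show ?thesis unfolding T_def J_def .
qed

section \<open>Weighted sublevel set estimates\<close>

text \<open>One linear functional \<open>v0\<close> compensates for the possible one-dimensional
  kernel: the pair of \<open>g (x, t)\<close> and \<open>v0 \<bullet> t\<close> separates points t
  near \<open>t0\<close> at a linear rate, uniformly in x. Cutting the sublevel set into slabs of
  thickness \<open>r\<close> with respect to \<open>v0\<close> gives O(1/r) pieces of diameter O(r),
  and the factor \<open>r\<close> on the left absorbs their number.\<close>

lemma sublevel_volume_local:
 fixes g :: "'a::euclidean_space \<times> 'a \<Rightarrow> 'a"
 assumes smooth: "smooth_on UNIV g"
  and rank: "DIM('a) \<le> dim (range (\<lambda>v. FD g (x0, t0) (0, v))) + 1"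
 obtains \<rho> C where "\<rho> > 0" "C \<ge> 0"
  "\<And>x \<xi> r. \<lbrakk>x \<in> ball x0 \<rho>; 0 < r; r \<le> 1\<rbrakk> \<Longrightarrow>
   ennreal r * emeasure lborel {t \<in> ball t0 \<rho>. norm (g (x, t) - \<xi>) \<le> r} \<le> ennreal (C * r ^ DIM('a))"
proof -
 define A where "A q v = FD g q (0, v)" for q v
 have blg: "bounded_linear (FD g q)" for q
  using has_derivative_bounded_linear[OF smooth_on_has_derivative[OF smooth]] by simp
 have linA: "linear (A q)" for q
  unfolding A_def by (intro bounded_linear.linear bounded_linear_compose[OF blg] bounded_linear_Pair) (auto intro: bounded_linear_zero bounded_linear_ident)
 define A0 where "A0 = A (x0, t0)"
 have linA0: "linear A0" using linA by (simp add: A0_def)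
 obtain v0 where v0: "\<And>v. A0 v = 0 \<Longrightarrow> v0 \<bullet> v = 0 \<Longrightarrow> v = 0"
 proof (cases "\<forall>v. A0 v = 0 \<longrightarrow> v = 0")
  case True then show ?thesis using that by blast
 next
  case False
  then obtain v1 where v1: "A0 v1 = 0" "v1 \<noteq> 0" by blast
  have "A0 (v1 /\<^sub>R norm v1) = 0" "norm (v1 /\<^sub>R norm v1) = 1" using v1 by (simp_all add: linear_scale[OF linA0])
  then show ?thesis
   using that corank_1_kernel[OF linA0 rank[folded A_def, folded A0_def], of "v1 /\<^sub>R norm v1"] by blast
 qed
 have lin2: "linear (\<lambda>v. (A0 v, v0 \<bullet> v))"
  by (rule linearI) (simp_all add: linear_add[OF linA0] linear_scale[OF linA0] inner_add_right)
 moreover have "inj (\<lambda>v. (A0 v, v0 \<bullet> v))"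
  unfolding linear_injective_0[OF lin2] using v0 by (auto simp: zero_prod_def)
 ultimately obtain c where c: "c > 0" "\<And>v. c * norm v \<le> norm (A0 v, v0 \<bullet> v)"
  by (rule linear_inj_bounded_below_pos) blast
 have c': "c * norm v \<le> norm (A0 v) + \<bar>v0 \<bullet> v\<bar>" for v
  using c(2)[of v] norm_Pair_le[of "A0 v" "v0 \<bullet> v"] by simp
 have "((\<lambda>q. Blinfun (FD g q)) \<longlongrightarrow> Blinfun (FD g (x0, t0))) (nhds (x0, t0))"
  by (rule continuous_on_tendsto_nhds[OF open_UNIV UNIV_I frechet_derivative_continuous_blinfun[OF open_UNIV smooth]])
 from tendstoD[OF this, of "c/2"] c(1) have "eventually (\<lambda>q. dist (Blinfun (FD g q)) (Blinfun (FD g (x0, t0))) < c / 2) (nhds (x0, t0))"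
  by simp
 then obtain \<rho>1 where \<rho>1: "\<rho>1 > 0" "\<And>q. dist q (x0, t0) < \<rho>1 \<Longrightarrow>
   norm (Blinfun (FD g q) - Blinfun (FD g (x0, t0))) < c / 2"
  unfolding eventually_nhds_metric dist_norm by blast
 define \<rho> where "\<rho> = \<rho>1 / 2"
 have \<rho>: "\<rho> > 0" using \<rho>1(1) by (simp add: \<rho>_def)
 have Adiff: "norm (A (x, t) v - A0 v) \<le> c / 2 * norm v" if "x \<in> ball x0 \<rho>" "t \<in> ball t0 \<rho>" for x t v
 proof -
  have "dist (x, t) (x0, t0) \<le> dist x x0 + dist t t0"
   unfolding dist_norm by (metis diff_Pair norm_Pair_le)
  also have "\<dots> < \<rho>1" using that by (simp add: \<rho>_def dist_commute)
  finally have b: "norm (Blinfun (FD g (x, t)) - Blinfun (FD g (x0, t0))) < c / 2"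
   by (rule \<rho>1(2))
  have "A (x, t) v - A0 v = blinfun_apply (Blinfun (FD g (x, t)) - Blinfun (FD g (x0, t0))) (0, v)"
   by (simp add: A_def A0_def blinfun.diff_left bounded_linear_Blinfun_apply[OF blg])
  also have "norm \<dots> \<le> norm (Blinfun (FD g (x, t)) - Blinfun (FD g (x0, t0))) * norm (0 :: 'a, v)"
   by (rule norm_blinfun)
  also have "\<dots> \<le> c / 2 * norm v" using b c(1) by (intro mult_mono) (auto simp: norm_Pair)
  finally show ?thesis .
 qed
 \<comment> \<open>The map minus its linearisation at the base point is Lipschitz with constant
   \<open>c / 2\<close>, so half of the lower bound \<open>c\<close> survives.\<close>
 have separated: "c / 2 * norm (t - t') \<le> norm (g (x, t) - g (x, t')) + \<bar>v0 \<bullet> (t - t')\<bar>"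
  if x: "x \<in> ball x0 \<rho>" and t: "t \<in> ball t0 \<rho>" "t' \<in> ball t0 \<rho>" for x t t'
 proof -
  have "norm ((g (x, t) - A0 t) - (g (x, t') - A0 t')) \<le> c / 2 * norm (t - t')"
  proof (rule differentiable_bound[where S = "ball t0 \<rho>" and f' = "\<lambda>s v. A (x, s) v - A0 v"])
   fix s assume s: "s \<in> ball t0 \<rho>"
   have "((\<lambda>s. (x, s)) has_derivative (\<lambda>v. (0, v))) (at s)"
    by (auto intro!: derivative_eq_intros)
   from diff_chain_at[OF this, of g "FD g (x, s)"]
   have "((\<lambda>s. g (x, s)) has_derivative A (x, s)) (at s)"
    using smooth_on_has_derivative[OF smooth] by (simp add: o_def A_def[abs_def])
   moreover have "(A0 has_derivative A0) (at s)" by (rule linear_imp_has_derivative[OF linA0])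
   ultimately show "((\<lambda>s. g (x, s) - A0 s) has_derivative (\<lambda>v. A (x, s) v - A0 v)) (at s within ball t0 \<rho>)"
    by (rule has_derivative_at_withinI[OF has_derivative_diff])
   show "onorm (\<lambda>v. A (x, s) v - A0 v) \<le> c / 2" by (rule onorm_le[OF Adiff[OF x s]])
  qed (use t in auto)
  moreover have "c * norm (t - t') \<le> norm (A0 (t - t')) + \<bar>v0 \<bullet> (t - t')\<bar>" by (rule c')
  moreover have "A0 (t - t') = (g (x, t) - g (x, t')) - ((g (x, t) - A0 t) - (g (x, t') - A0 t'))"
   by (simp add: linear_diff[OF linA0])
  then have "norm (A0 (t - t')) \<le> norm (g (x, t) - g (x, t')) + norm ((g (x, t) - A0 t) - (g (x, t') - A0 t'))"
   by (metis norm_triangle_ineq4)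
  ultimately show ?thesis by (simp add: field_simps)
 qed
 define L where "L = norm v0 * (norm t0 + \<rho>)"
 have L0: "L \<ge> 0" using \<rho> by (simp add: L_def)
 define C where "C = (2 * L + 5) * (unit_ball_vol DIM('a) * (6 / c) ^ DIM('a))"
 have C0: "C \<ge> 0" unfolding C_def using L0 c(1) by (intro mult_nonneg_nonneg) (auto simp: unit_ball_vol_nonneg)
 have main: "ennreal r * emeasure lborel {t \<in> ball t0 \<rho>. norm (g (x, t) - \<xi>) \<le> r} \<le> ennreal (C * r ^ DIM('a))"
  if x: "x \<in> ball x0 \<rho>" and r: "0 < r" "r \<le> 1" for x \<xi> r
 proof -
  define E where "E = {t \<in> ball t0 \<rho>. norm (g (x, t) - \<xi>) \<le> r}"
  \<comment> \<open>The functional is bounded by \<open>L\<close> on the ball, so the slab numbers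
    lie between plus and minus \<open>L / r\<close>; the extra integers at the ends allow for
    rounding.\<close>
  define I where "I = {- \<lfloor>L / r\<rfloor> - 1 .. \<lfloor>L / r\<rfloor> + 1}"
  define k where "k t = \<lfloor>v0 \<bullet> t / r\<rfloor>" for t
  have kI: "k t \<in> I" if "t \<in> E" for t
  proof -
   have "norm t \<le> norm t0 + \<rho>" using that norm_triangle_ineq2[of t t0] by (auto simp: E_def dist_norm norm_minus_commute)
   then have "\<bar>v0 \<bullet> t\<bar> \<le> L" unfolding L_def by (meson Cauchy_Schwarz_ineq2 mult_left_mono norm_ge_zero order_trans)
   then have "\<bar>v0 \<bullet> t / r\<bar> \<le> L / r" using r by (simp add: abs_divide divide_right_mono)
   then have "v0 \<bullet> t / r \<le> L / r" "- (L / r) \<le> v0 \<bullet> t / r" by linarith+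
   then show ?thesis unfolding I_def k_def by simp linarith
  qed
  \<comment> \<open>One point of each occupied slab serves as a centre. Two points of the same slab
    differ by at most \<open>2 * r\<close> in \<open>g\<close> and by at most \<open>r\<close> in
    the functional, hence by at most \<open>6 * r / c\<close>.\<close>
  define \<tau> where "\<tau> j = (SOME t. t \<in> E \<and> k t = j)" for j
  have sub: "E \<subseteq> (\<Union>j\<in>I. cball (\<tau> j) (6 * r / c))"
  proof
   fix t assume t: "t \<in> E"
   have \<tau>: "\<tau> (k t) \<in> E" "k (\<tau> (k t)) = k t"
    using someI[of "\<lambda>s. s \<in> E \<and> k s = k t" t] t by (auto simp: \<tau>_def)
   define s where "s = \<tau> (k t)"
   have "\<lfloor>v0 \<bullet> s / r\<rfloor> = \<lfloor>v0 \<bullet> t / r\<rfloor>" using \<tau>(2) by (simp add: s_def k_def)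
   then have "\<bar>v0 \<bullet> t / r - v0 \<bullet> s / r\<bar> \<le> 1" by linarith
   then have "\<bar>(v0 \<bullet> (t - s)) / r\<bar> \<le> 1" by (simp add: inner_diff_right diff_divide_distrib)
   then have 1: "\<bar>v0 \<bullet> (t - s)\<bar> \<le> r" using r by (simp add: abs_divide)
   have "norm (g (x, t) - \<xi>) \<le> r" "norm (g (x, s) - \<xi>) \<le> r" using t \<tau>(1) by (auto simp: E_def s_def)
   then have 2: "norm (g (x, t) - g (x, s)) \<le> 2 * r" using norm_triangle_ineq4[of "g (x, t) - \<xi>" "g (x, s) - \<xi>"] by simp
   have "c / 2 * norm (t - s) \<le> 3 * r" using separated[OF x, of t s] t \<tau>(1) 1 2 by (auto simp: E_def s_def)
   then have "norm (t - s) \<le> 6 * r / c" using c(1) by (simp add: field_simps)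
   then have "t \<in> cball (\<tau> (k t)) (6 * r / c)" by (simp add: s_def dist_norm norm_minus_commute)
   then show "t \<in> (\<Union>j\<in>I. cball (\<tau> j) (6 * r / c))" using kI[OF t] by blast
  qed
  have "emeasure lborel E \<le> emeasure lborel (\<Union>j\<in>I. cball (\<tau> j) (6 * r / c))"
   by (rule emeasure_mono[OF sub]) (auto simp: I_def)
  also have "\<dots> \<le> (\<Sum>j\<in>I. emeasure lborel (cball (\<tau> j) (6 * r / c)))"
   by (rule emeasure_subadditive_finite) (auto simp: I_def)
  also have "\<dots> = (\<Sum>j\<in>I. ennreal (unit_ball_vol DIM('a) * (6 * r / c) ^ DIM('a)))"
   using r c(1) by (simp add: emeasure_cball)
  also have "\<dots> = ennreal (real (card I) * (unit_ball_vol DIM('a) * (6 * r / c) ^ DIM('a)))"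
   by (simp add: ennreal_of_nat_eq_real_of_nat[symmetric] ennreal_mult'' c(1) r(1) less_imp_le unit_ball_vol_nonneg)
  finally have 3: "emeasure lborel E \<le> ennreal (real (card I) * (unit_ball_vol DIM('a) * (6 * r / c) ^ DIM('a)))" .
  have "L / r \<ge> 0" using L0 r by simp
  then have "real (card I) \<le> 2 * (L / r) + 3" unfolding I_def by simp linarith
  then have "r * real (card I) \<le> r * (2 * (L / r) + 3)" using r by (intro mult_left_mono) auto
  also have "\<dots> \<le> 2 * L + 5" using r by (simp add: field_simps)
  finally have 4: "r * real (card I) \<le> 2 * L + 5" .
  have "ennreal r * emeasure lborel E \<le> ennreal r * ennreal (real (card I) * (unit_ball_vol DIM('a) * (6 * r / c) ^ DIM('a)))"
   by (rule mult_left_mono[OF 3]) simp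
  also have "\<dots> = ennreal (r * real (card I) * (unit_ball_vol DIM('a) * (6 * r / c) ^ DIM('a)))"
   using r by (simp add: ennreal_mult'[symmetric] mult.assoc)
  also have "\<dots> \<le> ennreal ((2 * L + 5) * (unit_ball_vol DIM('a) * (6 * r / c) ^ DIM('a)))"
   using r c(1) by (intro ennreal_leI mult_right_mono[OF 4] mult_nonneg_nonneg) (auto simp: unit_ball_vol_nonneg)
  also have "(2 * L + 5) * (unit_ball_vol DIM('a) * (6 * r / c) ^ DIM('a)) = C * r ^ DIM('a)"
   by (simp add: C_def power_mult_distrib power_divide)
  finally show ?thesis unfolding E_def .
 qed
 show ?thesis by (rule that[OF \<rho> C0 main])
qed

lemma sublevel_volume:
 fixes g :: "'a::euclidean_space \<times> 'a \<Rightarrow> 'a"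
 assumes smooth: "smooth_on UNIV g"
  and rank: "\<And>q. DIM('a) \<le> dim (range (\<lambda>v. FD g q (0, v))) + 1"
  and \<Omega>: "compact \<Omega>1" "compact \<Omega>2"
 obtains C where "C \<ge> 0" "\<And>x \<xi> r. \<lbrakk>x \<in> \<Omega>1; 0 < r; r \<le> 1\<rbrakk> \<Longrightarrow>
   ennreal r * emeasure lborel {t \<in> \<Omega>2. norm (g (x, t) - \<xi>) \<le> r} \<le> ennreal (C * r ^ DIM('a))"
proof -
 have "\<exists>\<rho> C. \<rho> > 0 \<and> C \<ge> 0 \<and> (\<forall>x \<xi> r. x \<in> ball (fst p) \<rho> \<longrightarrow> 0 < r \<longrightarrow> r \<le> 1 \<longrightarrow>
   ennreal r * emeasure lborel {t \<in> ball (snd p) \<rho>. norm (g (x, t) - \<xi>) \<le> r} \<le> ennreal (C * r ^ DIM('a)))" for p :: "'a \<times> 'a"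
  by (rule sublevel_volume_local[OF smooth rank, of "fst p" "snd p"]) (blast)
 then have "\<forall>p :: 'a \<times> 'a. \<exists>\<rho>C. fst \<rho>C > 0 \<and> snd \<rho>C \<ge> 0 \<and> (\<forall>x \<xi> r. x \<in> ball (fst p) (fst \<rho>C) \<longrightarrow> 0 < r \<longrightarrow> r \<le> 1 \<longrightarrow>
   ennreal r * emeasure lborel {t \<in> ball (snd p) (fst \<rho>C). norm (g (x, t) - \<xi>) \<le> r} \<le> ennreal (snd \<rho>C * r ^ DIM('a)))"
  by (auto simp del: mem_ball)
 from choice[OF this] obtain \<rho>C where \<rho>C: "\<forall>p :: 'a \<times> 'a. fst (\<rho>C p) > 0 \<and> snd (\<rho>C p) \<ge> 0 \<and> (\<forall>x \<xi> r. x \<in> ball (fst p) (fst (\<rho>C p)) \<longrightarrow> 0 < r \<longrightarrow> r \<le> 1 \<longrightarrow>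
   ennreal r * emeasure lborel {t \<in> ball (snd p) (fst (\<rho>C p)). norm (g (x, t) - \<xi>) \<le> r} \<le> ennreal (snd (\<rho>C p) * r ^ DIM('a)))" ..
 define \<rho> where "\<rho> p = fst (\<rho>C p)" for p
 define C where "C p = snd (\<rho>C p)" for p
 have loc: "\<rho> p > 0" "C p \<ge> 0" "\<lbrakk>x \<in> ball (fst p) (\<rho> p); 0 < r; r \<le> 1\<rbrakk> \<Longrightarrow>
   ennreal r * emeasure lborel {t \<in> ball (snd p) (\<rho> p). norm (g (x, t) - \<xi>) \<le> r} \<le> ennreal (C p * r ^ DIM('a))" for p x \<xi> r
  using \<rho>C unfolding \<rho>_def C_def by blast+
 define Q where "Q p = ball (fst p) (\<rho> p) \<times> ball (snd p) (\<rho> p)" for p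
 obtain P where P: "P \<subseteq> \<Omega>1 \<times> \<Omega>2" "finite P" "\<Omega>1 \<times> \<Omega>2 \<subseteq> (\<Union>p\<in>P. Q p)"
 proof (rule compactE_image[OF compact_Times[OF \<Omega>], of "\<Omega>1 \<times> \<Omega>2" Q])
  show "\<Omega>1 \<times> \<Omega>2 \<subseteq> (\<Union>p\<in>\<Omega>1 \<times> \<Omega>2. Q p)" using loc(1) by (force simp: Q_def)
  show "open (Q p)" for p unfolding Q_def by (intro open_Times) auto
 qed (rule that)
 show ?thesis
 proof (rule that[of "\<Sum>p\<in>P. C p"])
  show "(\<Sum>p\<in>P. C p) \<ge> 0" using loc(2) by (intro sum_nonneg) auto
  fix x \<xi> r assume x: "x \<in> \<Omega>1" and r: "0 < (r::real)" "r \<le> 1"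
  define P' where "P' = {p \<in> P. x \<in> ball (fst p) (\<rho> p)}"
  have fP: "finite P'" using P(2) by (simp add: P'_def)
  define E where "E p = {t \<in> ball (snd p) (\<rho> p). norm (g (x, t) - \<xi>) \<le> r}" for p
  have cont: "continuous_on UNIV (\<lambda>t. norm (g (x, t) - \<xi>))"
   by (intro continuous_intros continuous_on_compose2[OF smooth_on_continuous[OF smooth]]) auto
  have mE: "E p \<in> sets lborel" for p
  proof -
   have "closed {t. norm (g (x, t) - \<xi>) \<le> r}" by (intro closed_Collect_le cont continuous_intros)
   moreover have "E p = ball (snd p) (\<rho> p) \<inter> {t. norm (g (x, t) - \<xi>) \<le> r}" by (auto simp: E_def)
   ultimately show ?thesis by (simp add: borel_closed)
  qed
  have sub: "{t \<in> \<Omega>2. norm (g (x, t) - \<xi>) \<le> r} \<subseteq> (\<Union>p\<in>P'. E p)"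
  proof
   fix t assume t: "t \<in> {t \<in> \<Omega>2. norm (g (x, t) - \<xi>) \<le> r}"
   then have "(x, t) \<in> (\<Union>p\<in>P. Q p)" using x P(3) by blast
   then obtain p where "p \<in> P" "(x, t) \<in> Q p" by blast
   then have "p \<in> P'" "t \<in> E p" using t by (auto simp: Q_def P'_def E_def)
   then show "t \<in> (\<Union>p\<in>P'. E p)" by blast
  qed
  have "emeasure lborel {t \<in> \<Omega>2. norm (g (x, t) - \<xi>) \<le> r} \<le> emeasure lborel (\<Union>p\<in>P'. E p)"
   by (rule emeasure_mono[OF sub]) (use fP mE in \<open>auto intro!: sets.finite_UN\<close>)
  also have "\<dots> \<le> (\<Sum>p\<in>P'. emeasure lborel (E p))"
   using fP mE by (intro emeasure_subadditive_finite) auto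
  finally have "ennreal r * emeasure lborel {t \<in> \<Omega>2. norm (g (x, t) - \<xi>) \<le> r} \<le> ennreal r * (\<Sum>p\<in>P'. emeasure lborel (E p))"
   by (rule mult_left_mono) simp
  also have "\<dots> = (\<Sum>p\<in>P'. ennreal r * emeasure lborel (E p))" by (simp add: sum_distrib_left)
  also have "\<dots> \<le> (\<Sum>p\<in>P'. ennreal (C p * r ^ DIM('a)))"
   unfolding E_def using loc(3) r by (intro sum_mono) (auto simp: P'_def)
  also have "\<dots> = ennreal (\<Sum>p\<in>P'. C p * r ^ DIM('a))"
   using loc(2) r by (intro sum_ennreal) auto
  also have "\<dots> \<le> ennreal (\<Sum>p\<in>P. C p * r ^ DIM('a))"
   using loc(2) r P(2) by (intro ennreal_leI sum_mono2) (auto simp: P'_def)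
  finally show "ennreal r * emeasure lborel {t \<in> \<Omega>2. norm (g (x, t) - \<xi>) \<le> r} \<le> ennreal ((\<Sum>p\<in>P. C p) * r ^ DIM('a))"
   by (simp add: sum_distrib_right)
 qed
qed

text \<open>The two parts of the weight are handled by different means. For the determinant the area
  formula applies, the fibres of \<open>g (x, _)\<close> being slices of fibres of the pair
  \<open>(fst q, g q)\<close>. For the constant \<open>h\<close> the rank condition gives a volume
  of order r^(n-1), and \<open>h \<le> r\<close> supplies the missing factor.\<close>

lemma weighted_sublevel:
 fixes g :: "(real^'n) \<times> (real^'n) \<Rightarrow> real^'n"
 assumes smooth: "smooth_on UNIV g"
  and rank: "\<And>q. CARD('n) \<le> dim (range (\<lambda>v. FD g q (0, v))) + 1"
  and \<Omega>: "compact \<Omega>1" "compact \<Omega>2"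
  and mult: "\<And>z. finite {q \<in> \<Omega>1 \<times> \<Omega>2. (fst q, g q) = z}" "\<And>z. card {q \<in> \<Omega>1 \<times> \<Omega>2. (fst q, g q) = z} \<le> N"
 obtains C where "C \<ge> 0" "\<And>x \<xi> r h. \<lbrakk>x \<in> \<Omega>1; 0 < h; h \<le> 1; h \<le> r\<rbrakk> \<Longrightarrow>
   (NN t. ennreal (\<bar>det (matrix (\<lambda>v. FD g (x, t) (0, v)))\<bar> + h) *
     indicator {t \<in> \<Omega>2. norm (g (x, t) - \<xi>) \<le> r} t) \<le> ennreal (C * r ^ CARD('n))"
proof -
 obtain C1 where C1: "C1 \<ge> 0" "\<And>x \<xi> r. \<lbrakk>x \<in> \<Omega>1; 0 < r; r \<le> 1\<rbrakk> \<Longrightarrow>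
   ennreal r * emeasure lborel {t \<in> \<Omega>2. norm (g (x, t) - \<xi>) \<le> r} \<le> ennreal (C1 * r ^ DIM(real^'n))"
  by (rule sublevel_volume[OF smooth _ \<Omega>]) (use rank in auto)
 define vol where "vol = measure lborel \<Omega>2"
 have vol: "emeasure lborel \<Omega>2 = ennreal vol" unfolding vol_def
  by (intro emeasure_eq_ennreal_measure) (use emeasure_bounded_finite[OF compact_imp_bounded[OF \<Omega>(2)]] in auto)
 define C where "C = real N * unit_ball_vol CARD('n) + (C1 + vol)"
 have C0: "C \<ge> 0" unfolding C_def vol_def using C1(1) by (intro add_nonneg_nonneg mult_nonneg_nonneg) (auto simp: unit_ball_vol_nonneg)
 have "(NN t. ennreal (\<bar>det (matrix (\<lambda>v. FD g (x, t) (0, v)))\<bar> + h) *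
     indicator {t \<in> \<Omega>2. norm (g (x, t) - \<xi>) \<le> r} t) \<le> ennreal (C * r ^ CARD('n))"
  if x: "x \<in> \<Omega>1" and h: "0 < h" "h \<le> 1" "h \<le> r" for x \<xi> r h
 proof -
  define gx where "gx t = g (x, t)" for t
  have smgx: "smooth_on UNIV gx"
   using smooth_on_compose_affine[OF bounded_linear_Pair[OF bounded_linear_zero bounded_linear_ident] smooth, of "(x, 0)"]
   by (simp add: gx_def[abs_def])
  have frgx: "FD gx t = (\<lambda>v. FD g (x, t) (0, v))" for t
  proof -
   have "((\<lambda>s. (x, s)) has_derivative (\<lambda>v. (0, v))) (at t)" by (auto intro!: derivative_eq_intros)
   from diff_chain_at[OF this, of g "FD g (x, t)"]
   have "(gx has_derivative (\<lambda>v. FD g (x, t) (0, v))) (at t)"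
    using smooth_on_has_derivative[OF smooth] by (simp add: o_def gx_def[abs_def])
   then show ?thesis using frechet_derivative_at by metis
  qed
  define J where "J t = det (matrix (FD gx t))" for t
  have "continuous_on UNIV (\<lambda>t. det_endo (FD gx t))"
   using smgx by (intro smooth_on_continuous smooth_intros) auto
  then have [measurable]: "J \<in> borel_measurable borel"
   unfolding J_def det_endo_eq_det_matrix by (rule borel_measurable_continuous_onI)
  define E where "E = {t \<in> \<Omega>2. norm (gx t - \<xi>) \<le> r}"
  have [measurable]: "\<Omega>2 \<in> sets borel" using \<Omega>(2) by (simp add: borel_compact)
  have Eeq: "E = \<Omega>2 \<inter> gx -` cball \<xi> r" by (auto simp: E_def dist_norm norm_minus_commute)
  have "closed (gx -` cball \<xi> r)"
   using smooth_on_continuous[OF smgx] by (intro closed_vimage) auto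
  then have Em [measurable]: "E \<in> sets borel" unfolding Eeq by (simp add: borel_closed)
  have r: "r > 0" using h by simp
  have fin: "{t \<in> \<Omega>2. gx t = y} = snd ` {q \<in> \<Omega>1 \<times> \<Omega>2. (fst q, g q) = (x, y)}" for y
   using x by (force simp: gx_def)
  have fibre: "finite {t \<in> \<Omega>2. gx t = y}" "card {t \<in> \<Omega>2. gx t = y} \<le> N" for y
   unfolding fin using mult[of "(x, y)"] by (auto intro: order_trans[OF card_image_le])
  have "(NN t. ennreal \<bar>J t\<bar> * indicator E t) \<le> of_nat N * emeasure lborel (cball \<xi> r)"
   unfolding J_def Eeq by (rule area_formula_le[OF smgx _ _ _ fibre]) auto
  also have "\<dots> = ennreal (real N * unit_ball_vol CARD('n) * r ^ CARD('n))"
   using r by (simp add: emeasure_cball ennreal_of_nat_eq_real_of_nat ennreal_mult'[symmetric] mult.assoc unit_ball_vol_nonneg)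
  finally have 1: "(NN t. ennreal \<bar>J t\<bar> * indicator E t) \<le> ennreal (real N * unit_ball_vol CARD('n) * r ^ CARD('n))" .
  have 2: "ennreal h * emeasure lborel E \<le> ennreal ((C1 + vol) * r ^ CARD('n))"
  proof (cases "r \<le> 1")
   case True
   have "ennreal h * emeasure lborel E \<le> ennreal r * emeasure lborel E"
    using h by (intro mult_right_mono ennreal_leI) auto
   also have "\<dots> \<le> ennreal (C1 * r ^ CARD('n))" using C1(2)[OF x r True, of \<xi>] by (simp add: E_def gx_def)
   also have "\<dots> \<le> ennreal ((C1 + vol) * r ^ CARD('n))"
    using r by (intro ennreal_leI mult_right_mono) (auto simp: vol_def)
   finally show ?thesis .
  next
   \<comment> \<open>For \<open>r > 1\<close> the whole compact set already has volume at most a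
     multiple of \<open>r ^ CARD('n)\<close>.\<close>
   case False
   have "ennreal h * emeasure lborel E \<le> 1 * emeasure lborel \<Omega>2"
    using h by (intro mult_mono emeasure_mono) (auto simp: E_def ennreal_le_1)
   also have "\<dots> = ennreal vol" using vol by simp
   also have "\<dots> \<le> ennreal ((C1 + vol) * r ^ CARD('n))"
   proof (rule ennreal_leI)
    have "1 \<le> r ^ CARD('n)" using False by (intro one_le_power) auto
    then have "(C1 + vol) * 1 \<le> (C1 + vol) * r ^ CARD('n)"
     using C1(1) by (intro mult_left_mono) (auto simp: vol_def)
    then show "vol \<le> (C1 + vol) * r ^ CARD('n)" using C1(1) by simp
   qed
   finally show ?thesis .
  qed
  have "(NN t. ennreal (\<bar>J t\<bar> + h) * indicator E t) = (NN t. ennreal \<bar>J t\<bar> * indicator E t + ennreal h * indicator E t)"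
   using h by (intro nn_integral_cong) (auto simp: indicator_def)
  also have "\<dots> = (NN t. ennreal \<bar>J t\<bar> * indicator E t) + (NN t. ennreal h * indicator E t)"
   by (rule nn_integral_add) measurable
  also have "(NN t. ennreal h * indicator E t) = ennreal h * emeasure lborel E"
   by (simp add: nn_integral_cmult_indicator)
  also have "(NN t. ennreal \<bar>J t\<bar> * indicator E t) + ennreal h * emeasure lborel E
   \<le> ennreal (real N * unit_ball_vol CARD('n) * r ^ CARD('n)) + ennreal ((C1 + vol) * r ^ CARD('n))"
   by (rule add_mono[OF 1 2])
  also have "\<dots> = ennreal (C * r ^ CARD('n))"
   using r C1(1) by (subst ennreal_plus[symmetric]) (auto simp: C_def vol_def algebra_simps unit_ball_vol_nonneg)
  finally show ?thesis by (simp add: J_def frgx E_def gx_def)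
 qed
 then show ?thesis using that[OF C0] by blast
qed

section \<open>Directional derivatives and symbols at scale h\<close>

text \<open>Only the restriction of \<open>f\<close> to parallel lines is differentiated. Cut-offs
  of finite smoothness and functions given by parameter integrals can thus be treated one direction
  at a time.\<close>

definition has_ddir :: "'a::real_normed_vector \<Rightarrow> ('a \<Rightarrow> 'b::real_normed_vector) \<Rightarrow> ('a \<Rightarrow> 'b) \<Rightarrow> bool" where
 "has_ddir v f f' \<longleftrightarrow> (\<forall>x. ((\<lambda>s. f (x + s *\<^sub>R v)) has_vector_derivative f' x) (at 0))"

lemma has_ddir_line:
 assumes "has_ddir v f f'"
 shows "((\<lambda>s. f (x + s *\<^sub>R v)) has_vector_derivative f' (x + s *\<^sub>R v)) (at s)"
proof -
 have 1: "((\<lambda>u. u - s) has_vector_derivative 1) (at s)" by (auto intro!: derivative_eq_intros)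
 have 2: "((\<lambda>u. f ((x + s *\<^sub>R v) + u *\<^sub>R v)) has_vector_derivative f' (x + s *\<^sub>R v)) (at (s - s))"
  using assms unfolding has_ddir_def by simp
 have "(x + s *\<^sub>R v) + (u - s) *\<^sub>R v = x + u *\<^sub>R v" for u by (simp add: algebra_simps)
 with vector_diff_chain_at[OF 1 2] show ?thesis by (simp add: o_def)
qed

lemma has_ddir_const: "has_ddir v (\<lambda>x. c) (\<lambda>x. 0)"
 by (simp add: has_ddir_def)

lemma has_ddir_add: "has_ddir v f f' \<Longrightarrow> has_ddir v g g' \<Longrightarrow> has_ddir v (\<lambda>x. f x + g x) (\<lambda>x. f' x + g' x)"
 unfolding has_ddir_def by (auto intro: has_vector_derivative_add)

lemma has_ddir_mult:
 fixes f :: "'a::real_normed_vector \<Rightarrow> 'b::real_normed_algebra"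
 shows "has_ddir v f f' \<Longrightarrow> has_ddir v g g' \<Longrightarrow> has_ddir v (\<lambda>x. f x * g x) (\<lambda>x. f x * g' x + f' x * g x)"
 unfolding has_ddir_def by (auto dest: spec intro: has_vector_derivative_eq_rhs[OF has_vector_derivative_mult])

lemma has_ddir_bounded_linear:
 "bounded_linear L \<Longrightarrow> has_ddir v f f' \<Longrightarrow> has_ddir v (\<lambda>x. L (f x)) (\<lambda>x. L (f' x))"
 unfolding has_ddir_def by (auto intro: bounded_linear.has_vector_derivative)

lemmas has_ddir_cmult = has_ddir_bounded_linear[OF bounded_linear_mult_right]
lemmas has_ddir_cnj = has_ddir_bounded_linear[OF bounded_linear_cnj]
lemmas has_ddir_of_real = has_ddir_bounded_linear[OF bounded_linear_of_real]

lemma has_ddir_exp: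
 fixes f :: "'a::real_normed_vector \<Rightarrow> complex"
 assumes "has_ddir v f f'" shows "has_ddir v (\<lambda>x. exp (f x)) (\<lambda>x. f' x * exp (f x))"
 unfolding has_ddir_def
proof
 fix x
 have "((\<lambda>s. f (x + s *\<^sub>R v)) has_vector_derivative f' x) (at 0)" using assms by (simp add: has_ddir_def)
 from field_vector_diff_chain_at[OF this DERIV_exp]
 show "((\<lambda>s. exp (f (x + s *\<^sub>R v))) has_vector_derivative f' x * exp (f x)) (at 0)" by (simp add: o_def)
qed

lemma has_ddir_affine:
 assumes "has_ddir (L v) f f'" "linear L"
 shows "has_ddir v (\<lambda>x. f (L x + c)) (\<lambda>x. f' (L x + c))"
 unfolding has_ddir_def
proof
 fix x
 have eq: "L (x + s *\<^sub>R v) + c = (L x + c) + s *\<^sub>R L v" for s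
  by (simp add: linear_add[OF assms(2)] linear_scale[OF assms(2)])
 show "((\<lambda>s. f (L (x + s *\<^sub>R v) + c)) has_vector_derivative f' (L x + c)) (at 0)"
  unfolding eq using assms(1) unfolding has_ddir_def by blast
qed

lemma has_ddir_zero_direction: "has_ddir 0 f (\<lambda>x. 0)"
 by (simp add: has_ddir_def)

lemma has_derivative_imp_has_ddir:
 assumes "\<And>x. (f has_derivative f' x) (at x)" shows "has_ddir v f (\<lambda>x. f' x v)"
 unfolding has_ddir_def
proof
 fix x
 have l: "((\<lambda>s. x + s *\<^sub>R v) has_derivative (\<lambda>t. t *\<^sub>R v)) (at 0)" by (auto intro!: derivative_eq_intros)
 have "(f has_derivative f' x) (at (x + 0 *\<^sub>R v))" using assms[of x] by simp
 from diff_chain_at[OF l this] have "((\<lambda>s. f (x + s *\<^sub>R v)) has_derivative (\<lambda>t. f' x (t *\<^sub>R v))) (at 0)" by (simp add: o_def)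
 then show "((\<lambda>s. f (x + s *\<^sub>R v)) has_vector_derivative f' x v) (at 0)"
  by (simp add: has_vector_derivative_def linear_scale[OF has_derivative_linear[OF assms]])
qed

lemma smooth_has_ddir: "smooth_on UNIV f \<Longrightarrow> has_ddir v f (\<lambda>x. FD f x v)"
 by (intro has_derivative_imp_has_ddir smooth_on_has_derivative) auto

lemma has_ddir_zero_outside:
 assumes "has_ddir v f f'" "closed X" "\<And>x. x \<notin> X \<Longrightarrow> f x = 0" "x \<notin> X"
 shows "f' x = 0"
proof -
 have "open ((\<lambda>s. x + s *\<^sub>R v) -` (- X))"
  using assms(2) by (intro open_vimage) (auto intro!: continuous_intros)
 then have "((\<lambda>s. f (x + s *\<^sub>R v)) has_vector_derivative 0) (at 0)"
  by (rule has_vector_derivative_transform_within_open[OF has_vector_derivative_const[of 0]])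
   (use assms(3,4) in auto)
 moreover have "((\<lambda>s. f (x + s *\<^sub>R v)) has_vector_derivative f' x) (at 0)" using assms(1) by (simp add: has_ddir_def)
 ultimately show ?thesis using vector_derivative_unique_at by metis
qed

text \<open>\<open>symb h D X B k f\<close>: all derivatives of \<open>f\<close> of order at most \<open>k\<close> along directions in \<open>D\<close>,
 each multiplied by \<open>h\<close>, are bounded by \<open>B\<close> on \<open>X\<close>.\<close>

primrec symb :: "real \<Rightarrow> 'a::real_normed_vector set \<Rightarrow> 'a set \<Rightarrow> ('a \<Rightarrow> real) \<Rightarrow> nat \<Rightarrow> ('a \<Rightarrow> complex) \<Rightarrow> bool" where
 "symb h D X B 0 f \<longleftrightarrow> continuous_on UNIV f \<and> (\<forall>x\<in>X. norm (f x) \<le> B x)"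
| "symb h D X B (Suc k) f \<longleftrightarrow> continuous_on UNIV f \<and> (\<forall>x\<in>X. norm (f x) \<le> B x) \<and>
   (\<forall>v\<in>D. \<exists>f'. has_ddir v f f' \<and> symb h D X B k (\<lambda>x. h *\<^sub>R f' x))"

lemma symb_continuous: "symb h D X B k f \<Longrightarrow> continuous_on UNIV f"
 by (cases k) auto

lemma symb_bound: "symb h D X B k f \<Longrightarrow> x \<in> X \<Longrightarrow> norm (f x) \<le> B x"
 by (cases k) auto

lemma symb_SucI:
 "\<lbrakk>continuous_on UNIV f; (\<And>x. x \<in> X \<Longrightarrow> norm (f x) \<le> B x);
  (\<And>v. v \<in> D \<Longrightarrow> \<exists>f'. has_ddir v f f' \<and> symb h D X B k (\<lambda>x. h *\<^sub>R f' x))\<rbrakk> \<Longrightarrow> symb h D X B (Suc k) f"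
 by simp

lemma symb_Suc_D: "symb h D X B (Suc k) f \<Longrightarrow> symb h D X B k f"
proof (induction k arbitrary: f)
 case (Suc k)
 show ?case
 proof (rule symb_SucI)
  fix v assume "v \<in> D"
  then obtain f' where "has_ddir v f f'" "symb h D X B (Suc k) (\<lambda>x. h *\<^sub>R f' x)"
   using Suc.prems by (auto simp del: symb.simps(2) simp: symb.simps(2)[of h D X B "Suc k"])
  then show "\<exists>f'. has_ddir v f f' \<and> symb h D X B k (\<lambda>x. h *\<^sub>R f' x)" using Suc.IH by blast
 qed (use Suc.prems in auto)
qed simp

lemma symb_mono_order: "j \<le> k \<Longrightarrow> symb h D X B k f \<Longrightarrow> symb h D X B j f"
 by (induction k rule: dec_induct) (auto dest: symb_Suc_D simp del: symb.simps)

lemma symb_weaken: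
 "\<lbrakk>symb h D X B k f; X' \<subseteq> X; (\<And>x. x \<in> X' \<Longrightarrow> B x \<le> B' x); D' \<subseteq> D\<rbrakk> \<Longrightarrow> symb h D' X' B' k f"
proof (induction k arbitrary: f)
 case 0 then show ?case by (auto dest!: subsetD intro: order_trans)
next
 case (Suc k)
 show ?case
 proof (rule symb_SucI)
  show "norm (f x) \<le> B' x" if "x \<in> X'" for x
   using symb_bound[OF Suc.prems(1), of x] Suc.prems(2,3) that by (metis order_trans subsetD)
  fix v assume "v \<in> D'"
  then have "v \<in> D" using Suc.prems(4) by blast
  then obtain f' where "has_ddir v f f'" "symb h D X B k (\<lambda>x. h *\<^sub>R f' x)"
   using Suc.prems(1) by auto
  then show "\<exists>f'. has_ddir v f f' \<and> symb h D' X' B' k (\<lambda>x. h *\<^sub>R f' x)" using Suc.IH Suc.prems by blast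
 qed (use Suc.prems(1) in auto)
qed

lemmas symb_bound_mono = symb_weaken[OF _ subset_refl _ subset_refl]

lemma symb_const:
 "(\<And>x. x \<in> X \<Longrightarrow> norm c \<le> B x) \<Longrightarrow> symb h D X B k (\<lambda>x. c)"
proof (induction k arbitrary: c)
 case (Suc k)
 have "0 \<le> B x" if "x \<in> X" for x using Suc.prems[OF that] norm_ge_zero order_trans by blast
 then show ?case
  using Suc by (intro symb_SucI exI[of _ "\<lambda>x. 0"]) (auto intro: has_ddir_const)
qed simp

lemma symb_add:
 "symb h D X B k f \<Longrightarrow> symb h D X B' k g \<Longrightarrow> symb h D X (\<lambda>x. B x + B' x) k (\<lambda>x. f x + g x)"
proof (induction k arbitrary: f g)
 case 0 then show ?case by (auto intro!: continuous_on_add norm_triangle_mono)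
next
 case (Suc k)
 show ?case
 proof (rule symb_SucI)
  fix v assume v: "v \<in> D"
  obtain f' where f': "has_ddir v f f'" "symb h D X B k (\<lambda>x. h *\<^sub>R f' x)" using Suc.prems(1) v by auto
  obtain g' where g': "has_ddir v g g'" "symb h D X B' k (\<lambda>x. h *\<^sub>R g' x)" using Suc.prems(2) v by auto
  show "\<exists>d. has_ddir v (\<lambda>x. f x + g x) d \<and> symb h D X (\<lambda>x. B x + B' x) k (\<lambda>x. h *\<^sub>R d x)"
   using Suc.IH[OF f'(2) g'(2)] has_ddir_add[OF f'(1) g'(1)]
   by (intro exI[of _ "\<lambda>x. f' x + g' x"]) (simp add: scaleR_add_right)
 qed (use Suc.prems in \<open>auto intro!: continuous_on_add norm_triangle_mono\<close>)
qed

lemma symb_cmult: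
 "symb h D X B k f \<Longrightarrow> symb h D X (\<lambda>x. norm c * B x) k (\<lambda>x. c * f x)"
proof (induction k arbitrary: f)
 case 0 then show ?case by (auto intro!: continuous_on_mult_left mult_left_mono simp: norm_mult)
next
 case (Suc k)
 show ?case
 proof (rule symb_SucI)
  fix v assume v: "v \<in> D"
  obtain f' where f': "has_ddir v f f'" "symb h D X B k (\<lambda>x. h *\<^sub>R f' x)" using Suc.prems(1) v by auto
  show "\<exists>d. has_ddir v (\<lambda>x. c * f x) d \<and> symb h D X (\<lambda>x. norm c * B x) k (\<lambda>x. h *\<^sub>R d x)"
   using Suc.IH[OF f'(2)] has_ddir_cmult[OF f'(1), of c] by (intro exI[of _ "\<lambda>x. c * f' x"]) simp
 qed (use Suc.prems in \<open>auto intro!: continuous_on_mult_left mult_left_mono simp: norm_mult\<close>)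
qed

lemma symb_cnj:
 "symb h D X B k f \<Longrightarrow> symb h D X B k (\<lambda>x. cnj (f x))"
proof (induction k arbitrary: f)
 case 0 then show ?case by (auto intro!: continuous_on_cnj)
next
 case (Suc k)
 show ?case
 proof (rule symb_SucI)
  fix v assume v: "v \<in> D"
  obtain f' where f': "has_ddir v f f'" "symb h D X B k (\<lambda>x. h *\<^sub>R f' x)" using Suc.prems(1) v by auto
  show "\<exists>d. has_ddir v (\<lambda>x. cnj (f x)) d \<and> symb h D X B k (\<lambda>x. h *\<^sub>R d x)"
   using Suc.IH[OF f'(2)] has_ddir_cnj[OF f'(1)] by (intro exI[of _ "\<lambda>x. cnj (f' x)"]) (simp add: scaleR_conv_of_real)
 qed (use Suc.prems in \<open>auto intro!: continuous_on_cnj\<close>)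
qed

text \<open>Each differentiation splits a product into two products of the same kind, whence
  \<open>2 ^ k\<close>. Since \<open>B\<close> and \<open>B'\<close> are functions, a pointwise
  weight can be carried through products.\<close>

lemma symb_mult:
 "symb h D X B k f \<Longrightarrow> symb h D X B' k g \<Longrightarrow> symb h D X (\<lambda>x. 2 ^ k * (B x * B' x)) k (\<lambda>x. f x * g x)"
proof (induction k arbitrary: f g)
 case 0 then show ?case by (auto intro!: continuous_on_mult mult_mono' simp: norm_mult)
next
 case (Suc k)
 have BB: "norm (f x * g x) \<le> B x * B' x" "0 \<le> B x * B' x" if "x \<in> X" for x
  using symb_bound[OF Suc.prems(1) that] symb_bound[OF Suc.prems(2) that]
  by (auto simp: norm_mult intro!: mult_mono' mult_nonneg_nonneg elim: order_trans[OF norm_ge_zero])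
 have pow: "B x * B' x \<le> 2 ^ Suc k * (B x * B' x)" if "x \<in> X" for x
  using mult_right_mono[of 1 "2 ^ Suc k :: real" "B x * B' x"] BB(2)[OF that] one_le_power[of "2::real" "Suc k"] by simp
 show ?case
 proof (rule symb_SucI)
  fix v assume v: "v \<in> D"
  obtain f' where f': "has_ddir v f f'" "symb h D X B k (\<lambda>x. h *\<^sub>R f' x)" using Suc.prems(1) v by auto
  obtain g' where g': "has_ddir v g g'" "symb h D X B' k (\<lambda>x. h *\<^sub>R g' x)" using Suc.prems(2) v by auto
  have "symb h D X (\<lambda>x. 2 ^ k * (B x * B' x) + 2 ^ k * (B x * B' x)) k (\<lambda>x. f x * (h *\<^sub>R g' x) + (h *\<^sub>R f' x) * g x)"
   by (intro symb_add Suc.IH f' g' symb_Suc_D[OF Suc.prems(1)] symb_Suc_D[OF Suc.prems(2)])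
  then have "symb h D X (\<lambda>x. 2 ^ Suc k * (B x * B' x)) k (\<lambda>x. h *\<^sub>R (f x * g' x + f' x * g x))"
   by (simp add: scaleR_add_right algebra_simps)
  then show "\<exists>d. has_ddir v (\<lambda>x. f x * g x) d \<and> symb h D X (\<lambda>x. 2 ^ Suc k * (B x * B' x)) k (\<lambda>x. h *\<^sub>R d x)"
   using has_ddir_mult[OF f'(1) g'(1)] by blast
 next
  fix x assume "x \<in> X"
  then show "norm (f x * g x) \<le> 2 ^ Suc k * (B x * B' x)" using BB(1) pow order_trans by blast
 qed (use Suc.prems in \<open>auto intro!: continuous_on_mult\<close>)
qed

text \<open>This serves for slices and frozen variables, where \<open>L\<close> may annihilate a
  direction; the derivative in such a direction is 0, a symbol as soon as the bound is
  nonnegative.\<close>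

lemma symb_affine:
 assumes L: "linear L" "continuous_on UNIV L" and D: "\<And>v. v \<in> D' \<Longrightarrow> L v \<in> D \<or> L v = 0"
  and X: "\<And>x. x \<in> X' \<Longrightarrow> L x + c \<in> X" "\<And>x. x \<in> X' \<Longrightarrow> B (L x + c) \<le> B' x" "\<And>x. x \<in> X' \<Longrightarrow> 0 \<le> B' x"
 shows "symb h D X B k f \<Longrightarrow> symb h D' X' B' k (\<lambda>x. f (L x + c))"
proof (induction k arbitrary: f)
 case 0
 have "continuous_on UNIV (\<lambda>x. f (L x + c))"
  by (rule continuous_on_compose2[OF symb_continuous[OF 0]]) (auto intro!: continuous_intros L)
 then show ?case using symb_bound[OF 0] X by (auto intro: order_trans)
next
 case (Suc k)
 show ?case
 proof (rule symb_SucI)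
  show "continuous_on UNIV (\<lambda>x. f (L x + c))"
   by (rule continuous_on_compose2[OF symb_continuous[OF Suc.prems]]) (auto intro!: continuous_intros L)
  show "norm (f (L x + c)) \<le> B' x" if "x \<in> X'" for x
   using symb_bound[OF Suc.prems X(1)[OF that]] X(2)[OF that] by simp
  fix v assume "v \<in> D'"
  then consider "L v \<in> D" | "L v = 0" using D by blast
  then show "\<exists>f'. has_ddir v (\<lambda>x. f (L x + c)) f' \<and> symb h D' X' B' k (\<lambda>x. h *\<^sub>R f' x)"
  proof cases
   case 1
   then obtain f' where f': "has_ddir (L v) f f'" "symb h D X B k (\<lambda>x. h *\<^sub>R f' x)" using Suc.prems by auto
   then show ?thesis using Suc.IH has_ddir_affine[OF f'(1) L(1)] by blast
  next
   case 2
   have "has_ddir (L v) f (\<lambda>x. 0)" unfolding 2 by (rule has_ddir_zero_direction)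
   then show ?thesis using has_ddir_affine[OF _ L(1)] symb_const[of X' 0 B'] X(3)
    by (intro exI[of _ "\<lambda>x. 0"]) auto
  qed
 qed
qed

text \<open>Derivatives are bounded on the compact set, and for \<open>h \<le> 1\<close> the factors
  of \<open>h\<close> in front of them only help, which makes one constant serve for all
  \<open>h\<close>.\<close>

lemma smooth_imp_symb:
 fixes f :: "'a::euclidean_space \<Rightarrow> complex"
 assumes "compact K" "finite D"
 shows "smooth_on UNIV f \<Longrightarrow> \<exists>C\<ge>0. \<forall>h. 0 < h \<longrightarrow> h \<le> 1 \<longrightarrow> symb h D K (\<lambda>_. C) k f"
proof (induction k arbitrary: f)
 case 0
 have "compact (f ` K)" using smooth_on_continuous[OF 0] \<open>compact K\<close> by (meson compact_continuous_image continuous_on_subset subset_UNIV)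
 then obtain C where "\<forall>x\<in>K. norm (f x) \<le> C" using compact_imp_bounded bounded_iff by (metis imageI)
 then have "\<forall>x\<in>K. norm (f x) \<le> \<bar>C\<bar>" by force
 then show ?case using smooth_on_continuous[OF 0] by (intro exI[of _ "\<bar>C\<bar>"]) auto
next
 case (Suc k)
 have "compact (f ` K)" using smooth_on_continuous[OF Suc.prems] \<open>compact K\<close> by (meson compact_continuous_image continuous_on_subset subset_UNIV)
 then obtain C0 where C0: "\<forall>x\<in>K. norm (f x) \<le> C0" using compact_imp_bounded bounded_iff by (metis imageI)
 have "\<forall>v. \<exists>C\<ge>0. \<forall>h. 0 < h \<longrightarrow> h \<le> 1 \<longrightarrow> symb h D K (\<lambda>_. C) k (\<lambda>x. FD f x v)"
  using Suc.IH[OF smooth_on_frechet_derivative[OF Suc.prems]] by blast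
 from choice[OF this] obtain C where C: "\<And>v. C v \<ge> 0" "\<And>v h. 0 < h \<Longrightarrow> h \<le> 1 \<Longrightarrow> symb h D K (\<lambda>_. C v) k (\<lambda>x. FD f x v)"
  by blast
 define C' where "C' = \<bar>C0\<bar> + (\<Sum>v\<in>D. C v)"
 have CC: "C v \<le> C'" if "v \<in> D" for v
  unfolding C'_def using member_le_sum[OF that, of C] C(1) \<open>finite D\<close> by fastforce
 have "symb h D K (\<lambda>_. C') (Suc k) f" if h: "0 < h" "h \<le> 1" for h
 proof (rule symb_SucI)
  show "norm (f x) \<le> C'" if "x \<in> K" for x
   unfolding C'_def using C0 that sum_nonneg[of D C] C(1) by force
  fix v assume v: "v \<in> D"
  have "symb h D K (\<lambda>_. norm (complex_of_real h) * C v) k (\<lambda>x. complex_of_real h * FD f x v)"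
   using C(2)[OF h] by (rule symb_cmult)
  then have "symb h D K (\<lambda>_. C') k (\<lambda>x. h *\<^sub>R FD f x v)"
   unfolding scaleR_conv_of_real
   using CC[OF v] h C(1)[of v] by (elim symb_weaken) (auto intro: order_trans[OF mult_left_le_one_le])
  then show "\<exists>f'. has_ddir v f f' \<and> symb h D K (\<lambda>_. C') k (\<lambda>x. h *\<^sub>R f' x)"
   using smooth_has_ddir[OF Suc.prems] by blast
 qed (rule smooth_on_continuous[OF Suc.prems])
 moreover have "C' \<ge> 0" unfolding C'_def using C(1) by (simp add: sum_nonneg)
 ultimately show ?case by blast
qed

section \<open>Oscillating exponentials as symbols\<close>

primrec exp_symb_const :: "real \<Rightarrow> nat \<Rightarrow> real" where
 "exp_symb_const C 0 = 1"
| "exp_symb_const C (Suc k) = max (exp_symb_const C k) (2 ^ k * (C * exp_symb_const C k))"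

lemma exp_symb_const_ge_1: "exp_symb_const C k \<ge> 1"
 by (induction k) auto

text \<open>Only derivatives of the phase enter: \<open>\<rho>\<close> may be large, while
  \<open>h\<close> times its derivative has to be a symbol. The constant follows the recursion in
  which the scaled derivative is that symbol times the same exponential at one order less.\<close>

lemma symb_exp:
 fixes \<rho> :: "'a::real_normed_vector \<Rightarrow> real"
 assumes "continuous_on UNIV \<rho>"
  and "\<And>v. v \<in> D \<Longrightarrow> \<exists>\<rho>'. has_ddir v \<rho> \<rho>' \<and> symb h D X (\<lambda>_. C) k (\<lambda>x. complex_of_real (h * \<rho>' x))"
 shows "j \<le> Suc k \<Longrightarrow> symb h D X (\<lambda>_. exp_symb_const C j) j (\<lambda>x. expi (\<rho> x))"
proof (induction j)
 case 0
 have "continuous_on UNIV (\<lambda>x. expi (\<rho> x))" by (intro continuous_intros assms)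
 then show ?case by simp
next
 case (Suc j)
 have IH: "symb h D X (\<lambda>_. exp_symb_const C j) j (\<lambda>x. expi (\<rho> x))" using Suc by simp
 show ?case
 proof (rule symb_SucI)
  show "continuous_on UNIV (\<lambda>x. expi (\<rho> x))" by (rule symb_continuous[OF IH])
  show "norm (expi (\<rho> x)) \<le> exp_symb_const C (Suc j)" for x
   using exp_symb_const_ge_1[of C "Suc j"] by (simp del: exp_symb_const.simps)
  fix v assume "v \<in> D"
  then obtain \<rho>' where \<rho>': "has_ddir v \<rho> \<rho>'" "symb h D X (\<lambda>_. C) k (\<lambda>x. complex_of_real (h * \<rho>' x))" using assms(2) by blast
  have "symb h D X (\<lambda>_. C) j (\<lambda>x. complex_of_real (h * \<rho>' x))" using symb_mono_order[OF _ \<rho>'(2)] Suc.prems by simp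
  then have "symb h D X (\<lambda>_. C) j (\<lambda>x. \<i> * complex_of_real (h * \<rho>' x))" by (drule_tac symb_cmult[of _ _ _ _ _ _ \<i>]) simp
  from symb_mult[OF this IH]
  have "symb h D X (\<lambda>_. exp_symb_const C (Suc j)) j (\<lambda>x. (\<i> * complex_of_real (h * \<rho>' x)) * expi (\<rho> x))"
   by (rule symb_weaken) auto
  moreover have "has_ddir v (\<lambda>x. expi (\<rho> x)) (\<lambda>x. (\<i> * complex_of_real (\<rho>' x)) * expi (\<rho> x))"
   by (intro has_ddir_exp has_ddir_cmult has_ddir_of_real \<rho>')
  ultimately show "\<exists>f'. has_ddir v (\<lambda>x. expi (\<rho> x)) f' \<and> symb h D X (\<lambda>_. exp_symb_const C (Suc j)) j (\<lambda>x. h *\<^sub>R f' x)"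
   by (intro exI[of _ "\<lambda>x. (\<i> * complex_of_real (\<rho>' x)) * expi (\<rho> x)"])
    (simp add: scaleR_conv_of_real mult_ac)
 qed
qed

section \<open>Oscillatory integrals\<close>

lemma has_vector_derivative_iff_quotient:
 fixes g :: "real \<Rightarrow> 'a::real_normed_vector"
 shows "(g has_vector_derivative d) (at 0) \<longleftrightarrow> ((\<lambda>s. (g s - g 0) /\<^sub>R s) \<longlongrightarrow> d) (at 0)"
proof -
 have "(g has_vector_derivative d) (at 0) \<longleftrightarrow> ((\<lambda>s. norm (g s - g 0 - s *\<^sub>R d) / norm s) \<longlongrightarrow> 0) (at 0)"
  unfolding has_vector_derivative_def has_derivative_iff_norm by (simp add: bounded_linear_scaleR_left)
 also have "\<dots> \<longleftrightarrow> ((\<lambda>s. norm ((g s - g 0) /\<^sub>R s - d)) \<longlongrightarrow> 0) (at 0)"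
 proof (rule tendsto_cong)
  show "eventually (\<lambda>s. norm (g s - g 0 - s *\<^sub>R d) / norm s = norm ((g s - g 0) /\<^sub>R s - d)) (at 0)"
   unfolding eventually_at
  proof (intro exI[of _ 1] conjI ballI impI)
   fix s :: real assume "s \<noteq> 0 \<and> dist s 0 < 1"
   then have "(g s - g 0) /\<^sub>R s - d = (g s - g 0 - s *\<^sub>R d) /\<^sub>R s" by (simp add: scaleR_diff_right)
   then show "norm (g s - g 0 - s *\<^sub>R d) / norm s = norm ((g s - g 0) /\<^sub>R s - d)"
    by (simp add: divide_inverse mult.commute)
  qed simp
 qed
 also have "\<dots> \<longleftrightarrow> ((\<lambda>s. (g s - g 0) /\<^sub>R s) \<longlongrightarrow> d) (at 0)"
  unfolding tendsto_norm_zero_iff LIM_zero_iff ..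
 finally show ?thesis .
qed

lemma has_ddir_difference_bound:
 assumes f: "has_ddir v f f'" and C: "\<And>\<tau>. \<bar>\<tau>\<bar> \<le> \<bar>s\<bar> \<Longrightarrow> norm (f' (x + \<tau> *\<^sub>R v)) \<le> C"
 shows "norm (f (x + s *\<^sub>R v) - f x) \<le> C * \<bar>s\<bar>"
proof -
 have "norm (f (x + s *\<^sub>R v) - f (x + 0 *\<^sub>R v)) \<le> C * norm (s - 0)"
 proof (rule differentiable_bound[where S = "{-\<bar>s\<bar>..\<bar>s\<bar>}" and f' = "\<lambda>\<tau> t. t *\<^sub>R f' (x + \<tau> *\<^sub>R v)"])
  fix \<tau> assume \<tau>: "\<tau> \<in> {-\<bar>s\<bar>..\<bar>s\<bar>}"
  show "((\<lambda>s. f (x + s *\<^sub>R v)) has_derivative (\<lambda>t. t *\<^sub>R f' (x + \<tau> *\<^sub>R v))) (at \<tau> within {-\<bar>s\<bar>..\<bar>s\<bar>})"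
   using has_ddir_line[OF f, of x \<tau>] unfolding has_vector_derivative_def by (rule has_derivative_at_withinI)
  have "norm (f' (x + \<tau> *\<^sub>R v)) \<le> C" using C \<tau> by auto
  then show "onorm (\<lambda>t. t *\<^sub>R f' (x + \<tau> *\<^sub>R v)) \<le> C"
   by (intro onorm_le) (metis abs_ge_zero mult.commute mult_left_mono norm_scaleR real_norm_def)
 qed auto
 then show ?thesis by simp
qed

lemma integrable_continuous_compact_support:
 fixes f :: "'a::euclidean_space \<Rightarrow> 'b::{banach, second_countable_topology}"
 assumes "continuous_on UNIV f" "compact X" "\<And>x. x \<notin> X \<Longrightarrow> f x = 0"
 shows "integrable lborel f"
proof -
 have "integrable lborel (\<lambda>x. indicator X x *\<^sub>R f x)"
  using assms(1,2) by (intro borel_integrable_compact continuous_on_subset[OF assms(1)]) auto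
 moreover have "(\<lambda>x. indicator X x *\<^sub>R f x) = f" using assms(3) by (auto simp: indicator_def)
 ultimately show ?thesis by simp
qed

lemma continuous_compact_support_bounded:
 fixes f :: "'a::topological_space \<Rightarrow> 'b::real_normed_vector"
 assumes "continuous_on UNIV f" "compact X" "\<And>x. x \<notin> X \<Longrightarrow> f x = 0"
 obtains C where "C \<ge> 0" "\<And>x. norm (f x) \<le> C"
proof -
 have "compact (f ` X)" using assms by (meson compact_continuous_image continuous_on_subset subset_UNIV)
 then obtain C where "\<forall>x\<in>X. norm (f x) \<le> C" using compact_imp_bounded bounded_iff by (metis imageI)
 then have "norm (f x) \<le> \<bar>C\<bar>" for x using assms(3)[of x] by (cases "x \<in> X") force+
 then show ?thesis using that[of "\<bar>C\<bar>"] by auto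
qed

text \<open>Integration by parts along a single direction: difference quotients have integral 0 by
  translation invariance of Lebesgue measure, and dominated convergence passes to the
  derivative.\<close>

lemma integral_ddir_eq_0:
 fixes f :: "'a::euclidean_space \<Rightarrow> complex"
 assumes f: "has_ddir v f f'" and cont: "continuous_on UNIV f" "continuous_on UNIV f'"
  and X: "compact X" "\<And>x. x \<notin> X \<Longrightarrow> f x = 0"
 shows "(LI x. f' x) = 0"
proof -
 have f'0: "f' x = 0" if "x \<notin> X" for x
  using has_ddir_zero_outside[OF f compact_imp_closed[OF X(1)] X(2)] that by blast
 obtain C where C: "C \<ge> 0" "\<And>x. norm (f' x) \<le> C"
  using continuous_compact_support_bounded[OF cont(2) X(1) f'0] by metis
 define s where "s n = 1 / real (Suc n)" for n
 have s: "s n \<noteq> 0" "\<bar>s n\<bar> \<le> 1" for n by (auto simp: s_def)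
 have s0: "s \<longlonglongrightarrow> 0" unfolding s_def using LIMSEQ_inverse_real_of_nat by (simp add: inverse_eq_divide)
 \<comment> \<open>All translates of the support by steps of length at most 1 in direction
   \<open>v\<close> lie in \<open>Y\<close>, so one compact set dominates every quotient.\<close>
 define Y where "Y = (\<lambda>(x, \<tau>). x + \<tau> *\<^sub>R v) ` (X \<times> {-1..1})"
 have cY: "compact Y" unfolding Y_def
  by (intro compact_continuous_image compact_Times X) (auto intro!: continuous_intros simp: case_prod_beta)
 have intf: "integrable lborel f" by (rule integrable_continuous_compact_support[OF cont(1) X])
 have mf: "f \<in> borel_measurable borel" "f' \<in> borel_measurable borel"
  using cont by (auto intro: borel_measurable_continuous_onI)
 define q where "q n x = (f (x + s n *\<^sub>R v) - f x) /\<^sub>R s n" for n x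
 have "(\<lambda>n. (LI x. q n x)) \<longlonglongrightarrow> (LI x. f' x)"
 proof (rule integral_dominated_convergence[where w = "\<lambda>x. C * indicator Y x"])
  show "integrable lborel (\<lambda>x. C * indicator Y x)"
   using cY emeasure_bounded_finite[OF compact_imp_bounded[OF cY]] by (intro integrable_mult_right integrable_real_indicator) (auto intro: borel_compact)
  show "AE x in lborel. (\<lambda>n. q n x) \<longlonglongrightarrow> f' x"
  proof (rule AE_I2)
   fix x
   have "((\<lambda>s. (f (x + s *\<^sub>R v) - f (x + 0 *\<^sub>R v)) /\<^sub>R s) \<longlongrightarrow> f' x) (at 0)"
    using f unfolding has_ddir_def has_vector_derivative_iff_quotient by blast
   moreover have "filterlim s (at 0) sequentially" using s0 s(1) by (auto simp: filterlim_at)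
   ultimately show "(\<lambda>n. q n x) \<longlonglongrightarrow> f' x" unfolding q_def by (auto dest: filterlim_compose)
  qed
  show "AE x in lborel. norm (q n x) \<le> C * indicator Y x" for n
  proof (rule AE_I2)
   fix x
   show "norm (q n x) \<le> C * indicator Y x"
   proof (cases "x \<in> Y")
    case True
    have "norm (f (x + s n *\<^sub>R v) - f x) \<le> C * \<bar>s n\<bar>" by (rule has_ddir_difference_bound[OF f C(2)])
    moreover have "norm (q n x) = norm (f (x + s n *\<^sub>R v) - f x) / \<bar>s n\<bar>"
     by (simp add: q_def divide_inverse mult.commute)
    ultimately show ?thesis using True s(1)[of n] by (simp add: divide_le_eq)
   next
    case False
    have "x \<notin> X" using False by (force simp: Y_def)
    moreover have "x + s n *\<^sub>R v \<notin> X"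
    proof
     assume "x + s n *\<^sub>R v \<in> X"
     then have "(x + s n *\<^sub>R v) + (- s n) *\<^sub>R v \<in> Y" 
      unfolding Y_def by (intro image_eqI[of _ _ "(x + s n *\<^sub>R v, - s n)"]) (use s(2)[of n] in \<open>auto simp: abs_le_iff\<close>)
     then show False using False by simp
    qed
    ultimately show ?thesis using X(2) C(1) by (simp add: q_def)
   qed
  qed
 qed (use mf in \<open>auto simp: q_def\<close>)
 moreover have "(LI x. q n x) = 0" for n
 proof -
  have "distr lborel borel ((+) (s n *\<^sub>R v)) = (lborel :: 'a measure)" by (rule lborel_distr_plus)
  then have 1: "(LI x. f (x + s n *\<^sub>R v)) = (LI x. f x)"
   using integral_distr[of "(+) (s n *\<^sub>R v)" lborel borel f] mf(1) by (simp add: add.commute)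
  have "integrable (distr lborel borel ((+) (s n *\<^sub>R v))) f" using intf by (simp add: lborel_distr_plus)
  then have 2: "integrable lborel (\<lambda>x. f (x + s n *\<^sub>R v))"
   using mf(1) by (simp add: integrable_distr_eq add.commute)
  show ?thesis unfolding q_def using 1 2 intf by (simp add: integral_diff)
 qed
 ultimately have "(\<lambda>n::nat. 0 :: complex) \<longlonglongrightarrow> (LI x. f' x)" by simp
 then show ?thesis by (simp add: LIMSEQ_const_iff)
qed

text \<open>Each integration by parts replaces the amplitude by \<open>h\<close> times its
  derivative and gains \<open>1 / \<bar>c\<bar>\<close>; the powers of \<open>h\<close> cancel. The
  right-hand side is kept as an integral of \<open>B\<close> instead of a supremum, so that L2
  information on a varying \<open>B\<close> can be inserted later.\<close>

lemma osc_linear_decay: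
 fixes a :: "'a::euclidean_space \<Rightarrow> complex"
 assumes h: "h > 0" and e: "e \<bullet> e = 1" and B: "continuous_on UNIV B"
 shows "symb h {e} (cball y \<rho>) B M a \<Longrightarrow> (\<And>x. x \<notin> cball y \<rho> \<Longrightarrow> a x = 0) \<Longrightarrow>
  \<bar>c\<bar> ^ M * norm (LI x. expi (c * (x \<bullet> e) / h) * a x) \<le> (LI x. indicator (cball y \<rho>) x * B x)"
proof (induction M arbitrary: a)
 case 0
 let ?f = "\<lambda>x. expi (c * (x \<bullet> e) / h) * a x"
 have cont: "continuous_on UNIV ?f" by (intro continuous_intros symb_continuous[OF 0(1)]) (use h in auto)
 have "norm (LI x. ?f x) \<le> (LI x. norm (?f x))" by (rule integral_norm_bound)
 also have "\<dots> \<le> (LI x. indicator (cball y \<rho>) x * B x)"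
 proof (rule integral_mono)
  show "integrable lborel (\<lambda>x. norm (?f x))"
   by (intro integrable_norm integrable_continuous_compact_support[OF cont compact_cball[of y \<rho>]]) (simp add: 0(2))
  show "integrable lborel (\<lambda>x. indicator (cball y \<rho>) x * B x)"
   using borel_integrable_compact[OF compact_cball continuous_on_subset[OF B subset_UNIV], of y \<rho>] by simp
  show "norm (?f x) \<le> indicator (cball y \<rho>) x * B x" for x
   using 0(1) 0(2)[of x] by (cases "x \<in> cball y \<rho>") (auto simp: norm_mult indicator_def)
 qed
 finally show ?case by simp
next
 case (Suc M)
 obtain a' where a': "has_ddir e a a'" "symb h {e} (cball y \<rho>) B M (\<lambda>x. h *\<^sub>R a' x)" using Suc.prems(1) by auto
 have a'0: "a' x = 0" if "x \<notin> cball y \<rho>" for x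
  using has_ddir_zero_outside[OF a'(1) closed_cball Suc.prems(2) that] .
 define E where "E x = expi (c * (x \<bullet> e) / h)" for x :: 'a
 have ca: "continuous_on UNIV a" using symb_continuous[OF Suc.prems(1)] .
 have cont': "continuous_on UNIV a'"
  using continuous_on_scaleR[OF continuous_on_const[of _ "inverse h"] symb_continuous[OF a'(2)]] h by simp
 have cE: "continuous_on UNIV E" unfolding E_def by (intro continuous_intros) (use h in auto)
 have "has_ddir e (\<lambda>x. c * (x \<bullet> e) / h) (\<lambda>x. c / h)"
  unfolding has_ddir_def using h by (auto simp: inner_add_left e algebra_simps add_divide_distrib intro!: derivative_eq_intros)
 then have dE: "has_ddir e E (\<lambda>x. (\<i> * complex_of_real (c / h)) * E x)"
  unfolding E_def by (intro has_ddir_exp has_ddir_cmult has_ddir_of_real)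
 have "(LI x. E x * a' x + (\<i> * complex_of_real (c / h)) * E x * a x) = 0"
 proof (rule integral_ddir_eq_0[OF has_ddir_mult[OF dE a'(1)] _ _ compact_cball[of y \<rho>]])
  show "continuous_on UNIV (\<lambda>x. E x * a x)" by (intro continuous_intros cE ca)
  show "continuous_on UNIV (\<lambda>x. E x * a' x + \<i> * complex_of_real (c / h) * E x * a x)"
   by (intro continuous_intros cE ca cont')
 qed (simp add: Suc.prems(2))
 moreover have i1: "integrable lborel (\<lambda>x. E x * a' x)"
  by (rule integrable_continuous_compact_support[OF _ compact_cball[of y \<rho>]]) (auto intro!: continuous_intros cE cont' simp: a'0)
 moreover have i2: "integrable lborel (\<lambda>x. (\<i> * complex_of_real (c / h)) * E x * a x)"
  by (rule integrable_continuous_compact_support[OF _ compact_cball[of y \<rho>]]) (use h in \<open>auto intro!: continuous_intros cE ca simp: Suc.prems(2)\<close>)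
 ultimately have "(LI x. E x * a' x) + (\<i> * complex_of_real (c / h)) * (LI x. E x * a x) = 0"
  by (simp add: integral_add mult.assoc)
 then have eq: "\<i> * complex_of_real (c / h) * (LI x. E x * a x) = - (LI x. E x * a' x)"
  by (simp add: eq_neg_iff_add_eq_0 add.commute)
 have "\<bar>c\<bar> / h * norm (LI x. E x * a x) = norm (\<i> * complex_of_real (c / h) * (LI x. E x * a x))"
  using h by (simp add: norm_mult abs_divide norm_divide)
 also have "\<dots> = norm (LI x. E x * a' x)" unfolding eq by simp
 finally have "\<bar>c\<bar> * norm (LI x. E x * a x) = h * norm (LI x. E x * a' x)"
  using h by (simp add: field_simps)
 also have "\<dots> = norm (LI x. E x * (h *\<^sub>R a' x))"
  using h by (simp add: scaleR_conv_of_real mult.left_commute[of _ "complex_of_real h"] norm_mult)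
 finally have "\<bar>c\<bar> ^ Suc M * norm (LI x. E x * a x) = \<bar>c\<bar> ^ M * norm (LI x. E x * (h *\<^sub>R a' x))"
  by (simp add: mult.assoc mult.left_commute)
 also have "\<dots> \<le> (LI x. indicator (cball y \<rho>) x * B x)"
  unfolding E_def by (rule Suc.IH[OF a'(2)]) (simp add: a'0)
 finally show ?case unfolding E_def .
qed

lemma smooth_lipschitz:
 fixes f :: "'a::euclidean_space \<Rightarrow> 'b::real_normed_vector"
 assumes "smooth_on UNIV f" "compact K" "convex K"
 obtains L where "L \<ge> 0" "\<And>x y. x \<in> K \<Longrightarrow> y \<in> K \<Longrightarrow> norm (f x - f y) \<le> L * norm (x - y)"
proof -
 have "compact ((\<lambda>x. Blinfun (FD f x)) ` K)"
  using frechet_derivative_continuous_blinfun[OF open_UNIV assms(1)] assms(2)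
  by (meson compact_continuous_image continuous_on_subset subset_UNIV)
 then have "bounded ((\<lambda>x. Blinfun (FD f x)) ` K)" by (rule compact_imp_bounded)
 then obtain L where L: "\<forall>x\<in>K. norm (Blinfun (FD f x)) \<le> L"
  unfolding bounded_iff by blast
 have "norm (f x - f y) \<le> \<bar>L\<bar> * norm (x - y)" if "x \<in> K" "y \<in> K" for x y
 proof (rule differentiable_bound[OF \<open>convex K\<close>])
  fix z assume z: "z \<in> K"
  have hd: "(f has_derivative FD f z) (at z)" using smooth_on_has_derivative[OF assms(1)] by simp
  then show "(f has_derivative FD f z) (at z within K)" by (rule has_derivative_at_withinI)
  have "norm (Blinfun (FD f z)) \<le> \<bar>L\<bar>" using L z by force
  then show "onorm (FD f z) \<le> \<bar>L\<bar>"
   by (simp add: norm_blinfun.rep_eq bounded_linear_Blinfun_apply[OF has_derivative_bounded_linear[OF hd]])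
 qed (use that in auto)
 then show ?thesis using that[of "\<bar>L\<bar>"] by simp
qed

lemma one_add_power_le: "(1 + c) ^ M \<le> 2 ^ M * (1 + c ^ M)" if "c \<ge> (0::real)"
proof (cases "c \<le> 1")
 case True
 have "(1 + c) ^ M \<le> 2 ^ M" using True that by (intro power_mono) auto
 also have "\<dots> \<le> 2 ^ M * (1 + c ^ M)" using that by simp
 finally show ?thesis .
next
 case False
 have "(1 + c) ^ M \<le> (2 * c) ^ M" using False by (intro power_mono) auto
 also have "\<dots> \<le> 2 ^ M * (1 + c ^ M)" by (simp add: power_mult_distrib)
 finally show ?thesis .
qed

text \<open>On a ball of radius \<open>h\<close> the phase is, in direction \<open>b\<close>, linear
  with slope c/h up to a term \<open>\<rho>\<close> whose derivative times \<open>h\<close> is O(1),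
  because the gradient varies by O(h) there and is divided by \<open>h\<close>. The exponential of
  \<open>\<rho>\<close> is then a symbol at scale \<open>h\<close> and joins the amplitude, which
  leaves a linear phase.\<close>

lemma osc_estimate_direction:
 fixes S :: "'a::euclidean_space \<times> 'a \<Rightarrow> real"
 assumes smooth: "smooth_on UNIV S"
 obtains C where "C \<ge> 0" "\<And>h y w w' b a B. \<lbrakk>0 < h; h \<le> 1; b \<in> Basis; cball y h \<subseteq> cball 0 R;
   w \<in> cball 0 R; w' \<in> cball 0 R; symb h {b} (cball y h) B M a; (\<And>x. x \<notin> cball y h \<Longrightarrow> a x = 0);
   continuous_on UNIV B; (\<And>x. 0 \<le> B x)\<rbrakk> \<Longrightarrow>
   (1 + \<bar>FD S (y, w) (b, 0) - FD S (y, w') (b, 0)\<bar> / h) ^ M *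
    norm (LI x. expi ((S (x, w) - S (x, w')) / h\<^sup>2) * a x)
   \<le> C * (LI x. indicator (cball y h) x * B x)"
proof -
 define K :: "('a \<times> 'a) set" where "K = cball 0 R \<times> cball 0 R"
 have K: "compact K" "convex K" unfolding K_def by (auto intro: compact_Times convex_Times)
 define g where "g b q = FD S q (b, 0)" for b q
 have smg: "smooth_on UNIV (g b)" for b unfolding g_def by (intro smooth_intros smooth)
 define g2 where "g2 b q = FD (g b) q (b, 0)" for b q
 have smg2: "smooth_on UNIV (\<lambda>q. complex_of_real (g2 b q))" for b
  unfolding g2_def
  by (rule smooth_on_bounded_linear[OF open_UNIV bounded_linear_of_real smooth_on_frechet_derivative[OF smg]])
 have "\<forall>b. \<exists>L\<ge>0. \<forall>x\<in>K. \<forall>y\<in>K. norm (g b x - g b y) \<le> L * norm (x - y)"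
  using smooth_lipschitz[OF smg K] by metis
 from choice[OF this] obtain L where L: "\<And>b. L b \<ge> 0" "\<And>b x y. x \<in> K \<Longrightarrow> y \<in> K \<Longrightarrow> norm (g b x - g b y) \<le> L b * norm (x - y)" by blast
 have "\<forall>b. \<exists>C\<ge>0. \<forall>h. 0 < h \<longrightarrow> h \<le> 1 \<longrightarrow> symb h {(b, 0)} K (\<lambda>_. C) M (\<lambda>q. complex_of_real (g2 b q))"
  using smooth_imp_symb[OF K(1) _ smg2] by blast
 from choice[OF this] obtain D where D: "\<And>b. D b \<ge> 0"
  "\<And>b h. 0 < h \<Longrightarrow> h \<le> 1 \<Longrightarrow> symb h {(b, 0)} K (\<lambda>_. D b) M (\<lambda>q. complex_of_real (g2 b q))" by blast
 \<comment> \<open>\<open>L b\<close> bounds the values of \<open>p\<close> and \<open>D b\<close>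
   its derivatives; each occurs once for \<open>w\<close> and once for \<open>w'\<close>, hence the
   factors 2.\<close>
 define C1 where "C1 = (\<Sum>b\<in>Basis. 2 * L b + 2 * D b)"
 have C1: "2 * L b + 2 * D b \<le> C1" if "b \<in> Basis" for b
  unfolding C1_def using L(1) D(1) by (intro member_le_sum[OF that]) auto
 have C1_0: "C1 \<ge> 0" unfolding C1_def using L(1) D(1) by (intro sum_nonneg) auto
 define C2 where "C2 = 2 ^ M * exp_symb_const C1 M"
 have C2: "C2 \<ge> 1" unfolding C2_def using mult_mono[OF one_le_power[of "2::real" M] exp_symb_const_ge_1[of C1 M]] by simp
 define C where "C = 2 ^ M * 2 * C2"
 have main: "(1 + \<bar>g b (y, w) - g b (y, w')\<bar> / h) ^ M *
    norm (LI x. expi ((S (x, w) - S (x, w')) / h\<^sup>2) * a x)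
   \<le> C * (LI x. indicator (cball y h) x * B x)"
  if h: "0 < h" "h \<le> 1" and b: "b \<in> Basis" and y: "cball y h \<subseteq> cball 0 R" and w: "w \<in> cball 0 R" "w' \<in> cball 0 R"
   and a: "symb h {b} (cball y h) B M a" "\<And>x. x \<notin> cball y h \<Longrightarrow> a x = 0" and B: "continuous_on UNIV B" "\<And>x. 0 \<le> B x"
  for h y w w' b a B
 proof -
  define c where "c = (g b (y, w) - g b (y, w')) / h"
  define \<rho> where "\<rho> x = (S (x, w) - S (x, w')) / h\<^sup>2 - c * (x \<bullet> b) / h" for x
  define p where "p x = (g b (x, w) - g b (x, w')) / h - c" for x
  have inK: "(x, w) \<in> K" "(x, w') \<in> K" if "x \<in> cball y h" for x using that y w unfolding K_def by blast+
  have sl: "bounded_linear (\<lambda>x::'a. (x, 0::'a))" by (intro bounded_linear_Pair bounded_linear_ident bounded_linear_zero)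
  have slice: "has_ddir b (\<lambda>x. f (x, z)) (\<lambda>x. f' (x, z))" if "has_ddir (b, 0) f f'" for f f' and z :: 'a
   using has_ddir_affine[of "\<lambda>x. (x, 0)" b f f' "(0, z)"] that bounded_linear.linear[OF sl] by simp
  have contS: "continuous_on UNIV (\<lambda>x. f (x, z))" if "continuous_on UNIV f" for f :: "'a \<times> 'a \<Rightarrow> real" and z
   by (rule continuous_on_compose2[OF that]) (auto intro!: continuous_intros)
  have c\<rho>: "continuous_on UNIV \<rho>" unfolding \<rho>_def
   by (intro continuous_intros contS smooth_on_continuous[OF smooth]) (use h in auto)
  have d\<rho>: "has_ddir b \<rho> (\<lambda>x. (g b (x, w) - g b (x, w')) / h\<^sup>2 - c / h)"
  proof -
   have S': "has_ddir (b, 0) S (g b)" unfolding g_def by (rule smooth_has_ddir[OF smooth])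
   have 1: "has_ddir b (\<lambda>x. c * (x \<bullet> b) / h) (\<lambda>x. c / h)"
    unfolding has_ddir_def using b h by (auto simp: inner_add_left algebra_simps add_divide_distrib intro!: derivative_eq_intros)
   have "has_ddir b (\<lambda>x. inverse (h\<^sup>2) * (S (x, w) + (- 1) * S (x, w')) + (- 1) * (c * (x \<bullet> b) / h))
    (\<lambda>x. inverse (h\<^sup>2) * (g b (x, w) + (- 1) * g b (x, w')) + (- 1) * (c / h))"
    by (intro has_ddir_add has_ddir_cmult slice[OF S'] 1)
   then show ?thesis unfolding \<rho>_def by (simp add: divide_inverse mult.commute)
  qed
  have hp: "h * ((g b (x, w) - g b (x, w')) / h\<^sup>2 - c / h) = p x" for x
   using h by (simp add: p_def field_simps power2_eq_square)
  have symbp: "symb h {b} (cball y h) (\<lambda>_. C1) M (\<lambda>x. complex_of_real (p x))"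
  proof -
   have bound: "norm (complex_of_real (p x)) \<le> C1" if x: "x \<in> cball y h" for x
   proof -
    have yy: "y \<in> cball y h" using h by simp
    have "p x = ((g b (x, w) - g b (y, w)) - (g b (x, w') - g b (y, w'))) / h" unfolding p_def c_def by (simp add: diff_divide_distrib)
    then have "\<bar>p x\<bar> = \<bar>(g b (x, w) - g b (y, w)) - (g b (x, w') - g b (y, w'))\<bar> / h" using h by (simp add: abs_divide)
    also have "\<dots> \<le> (\<bar>g b (x, w) - g b (y, w)\<bar> + \<bar>g b (x, w') - g b (y, w')\<bar>) / h"
     using h by (intro divide_right_mono abs_triangle_ineq4) auto
    also have "\<dots> \<le> (L b * norm ((x, w) - (y, w)) + L b * norm ((x, w') - (y, w'))) / h"
     using L(2)[OF inK(1)[OF x] inK(1)[OF yy], of b] L(2)[OF inK(2)[OF x] inK(2)[OF yy], of b] h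
     by (intro divide_right_mono add_mono) auto
    also have "\<dots> = 2 * L b * norm (x - y) / h" by (simp add: norm_Pair)
    also have "\<dots> \<le> 2 * L b * h / h" using x L(1)[of b] h
     by (intro divide_right_mono mult_left_mono) (auto simp: dist_norm norm_minus_commute)
    also have "\<dots> \<le> C1" using h C1[OF b] D(1)[of b] by simp
    finally show ?thesis by simp
   qed
   have cp: "continuous_on UNIV (\<lambda>x. complex_of_real (p x))" unfolding p_def
    by (intro continuous_intros contS smooth_on_continuous[OF smg]) (use h in auto)
   show ?thesis
   proof (cases M)
    case 0 then show ?thesis using bound cp by simp
   next
    case (Suc M')
    have "symb h {b} (cball y h) (\<lambda>_. D b) M (\<lambda>x. complex_of_real (g2 b ((x, 0) + (0, z))))" if "z \<in> cball 0 R" for z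
     by (rule symb_affine[OF bounded_linear.linear[OF sl] _ _ _ _ _ D(2)[OF h]])
      (use that y D(1) in \<open>auto simp: K_def intro!: continuous_intros\<close>)
    then have s1: "symb h {b} (cball y h) (\<lambda>_. D b) M (\<lambda>x. complex_of_real (g2 b (x, z)))" if "z \<in> cball 0 R" for z
     using that by simp
    have "symb h {b} (cball y h) (\<lambda>x. D b + norm (- 1 :: complex) * D b) M (\<lambda>x. complex_of_real (g2 b (x, w)) + (- 1) * complex_of_real (g2 b (x, w')))"
     by (intro symb_add symb_cmult s1 w)
    moreover have "D b + norm (- 1 :: complex) * D b \<le> C1" using C1[OF b] L(1)[of b] by simp
    ultimately have "symb h {b} (cball y h) (\<lambda>x. C1) M (\<lambda>x. complex_of_real (g2 b (x, w)) + (- 1) * complex_of_real (g2 b (x, w')))"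
     by (rule symb_bound_mono)
    then have s2: "symb h {b} (cball y h) (\<lambda>x. C1) M (\<lambda>x. complex_of_real (g2 b (x, w) - g2 b (x, w')))"
     by simp
    have g2d: "has_ddir (b, 0) (g b) (g2 b)" unfolding g2_def by (rule smooth_has_ddir[OF smg])
    have "has_ddir b (\<lambda>x. complex_of_real (inverse h * (g b (x, w) + (- 1) * g b (x, w')) + (- c)))
     (\<lambda>x. complex_of_real (inverse h * (g2 b (x, w) + (- 1) * g2 b (x, w')) + 0))"
     by (intro has_ddir_of_real has_ddir_add has_ddir_cmult slice[OF g2d] has_ddir_const)
    then have "has_ddir b (\<lambda>x. complex_of_real (p x)) (\<lambda>x. complex_of_real ((g2 b (x, w) - g2 b (x, w')) / h))"
     unfolding p_def by (simp add: divide_inverse mult.commute)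
    moreover have "symb h {b} (cball y h) (\<lambda>_. C1) M' (\<lambda>x. h *\<^sub>R complex_of_real ((g2 b (x, w) - g2 b (x, w')) / h))"
     using symb_mono_order[OF _ s2, of M'] h Suc by (simp add: scaleR_conv_of_real del: symb.simps)
    ultimately show ?thesis unfolding Suc using bound cp by (intro symb_SucI) auto
   qed
  qed
  have sE: "symb h {b} (cball y h) (\<lambda>_. exp_symb_const C1 M) M (\<lambda>x. expi (\<rho> x))"
  proof (rule symb_exp[OF c\<rho>, where k = M])
   fix v assume "v \<in> {b}"
   then show "\<exists>\<rho>'. has_ddir v \<rho> \<rho>' \<and> symb h {b} (cball y h) (\<lambda>_. C1) M (\<lambda>x. complex_of_real (h * \<rho>' x))"
    using d\<rho> symbp hp by (intro exI[of _ "\<lambda>x. (g b (x, w) - g b (x, w')) / h\<^sup>2 - c / h"]) simp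
  qed simp
  define a2 where "a2 x = expi (\<rho> x) * a x" for x
  have "symb h {b} (cball y h) (\<lambda>x. 2 ^ M * (exp_symb_const C1 M * B x)) M a2"
   unfolding a2_def by (rule symb_mult[OF sE a(1)])
  then have sa2: "symb h {b} (cball y h) (\<lambda>x. C2 * B x) M a2" by (simp add: C2_def mult.assoc)
  have a20: "a2 x = 0" if "x \<notin> cball y h" for x using a(2)[OF that] by (simp add: a2_def)
  have cB: "continuous_on UNIV (\<lambda>x. C2 * B x)" by (intro continuous_intros B)
  define I where "I = (LI x. expi ((S (x, w) - S (x, w')) / h\<^sup>2) * a x)"
  define Q where "Q = (LI x. indicator (cball y h) x * B x)"
  have I: "I = (LI x. expi (c * (x \<bullet> b) / h) * a2 x)"
  proof -
   have "(S (x, w) - S (x, w')) / h\<^sup>2 = c * (x \<bullet> b) / h + \<rho> x" for x by (simp add: \<rho>_def)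
   then show ?thesis unfolding I_def a2_def by (simp only: of_real_add distrib_left exp_add mult.assoc)
  qed
  have Q2: "(LI x. indicator (cball y h) x * (C2 * B x)) = C2 * Q"
   unfolding Q_def by (simp add: mult.left_commute)
  have bb: "b \<bullet> b = 1" using b by simp
  have 1: "\<bar>c\<bar> ^ M * norm I \<le> C2 * Q"
   using osc_linear_decay[OF h(1) bb cB sa2 a20, of c] unfolding I Q2 by simp
  \<comment> \<open>The estimate without integration by parts takes care of small \<open>c\<close>;
    together with the one of order \<open>M\<close> it yields decay in
    \<open>1 + \<bar>c\<bar>\<close>.\<close>
  have 2: "norm I \<le> C2 * Q"
   using osc_linear_decay[OF h(1) bb cB symb_mono_order[OF _ sa2, of 0] a20, of c] unfolding I Q2 by simp
  have "(1 + \<bar>c\<bar>) ^ M * norm I \<le> (2 ^ M * (1 + \<bar>c\<bar> ^ M)) * norm I"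
   by (intro mult_right_mono one_add_power_le) auto
  also have "\<dots> = 2 ^ M * (norm I + \<bar>c\<bar> ^ M * norm I)" by (simp add: algebra_simps)
  also have "\<dots> \<le> 2 ^ M * (C2 * Q + C2 * Q)" using 1 2 by (intro mult_left_mono add_mono) auto
  also have "\<dots> = C * Q" by (simp add: C_def)
  finally show ?thesis unfolding I_def Q_def c_def using h by (simp add: abs_divide)
 qed
 have "C \<ge> 0" using C2 by (simp add: C_def)
 then show ?thesis by (rule that[OF _ main[unfolded g_def]])
qed

section \<open>Symmetry of second derivatives\<close>

lemma has_ddir_mvt:
 fixes f :: "'a::real_normed_vector \<Rightarrow> real"
 assumes "has_ddir v f f'" "s > 0"
 obtains \<tau> where "0 < \<tau>" "\<tau> < s" "f (x + s *\<^sub>R v) - f x = s * f' (x + \<tau> *\<^sub>R v)"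
proof -
 have "\<exists>z>0. z < s \<and> f (x + s *\<^sub>R v) - f (x + 0 *\<^sub>R v) = (s - 0) * f' (x + z *\<^sub>R v)"
  using has_ddir_line[OF assms(1)] assms(2)
  by (intro MVT2) (auto simp: has_real_derivative_iff_has_vector_derivative)
 then show ?thesis using that by auto
qed

text \<open>The second difference over a small parallelogram is symmetric in \<open>u\<close> and
  \<open>v\<close>. Two applications of the mean value theorem identify it with either mixed
  derivative at a nearby point, and continuity concludes. The symmetry will identify the
  differential of \<open>grad_theta\<close> in x with the transposed mixed Hessian.\<close>

lemma mixed_derivatives_symmetric:
 fixes f :: "'a::euclidean_space \<Rightarrow> real"
 assumes smooth: "smooth_on UNIV f"
 shows "FD (\<lambda>q. FD f q u) x v =
  FD (\<lambda>q. FD f q v) x u"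
proof -
 define D where "D v q = FD f q v" for v q
 define P where "P u v q = FD (D u) q v" for u v q
 have smD: "smooth_on UNIV (D v)" for v unfolding D_def by (intro smooth_intros smooth)
 have 1: "has_ddir v f (D v)" for v unfolding D_def by (rule smooth_has_ddir[OF smooth])
 have 2: "has_ddir v (D u) (P u v)" for u v unfolding P_def by (rule smooth_has_ddir[OF smD])
 have shift: "has_ddir v (\<lambda>q. g (q + z)) (\<lambda>q. g' (q + z))" if "has_ddir v g g'" for v z and g g' :: "'a \<Rightarrow> real"
  using has_ddir_affine[of id v g g' z] that by (simp add: id_def linear_id[unfolded id_def])
 have square: "\<exists>\<tau> \<sigma>. 0 < \<tau> \<and> \<tau> < s \<and> 0 < \<sigma> \<and> \<sigma> < s \<and>
   f (x + s *\<^sub>R u + s *\<^sub>R v) - f (x + s *\<^sub>R u) - f (x + s *\<^sub>R v) + f x = s * (s * P u v (x + \<tau> *\<^sub>R u + \<sigma> *\<^sub>R v))"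
  if s: "s > 0" for s u v
 proof -
  have "has_ddir u (\<lambda>q. f (q + s *\<^sub>R v) + (- 1) * f q) (\<lambda>q. D u (q + s *\<^sub>R v) + (- 1) * D u q)"
   by (intro has_ddir_add has_ddir_cmult shift 1)
  from has_ddir_mvt[OF this s, of x] obtain \<tau> where \<tau>: "0 < \<tau>" "\<tau> < s"
   "f (x + s *\<^sub>R u + s *\<^sub>R v) - f (x + s *\<^sub>R u) - (f (x + s *\<^sub>R v) - f x) = s * (D u (x + \<tau> *\<^sub>R u + s *\<^sub>R v) - D u (x + \<tau> *\<^sub>R u))"
   by (auto simp: algebra_simps)
  obtain \<sigma> where \<sigma>: "0 < \<sigma>" "\<sigma> < s" "D u (x + \<tau> *\<^sub>R u + s *\<^sub>R v) - D u (x + \<tau> *\<^sub>R u) = s * P u v (x + \<tau> *\<^sub>R u + \<sigma> *\<^sub>R v)"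
   by (rule has_ddir_mvt[OF 2 s])
  show ?thesis using \<tau> \<sigma> by (intro exI[of _ \<tau>] exI[of _ \<sigma>]) auto
 qed
 have cont: "continuous_on UNIV (P u v)" for u v unfolding P_def
  by (intro smooth_on_continuous smooth_intros smD)
 have "P u v x = P v u x"
 proof (rule ccontr)
  define \<epsilon> where "\<epsilon> = \<bar>P u v x - P v u x\<bar> / 2"
  assume "P u v x \<noteq> P v u x"
  then have "\<epsilon> > 0" by (simp add: \<epsilon>_def)
  obtain d1 where d1: "d1 > 0" "\<And>q. dist q x < d1 \<Longrightarrow> dist (P u v q) (P u v x) < \<epsilon>"
  proof -
   have "\<exists>d>0. \<forall>q. dist q x < d \<longrightarrow> dist (P u v q) (P u v x) < \<epsilon>"
    using cont[of u v] \<open>\<epsilon> > 0\<close> by (simp add: continuous_on_iff)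
   then show ?thesis using that by blast
  qed
  obtain d2 where d2: "d2 > 0" "\<And>q. dist q x < d2 \<Longrightarrow> dist (P v u q) (P v u x) < \<epsilon>"
  proof -
   have "\<exists>d>0. \<forall>q. dist q x < d \<longrightarrow> dist (P v u q) (P v u x) < \<epsilon>"
    using cont[of v u] \<open>\<epsilon> > 0\<close> by (simp add: continuous_on_iff)
   then show ?thesis using that by blast
  qed
  define N where "N = norm u + norm v + 1"
  have N: "N > 0" by (simp add: N_def add_nonneg_pos)
  define s where "s = min d1 d2 / N"
  have s: "s > 0" using d1 d2 N by (simp add: s_def)
  have near: "dist (x + \<tau> *\<^sub>R a + \<sigma> *\<^sub>R b) x < min d1 d2" if "0 < \<tau>" "\<tau> < s" "0 < \<sigma>" "\<sigma> < s" "{a, b} = {u, v}" for \<tau> \<sigma> a b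
  proof -
   have "dist (x + \<tau> *\<^sub>R a + \<sigma> *\<^sub>R b) x \<le> \<tau> * norm a + \<sigma> * norm b"
    using norm_triangle_ineq[of "\<tau> *\<^sub>R a" "\<sigma> *\<^sub>R b"] that by (simp add: dist_norm algebra_simps)
   also have "\<dots> \<le> s * norm a + s * norm b" using that by (intro add_mono mult_right_mono) auto
   also have "\<dots> = s * (norm u + norm v)" using that(5) by (auto simp: doubleton_eq_iff algebra_simps)
   also have "\<dots> < s * N" using s by (simp add: N_def)
   also have "\<dots> = min d1 d2" using N by (simp add: s_def)
   finally show ?thesis .
  qed
  obtain \<tau> \<sigma> where a: "0 < \<tau>" "\<tau> < s" "0 < \<sigma>" "\<sigma> < s"
   "f (x + s *\<^sub>R u + s *\<^sub>R v) - f (x + s *\<^sub>R u) - f (x + s *\<^sub>R v) + f x = s * (s * P u v (x + \<tau> *\<^sub>R u + \<sigma> *\<^sub>R v))"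
   using square[OF s, of u v] by blast
  obtain \<tau>' \<sigma>' where b: "0 < \<tau>'" "\<tau>' < s" "0 < \<sigma>'" "\<sigma>' < s"
   "f (x + s *\<^sub>R v + s *\<^sub>R u) - f (x + s *\<^sub>R v) - f (x + s *\<^sub>R u) + f x = s * (s * P v u (x + \<tau>' *\<^sub>R v + \<sigma>' *\<^sub>R u))"
   using square[OF s, of v u] by blast
  have "f (x + s *\<^sub>R u + s *\<^sub>R v) = f (x + s *\<^sub>R v + s *\<^sub>R u)" by (simp add: algebra_simps)
  then have "s * (s * P u v (x + \<tau> *\<^sub>R u + \<sigma> *\<^sub>R v)) = s * (s * P v u (x + \<tau>' *\<^sub>R v + \<sigma>' *\<^sub>R u))"
   unfolding a(5)[symmetric] b(5)[symmetric] by simp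
  then have "P u v (x + \<tau> *\<^sub>R u + \<sigma> *\<^sub>R v) = P v u (x + \<tau>' *\<^sub>R v + \<sigma>' *\<^sub>R u)" using s by simp
  moreover have "dist (P u v (x + \<tau> *\<^sub>R u + \<sigma> *\<^sub>R v)) (P u v x) < \<epsilon>" using near[OF a(1-4)] by (intro d1(2)) auto
  moreover have "dist (P v u (x + \<tau>' *\<^sub>R v + \<sigma>' *\<^sub>R u)) (P v u x) < \<epsilon>" using near[OF b(1-4)] by (intro d2(2)) auto
  moreover have False if "a = b" "dist a p < \<bar>p - q\<bar> / 2" "dist b q < \<bar>p - q\<bar> / 2" for a b p q :: real
   using that dist_triangle3[of p q a] by (simp add: dist_real_def)
  ultimately show False unfolding \<epsilon>_def by blast
 qed
 then show ?thesis unfolding P_def D_def .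
qed

section \<open>Parameter integrals and the Schur test\<close>

lemma integrable_bounded_compact_support:
 fixes f :: "'a::euclidean_space \<Rightarrow> 'b::{banach, second_countable_topology}"
 assumes "f \<in> borel_measurable borel" "\<And>x. norm (f x) \<le> C" "compact X" "\<And>x. x \<notin> X \<Longrightarrow> f x = 0"
 shows "integrable lborel f"
proof (rule Bochner_Integration.integrable_bound)
 show "integrable lborel (\<lambda>x. C * indicator X x :: real)"
  using \<open>compact X\<close> emeasure_bounded_finite[OF compact_imp_bounded]
  by (intro integrable_mult_right integrable_real_indicator) (auto intro: borel_compact)
 have "norm (f x) \<le> norm (C * indicator X x :: real)" for x
  using assms(2)[of x] assms(4)[of x] by (cases "x \<in> X") auto
 then show "AE x in lborel. norm (f x) \<le> norm (C * indicator X x :: real)" by simp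
qed (use assms(1) in simp)

lemma borel_measurable_fst_borel [measurable]:
 "fst \<in> borel_measurable (borel :: ('a::second_countable_topology \<times> 'b::second_countable_topology) measure)"
 and borel_measurable_snd_borel [measurable]:
 "snd \<in> borel_measurable (borel :: ('a::second_countable_topology \<times> 'b::second_countable_topology) measure)"
 by (auto intro!: borel_measurable_continuous_onI continuous_intros)

lemma borel_measurable_cnj [measurable]: "cnj \<in> borel_measurable borel"
 by (intro borel_measurable_continuous_onI continuous_intros)

lemma borel_measurable_param_integral:
 fixes k :: "'a::euclidean_space \<Rightarrow> 'b::euclidean_space \<Rightarrow> complex"
 assumes "(\<lambda>z. k (fst z) (snd z)) \<in> borel_measurable borel"
 shows "(\<lambda>x. (LI t. k x t)) \<in> borel_measurable borel"
proof -
 have "measurable (borel \<Otimes>\<^sub>M lborel) borel = measurable (borel :: ('a \<times> 'b) measure) (borel :: complex measure)"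
  by (rule measurable_cong_sets) (simp_all add: borel_prod[symmetric] cong: sets_pair_measure_cong)
 then have "case_prod k \<in> borel_measurable (borel \<Otimes>\<^sub>M lborel)" using assms by (simp add: case_prod_beta')
 then show ?thesis by (rule lborel.borel_measurable_lebesgue_integral)
qed

lemma borel_measurable_slice:
 fixes \<phi> :: "'a::euclidean_space \<times> 'b::euclidean_space \<Rightarrow> complex"
 assumes "continuous_on UNIV \<phi>" shows "(\<lambda>t. \<phi> (y, t)) \<in> borel_measurable borel"
 by (intro borel_measurable_continuous_onI continuous_on_compose2[OF assms, of UNIV "Pair y"] continuous_intros) auto

lemma integral_param_tendsto:
 fixes k :: "real \<Rightarrow> 'b::euclidean_space \<Rightarrow> complex"
 assumes meas: "\<And>s. k s \<in> borel_measurable borel" "f \<in> borel_measurable borel"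
  and bound: "\<And>s t. \<bar>s\<bar> \<le> 1 \<Longrightarrow> s \<noteq> 0 \<Longrightarrow> norm (k s t) \<le> C * indicator Y t" and Y: "compact Y"
  and lim: "\<And>t. ((\<lambda>s. k s t) \<longlongrightarrow> f t) (at 0)"
 shows "((\<lambda>s. (LI t. k s t)) \<longlongrightarrow> (LI t. f t)) (at 0)"
proof -
 \<comment> \<open>Restricting the filter to \<open>{-1..1}\<close> makes the domination, assumed
   for small parameters only, available along every sequence.\<close>
 have at: "at (0::real) = at 0 within {-1..1}" by (rule at_within_interior[symmetric]) auto
 show ?thesis unfolding at tendsto_at_iff_sequentially o_def
 proof (intro allI impI)
  fix s :: "nat \<Rightarrow> real" assume s: "\<forall>i. s i \<in> {-1..1} - {0}" "s \<longlonglongrightarrow> 0"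
  have sf: "filterlim s (at 0) sequentially" using s by (auto simp: filterlim_at)
  show "(\<lambda>n. (LI t. k (s n) t)) \<longlonglongrightarrow> (LI t. f t)"
  proof (rule integral_dominated_convergence[where w = "\<lambda>t. C * indicator Y t"])
   show "integrable lborel (\<lambda>t. C * indicator Y t)"
    using Y emeasure_bounded_finite[OF compact_imp_bounded[OF Y]]
    by (intro integrable_mult_right integrable_real_indicator) (auto intro: borel_compact)
   show "AE t in lborel. (\<lambda>n. k (s n) t) \<longlonglongrightarrow> f t" using filterlim_compose[OF lim sf] by simp
   show "AE t in lborel. norm (k (s n) t) \<le> C * indicator Y t" for n
    using s(1) by (intro AE_I2 bound) (auto simp: abs_le_iff)
  qed (use meas in auto)
 qed
qed

lemma integral_param_continuous:
 fixes \<phi> :: "'a::euclidean_space \<times> 'b::euclidean_space \<Rightarrow> complex"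
 assumes \<phi>: "continuous_on UNIV \<phi>" and u: "u \<in> borel_measurable borel" "\<And>t. norm (u t) \<le> M"
  and Y: "compact Y" "\<And>t. t \<notin> Y \<Longrightarrow> u t = 0"
 shows "continuous_on UNIV (\<lambda>x. (LI t. \<phi> (x, t) * u t))"
 unfolding continuous_on_sequentially o_def
proof (intro ballI allI impI)
 fix x :: 'a and z :: "nat \<Rightarrow> 'a" assume "(\<forall>n. z n \<in> UNIV) \<and> z \<longlonglongrightarrow> x"
 then have z: "z \<longlonglongrightarrow> x" by blast
 have M0: "M \<ge> 0" using u(2) norm_ge_zero order_trans by blast
 define Z where "Z = insert x (range z)"
 have "compact (Z \<times> Y)" unfolding Z_def using z Y(1) by (intro compact_Times compact_sequence_with_limit)
 then have "compact (\<phi> ` (Z \<times> Y))" using \<phi> by (meson compact_continuous_image continuous_on_subset subset_UNIV)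
 then have "bounded (\<phi> ` (Z \<times> Y))" by (rule compact_imp_bounded)
 then obtain C where C: "\<And>q. q \<in> Z \<times> Y \<Longrightarrow> norm (\<phi> q) \<le> C" unfolding bounded_iff by blast
 have meas: "(\<lambda>t. \<phi> (y, t) * u t) \<in> borel_measurable lborel" for y
  using u(1) borel_measurable_slice[OF \<phi>, of y] by auto
 show "(\<lambda>n. (LI t. \<phi> (z n, t) * u t)) \<longlonglongrightarrow> (LI t. \<phi> (x, t) * u t)"
 proof (rule integral_dominated_convergence[where w = "\<lambda>t. (\<bar>C\<bar> * M) * indicator Y t"])
  show "integrable lborel (\<lambda>t. (\<bar>C\<bar> * M) * indicator Y t)"
   using Y emeasure_bounded_finite[OF compact_imp_bounded[OF Y(1)]]
   by (intro integrable_mult_right integrable_real_indicator) (auto intro: borel_compact)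
  show "AE t in lborel. (\<lambda>n. \<phi> (z n, t) * u t) \<longlonglongrightarrow> \<phi> (x, t) * u t"
  proof (rule AE_I2)
   fix t
   have "isCont \<phi> (x, t)" using \<phi> by (simp add: continuous_on_eq_continuous_at)
   then have "(\<lambda>n. \<phi> (z n, t)) \<longlonglongrightarrow> \<phi> (x, t)" by (rule isCont_tendsto_compose) (intro tendsto_intros z)
   then show "(\<lambda>n. \<phi> (z n, t) * u t) \<longlonglongrightarrow> \<phi> (x, t) * u t" by (intro tendsto_intros)
  qed
  show "AE t in lborel. norm (\<phi> (z n, t) * u t) \<le> (\<bar>C\<bar> * M) * indicator Y t" for n
  proof (rule AE_I2)
   fix t
   show "norm (\<phi> (z n, t) * u t) \<le> (\<bar>C\<bar> * M) * indicator Y t"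
   proof (cases "t \<in> Y")
    case True
    have "norm (\<phi> (z n, t)) \<le> \<bar>C\<bar>" using C[of "(z n, t)"] True by (simp add: Z_def abs_le_iff)
    then show ?thesis using True u(2)[of t] by (simp add: norm_mult mult_mono)
   qed (simp add: Y(2))
  qed
 qed (use meas in auto)
qed

text \<open>Differentiation under the integral sign: the mean value inequality dominates the
  difference quotients on the compact product of the parameter segment and a set carrying
  \<open>u\<close>.\<close>

lemma integral_has_ddir:
 fixes \<phi> :: "'a::euclidean_space \<times> 'b::euclidean_space \<Rightarrow> complex"
 assumes d: "has_ddir (v, 0) \<phi> \<phi>'" and \<phi>: "continuous_on UNIV \<phi>" and \<phi>': "continuous_on UNIV \<phi>'"
  and u: "u \<in> borel_measurable borel" "\<And>t. norm (u t) \<le> M"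
  and Y: "compact Y" "\<And>t. t \<notin> Y \<Longrightarrow> u t = 0"
 shows "has_ddir v (\<lambda>x. (LI t. \<phi> (x, t) * u t)) (\<lambda>x. (LI t. \<phi>' (x, t) * u t))"
 unfolding has_ddir_def has_vector_derivative_iff_quotient
proof
 fix x :: 'a
 have M0: "M \<ge> 0" using u(2) norm_ge_zero order_trans by blast
 define Z where "Z = (\<lambda>\<tau>. x + \<tau> *\<^sub>R v) ` {-1..1::real}"
 have "compact (Z \<times> Y)" unfolding Z_def
  by (intro compact_Times Y compact_continuous_image continuous_intros) auto
 then have "compact (\<phi>' ` (Z \<times> Y))" using \<phi>' by (meson compact_continuous_image continuous_on_subset subset_UNIV)
 then have "bounded (\<phi>' ` (Z \<times> Y))" by (rule compact_imp_bounded)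
 then obtain C where C: "\<And>q. q \<in> Z \<times> Y \<Longrightarrow> norm (\<phi>' q) \<le> C" unfolding bounded_iff by blast
 have meas: "(\<lambda>t. f (y, t) * u t) \<in> borel_measurable borel" if "continuous_on UNIV f" for y and f :: "'a \<times> 'b \<Rightarrow> complex"
  using u(1) borel_measurable_slice[OF that, of y] by auto
 have int: "integrable lborel (\<lambda>t. \<phi> (y, t) * u t)" for y
 proof -
  have "compact (\<phi> ` ({y} \<times> Y))" 
   by (rule compact_continuous_image[OF continuous_on_subset[OF \<phi> subset_UNIV] compact_Times[OF compact_sing Y(1)]])
  then have "bounded (\<phi> ` ({y} \<times> Y))" by (rule compact_imp_bounded)
  then obtain C' where C': "\<And>q. q \<in> {y} \<times> Y \<Longrightarrow> norm (\<phi> q) \<le> C'" unfolding bounded_iff by blast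
  show ?thesis
  proof (rule integrable_bounded_compact_support[OF meas[OF \<phi>] _ Y(1)])
   show "norm (\<phi> (y, t) * u t) \<le> \<bar>C'\<bar> * M" for t
   proof (cases "t \<in> Y")
    case True
    have "norm (\<phi> (y, t)) \<le> \<bar>C'\<bar>" using C'[of "(y, t)"] True by (simp add: abs_le_iff)
    then show ?thesis using u(2)[of t] by (simp add: norm_mult mult_mono)
   qed (use M0 Y(2) in simp)
  qed (simp add: Y(2))
 qed
 let ?k = "\<lambda>s t. ((\<phi> (x + s *\<^sub>R v, t) * u t) - \<phi> (x, t) * u t) /\<^sub>R s"
 have lim: "((\<lambda>s. (LI t. ?k s t)) \<longlongrightarrow> (LI t. \<phi>' (x, t) * u t)) (at 0)"
 proof (rule integral_param_tendsto[where C = "\<bar>C\<bar> * M", OF _ meas[OF \<phi>'] _ Y(1)])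
  show "?k s \<in> borel_measurable borel" for s
   using meas[OF \<phi>, of "x + s *\<^sub>R v"] meas[OF \<phi>, of x] by measurable
  show "norm (?k s t) \<le> \<bar>C\<bar> * M * indicator Y t" if s: "\<bar>s\<bar> \<le> 1" "s \<noteq> 0" for s t
  proof (cases "t \<in> Y")
   case True
   have "norm (\<phi> ((x, t) + s *\<^sub>R (v, 0)) - \<phi> (x, t)) \<le> \<bar>C\<bar> * \<bar>s\<bar>"
   proof (rule has_ddir_difference_bound[OF d])
    fix \<tau> assume "\<bar>\<tau>\<bar> \<le> \<bar>s\<bar>"
    then have "\<tau> \<in> {-1..1}" using s by (auto simp: abs_le_iff)
    then have "x + \<tau> *\<^sub>R v \<in> Z" unfolding Z_def by (rule imageI)
    then have "(x, t) + \<tau> *\<^sub>R (v, 0) \<in> Z \<times> Y" using True by simp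
    then show "norm (\<phi>' ((x, t) + \<tau> *\<^sub>R (v, 0))) \<le> \<bar>C\<bar>" using C by (meson abs_ge_self order_trans)
   qed
   then have "norm (\<phi> (x + s *\<^sub>R v, t) - \<phi> (x, t)) * norm (u t) \<le> (\<bar>C\<bar> * \<bar>s\<bar>) * M" using u(2)[of t] by (intro mult_mono) auto
   moreover have "norm (?k s t) = norm (\<phi> (x + s *\<^sub>R v, t) - \<phi> (x, t)) * norm (u t) / \<bar>s\<bar>"
   proof -
    have "?k s t = ((\<phi> (x + s *\<^sub>R v, t) - \<phi> (x, t)) * u t) /\<^sub>R s" by (simp add: left_diff_distrib)
    then have "norm (?k s t) = norm (((\<phi> (x + s *\<^sub>R v, t) - \<phi> (x, t)) * u t) /\<^sub>R s)" by (rule arg_cong)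
    then show ?thesis by (simp only: norm_scaleR norm_mult abs_inverse divide_inverse mult.commute[of "inverse \<bar>s\<bar>"])
   qed
   ultimately show ?thesis using True s by (simp add: divide_le_eq mult_ac)
  qed (simp add: Y(2))
  show "((\<lambda>s. ?k s t) \<longlongrightarrow> \<phi>' (x, t) * u t) (at 0)" for t
  proof -
   have "((\<lambda>s. (\<phi> ((x, t) + s *\<^sub>R (v, 0)) - \<phi> ((x, t) + 0 *\<^sub>R (v, 0))) /\<^sub>R s) \<longlongrightarrow> \<phi>' (x, t)) (at 0)"
    using d unfolding has_ddir_def has_vector_derivative_iff_quotient by blast
   from tendsto_mult_right[OF this, of "u t"] show ?thesis by (simp add: algebra_simps)
  qed
 qed
 have eq: "(LI t. ?k s t) = ((LI t. \<phi> (x + s *\<^sub>R v, t) * u t) - (LI t. \<phi> (x + 0 *\<^sub>R v, t) * u t)) /\<^sub>R s" for s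
  using int by (simp add: Bochner_Integration.integral_diff)
 show "((\<lambda>s. ((LI t. \<phi> (x + s *\<^sub>R v, t) * u t) - (LI t. \<phi> (x + 0 *\<^sub>R v, t) * u t)) /\<^sub>R s)
   \<longlongrightarrow> (LI t. \<phi>' (x, t) * u t)) (at 0)" using lim unfolding eq .
qed

lemma fubini_bounded:
 fixes k :: "'a::euclidean_space \<Rightarrow> 'b::euclidean_space \<Rightarrow> complex"
 assumes k: "(\<lambda>z. k (fst z) (snd z)) \<in> borel_measurable borel" "\<And>x t. norm (k x t) \<le> C"
  and XY: "compact X" "compact Y" "\<And>x t. x \<notin> X \<or> t \<notin> Y \<Longrightarrow> k x t = 0"
 shows "(LI x. (LI t. k x t)) = (LI t. (LI x. k x t))"
proof -
 have "integrable lborel (\<lambda>z. k (fst z) (snd z))"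
 proof (rule integrable_bounded_compact_support[OF k(1) _ compact_Times[OF XY(1,2)]])
  show "k (fst z) (snd z) = 0" if "z \<notin> X \<times> Y" for z
   using that by (intro XY(3)) (auto simp: mem_Times_iff)
 qed (rule k(2))
 then have "integrable (lborel \<Otimes>\<^sub>M lborel) (\<lambda>(x, t). k x t)" by (simp add: lborel_prod case_prod_beta')
 from lborel_pair.Fubini_integral[OF this] show ?thesis by simp
qed

lemma norm_integral_bound:
 fixes f :: "'a \<Rightarrow> complex"
 assumes "integrable M F" "f \<in> borel_measurable M" "\<And>x. norm (f x) \<le> F x"
 shows "norm (\<integral>x. f x \<partial>M) \<le> (\<integral>x. F x \<partial>M)"
proof -
 have "norm (f x) \<le> norm (F x)" for x using assms(3)[of x] abs_ge_self[of "F x"] by simp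
 then have "integrable M f" using assms(1,2) by (auto intro: Bochner_Integration.integrable_bound)
 then have "(\<integral>x. norm (f x) \<partial>M) \<le> (\<integral>x. F x \<partial>M)"
  using assms(1,3) by (intro integral_mono) auto
 then show ?thesis using integral_norm_bound[of M f] by linarith
qed

text \<open>Duality with the weight built in. Let A be the image of \<open>u\<close> and g = A / b;
  then the left-hand side Q is, up to conjugation, the pairing of \<open>u\<close> with the adjoint
  applied to g. The cut-off \<open>\<kappa>\<close>, at least \<open>c0\<close> where
  \<open>u\<close> lives, is inserted so that the composed kernel has a smooth amplitude although
  \<open>u\<close> is arbitrary. Schur's test for that kernel, with row sums at most
  \<open>\<Lambda> * b x\<close>, bounds its quadratic form at g by \<open>\<Lambda>\<close> times
  Q, and half of Q is absorbed into the left-hand side.\<close>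

lemma schur_TT_star:
 fixes K :: "'a::euclidean_space \<times> 'b::euclidean_space \<Rightarrow> complex"
 assumes K: "continuous_on UNIV K" and XY: "compact X" "compact Y" "\<And>x t. x \<notin> X \<Longrightarrow> t \<in> Y \<Longrightarrow> K (x, t) = 0"
  and b: "continuous_on UNIV b" "\<And>x. b x > 0"
  and \<kappa>: "\<kappa> \<in> borel_measurable borel" "\<And>t. 0 \<le> \<kappa> t" "\<And>t. \<kappa> t \<le> 1" "\<And>t. t \<notin> Y \<Longrightarrow> \<kappa> t = 0"
  and u: "u \<in> borel_measurable borel" "\<And>t. norm (u t) \<le> Mu" "\<And>t. u t \<noteq> 0 \<Longrightarrow> c0 \<le> \<kappa> t" and c0: "c0 > 0"
  and \<Lambda>: "\<Lambda> > 0" "\<And>x. x \<in> X \<Longrightarrow>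
   (LI x'. norm (LI t. K (x, t) * cnj (K (x', t)) * complex_of_real (\<kappa> t))) \<le> \<Lambda> * b x"
 shows "(LI x. (norm (LI t. K (x, t) * u t))\<^sup>2 / b x) \<le> (\<Lambda> / c0) * (LI t. (norm (u t))\<^sup>2)"
proof -
 have u0: "u t = 0" if "t \<notin> Y" for t using u(3)[of t] \<kappa>(4)[OF that] c0 by force
 have Km [measurable]: "K \<in> borel_measurable borel" by (rule borel_measurable_continuous_onI[OF K])
 have bm [measurable]: "b \<in> borel_measurable borel" by (rule borel_measurable_continuous_onI[OF b(1)])
 note [measurable] = \<kappa>(1) u(1)
 have "compact (K ` (X \<times> Y))" using K compact_Times[OF XY(1,2)] by (meson compact_continuous_image continuous_on_subset subset_UNIV)
 then have "bounded (K ` (X \<times> Y))" by (rule compact_imp_bounded)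
 then obtain CK0 where "\<And>q. q \<in> X \<times> Y \<Longrightarrow> norm (K q) \<le> CK0" unfolding bounded_iff by blast
 then have CK0: "norm (K (x, t)) \<le> \<bar>CK0\<bar>" if "t \<in> Y" for x t
  using XY(3)[of x t] that by (cases "x \<in> X") (force simp: abs_le_iff)+
 define CK where "CK = \<bar>CK0\<bar>"
 have CK: "norm (K (x, t)) \<le> CK" if "t \<in> Y" for x t using CK0[OF that] by (simp add: CK_def)
 have CK1: "CK \<ge> 0" by (simp add: CK_def)
 have Mu0: "Mu \<ge> 0" using u(2) norm_ge_zero order_trans by blast
 have "compact ((\<lambda>x. inverse (b x)) ` X)"
  using XY(1) b by (intro compact_continuous_image continuous_on_inverse continuous_on_subset[OF b(1)]) (auto simp: less_imp_neq[symmetric])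
 then have "bounded ((\<lambda>x. inverse (b x)) ` X)" by (rule compact_imp_bounded)
 then obtain Cb0 where Cb0: "\<And>x. x \<in> X \<Longrightarrow> norm (inverse (b x)) \<le> Cb0" unfolding bounded_iff by blast
 define Cb where "Cb = \<bar>Cb0\<bar>"
 have Cb: "inverse (b x) \<le> Cb" if "x \<in> X" for x using Cb0[OF that] b(2)[of x] by (simp add: Cb_def)
 have Cb1: "Cb \<ge> 0" by (simp add: Cb_def)
 define A where "A x = (LI t. K (x, t) * u t)" for x
 have Am [measurable]: "A \<in> borel_measurable borel" unfolding A_def by (rule borel_measurable_param_integral) measurable
 have A0: "A x = 0" if "x \<notin> X" for x
 proof -
  have "K (x, t) * u t = 0" for t using XY(3)[OF that, of t] u0[of t] by (cases "t \<in> Y") auto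
  then show ?thesis unfolding A_def by (simp only: Bochner_Integration.integral_zero)
 qed
 define vol where "vol = measure lborel Y"
 have volY: "(LI t. indicator Y t) = vol" "integrable lborel (indicator Y :: 'b \<Rightarrow> real)"
  using emeasure_bounded_finite[OF compact_imp_bounded[OF XY(2)]] XY(2) by (auto simp: vol_def borel_compact)
 have intbd: "norm (LI t. f t) \<le> C * vol" if "\<And>t. norm (f t) \<le> C * indicator Y t" "f \<in> borel_measurable borel" for f :: "'b \<Rightarrow> complex" and C
 proof -
  have "norm (LI t. f t) \<le> (LI t. C * indicator Y t)"
   by (rule norm_integral_bound) (use that volY(2) in auto)
  then show ?thesis using volY by simp
 qed
 have Abd: "norm (A x) \<le> CK * Mu * vol" for x unfolding A_def
 proof (rule intbd)
  show "norm (K (x, t) * u t) \<le> CK * Mu * indicator Y t" for t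
   using CK[of t x] u(2)[of t] u0[of t] CK1 by (cases "t \<in> Y") (auto simp: norm_mult intro: mult_mono)
 qed measurable
 define g where "g x = A x / complex_of_real (b x)" for x
 have gm [measurable]: "g \<in> borel_measurable borel" unfolding g_def by measurable
 have g0: "g x = 0" if "x \<notin> X" for x using A0[OF that] by (simp add: g_def)
 define Cg where "Cg = (CK * Mu * vol) * Cb"
 have vol0: "vol \<ge> 0" by (simp add: vol_def)
 have gbd: "norm (g x) \<le> Cg" for x
 proof (cases "x \<in> X")
  case True
  have "norm (g x) = norm (A x) * inverse (b x)" 
   using b(2)[of x] unfolding g_def norm_divide norm_of_real by (simp add: divide_inverse)
  also have "\<dots> \<le> (CK * Mu * vol) * Cb" using Abd Cb[OF True] b(2)[of x] CK1 Mu0 vol0 by (intro mult_mono) (auto intro: less_imp_le)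
  finally show ?thesis by (simp add: Cg_def)
 qed (use g0 CK1 Mu0 vol0 Cb1 in \<open>simp add: Cg_def\<close>)
 define Q where "Q = (LI x. (norm (A x))\<^sup>2 / b x)"
 have AQ: "A x * cnj (g x) = complex_of_real ((norm (A x))\<^sup>2 / b x)" for x
  by (simp add: g_def complex_norm_square[symmetric] of_real_divide del: of_real_power)
 have gQ: "(norm (g x))\<^sup>2 * b x = (norm (A x))\<^sup>2 / b x" for x
  using b(2)[of x] by (simp add: g_def norm_divide power_divide power2_eq_square)
 define G where "G t = (LI x. K (x, t) * cnj (g x))" for t
 have Gm [measurable]: "G \<in> borel_measurable borel" unfolding G_def
  by (rule borel_measurable_param_integral) measurable
 define volX where "volX = measure lborel X"
 have volX: "(LI t. indicator X t) = volX" "integrable lborel (indicator X :: 'a \<Rightarrow> real)"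
  using emeasure_bounded_finite[OF compact_imp_bounded[OF XY(1)]] XY(1) by (auto simp: volX_def borel_compact)
 have Cg0: "Cg \<ge> 0" using gbd norm_ge_zero order_trans by blast
 have Gbd: "norm (G t) \<le> CK * Cg * volX" if "t \<in> Y" for t
 proof -
  have kb: "norm (K (x, t) * cnj (g x)) \<le> CK * Cg * indicator X x" for x
   using CK[OF that, of x] gbd[of x] g0[of x] CK1 Cg0 by (cases "x \<in> X") (auto simp: norm_mult intro: mult_mono)
  have "norm (G t) \<le> (LI x. CK * Cg * indicator X x)" unfolding G_def
  proof (rule norm_integral_bound)
   show "(\<lambda>x. K (x, t) * cnj (g x)) \<in> borel_measurable lborel" by measurable
  qed (use kb volX(2) in auto)
  then show ?thesis using volX by simp
 qed
 have pairing: "complex_of_real Q = (LI t. u t * G t)"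
 proof -
  have "complex_of_real Q = (LI x. A x * cnj (g x))" unfolding Q_def AQ by (rule integral_complex_of_real[symmetric])
  also have "\<dots> = (LI x. (LI t. K (x, t) * u t * cnj (g x)))" unfolding A_def by simp
  also have "\<dots> = (LI t. (LI x. K (x, t) * u t * cnj (g x)))"
  proof (rule fubini_bounded[OF _ _ XY(1,2), where C = "CK * Mu * Cg"])
   show "norm (K (x, t) * u t * cnj (g x)) \<le> CK * Mu * Cg" for x t
    using CK[of t x] u(2)[of t] gbd[of x] CK1 Mu0 Cg0 u0[of t] by (cases "t \<in> Y") (auto simp: norm_mult intro!: mult_mono mult_nonneg_nonneg)
   show "K (x, t) * u t * cnj (g x) = 0" if "x \<notin> X \<or> t \<notin> Y" for x t using that u0 g0 by auto
  qed measurable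
  also have "\<dots> = (LI t. u t * G t)" unfolding G_def by (simp add: mult.assoc mult.left_commute)
  finally show ?thesis .
 qed
 define V where "V = (LI t. (norm (u t))\<^sup>2)"
 define H where "H = (LI t. \<kappa> t * (norm (G t))\<^sup>2)"
 have intV: "integrable lborel (\<lambda>t. (norm (u t))\<^sup>2)"
  by (rule integrable_bounded_compact_support[OF _ _ XY(2), of _ "Mu\<^sup>2"]) (use u u0 in \<open>auto intro: power_mono\<close>)
 have intH: "integrable lborel (\<lambda>t. \<kappa> t * (norm (G t))\<^sup>2)"
 proof (rule integrable_bounded_compact_support[OF _ _ XY(2), of _ "1 * (CK * Cg * volX)\<^sup>2"])
  show "norm (\<kappa> t * (norm (G t))\<^sup>2) \<le> 1 * (CK * Cg * volX)\<^sup>2" for t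
  proof (cases "t \<in> Y")
   case True
   have "\<kappa> t * (norm (G t))\<^sup>2 \<le> 1 * (CK * Cg * volX)\<^sup>2"
    using \<kappa>(2,3)[of t] Gbd[OF True] by (intro mult_mono power_mono) auto
   then show ?thesis using \<kappa>(2)[of t] by simp
  qed (simp add: \<kappa>(4))
 qed (use \<kappa>(4) in auto)
 text \<open>AM-GM: \<open>2 |u G| \<le> \<Lambda> |u|\<^sup>2 / c0 + \<kappa> |G|\<^sup>2 / \<Lambda>\<close>, since \<open>c0 \<le> \<kappa>\<close> where \<open>u\<close> does not vanish.\<close>
 have "norm (u t * G t) \<le> (\<Lambda> / c0) / 2 * (norm (u t))\<^sup>2 + (1 / (2 * \<Lambda>)) * (\<kappa> t * (norm (G t))\<^sup>2)" for t
 proof (cases "u t = 0")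
  case True then show ?thesis using \<kappa>(2)[of t] \<Lambda>(1) by simp
 next
  case False
  define p where "p = norm (u t)" define q where "q = norm (G t)"
  have "0 \<le> (\<Lambda> * p - c0 * q)\<^sup>2" by simp
  then have "2 * \<Lambda> * c0 * (p * q) \<le> \<Lambda>\<^sup>2 * p\<^sup>2 + c0 * (c0 * q\<^sup>2)" by (simp add: power2_eq_square algebra_simps)
  also have "\<dots> \<le> \<Lambda>\<^sup>2 * p\<^sup>2 + c0 * (\<kappa> t * q\<^sup>2)" using u(3)[OF False] c0 by (intro add_left_mono mult_left_mono mult_right_mono) auto
  finally have "p * q \<le> (\<Lambda>\<^sup>2 * p\<^sup>2 + c0 * (\<kappa> t * q\<^sup>2)) / (2 * \<Lambda> * c0)" using \<Lambda>(1) c0 by (simp add: pos_le_divide_eq mult.commute)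
  also have "\<dots> = (\<Lambda> / c0) / 2 * p\<^sup>2 + (1 / (2 * \<Lambda>)) * (\<kappa> t * q\<^sup>2)" using \<Lambda>(1) c0 by (simp add: field_simps power2_eq_square)
  finally show ?thesis by (simp add: norm_mult p_def q_def)
 qed
 then have "norm (LI t. u t * G t) \<le> (LI t. (\<Lambda> / c0) / 2 * (norm (u t))\<^sup>2 + (1 / (2 * \<Lambda>)) * (\<kappa> t * (norm (G t))\<^sup>2))"
  using intV intH by (intro norm_integral_bound) auto
 then have 1: "Q \<le> (\<Lambda> / c0) / 2 * V + (1 / (2 * \<Lambda>)) * H"
  using intV intH abs_ge_self[of Q] by (simp add: pairing[symmetric] V_def H_def)
 define L where "L x x' = (LI t. K (x, t) * cnj (K (x', t)) * complex_of_real (\<kappa> t))" for x x'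
 have Lm [measurable]: "(\<lambda>z. L (fst z) (snd z)) \<in> borel_measurable borel" unfolding L_def
  by (rule borel_measurable_param_integral) measurable
 have Lsym: "L x' x = cnj (L x x')" for x x'
 proof -
  have "cnj (L x x') = (LI t. cnj (K (x, t) * cnj (K (x', t)) * complex_of_real (\<kappa> t)))"
   unfolding L_def by (rule Bochner_Integration.integral_cnj[symmetric])
  also have "\<dots> = L x' x" unfolding L_def by (intro Bochner_Integration.integral_cong refl) (simp add: mult_ac)
  finally show ?thesis ..
 qed
 have Lbd: "norm (L x x') \<le> CK * CK * vol" for x x' unfolding L_def
 proof (rule intbd)
  show "norm (K (x, t) * cnj (K (x', t)) * complex_of_real (\<kappa> t)) \<le> CK * CK * indicator Y t" for t
  proof (cases "t \<in> Y")
   case True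
   have "norm (K (x, t)) * norm (K (x', t)) * \<kappa> t \<le> CK * CK * 1"
    using CK[OF True] \<kappa>(2,3)[of t] CK1 by (intro mult_mono) auto
   then show ?thesis using True \<kappa>(2)[of t] by (simp add: norm_mult)
  qed (simp add: \<kappa>(4))
 qed measurable
 have "complex_of_real H = (LI t. (LI x. K (x, t) * cnj (g x) * (cnj (G t) * complex_of_real (\<kappa> t))))"
 proof -
  have "(LI x. K (x, t) * cnj (g x) * (cnj (G t) * complex_of_real (\<kappa> t))) = complex_of_real (\<kappa> t * (norm (G t))\<^sup>2)" for t
  proof -
   have "(LI x. K (x, t) * cnj (g x) * (cnj (G t) * complex_of_real (\<kappa> t))) = G t * (cnj (G t) * complex_of_real (\<kappa> t))"
    unfolding G_def[of t] by (rule Bochner_Integration.integral_mult_left_zero)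
   also have "\<dots> = complex_of_real (\<kappa> t * (norm (G t))\<^sup>2)"
    unfolding of_real_mult complex_norm_square by (simp only: mult_ac)
   finally show ?thesis .
  qed
  then show ?thesis unfolding H_def by (simp only: integral_complex_of_real)
 qed
 also have "\<dots> = (LI x. (LI t. K (x, t) * cnj (g x) * (cnj (G t) * complex_of_real (\<kappa> t))))"
 proof (rule fubini_bounded[OF _ _ XY(1,2), where C = "CK * Cg * (CK * Cg * volX * 1)", symmetric])
  show "norm (K (x, t) * cnj (g x) * (cnj (G t) * complex_of_real (\<kappa> t))) \<le> CK * Cg * (CK * Cg * volX * 1)" for x t
  proof (cases "t \<in> Y")
   case True
   have "volX \<ge> 0" by (simp add: volX_def)
   then show ?thesis using CK[OF True, of x] gbd[of x] Gbd[OF True] \<kappa>(2,3)[of t] CK1 Cg0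
    unfolding norm_mult complex_mod_cnj norm_of_real by (intro mult_mono mult_nonneg_nonneg) auto
  qed (use \<kappa>(4) CK1 Cg0 in \<open>auto simp: volX_def\<close>)
  show "K (x, t) * cnj (g x) * (cnj (G t) * complex_of_real (\<kappa> t)) = 0" if "x \<notin> X \<or> t \<notin> Y" for x t using that \<kappa>(4) g0 by auto
 qed measurable
 also have "\<dots> = (LI x. (LI x'. cnj (g x) * g x' * L x x'))"
 proof (intro Bochner_Integration.integral_cong refl)
  fix x
  have "(LI t. K (x, t) * cnj (g x) * (cnj (G t) * complex_of_real (\<kappa> t)))
   = (LI t. (LI x'. K (x, t) * cnj (g x) * complex_of_real (\<kappa> t) * (cnj (K (x', t)) * g x')))"
  proof (intro Bochner_Integration.integral_cong refl)
   fix t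
   have cG: "cnj (G t) = (LI x'. cnj (K (x', t)) * g x')"
    unfolding G_def Bochner_Integration.integral_cnj[symmetric] by simp
   have "K (x, t) * cnj (g x) * (cnj (G t) * complex_of_real (\<kappa> t)) = K (x, t) * cnj (g x) * complex_of_real (\<kappa> t) * cnj (G t)"
    by (simp only: mult_ac)
   also have "\<dots> = (LI x'. K (x, t) * cnj (g x) * complex_of_real (\<kappa> t) * (cnj (K (x', t)) * g x'))"
    unfolding cG by (rule Bochner_Integration.integral_mult_right_zero[symmetric])
   finally show "K (x, t) * cnj (g x) * (cnj (G t) * complex_of_real (\<kappa> t))
    = (LI x'. K (x, t) * cnj (g x) * complex_of_real (\<kappa> t) * (cnj (K (x', t)) * g x'))" .
  qed
  also have "\<dots> = (LI x'. (LI t. K (x, t) * cnj (g x) * complex_of_real (\<kappa> t) * (cnj (K (x', t)) * g x')))"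
  proof (rule fubini_bounded[OF _ _ XY(1,2), where C = "CK * Cg * 1 * (CK * Cg)", symmetric])
   show "norm (K (x, t) * cnj (g x) * complex_of_real (\<kappa> t) * (cnj (K (x', t)) * g x')) \<le> CK * Cg * 1 * (CK * Cg)" for x' t
   proof (cases "t \<in> Y")
    case True
    then show ?thesis using CK[OF True, of x] CK[OF True, of x'] gbd[of x] gbd[of x'] \<kappa>(2,3)[of t] CK1 Cg0
     unfolding norm_mult complex_mod_cnj norm_of_real by (intro mult_mono mult_nonneg_nonneg) auto
   qed (use \<kappa>(4) CK1 Cg0 in auto)
   show "K (x, t) * cnj (g x) * complex_of_real (\<kappa> t) * (cnj (K (x', t)) * g x') = 0" if "x' \<notin> X \<or> t \<notin> Y" for x' t using that \<kappa>(4) g0 by auto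
  qed measurable
  also have "\<dots> = (LI x'. cnj (g x) * g x' * L x x')"
  proof (intro Bochner_Integration.integral_cong refl)
   fix x'
   have "(LI t. K (x, t) * cnj (g x) * complex_of_real (\<kappa> t) * (cnj (K (x', t)) * g x'))
    = (LI t. cnj (g x) * g x' * (K (x, t) * cnj (K (x', t)) * complex_of_real (\<kappa> t)))"
    by (intro Bochner_Integration.integral_cong refl) (simp only: mult_ac)
   also have "\<dots> = cnj (g x) * g x' * L x x'"
    unfolding L_def by (rule Bochner_Integration.integral_mult_right_zero)
   finally show "(LI t. K (x, t) * cnj (g x) * complex_of_real (\<kappa> t) * (cnj (K (x', t)) * g x')) = cnj (g x) * g x' * L x x'" .
  qed
  finally show "(LI t. K (x, t) * cnj (g x) * (cnj (G t) * complex_of_real (\<kappa> t))) = (LI x'. cnj (g x) * g x' * L x x')" .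
 qed
 finally have H: "complex_of_real H = (LI x. (LI x'. cnj (g x) * g x' * L x x'))" .
 \<comment> \<open>By AM-GM the product of \<open>g x\<close> and \<open>g x'\<close> is replaced by
   squares. The symmetry of \<open>norm (L x x')\<close> makes the two double integrals equal, so
   that only integrals over \<open>x'\<close> for fixed \<open>x\<close> remain, where the row bound
   applies.\<close>
 define w where "w x x' = (norm (g x))\<^sup>2 * norm (L x x') * indicator X x'" for x x'
 have wm [measurable]: "(\<lambda>z. w (fst z) (snd z)) \<in> borel_measurable borel"
  unfolding w_def using borel_compact[OF XY(1)] by measurable
 have wint: "integrable (lborel \<Otimes>\<^sub>M lborel) (\<lambda>(x, x'). w x x')"
  unfolding lborel_prod case_prod_beta'
 proof (rule integrable_bounded_compact_support[OF wm _ compact_Times[OF XY(1) XY(1)], of "Cg\<^sup>2 * (CK * CK * vol) * 1"])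
  show "norm (w (fst z) (snd z)) \<le> Cg\<^sup>2 * (CK * CK * vol) * 1" for z
  proof -
   have "(norm (g a))\<^sup>2 * norm (L a a') * indicator X a' \<le> Cg\<^sup>2 * (CK * CK * vol) * 1" for a a'
    using gbd[of a] Lbd[of a a'] CK1 vol0
    by (intro mult_mono power_mono mult_nonneg_nonneg zero_le_power2 norm_ge_zero) (auto simp: indicator_def)
   then show ?thesis by (simp add: w_def)
  qed
  show "w (fst z) (snd z) = 0" if "z \<notin> X \<times> X" for z
   using that g0[of "fst z"] by (cases "snd z \<in> X") (auto simp: w_def mem_Times_iff)
 qed
 have wint': "integrable (lborel \<Otimes>\<^sub>M lborel) (\<lambda>(x, x'). w x' x)"
  using wint by (subst lborel_pair.integrable_product_swap_iff[symmetric]) (simp add: case_prod_beta)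
 have wint1: "integrable (lborel \<Otimes>\<^sub>M lborel) (\<lambda>z. w (fst z) (snd z))" using wint by (simp add: case_prod_beta')
 have wint2: "integrable (lborel \<Otimes>\<^sub>M lborel) (\<lambda>z. w (snd z) (fst z))" using wint' by (simp add: case_prod_beta')
 have pw: "norm (cnj (g x) * g x' * L x x') \<le> (w x x' + w x' x) / 2" for x x'
 proof (cases "x \<in> X \<and> x' \<in> X")
  case True
  have "norm (L x' x) = norm (L x x')" by (simp add: Lsym[of x' x])
  moreover have "norm (g x) * norm (g x') \<le> ((norm (g x))\<^sup>2 + (norm (g x'))\<^sup>2) / 2"
   using sum_squares_bound[of "norm (g x)" "norm (g x')"] by simp
  from mult_right_mono[OF this norm_ge_zero[of "L x x'"]]
  have "norm (g x) * norm (g x') * norm (L x x') \<le> ((norm (g x))\<^sup>2 * norm (L x x') + (norm (g x'))\<^sup>2 * norm (L x x')) / 2"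
   by (simp add: algebra_simps)
  ultimately show ?thesis using True by (simp add: w_def norm_mult)
 next
  case False
  then have "g x = 0 \<or> g x' = 0" using g0 by blast
  then show ?thesis by (auto simp: w_def)
 qed
 have "norm (complex_of_real H) = norm (\<integral>z. (case z of (x, x') \<Rightarrow> cnj (g x) * g x' * L x x') \<partial>(lborel \<Otimes>\<^sub>M lborel))"
 proof -
  have "integrable (lborel \<Otimes>\<^sub>M lborel) (\<lambda>(x, x'). cnj (g x) * g x' * L x x')"
   unfolding lborel_prod case_prod_beta'
  proof (rule integrable_bounded_compact_support[OF _ _ compact_Times[OF XY(1) XY(1)]])
   show "norm (cnj (g (fst z)) * g (snd z) * L (fst z) (snd z)) \<le> Cg * Cg * (CK * CK * vol)" for z
    unfolding norm_mult complex_mod_cnj using gbd Lbd Cg0 CK1 vol0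
    by (intro mult_mono mult_nonneg_nonneg norm_ge_zero) auto
   show "cnj (g (fst z)) * g (snd z) * L (fst z) (snd z) = 0" if "z \<notin> X \<times> X" for z
    using that g0[of "fst z"] g0[of "snd z"] by (auto simp: mem_Times_iff)
  qed measurable
  from lborel_pair.integral_fst'[OF this] show ?thesis unfolding H by simp
 qed
 also have "\<dots> \<le> (\<integral>z. (w (fst z) (snd z) + w (snd z) (fst z)) / 2 \<partial>(lborel \<Otimes>\<^sub>M lborel))"
 proof (rule norm_integral_bound)
  have "(\<lambda>z. cnj (g (fst z)) * g (snd z) * L (fst z) (snd z)) \<in> borel_measurable (borel :: ('a \<times> 'a) measure)" by measurable
  then show "(\<lambda>z. case z of (x, x') \<Rightarrow> cnj (g x) * g x' * L x x') \<in> borel_measurable (lborel \<Otimes>\<^sub>M lborel)"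
   unfolding lborel_prod case_prod_beta' by simp
  show "integrable (lborel \<Otimes>\<^sub>M lborel) (\<lambda>z. (w (fst z) (snd z) + w (snd z) (fst z)) / 2)"
   by (intro integrable_divide Bochner_Integration.integrable_add wint1 wint2)
 qed (use pw in \<open>simp add: case_prod_beta\<close>)
 also have "\<dots> = (\<integral>z. w (fst z) (snd z) \<partial>(lborel \<Otimes>\<^sub>M lborel))"
 proof -
  have "(\<integral>z. w (snd z) (fst z) \<partial>(lborel \<Otimes>\<^sub>M lborel)) = (\<integral>z. w (fst z) (snd z) \<partial>(lborel \<Otimes>\<^sub>M lborel))"
   using lborel_pair.integral_product_swap[of "\<lambda>(x, x'). w x x'"] wint by (simp add: case_prod_beta')
  then show ?thesis using wint1 wint2 by (simp add: add_divide_distrib Bochner_Integration.integral_add)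
 qed
 also have "\<dots> = (LI x. (LI x'. w x x'))" using lborel_pair.integral_fst'[OF wint1] by simp
 also have "\<dots> \<le> (LI x. \<Lambda> * ((norm (A x))\<^sup>2 / b x))"
 proof (rule integral_mono)
  show "integrable lborel (\<lambda>x. (LI x'. w x x'))" using lborel_pair.integrable_fst'[OF wint] by simp
  show "integrable lborel (\<lambda>x. \<Lambda> * ((norm (A x))\<^sup>2 / b x))"
  proof -
   have "integrable lborel (\<lambda>x. complex_of_real ((norm (A x))\<^sup>2 / b x))"
    unfolding AQ[symmetric]
   proof (rule integrable_bounded_compact_support[OF _ _ XY(1)])
    show "norm (A x * cnj (g x)) \<le> (CK * Mu * vol) * Cg" for x
     unfolding norm_mult complex_mod_cnj using Abd gbd CK1 Mu0 vol0
     by (intro mult_mono mult_nonneg_nonneg norm_ge_zero) auto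
   qed (use g0 in auto)
   then have "integrable lborel (\<lambda>x. (norm (A x))\<^sup>2 / b x)" unfolding complex_of_real_integrable_eq .
   then show ?thesis by (rule integrable_mult_right)
  qed
  fix x
  show "(LI x'. w x x') \<le> \<Lambda> * ((norm (A x))\<^sup>2 / b x)"
  proof (cases "x \<in> X")
   case True
   have L0: "L x x' = 0" if "x' \<notin> X" for x'
   proof -
    have "K (x, t) * cnj (K (x', t)) * complex_of_real (\<kappa> t) = 0" for t using XY(3)[OF that, of t] \<kappa>(4)[of t] by (cases "t \<in> Y") auto
    then show ?thesis unfolding L_def by (simp only: Bochner_Integration.integral_zero)
   qed
   have "w x x' = (norm (g x))\<^sup>2 * norm (L x x')" for x' using L0[of x'] by (cases "x' \<in> X") (auto simp: w_def)
   then have "(LI x'. w x x') = (norm (g x))\<^sup>2 * (LI x'. norm (L x x'))" by simp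
   also have "\<dots> \<le> (norm (g x))\<^sup>2 * (\<Lambda> * b x)" using \<Lambda>(2)[OF True] unfolding L_def by (intro mult_left_mono) auto
   also have "\<dots> = \<Lambda> * ((norm (A x))\<^sup>2 / b x)" unfolding gQ[symmetric] by simp
   finally show ?thesis .
  next
   case False then show ?thesis using g0 A0 by (simp add: w_def)
  qed
 qed
 also have "\<dots> = \<Lambda> * Q" unfolding Q_def by (rule Bochner_Integration.integral_mult_right_zero)
 finally have "H \<le> \<Lambda> * Q" using abs_ge_self[of H] by simp
 \<comment> \<open>\<open>Q\<close> is a finite real number, so half of it may be moved to the
   left-hand side.\<close>
 then have "(1 / (2 * \<Lambda>)) * H \<le> (1 / (2 * \<Lambda>)) * (\<Lambda> * Q)" using \<Lambda>(1) by (intro mult_left_mono) auto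
 also have "\<dots> = Q / 2" using \<Lambda>(1) by simp
 finally have "(1 / (2 * \<Lambda>)) * H \<le> Q / 2" .
 moreover have "(\<Lambda> / c0) / 2 * V = ((\<Lambda> / c0) * V) / 2" by simp
 moreover have "q \<le> x" if "y \<le> q / 2" "z = x / 2" "q \<le> z + y" for q x y z :: real using that by linarith
 ultimately have "Q \<le> (\<Lambda> / c0) * V" using 1 by blast
 then show ?thesis by (simp add: Q_def V_def A_def)
qed

section \<open>Cut-off functions, decay and cells\<close>

text \<open>A truncated polynomial, smooth to finite order, which is enough for a fixed number of
  integrations by parts; its explicit form makes all constants independent of centre and
  radius.\<close>

definition bump :: "'a::real_inner \<Rightarrow> real \<Rightarrow> nat \<Rightarrow> 'a \<Rightarrow> real" where
 "bump y h m x = (max 0 (1 - (norm (x - y))\<^sup>2 / h\<^sup>2)) ^ m"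

lemma bump_nonneg: "0 \<le> bump y h m x" and bump_le_1: "bump y h m x \<le> 1"
proof -
 show "0 \<le> bump y h m x" by (simp add: bump_def)
 have "0 \<le> (norm (x - y))\<^sup>2 / h\<^sup>2" by simp
 then show "bump y h m x \<le> 1" unfolding bump_def by (intro power_le_one) auto
qed

lemma bump_eq_0: "\<lbrakk>h > 0; m > 0; x \<notin> cball y h\<rbrakk> \<Longrightarrow> bump y h m x = 0"
proof -
 assume *: "h > 0" "m > 0" "x \<notin> cball y h"
 then have "h\<^sup>2 \<le> (norm (x - y))\<^sup>2" by (intro power_mono) (auto simp: dist_norm norm_minus_commute)
 then have "1 \<le> (norm (x - y))\<^sup>2 / h\<^sup>2" using * by (simp add: le_divide_eq)
 then show ?thesis using * by (simp add: bump_def)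
qed

lemma bump_lower: "h > 0 \<Longrightarrow> norm (x - y) \<le> h / 2 \<Longrightarrow> (3/4) ^ m \<le> bump y h m x"
proof -
 assume *: "h > 0" "norm (x - y) \<le> h / 2"
 have "(norm (x - y))\<^sup>2 \<le> (h / 2)\<^sup>2" using * by (intro power_mono) auto
 then have "(norm (x - y))\<^sup>2 / h\<^sup>2 \<le> 1 / 4" using * by (simp add: divide_le_eq power_divide)
 then have "3/4 \<le> max 0 (1 - (norm (x - y))\<^sup>2 / h\<^sup>2)" by (intro max.coboundedI2) linarith
 then show ?thesis unfolding bump_def by (rule power_mono) simp
qed

lemma continuous_bump: "continuous_on UNIV (bump y h m)"
 unfolding bump_def[abs_def] by (cases "h = 0") (auto intro!: continuous_intros)

lemma DERIV_positive_part_power: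
 "DERIV (\<lambda>t. (max 0 t) ^ Suc (Suc m)) (t::real) :> real (Suc (Suc m)) * (max 0 t) ^ Suc m"
proof -
 consider "t < 0" | "t > 0" | "t = 0" by linarith
 then show ?thesis
 proof cases
  case 1
  have "DERIV (\<lambda>t. 0 :: real) t :> 0" by simp
  moreover have "eventually (\<lambda>t. 0 = (max 0 t) ^ Suc (Suc m)) (nhds t)"
   using eventually_nhds_in_open[of "{..<0::real}" t] 1 by (auto elim!: eventually_mono simp: max_def)
  ultimately show ?thesis using 1 DERIV_cong_ev[OF refl, of "\<lambda>t. 0" "\<lambda>t. (max 0 t) ^ Suc (Suc m)" t 0 0]
   by (simp add: max_def)
 next
  case 2
  have "DERIV (\<lambda>t. t ^ Suc (Suc m)) t :> real (Suc (Suc m)) * t ^ Suc m" by (rule DERIV_pow[THEN DERIV_cong]) simp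
  moreover have "eventually (\<lambda>t. t ^ Suc (Suc m) = (max 0 t) ^ Suc (Suc m)) (nhds t)"
   using eventually_nhds_in_open[of "{0::real<..}" t] 2 by (auto elim!: eventually_mono simp: max_def)
  ultimately have "DERIV (\<lambda>t. (max 0 t) ^ Suc (Suc m)) t :> real (Suc (Suc m)) * t ^ Suc m"
   using DERIV_cong_ev[OF refl _ refl, of "\<lambda>t. t ^ Suc (Suc m)" "\<lambda>t. (max 0 t) ^ Suc (Suc m)" t] by blast
  then show ?thesis using 2 by (simp add: max_def)
 next
  case 3
  have "((\<lambda>s. ((max 0 s) ^ Suc (Suc m) - (max 0 0) ^ Suc (Suc m)) /\<^sub>R s) \<longlongrightarrow> (0::real)) (at 0)"
  proof (rule Lim_null_comparison)
   show "eventually (\<lambda>s. norm (((max 0 s) ^ Suc (Suc m) - (max 0 0) ^ Suc (Suc m)) /\<^sub>R s) \<le> max 0 s ^ Suc m) (at (0::real))"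
    unfolding eventually_at by (intro exI[of _ 1]) (auto simp: max_def)
   have "((\<lambda>s::real. max 0 s ^ Suc m) \<longlongrightarrow> max 0 0 ^ Suc m) (at 0)" by (intro tendsto_intros)
   then show "((\<lambda>s::real. max 0 s ^ Suc m) \<longlongrightarrow> 0) (at 0)" by simp
  qed
  then have "((\<lambda>t. (max 0 t) ^ Suc (Suc m)) has_vector_derivative (0::real)) (at 0)"
   unfolding has_vector_derivative_iff_quotient .
  then show ?thesis using 3 by (simp add: has_real_derivative_iff_has_vector_derivative)
 qed
qed

primrec bump_const :: "nat \<Rightarrow> real" where
 "bump_const 0 = 1"
| "bump_const (Suc m) = max (bump_const m) (real (Suc (Suc m)) * (2 ^ m * (bump_const m * 2)))"

lemma bump_const_ge_1: "bump_const m \<ge> 1"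
 by (induction m) auto

text \<open>The exponent drops by one with each derivative, and the inner derivative is a linear
  factor of size O(1/h) on the ball. Exponent \<open>Suc m\<close> therefore still leaves a
  continuous function after \<open>m\<close> derivatives.\<close>

lemma symb_bump:
 fixes y :: "'a::euclidean_space"
 assumes h: "h > 0" and D: "\<And>v. v \<in> D \<Longrightarrow> norm v \<le> 1"
 shows "symb h D (cball y h) (\<lambda>_. bump_const m) m (\<lambda>x. complex_of_real (bump y h (Suc m) x))"
proof (induction m)
 case 0
 show ?case using continuous_bump[of y h "Suc 0"] bump_nonneg[of y h "Suc 0"] bump_le_1[of y h "Suc 0"]
  by (auto intro!: continuous_intros simp: abs_of_nonneg)
next
 case (Suc m)
 show ?case
 proof (rule symb_SucI)
  show "continuous_on UNIV (\<lambda>x. complex_of_real (bump y h (Suc (Suc m)) x))" by (intro continuous_intros continuous_bump)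
  show "norm (complex_of_real (bump y h (Suc (Suc m)) x)) \<le> bump_const (Suc m)" for x
   using bump_const_ge_1[of "Suc m"] bump_nonneg[of y h "Suc (Suc m)" x] bump_le_1[of y h "Suc (Suc m)" x]
   by (simp del: bump_const.simps)
  fix v assume v: "v \<in> D"
  define l where "l x = - 2 * ((x - y) \<bullet> v) / h" for x
  have l_ddir: "has_ddir v' (\<lambda>x. complex_of_real (l x)) (\<lambda>x. complex_of_real (- 2 * (v' \<bullet> v) / h))" for v'
  proof -
   have "(l has_derivative (\<lambda>z. - 2 * (z \<bullet> v) / h)) (at x)" for x
    unfolding l_def using h by (auto intro!: derivative_eq_intros)
   from has_ddir_of_real[OF has_derivative_imp_has_ddir[of l "\<lambda>x z. - 2 * (z \<bullet> v) / h", OF this]] show ?thesis .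
  qed
  have l_bd: "norm (complex_of_real (l x)) \<le> 2" if "x \<in> cball y h" for x
  proof -
   have "\<bar>(x - y) \<bullet> v\<bar> \<le> norm (x - y) * norm v" by (rule Cauchy_Schwarz_ineq2)
   also have "\<dots> \<le> h * 1" using that D[OF v] h by (intro mult_mono) (auto simp: dist_norm norm_minus_commute)
   finally show ?thesis unfolding norm_of_real l_def using h by (simp add: abs_mult abs_divide divide_le_eq)
  qed
  have cl: "continuous_on UNIV (\<lambda>x. complex_of_real (l x))" unfolding l_def using h by (intro continuous_intros) auto
  have l_symb: "symb h D (cball y h) (\<lambda>_. 2) k (\<lambda>x. complex_of_real (l x))" for k
  proof (cases k)
   case 0 then show ?thesis using l_bd cl by simp
  next
   case (Suc k')
   have "symb h D (cball y h) (\<lambda>_. 2) k' (\<lambda>x. h *\<^sub>R complex_of_real (- 2 * (v' \<bullet> v) / h))" if "v' \<in> D" for v'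
   proof (rule symb_const)
    have "\<bar>v' \<bullet> v\<bar> \<le> norm v' * norm v" by (rule Cauchy_Schwarz_ineq2)
    also have "\<dots> \<le> 1 * 1" using D[OF that] D[OF v] by (intro mult_mono) auto
    finally show "norm (h *\<^sub>R complex_of_real (- 2 * (v' \<bullet> v) / h)) \<le> 2" using h by (simp add: norm_mult norm_divide)
   qed
   then show ?thesis unfolding Suc using l_bd cl l_ddir by (intro symb_SucI) blast+
  qed
  have "has_ddir v (\<lambda>x. bump y h (Suc (Suc m)) x) (\<lambda>x. real (Suc (Suc m)) * bump y h (Suc m) x * (l x / h))"
  proof -
   have "((\<lambda>x. 1 - (norm (x - y))\<^sup>2 / h\<^sup>2) has_derivative (\<lambda>z. - 2 * ((x - y) \<bullet> z) / h\<^sup>2)) (at x)" for x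
    unfolding power2_norm_eq_inner using h by (auto intro!: derivative_eq_intros simp: inner_commute field_simps)
   then have "((\<lambda>x. (max 0 (1 - (norm (x - y))\<^sup>2 / h\<^sup>2)) ^ Suc (Suc m)) has_derivative
    (\<lambda>z. real (Suc (Suc m)) * (max 0 (1 - (norm (x - y))\<^sup>2 / h\<^sup>2)) ^ Suc m * (- 2 * ((x - y) \<bullet> z) / h\<^sup>2))) (at x)" for x
    using DERIV_positive_part_power[of m "1 - (norm (x - y))\<^sup>2 / h\<^sup>2"]
    by (rule DERIV_compose_FDERIV[rotated, THEN has_derivative_eq_rhs]) (auto simp: mult_ac)
   then have "has_ddir v (\<lambda>x. bump y h (Suc (Suc m)) x)
    (\<lambda>x. real (Suc (Suc m)) * (max 0 (1 - (norm (x - y))\<^sup>2 / h\<^sup>2)) ^ Suc m * (- 2 * ((x - y) \<bullet> v) / h\<^sup>2))"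
    unfolding bump_def by (rule has_derivative_imp_has_ddir)
   moreover have "real (Suc (Suc m)) * (max 0 (1 - (norm (x - y))\<^sup>2 / h\<^sup>2)) ^ Suc m * (- 2 * ((x - y) \<bullet> v) / h\<^sup>2)
    = real (Suc (Suc m)) * bump y h (Suc m) x * (l x / h)" for x
    by (simp add: bump_def l_def power2_eq_square)
   ultimately show ?thesis by (simp only:)
  qed
  from has_ddir_of_real[OF this]
  have d: "has_ddir v (\<lambda>x. complex_of_real (bump y h (Suc (Suc m)) x))
   (\<lambda>x. complex_of_real (real (Suc (Suc m)) * bump y h (Suc m) x * (l x / h)))" .
  have "symb h D (cball y h) (\<lambda>x. norm (complex_of_nat (Suc (Suc m))) * (2 ^ m * (bump_const m * 2))) m
   (\<lambda>x. complex_of_nat (Suc (Suc m)) * (complex_of_real (bump y h (Suc m) x) * complex_of_real (l x)))"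
   by (intro symb_cmult symb_mult Suc.IH l_symb)
  then have "symb h D (cball y h) (\<lambda>_. bump_const (Suc m)) m
   (\<lambda>x. complex_of_nat (Suc (Suc m)) * (complex_of_real (bump y h (Suc m) x) * complex_of_real (l x)))"
  proof (rule symb_bound_mono)
   show "norm (complex_of_nat (Suc (Suc m))) * (2 ^ m * (bump_const m * 2)) \<le> bump_const (Suc m)"
    unfolding norm_of_nat bump_const.simps(2) by (rule max.cobounded2)
  qed
  also have "(\<lambda>x. complex_of_nat (Suc (Suc m)) * (complex_of_real (bump y h (Suc m) x) * complex_of_real (l x)))
   = (\<lambda>x. h *\<^sub>R complex_of_real (real (Suc (Suc m)) * bump y h (Suc m) x * (l x / h)))"
   using h by (auto simp: scaleR_conv_of_real fun_eq_iff)
  finally show "\<exists>f'. has_ddir v (\<lambda>x. complex_of_real (bump y h (Suc (Suc m)) x)) f' \<and>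
   symb h D (cball y h) (\<lambda>_. bump_const (Suc m)) m (\<lambda>x. h *\<^sub>R f' x)" using d by blast
 qed
qed

text \<open>Where s lies between k and k + 1 the decaying factor is at most (k + 1)^-(n+2), while
  the mass is at most A (k + 1)^n; a convergent sum of inverse squares remains. This is the origin
  of the exponent n + 2, which is also the number of integrations by parts in what follows.\<close>

lemma layer_decay:
 fixes w :: "'a::euclidean_space \<Rightarrow> ennreal" and s :: "'a \<Rightarrow> real"
 assumes meas: "w \<in> borel_measurable borel" "s \<in> borel_measurable borel" and s: "\<And>t. 0 \<le> s t" and A: "A \<ge> 0"
  and layer: "\<And>k. (NN t. w t * indicator {t. s t \<le> real (Suc k)} t) \<le> ennreal (A * real (Suc k) ^ n)"
 shows "(NN t. w t * ennreal (inverse ((1 + s t) ^ (n + 2)))) \<le> ennreal (A * (\<Sum>k. inverse (real (Suc k) ^ 2)))"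
proof -
 note [measurable] = meas
 let ?c = "\<lambda>k. inverse (real (Suc k) ^ (n + 2))"
 have "(NN t. w t * ennreal (inverse ((1 + s t) ^ (n + 2))))
  \<le> (NN t. (\<Sum>k. ennreal (?c k) * (w t * indicator {t. s t \<le> real (Suc k)} t)))"
 proof (rule nn_integral_mono)
  fix t
  define k where "k = nat \<lfloor>s t\<rfloor>"
  have k: "s t \<le> real (Suc k)" "real (Suc k) \<le> 1 + s t" using s[of t] by (auto simp: k_def) linarith
  have "ennreal (inverse ((1 + s t) ^ (n + 2))) \<le> ennreal (?c k)"
   using k(2) by (intro ennreal_leI le_imp_inverse_le power_mono) auto
  then have "w t * ennreal (inverse ((1 + s t) ^ (n + 2))) \<le> ennreal (?c k) * (w t * indicator {t. s t \<le> real (Suc k)} t)"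
   using k(1) by (simp add: mult.commute mult_left_mono)
  also have "\<dots> \<le> (\<Sum>k. ennreal (?c k) * (w t * indicator {t. s t \<le> real (Suc k)} t))"
   using sum_le_suminf[of "\<lambda>k. ennreal (?c k) * (w t * indicator {t. s t \<le> real (Suc k)} t)" "{k}"] by simp
  finally show "w t * ennreal (inverse ((1 + s t) ^ (n + 2))) \<le> (\<Sum>k. ennreal (?c k) * (w t * indicator {t. s t \<le> real (Suc k)} t))" .
 qed
 also have "\<dots> = (\<Sum>k. (NN t. ennreal (?c k) * (w t * indicator {t. s t \<le> real (Suc k)} t)))"
  by (intro nn_integral_suminf) measurable
 also have "\<dots> = (\<Sum>k. ennreal (?c k) * (NN t. w t * indicator {t. s t \<le> real (Suc k)} t))"
  by (intro suminf_cong nn_integral_cmult) measurable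
 also have "\<dots> \<le> (\<Sum>k. ennreal (A * inverse (real (Suc k) ^ 2)))"
 proof (intro suminf_le summableI)
  fix k
  have "ennreal (?c k) * (NN t. w t * indicator {t. s t \<le> real (Suc k)} t) \<le> ennreal (?c k) * ennreal (A * real (Suc k) ^ n)"
   by (intro mult_left_mono layer) simp
  also have "\<dots> = ennreal (A * inverse (real (Suc k) ^ 2))"
   using A by (subst ennreal_mult''[symmetric]) (auto simp: power_add power2_eq_square field_simps simp del: of_nat_Suc)
  finally show "ennreal (?c k) * (NN t. w t * indicator {t. s t \<le> real (Suc k)} t) \<le> ennreal (A * inverse (real (Suc k) ^ 2))" .
 qed
 also have "\<dots> = ennreal (\<Sum>k. A * inverse (real (Suc k) ^ 2))"
 proof (rule suminf_ennreal2)
  show "summable (\<lambda>k. A * inverse (real (Suc k) ^ 2))"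
   using inverse_power_summable[of 2, where 'a = real] by (intro summable_mult) (simp add: summable_Suc_iff[of "\<lambda>k. inverse (real k ^ 2)"] del: of_nat_Suc)
 qed (use A in auto)
 also have "(\<Sum>k. A * inverse (real (Suc k) ^ 2)) = A * (\<Sum>k. inverse (real (Suc k) ^ 2))"
  using inverse_power_summable[of 2, where 'a = real]
  by (intro suminf_mult) (simp add: summable_Suc_iff[of "\<lambda>k. inverse (real k ^ 2)"] del: of_nat_Suc)
 finally show ?thesis .
qed

section \<open>Cells of a cubic grid and sums over them\<close>

definition cell :: "real \<Rightarrow> 'a::euclidean_space \<Rightarrow> 'a" where
 "cell \<delta> t = (\<Sum>b\<in>Basis. (\<delta> * of_int \<lfloor>(t \<bullet> b) / \<delta>\<rfloor>) *\<^sub>R b)"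

lemma cell_inner: "b \<in> Basis \<Longrightarrow> cell \<delta> t \<bullet> b = \<delta> * of_int \<lfloor>(t \<bullet> b) / \<delta>\<rfloor>"
 unfolding cell_def by (simp add: inner_sum_left_Basis)

lemma measurable_cell [measurable]: "cell \<delta> \<in> borel_measurable borel"
 unfolding cell_def[abs_def] by measurable

lemma cell_dist:
 fixes t :: "'a::euclidean_space" and \<delta> :: real
 assumes "\<delta> > 0" shows "norm (t - cell \<delta> t) \<le> DIM('a) * \<delta>"
proof -
 have "norm (t - cell \<delta> t) \<le> (\<Sum>b\<in>Basis. \<bar>(t - cell \<delta> t) \<bullet> b\<bar>)" by (rule norm_le_l1)
 also have "\<dots> \<le> (\<Sum>b\<in>(Basis::'a set). \<delta>)"
 proof (rule sum_mono)
  fix b :: 'a assume b: "b \<in> Basis"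
  have fl: "of_int \<lfloor>(t \<bullet> b) / \<delta>\<rfloor> \<le> (t \<bullet> b) / \<delta>" "(t \<bullet> b) / \<delta> < of_int \<lfloor>(t \<bullet> b) / \<delta>\<rfloor> + 1" by linarith+
  have "\<delta> * of_int \<lfloor>(t \<bullet> b) / \<delta>\<rfloor> \<le> t \<bullet> b" using mult_left_mono[OF fl(1), of \<delta>] assms by simp
  moreover have "t \<bullet> b \<le> \<delta> * of_int \<lfloor>(t \<bullet> b) / \<delta>\<rfloor> + \<delta>" using fl(2) assms by (simp add: pos_divide_less_eq algebra_simps)
  ultimately show "\<bar>(t - cell \<delta> t) \<bullet> b\<bar> \<le> \<delta>" using b by (simp add: inner_diff_left cell_inner)
 qed
 finally show ?thesis by simp
qed

lemma finite_cells:
 fixes R :: real assumes "\<delta> > 0" shows "finite (cell \<delta> ` (cball 0 R :: 'a::euclidean_space set))"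
proof -
 define N where "N = \<lceil>R / \<delta>\<rceil> + 1"
 define A where "A = (\<lambda>f::'a \<Rightarrow> int. \<Sum>b\<in>Basis. (\<delta> * of_int (f b)) *\<^sub>R b) ` (Basis \<rightarrow>\<^sub>E {-N..N})"
 have "finite A" unfolding A_def by (intro finite_imageI finite_PiE) auto
 moreover have "cell \<delta> t \<in> A" if "t \<in> cball 0 R" for t :: 'a
 proof -
  define f where "f = restrict (\<lambda>b. \<lfloor>(t \<bullet> b) / \<delta>\<rfloor>) Basis"
  have "f \<in> Basis \<rightarrow>\<^sub>E {-N..N}"
  proof -
   have "\<lfloor>(t \<bullet> b) / \<delta>\<rfloor> \<in> {-N..N}" if "b \<in> Basis" for b
   proof -
    have "\<bar>t \<bullet> b\<bar> \<le> R" using Basis_le_norm[OF that, of t] \<open>t \<in> cball 0 R\<close> by simp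
    then have "\<bar>(t \<bullet> b) / \<delta>\<bar> \<le> R / \<delta>" using assms by (simp add: abs_divide divide_right_mono)
    then have "(t \<bullet> b) / \<delta> \<le> R / \<delta>" "- (R / \<delta>) \<le> (t \<bullet> b) / \<delta>" by linarith+
    then show ?thesis unfolding N_def by simp linarith
   qed
   then show ?thesis unfolding f_def by auto
  qed
  moreover have "cell \<delta> t = (\<Sum>b\<in>Basis. (\<delta> * of_int (f b)) *\<^sub>R b)" unfolding cell_def f_def by simp
  ultimately show ?thesis unfolding A_def by blast
 qed
 ultimately show ?thesis by (meson finite_subset image_subsetI)
qed

lemma emeasure_cell_ge:
 fixes t0 :: "'a::euclidean_space"
 assumes "\<delta> > 0" shows "ennreal (\<delta> ^ DIM('a)) \<le> emeasure lborel {t. cell \<delta> t = cell \<delta> t0}"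
proof -
 define w where "w = cell \<delta> t0"
 define One where "One = (\<Sum>b\<in>(Basis::'a set). b)"
 have One: "One \<bullet> b = 1" if "b \<in> Basis" for b :: 'a
  using inner_sum_left_Basis[OF that, of "\<lambda>_. 1"] by (simp add: One_def)
 have "box w (w + \<delta> *\<^sub>R One) \<subseteq> {t. cell \<delta> t = w}"
 proof
  fix t assume t: "t \<in> box w (w + \<delta> *\<^sub>R One)"
  have "\<lfloor>(t \<bullet> b) / \<delta>\<rfloor> = \<lfloor>(t0 \<bullet> b) / \<delta>\<rfloor>" if b: "b \<in> Basis" for b
  proof (rule floor_unique)
   have "w \<bullet> b < t \<bullet> b" "t \<bullet> b < w \<bullet> b + \<delta>" using t b by (auto simp: mem_box inner_add_left One)
   then show "of_int \<lfloor>(t0 \<bullet> b) / \<delta>\<rfloor> \<le> (t \<bullet> b) / \<delta>" "(t \<bullet> b) / \<delta> < of_int \<lfloor>(t0 \<bullet> b) / \<delta>\<rfloor> + 1"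
    using assms b by (auto simp: w_def cell_inner field_simps)
  qed
  then show "t \<in> {t. cell \<delta> t = w}" unfolding w_def cell_def by simp
 qed
 then have "emeasure lborel (box w (w + \<delta> *\<^sub>R One)) \<le> emeasure lborel {t. cell \<delta> t = w}"
  by (rule emeasure_mono) measurable
 moreover have "emeasure lborel (box w (w + \<delta> *\<^sub>R One)) = ennreal (\<Prod>b\<in>Basis. (w + \<delta> *\<^sub>R One - w) \<bullet> b)"
  using assms by (intro emeasure_lborel_box) (auto simp: inner_add_left One)
 moreover have "(\<Prod>b\<in>(Basis::'a set). (w + \<delta> *\<^sub>R One - w) \<bullet> b) = (\<Prod>b\<in>(Basis::'a set). \<delta>)"
  by (intro prod.cong) (auto simp: One)
 ultimately show ?thesis by (simp add: w_def)
qed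

text \<open>Each cell has volume at least \<open>\<delta> ^ DIM('a)\<close> and the value at its
  corner is dominated by \<open>H\<close> on the whole cell, so a sum over corners becomes an
  integral.\<close>

lemma sum_cells_le:
 fixes X :: "'a::euclidean_space set" and F H :: "'a \<Rightarrow> ennreal"
 assumes \<delta>: "\<delta> > 0" and fin: "finite (cell \<delta> ` X)" and H: "H \<in> borel_measurable borel"
  and le: "\<And>t. cell \<delta> t \<in> cell \<delta> ` X \<Longrightarrow> F (cell \<delta> t) \<le> H t"
 shows "ennreal (\<delta> ^ DIM('a)) * (\<Sum>w\<in>cell \<delta> ` X. F w) \<le> (NN t. H t)"
proof -
 note [measurable] = H
 have "ennreal (\<delta> ^ DIM('a)) * (\<Sum>w\<in>cell \<delta> ` X. F w) = (\<Sum>w\<in>cell \<delta> ` X. F w * ennreal (\<delta> ^ DIM('a)))"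
  by (simp add: sum_distrib_left mult.commute)
 also have "\<dots> \<le> (\<Sum>w\<in>cell \<delta> ` X. F w * emeasure lborel {t. cell \<delta> t = w})"
  using emeasure_cell_ge[OF \<delta>] by (intro sum_mono mult_left_mono) auto
 also have "\<dots> = (\<Sum>w\<in>cell \<delta> ` X. (NN t. F w * indicator {t. cell \<delta> t = w} t))"
  by (intro sum.cong refl nn_integral_cmult_indicator[symmetric]) measurable
 also have "\<dots> = (NN t. (\<Sum>w\<in>cell \<delta> ` X. F w * indicator {t. cell \<delta> t = w} t))"
  by (intro nn_integral_sum[symmetric]) measurable
 also have "\<dots> \<le> (NN t. H t)"
 proof (rule nn_integral_mono)
  fix t
  have "(\<Sum>w\<in>cell \<delta> ` X. F w * indicator {t. cell \<delta> t = w} t) = (\<Sum>w\<in>cell \<delta> ` X. if cell \<delta> t = w then F w else 0)"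
   by (intro sum.cong) (auto simp: indicator_def)
  also have "\<dots> = (if cell \<delta> t \<in> cell \<delta> ` X then F (cell \<delta> t) else 0)" using fin by (simp add: sum.delta')
  finally show "(\<Sum>w\<in>cell \<delta> ` X. F w * indicator {t. cell \<delta> t = w} t) \<le> H t" using le[of t] by simp
 qed
 finally show ?thesis .
qed

section \<open>Uniform constants for finite families, and decay from sublevel bounds\<close>

lemma symb_of_sequence:
 assumes "h > 0"
 shows "\<lbrakk>(\<And>i. i \<le> k \<Longrightarrow> continuous_on UNIV (G i)); (\<And>i x. i \<le> k \<Longrightarrow> x \<in> X \<Longrightarrow> norm (G i x) \<le> B x);
  (\<And>i. i < k \<Longrightarrow> has_ddir e (G i) (\<lambda>x. G (Suc i) x /\<^sub>R h))\<rbrakk> \<Longrightarrow> symb h {e} X B k (G 0)"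
proof (induction k arbitrary: G)
 case (Suc k)
 have "symb h {e} X B k (G (Suc 0))" using Suc.prems by (intro Suc.IH[of "\<lambda>i. G (Suc i)"]) auto
 then have "symb h {e} X B k (\<lambda>x. h *\<^sub>R (G (Suc 0) x /\<^sub>R h))" using assms by simp
 then show ?case using Suc.prems(1)[of 0] Suc.prems(2)[of 0] Suc.prems(3)[of 0]
  by (intro symb_SucI) auto
qed simp

text \<open>A canonical choice of the derivative, which allows amplitudes to be defined by recursion
  before their differentiability is known.\<close>

definition ddir :: "'a::real_normed_vector \<Rightarrow> ('a \<Rightarrow> 'b::real_normed_vector) \<Rightarrow> 'a \<Rightarrow> 'b" where
 "ddir v f x = vector_derivative (\<lambda>s. f (x + s *\<^sub>R v)) (at 0)"

lemma has_ddir_imp_ddir: "has_ddir v f f' \<Longrightarrow> ddir v f = f'"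
 unfolding has_ddir_def ddir_def by (auto intro: vector_derivative_at)

lemma symb_ddir:
 assumes "symb h D X B (Suc k) f" "v \<in> D"
 shows "has_ddir v f (ddir v f)" "symb h D X B k (\<lambda>x. h *\<^sub>R ddir v f x)"
proof -
 obtain f' where f': "has_ddir v f f'" "symb h D X B k (\<lambda>x. h *\<^sub>R f' x)" using assms by auto
 then show "has_ddir v f (ddir v f)" "symb h D X B k (\<lambda>x. h *\<^sub>R ddir v f x)"
  using has_ddir_imp_ddir[OF f'(1)] by auto
qed

lemma smooth_on_vec:
 fixes f :: "'n::finite \<Rightarrow> 'a::real_normed_vector \<Rightarrow> real"
 assumes "open X" "\<And>i. smooth_on X (f i)" shows "smooth_on X (\<lambda>q. \<chi> i. f i q)"
proof -
 have "(\<lambda>q. \<chi> i. f i q) = (\<lambda>q. \<Sum>i\<in>UNIV. f i q *\<^sub>R axis i 1)"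
  by (auto simp: fun_eq_iff vec_eq_iff axis_def if_distrib cong: if_cong)
 then show ?thesis using assms by (auto intro!: smooth_intros)
qed

lemma uniform_symb_finite:
 fixes f :: "'i \<Rightarrow> 'a::euclidean_space \<Rightarrow> complex"
 assumes "finite A" "compact K" "finite D" "\<And>a. a \<in> A \<Longrightarrow> smooth_on UNIV (f a)"
 obtains C where "C \<ge> 0" "\<And>a h. \<lbrakk>a \<in> A; 0 < h; h \<le> 1\<rbrakk> \<Longrightarrow> symb h D K (\<lambda>_. C) k (f a)"
proof -
 have "\<forall>a\<in>A. \<exists>C\<ge>0. \<forall>h. 0 < h \<longrightarrow> h \<le> 1 \<longrightarrow> symb h D K (\<lambda>_. C) k (f a)"
  using smooth_imp_symb[OF assms(2,3)] assms(4) by blast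
 from bchoice[OF this] obtain C where C: "\<And>a. a \<in> A \<Longrightarrow> C a \<ge> 0"
  "\<And>a h. \<lbrakk>a \<in> A; 0 < h; h \<le> 1\<rbrakk> \<Longrightarrow> symb h D K (\<lambda>_. C a) k (f a)" by blast
 show ?thesis
 proof (rule that[of "\<Sum>a\<in>A. C a"])
  show "(\<Sum>a\<in>A. C a) \<ge> 0" using C(1) by (intro sum_nonneg) auto
  fix a h assume a: "a \<in> A" and h: "0 < (h::real)" "h \<le> 1"
  have "C a \<le> (\<Sum>a\<in>A. C a)" using C(1) assms(1) by (intro member_le_sum[OF a]) auto
  then show "symb h D K (\<lambda>_. \<Sum>a\<in>A. C a) k (f a)" by (rule symb_bound_mono[OF C(2)[OF a h]])
 qed
qed

lemma uniform_lipschitz_finite: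
 fixes f :: "'i \<Rightarrow> 'a::euclidean_space \<Rightarrow> 'b::real_normed_vector"
 assumes "finite A" "compact K" "convex K" "\<And>a. a \<in> A \<Longrightarrow> smooth_on UNIV (f a)"
 obtains L where "L \<ge> 0" "\<And>a x y. \<lbrakk>a \<in> A; x \<in> K; y \<in> K\<rbrakk> \<Longrightarrow> norm (f a x - f a y) \<le> L * norm (x - y)"
proof -
 have "\<exists>L\<ge>0. \<forall>x\<in>K. \<forall>y\<in>K. norm (f a x - f a y) \<le> L * norm (x - y)" if "a \<in> A" for a
  by (rule smooth_lipschitz[OF assms(4)[OF that] assms(2,3)]) blast
 then have "\<forall>a\<in>A. \<exists>L\<ge>0. \<forall>x\<in>K. \<forall>y\<in>K. norm (f a x - f a y) \<le> L * norm (x - y)" by blast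
 from bchoice[OF this] obtain L where L: "\<And>a. a \<in> A \<Longrightarrow> L a \<ge> 0"
  "\<And>a x y. \<lbrakk>a \<in> A; x \<in> K; y \<in> K\<rbrakk> \<Longrightarrow> norm (f a x - f a y) \<le> L a * norm (x - y)" by blast
 show ?thesis
 proof (rule that[of "\<Sum>a\<in>A. L a"])
  show "(\<Sum>a\<in>A. L a) \<ge> 0" using L(1) by (intro sum_nonneg) auto
  fix a x y assume a: "a \<in> A" and xy: "x \<in> K" "y \<in> K"
  have "L a \<le> (\<Sum>a\<in>A. L a)" using L(1) assms(1) by (intro member_le_sum[OF a]) auto
  then show "norm (f a x - f a y) \<le> (\<Sum>a\<in>A. L a) * norm (x - y)"
   using L(2)[OF a xy] mult_right_mono[of "L a" "\<Sum>a\<in>A. L a" "norm (x - y)"] by simp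
 qed
qed

text \<open>Layers of \<open>norm (G t - \<xi>) / h\<close> correspond to the radii
  \<open>h * real (Suc k)\<close>. All of these are at least \<open>h\<close>, exactly the range in
  which the sublevel bound is available.\<close>

lemma decay_from_sublevel:
 fixes W :: "'a::euclidean_space \<Rightarrow> real" and G :: "'a \<Rightarrow> 'b::euclidean_space"
 assumes h: "h > 0" and C: "C \<ge> 0" and meas: "W \<in> borel_measurable borel" "G \<in> borel_measurable borel" "\<Omega> \<in> sets borel"
  and sub: "\<And>r. h \<le> r \<Longrightarrow> (NN t. ennreal (W t) * indicator {t \<in> \<Omega>. norm (G t - \<xi>) \<le> r} t) \<le> ennreal (C * r ^ n)"
 shows "(NN t. ennreal (W t) * indicator \<Omega> t * ennreal (inverse ((1 + norm (G t - \<xi>) / h) ^ (n + 2))))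
  \<le> ennreal (C * (\<Sum>k. inverse (real (Suc k) ^ 2)) * h ^ n)"
proof -
 note [measurable] = meas
 have "(NN t. (ennreal (W t) * indicator \<Omega> t) * ennreal (inverse ((1 + norm (G t - \<xi>) / h) ^ (n + 2))))
  \<le> ennreal ((C * h ^ n) * (\<Sum>k. inverse (real (Suc k) ^ 2)))"
 proof (rule layer_decay)
  fix k
  have r: "h \<le> h * real (Suc k)" using h by simp
  have "(NN t. ennreal (W t) * indicator \<Omega> t * indicator {t. norm (G t - \<xi>) / h \<le> real (Suc k)} t)
   = (NN t. ennreal (W t) * indicator {t \<in> \<Omega>. norm (G t - \<xi>) \<le> h * real (Suc k)} t)"
   using h by (intro nn_integral_cong) (auto simp: indicator_def pos_divide_le_eq mult.commute)
  also have "\<dots> \<le> ennreal (C * (h * real (Suc k)) ^ n)" by (rule sub[OF r])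
  finally show "(NN t. ennreal (W t) * indicator \<Omega> t * indicator {t. norm (G t - \<xi>) / h \<le> real (Suc k)} t)
   \<le> ennreal (C * h ^ n * real (Suc k) ^ n)" by (simp only: power_mult_distrib mult.assoc)
 qed (use h C in auto)
 then show ?thesis by (simp only: mult_ac)
qed

lemma integral_le_of_nn_integral:
 fixes f :: "'a \<Rightarrow> real"
 assumes "(\<integral>\<^sup>+x. ennreal (f x) \<partial>M) \<le> ennreal C" "C \<ge> 0" "\<And>x. f x \<ge> 0"
 shows "(\<integral>x. f x \<partial>M) \<le> C"
proof (cases "integrable M f")
 case True
 then have "ennreal (\<integral>x. f x \<partial>M) \<le> ennreal C" using assms(1,3) by (simp add: nn_integral_eq_integral)
 then show ?thesis using assms(2) by (simp add: ennreal_le_iff)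
qed (use assms(2) in \<open>simp add: not_integrable_integral_eq\<close>)

section \<open>Wave packets\<close>

text \<open>Rank and finite type enter the analysis through the two sublevel bounds alone. These are
  required on balls of radius \<open>R0 + 2\<close>, because corners of cells and centres of balls
  reach norm \<open>R0 + 1\<close> and balls of radius \<open>h \<le> 1\<close> around them are
  used.\<close>

locale damped_oscillation =
 fixes S :: "(real^'n) \<times> (real^'n) \<Rightarrow> real" and \<psi> :: "(real^'n) \<times> (real^'n) \<Rightarrow> complex"
  and R0 c CL CR :: real
 assumes S_smooth: "smooth_on UNIV S" and psi_smooth: "smooth_on UNIV \<psi>"
  and R0: "R0 \<ge> 0" and psi_supp: "\<And>q. \<psi> q \<noteq> 0 \<Longrightarrow> q \<in> cball 0 R0 \<times> cball 0 R0"
  and psi_bound: "\<And>q. norm (\<psi> q) \<le> c * \<bar>det (mixed_hessian S q)\<bar>"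
  and CLR: "CL \<ge> 0" "CR \<ge> 0"
  and sublevel_x: "\<And>x \<xi> r h. \<lbrakk>norm x \<le> R0 + 2; 0 < h; h \<le> 1; h \<le> r\<rbrakk> \<Longrightarrow>
   (NN t. ennreal (\<bar>det (mixed_hessian S (x, t))\<bar> + h) *
     indicator {t \<in> cball 0 (R0 + 2). norm (grad_x S (x, t) - \<xi>) \<le> r} t) \<le> ennreal (CL * r ^ CARD('n))"
  and sublevel_t: "\<And>t \<xi> r h. \<lbrakk>norm t \<le> R0 + 2; 0 < h; h \<le> 1; h \<le> r\<rbrakk> \<Longrightarrow>
   (NN x. ennreal (\<bar>det (mixed_hessian S (x, t))\<bar> + h) *
     indicator {x \<in> cball 0 (R0 + 2). norm (grad_theta S (x, t) - \<xi>) \<le> r} x) \<le> ennreal (CR * r ^ CARD('n))"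
begin

definition R where "R = R0 + 2"
definition Delta where "Delta q = det (mixed_hessian S q)"
definition wt where "wt h x t = \<bar>Delta (x, t)\<bar> + h"
definition gx where "gx b q = FD S q (b, 0)"
text \<open>The phase with its value at the cell corner \<open>w\<close> split off. For t within
  \<open>h\<close> of \<open>w\<close> its x-derivative is only O(1/h), so the kernel varies at
  scale \<open>h\<close> in x; the removed factor depends on x and \<open>w\<close> alone.
  \<open>pp\<close> is \<open>h\<close> times that derivative in direction \<open>b\<close>.\<close>

definition ph where "ph h w q = (S q - S (fst q, w)) / h\<^sup>2"
definition pp where "pp h b w q = (gx b q - gx b (fst q, w)) / h"
definition Xw where "Xw h w = {q. norm (fst q) \<le> R \<and> dist w (snd q) \<le> h}"
definition box where "box = (cball 0 R \<times> cball 0 R :: ((real^'n) \<times> (real^'n)) set)"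

text \<open>Amplitude of the \<open>i\<close>-th scaled derivative: applying \<open>h\<close> times
  the derivative in direction \<open>(b, 0)\<close> to
  \<open>expi (ph h w q) * amp h b w i q\<close> reproduces the exponential with the next
  amplitude.\<close>

primrec amp :: "real \<Rightarrow> real^'n \<Rightarrow> real^'n \<Rightarrow> nat \<Rightarrow> (real^'n) \<times> (real^'n) \<Rightarrow> complex" where
 "amp h b w 0 = \<psi>"
| "amp h b w (Suc i) = (\<lambda>q. h *\<^sub>R ddir (b, 0) (amp h b w i) q + (\<i> * complex_of_real (pp h b w q)) * amp h b w i q)"

definition ker where "ker h b w i q = expi (ph h w q) * amp h b w i q"
definition Fop where "Fop h b w i u x = (LI t. ker h b w i (x, t) * u t)"

section \<open>Symbol estimates for frozen phases and amplitudes\<close>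

lemma box_props: "compact box" "convex box"
 unfolding box_def by (auto intro: compact_Times convex_Times)

lemma gx_smooth: "smooth_on UNIV (gx b)"
 unfolding gx_def by (intro smooth_intros S_smooth)

lemma grad_x_smooth: "smooth_on UNIV (grad_x S)" and grad_theta_smooth: "smooth_on UNIV (grad_theta S)"
 unfolding grad_x_def[abs_def] grad_theta_def[abs_def]
 by (intro smooth_on_vec smooth_intros S_smooth open_UNIV)+

lemma Delta_smooth: "smooth_on UNIV Delta"
 unfolding Delta_def[abs_def] det_def mixed_hessian_def grad_x_def
 by (simp, intro smooth_intros S_smooth open_UNIV)

lemma wt_pos: "h > 0 \<Longrightarrow> wt h x t > 0"
 by (simp add: wt_def add_nonneg_pos)

lemma wt_continuous: "continuous_on UNIV (\<lambda>x. wt h x t)" "continuous_on UNIV (\<lambda>t. wt h x t)"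
 unfolding wt_def
 by (intro continuous_intros continuous_on_compose2[OF smooth_on_continuous[OF Delta_smooth]]; auto)+

lemma norm_slice: "norm (q - (fst q, w)) = dist w (snd q)"
 by (cases q) (simp add: norm_Pair dist_norm norm_minus_commute)

lemma Xw_box: "h \<le> 1 \<Longrightarrow> norm w \<le> R0 + 1 \<Longrightarrow> Xw h w \<subseteq> box"
 unfolding Xw_def box_def R_def
proof (clarify)
 fix a b assume *: "h \<le> 1" "norm w \<le> R0 + 1" "norm (fst (a, b)) \<le> R0 + 2" "dist w (snd (a, b)) \<le> h"
 have "norm b \<le> norm w + dist w b" using norm_triangle_ineq[of w "b - w"] by (simp add: dist_norm norm_minus_commute)
 then show "a \<in> cball 0 (R0 + 2) \<and> b \<in> cball 0 (R0 + 2)" using * by simp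
qed

text \<open>The summand \<open>h\<close> in the weight absorbs the Lipschitz variation of the
  determinant over a distance \<open>h\<close>.\<close>

lemma wt_comparable:
 obtains C where "C \<ge> 1"
  "\<And>h x t x' t'. \<lbrakk>0 < h; norm x \<le> R; norm t \<le> R; norm x' \<le> R; norm t' \<le> R;
   norm ((x, t) - (x', t')) \<le> h\<rbrakk> \<Longrightarrow> wt h x t \<le> C * wt h x' t'"
proof -
 obtain L where L: "L \<ge> 0" "\<And>q q'. q \<in> box \<Longrightarrow> q' \<in> box \<Longrightarrow> norm (Delta q - Delta q') \<le> L * norm (q - q')"
  by (rule smooth_lipschitz[OF Delta_smooth box_props]) blast
 show ?thesis
 proof (rule that[of "1 + L"])
  fix h :: real and x t x' t' :: "real^'n" assume *: "0 < h" "norm x \<le> R" "norm t \<le> R" "norm x' \<le> R" "norm t' \<le> R" "norm ((x, t) - (x', t')) \<le> h"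
  have "\<bar>Delta (x, t) - Delta (x', t')\<bar> \<le> L * norm ((x, t) - (x', t'))"
   using L(2)[of "(x, t)" "(x', t')"] * by (simp add: box_def)
  also have "\<dots> \<le> L * h" using *(6) L(1) by (rule mult_left_mono)
  finally have "\<bar>Delta (x, t)\<bar> \<le> \<bar>Delta (x', t')\<bar> + L * h" by linarith
  moreover have "0 \<le> L * \<bar>Delta (x', t')\<bar>" using L(1) by simp
  ultimately show "wt h x t \<le> (1 + L) * wt h x' t'" by (simp add: wt_def algebra_simps)
 qed (use L in auto)
qed

text \<open>Two estimates of different origin: \<open>pp\<close> itself is a difference of gradients
  at distance at most \<open>h\<close>, divided by \<open>h\<close>; in its derivatives the factor
  \<open>h\<close> of the symbol norm cancels the division.\<close>

lemma pp_symb: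
 "\<exists>C\<ge>0. \<forall>h b w. 0 < h \<longrightarrow> h \<le> 1 \<longrightarrow> b \<in> Basis \<longrightarrow> norm w \<le> R0 + 1 \<longrightarrow>
  symb h Basis (Xw h w) (\<lambda>_. C) k (\<lambda>q. complex_of_real (pp h b w q))"
proof -
 obtain L where L: "L \<ge> 0" "\<And>b q q'. \<lbrakk>b \<in> Basis; q \<in> box; q' \<in> box\<rbrakk> \<Longrightarrow> norm (gx b q - gx b q') \<le> L * norm (q - q')"
  by (rule uniform_lipschitz_finite[of Basis box gx]) (auto intro: box_props gx_smooth)
 define gxx where "gxx b v q = FD (gx b) q v" for b v q
 have gxxs: "smooth_on UNIV (\<lambda>q. complex_of_real (gxx b v q))" for b v
  unfolding gxx_def by (rule smooth_on_bounded_linear[OF open_UNIV bounded_linear_of_real smooth_on_frechet_derivative[OF gx_smooth]])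
 define T where "T = (Basis :: ((real^'n) \<times> (real^'n)) set)"
 have fT: "finite T" by (simp add: T_def)
 obtain D1 where D1: "D1 \<ge> 0" "\<And>bv h. \<lbrakk>bv \<in> Basis \<times> T; 0 < h; h \<le> 1\<rbrakk> \<Longrightarrow> symb h T box (\<lambda>_. D1) k (\<lambda>q. complex_of_real (gxx (fst bv) (snd bv) q))"
  by (rule uniform_symb_finite[of "Basis \<times> T" box T "\<lambda>bv q. complex_of_real (gxx (fst bv) (snd bv) q)"])
   (use fT gxxs box_props in auto)
 \<comment> \<open>The term frozen at \<open>w\<close> varies with the first slot only, hence the
   projected directions.\<close>
 obtain D2 where D2: "D2 \<ge> 0" "\<And>bv h. \<lbrakk>bv \<in> Basis \<times> T; 0 < h; h \<le> 1\<rbrakk> \<Longrightarrow> symb h T box (\<lambda>_. D2) k (\<lambda>q. complex_of_real (gxx (fst bv) (fst (snd bv), 0) q))"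
  by (rule uniform_symb_finite[of "Basis \<times> T" box T "\<lambda>bv q. complex_of_real (gxx (fst bv) (fst (snd bv), 0) q)"])
   (use fT gxxs box_props in auto)
 define C where "C = L + D1 + D2"
 have "symb h T (Xw h w) (\<lambda>_. C) k (\<lambda>q. complex_of_real (pp h b w q))"
  if h: "0 < h" "h \<le> 1" and b: "b \<in> Basis" and w: "norm w \<le> R0 + 1" for h b w
 proof -
  have sub: "Xw h w \<subseteq> box" by (rule Xw_box[OF h(2) w])
  have wR: "norm w \<le> R" using w by (simp add: R_def)
  have bd: "norm (complex_of_real (pp h b w q)) \<le> C" if q: "q \<in> Xw h w" for q
  proof -
   have "(fst q, w) \<in> box" using q wR by (simp add: Xw_def box_def)
   then have "\<bar>gx b q - gx b (fst q, w)\<bar> \<le> L * norm (q - (fst q, w))" using L(2)[OF b subsetD[OF sub q], of "(fst q, w)"] by simp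
   also have "norm (q - (fst q, w)) = dist w (snd q)" by (rule norm_slice)
   also have "L * dist w (snd q) \<le> L * h" using q L(1) by (intro mult_left_mono) (auto simp: Xw_def)
   finally have "\<bar>pp h b w q\<bar> \<le> L" using h by (simp add: pp_def abs_divide divide_le_eq)
   then show ?thesis using D1(1) D2(1) by (simp add: C_def)
  qed
  have slice_lin: "linear (\<lambda>q::(real^'n) \<times> (real^'n). (fst q, 0::real^'n))" by (auto intro!: linearI)
  have cont: "continuous_on UNIV (\<lambda>q. complex_of_real (pp h b w q))" unfolding pp_def
   using h(1) by (intro continuous_intros continuous_on_compose2[OF smooth_on_continuous[OF gx_smooth]]) auto
  show ?thesis
  proof (cases k)
   case 0 then show ?thesis using bd cont by simp
  next
   case (Suc k')
   show ?thesis unfolding Suc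
   proof (rule symb_SucI[OF cont bd])
    fix v assume v: "v \<in> T"
    have d: "has_ddir v (gx b) (gxx b v)" for v unfolding gxx_def by (rule smooth_has_ddir[OF gx_smooth])
    have d2: "has_ddir v (\<lambda>q. gx b (fst q, w)) (\<lambda>q. gxx b (fst v, 0) (fst q, w))"
     using has_ddir_affine[where L = "\<lambda>q. (fst q, 0)" and c = "(0, w)", OF d slice_lin] by simp
    have "has_ddir v (\<lambda>q. complex_of_real (inverse h * (gx b q + (- 1) * gx b (fst q, w))))
     (\<lambda>q. complex_of_real (inverse h * (gxx b v q + (- 1) * gxx b (fst v, 0) (fst q, w))))"
     by (intro has_ddir_of_real has_ddir_cmult has_ddir_add d d2)
    then have dpp: "has_ddir v (\<lambda>q. complex_of_real (pp h b w q))
     (\<lambda>q. complex_of_real (inverse h * (gxx b v q + (- 1) * gxx b (fst v, 0) (fst q, w))))"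
     unfolding pp_def by (simp add: divide_inverse mult.commute)
    have s1: "symb h T (Xw h w) (\<lambda>_. D1) k (\<lambda>q. complex_of_real (gxx b v q))"
     using symb_weaken[OF D1(2)[of "(b, v)" h] sub, of "\<lambda>_. D1" T] b v h by simp
    have "symb h T (Xw h w) (\<lambda>_. D2) k (\<lambda>q. complex_of_real (gxx b (fst v, 0) ((fst q, 0) + (0, w))))"
    proof (rule symb_affine[OF slice_lin])
     show "symb h T box (\<lambda>_. D2) k (\<lambda>q. complex_of_real (gxx b (fst v, 0) q))" using D2(2)[of "(b, v)" h] b v h by simp
     show "continuous_on UNIV (\<lambda>q::(real^'n) \<times> (real^'n). (fst q, 0::real^'n))" by (intro continuous_intros)
     show "(fst v', 0) \<in> T \<or> (fst v', 0) = 0" if "v' \<in> T" for v'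
      using that by (auto simp: T_def Basis_prod_def zero_prod_def)
     show "(fst q, 0) + (0, w) \<in> box" if "q \<in> Xw h w" for q using that wR by (simp add: Xw_def box_def)
    qed (use D2(1) in auto)
    then have s2: "symb h T (Xw h w) (\<lambda>_. D2) k (\<lambda>q. complex_of_real (gxx b (fst v, 0) (fst q, w)))" by simp
    have "symb h T (Xw h w) (\<lambda>_. D1 + norm (- 1 :: complex) * D2) k
     (\<lambda>q. complex_of_real (gxx b v q) + (- 1) * complex_of_real (gxx b (fst v, 0) (fst q, w)))"
     by (intro symb_add symb_cmult s1 s2)
    then have "symb h T (Xw h w) (\<lambda>_. C) k (\<lambda>q. complex_of_real (gxx b v q) + (- 1) * complex_of_real (gxx b (fst v, 0) (fst q, w)))"
     by (rule symb_bound_mono) (use L(1) in \<open>simp add: C_def\<close>)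
    from symb_mono_order[OF _ this, of k']
    have "symb h T (Xw h w) (\<lambda>_. C) k' (\<lambda>q. complex_of_real (gxx b v q) + (- 1) * complex_of_real (gxx b (fst v, 0) (fst q, w)))"
     using Suc by simp
    then have "symb h T (Xw h w) (\<lambda>_. C) k' (\<lambda>q. h *\<^sub>R complex_of_real (inverse h * (gxx b v q + (- 1) * gxx b (fst v, 0) (fst q, w))))"
     using h by (simp add: scaleR_conv_of_real mult.assoc[symmetric])
    then show "\<exists>f'. has_ddir v (\<lambda>q. complex_of_real (pp h b w q)) f' \<and> symb h T (Xw h w) (\<lambda>_. C) k' (\<lambda>x. h *\<^sub>R f' x)"
     using dpp by blast
   qed
  qed
 qed
 moreover have "C \<ge> 0" using L(1) D1(1) D2(1) by (simp add: C_def)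
 ultimately show ?thesis unfolding T_def by blast
qed

text \<open>The damping is used for the values of \<open>\<psi>\<close>. Its derivatives need not be
  small on the critical variety, but each comes with a factor \<open>h\<close>, which
  \<open>wt\<close> dominates.\<close>

lemma psi_symb:
 "\<exists>C\<ge>0. \<forall>h w. 0 < h \<longrightarrow> h \<le> 1 \<longrightarrow> norm w \<le> R0 + 1 \<longrightarrow>
  symb h Basis (Xw h w) (\<lambda>q. C * wt h (fst q) w) k \<psi>"
proof -
 obtain C0 where C0: "C0 \<ge> 1"
  "\<And>h x t x' t'. \<lbrakk>0 < h; norm x \<le> R; norm t \<le> R; norm x' \<le> R; norm t' \<le> R;
   norm ((x, t) - (x', t')) \<le> h\<rbrakk> \<Longrightarrow> wt h x t \<le> C0 * wt h x' t'"
  using wt_comparable by blast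
 obtain D where D: "D \<ge> 0" "\<And>v h. \<lbrakk>v \<in> Basis; 0 < h; h \<le> 1\<rbrakk> \<Longrightarrow> symb h Basis box (\<lambda>_. D) k (\<lambda>q. FD \<psi> q v)"
  by (rule uniform_symb_finite[of Basis box Basis "\<lambda>v q. FD \<psi> q v"])
   (auto intro: box_props smooth_on_frechet_derivative psi_smooth)
 define C where "C = \<bar>c\<bar> * C0 + D"
 have C: "C \<ge> 0" using C0(1) D(1) by (simp add: C_def)
 have "symb h Basis (Xw h w) (\<lambda>q. C * wt h (fst q) w) k \<psi>"
  if h: "0 < h" "h \<le> 1" and w: "norm w \<le> R0 + 1" for h w
 proof -
  have sub: "Xw h w \<subseteq> box" by (rule Xw_box[OF h(2) w])
  have bd: "norm (\<psi> q) \<le> C * wt h (fst q) w" if q: "q \<in> Xw h w" for q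
  proof -
   have "norm (\<psi> q) \<le> c * \<bar>Delta q\<bar>" using psi_bound[of q] by (simp add: Delta_def)
   also have "\<dots> \<le> \<bar>c\<bar> * wt h (fst q) (snd q)" using h by (intro mult_mono) (auto simp: wt_def)
   also have "\<dots> \<le> \<bar>c\<bar> * (C0 * wt h (fst q) w)"
   proof (intro mult_left_mono C0(2))
    show "norm ((fst q, snd q) - (fst q, w)) \<le> h" using q norm_slice[of q w] by (simp add: Xw_def)
   qed (use q sub w h in \<open>auto simp: Xw_def box_def R_def\<close>)
   also have "\<dots> \<le> C * wt h (fst q) w" using wt_pos[OF h(1), of "fst q" w] D(1) by (simp add: C_def algebra_simps)
   finally show ?thesis .
  qed
  show ?thesis
  proof (cases k)
   case 0 then show ?thesis using bd smooth_on_continuous[OF psi_smooth] by simp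
  next
   case (Suc k')
   show ?thesis unfolding Suc
   proof (rule symb_SucI[OF smooth_on_continuous[OF psi_smooth] bd])
    fix v :: "(real^'n) \<times> (real^'n)" assume v: "v \<in> Basis"
    have "symb h Basis (Xw h w) (\<lambda>_. norm (complex_of_real h) * D) k (\<lambda>q. complex_of_real h * FD \<psi> q v)"
     by (rule symb_cmult[OF symb_weaken[OF D(2)[OF v h] sub order_refl subset_refl]])
    then have "symb h Basis (Xw h w) (\<lambda>q. C * wt h (fst q) w) k (\<lambda>q. complex_of_real h * FD \<psi> q v)"
    proof (rule symb_bound_mono)
     fix q
     have "D * h \<le> C * wt h (fst q) w" using D(1) C0(1) h by (intro mult_mono) (auto simp: C_def wt_def)
     then show "norm (complex_of_real h) * D \<le> C * wt h (fst q) w" using h by (simp add: mult.commute)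
    qed
    from symb_mono_order[OF _ this, of k']
    have "symb h Basis (Xw h w) (\<lambda>q. C * wt h (fst q) w) k' (\<lambda>q. h *\<^sub>R FD \<psi> q v)"
     using Suc by (simp add: scaleR_conv_of_real)
    then show "\<exists>f'. has_ddir v \<psi> f' \<and> symb h Basis (Xw h w) (\<lambda>q. C * wt h (fst q) w) k' (\<lambda>x. h *\<^sub>R f' x)"
     using smooth_has_ddir[OF psi_smooth] by blast
   qed
  qed
 qed
 then show ?thesis using C by blast
qed

lemma Basis_left: "b \<in> Basis \<Longrightarrow> (b, 0) \<in> (Basis :: ((real^'n) \<times> (real^'n)) set)"
 by (simp add: Basis_prod_def)

text \<open>Each step of the recursion consumes one derivative of the previous amplitude, so the
  induction on \<open>i\<close> runs over all orders \<open>k\<close> simultaneously.\<close>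

lemma amp_symb:
 "\<exists>C\<ge>0. \<forall>h b w. 0 < h \<longrightarrow> h \<le> 1 \<longrightarrow> b \<in> Basis \<longrightarrow> norm w \<le> R0 + 1 \<longrightarrow>
  symb h Basis (Xw h w) (\<lambda>q. C * wt h (fst q) w) k (amp h b w i)"
proof (induction i arbitrary: k)
 case 0
 show ?case using psi_symb[of k] by auto
next
 case (Suc i)
 obtain C where C: "C \<ge> 0" "\<And>h b w. \<lbrakk>0 < h; h \<le> 1; b \<in> Basis; norm w \<le> R0 + 1\<rbrakk> \<Longrightarrow>
  symb h Basis (Xw h w) (\<lambda>q. C * wt h (fst q) w) (Suc k) (amp h b w i)" using Suc.IH[of "Suc k"] by blast
 obtain P where P: "P \<ge> 0" "\<And>h b w. \<lbrakk>0 < h; h \<le> 1; b \<in> Basis; norm w \<le> R0 + 1\<rbrakk> \<Longrightarrow>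
  symb h Basis (Xw h w) (\<lambda>_. P) k (\<lambda>q. complex_of_real (pp h b w q))" using pp_symb[of k] by blast
 define C' where "C' = C + 2 ^ k * (P * C)"
 have "symb h Basis (Xw h w) (\<lambda>q. C' * wt h (fst q) w) k (amp h b w (Suc i))"
  if h: "0 < h" "h \<le> 1" and b: "b \<in> Basis" and w: "norm w \<le> R0 + 1" for h b w
 proof -
  note sC = C(2)[OF h b w]
  have s1: "symb h Basis (Xw h w) (\<lambda>_. P) k (\<lambda>q. \<i> * complex_of_real (pp h b w q))"
   using symb_cmult[OF P(2)[OF h b w], of \<i>] by simp
  have "symb h Basis (Xw h w) (\<lambda>q. C * wt h (fst q) w + 2 ^ k * (P * (C * wt h (fst q) w))) k (amp h b w (Suc i))"
   unfolding amp.simps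
   by (intro symb_add symb_mult symb_ddir(2)[OF sC Basis_left[OF b]] s1 symb_Suc_D[OF sC])
  then show ?thesis by (rule symb_bound_mono) (simp add: C'_def algebra_simps)
 qed
 moreover have "C' \<ge> 0" using C(1) P(1) by (simp add: C'_def)
 ultimately show ?case by blast
qed

lemma amp_continuous:
 assumes "0 < h" "h \<le> 1" "b \<in> Basis" "norm w \<le> R0 + 1" shows "continuous_on UNIV (amp h b w i)"
 using amp_symb[of 0 i] assms symb_continuous by blast

lemma amp_ddir:
 assumes "0 < h" "h \<le> 1" "b \<in> Basis" "norm w \<le> R0 + 1"
 shows "has_ddir (b, 0) (amp h b w i) (ddir (b, 0) (amp h b w i))"
 using amp_symb[of "Suc 0" i] assms symb_ddir(1)[OF _ Basis_left[OF assms(3)]] by blast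

lemma amp_eq_0:
 assumes "0 < h" "h \<le> 1" "b \<in> Basis" "norm w \<le> R0 + 1"
 shows "q \<notin> cball 0 R0 \<times> cball 0 R0 \<Longrightarrow> amp h b w i q = 0"
proof (induction i arbitrary: q)
 case 0 then show ?case using psi_supp[of q] by (metis amp.simps(1))
next
 case (Suc i)
 have "ddir (b, 0) (amp h b w i) q = 0"
  by (rule has_ddir_zero_outside[OF amp_ddir[OF assms] _ Suc.IH Suc.prems]) (auto intro: closed_Times)
 then show ?case using Suc.IH[OF Suc.prems] by simp
qed

lemma ph_continuous: "0 < h \<Longrightarrow> continuous_on UNIV (ph h w)"
 unfolding ph_def[abs_def] by (intro continuous_intros continuous_on_compose2[OF smooth_on_continuous[OF S_smooth]]) auto

lemma ker_continuous:
 assumes "0 < h" "h \<le> 1" "b \<in> Basis" "norm w \<le> R0 + 1" shows "continuous_on UNIV (ker h b w i)"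
 unfolding ker_def[abs_def] by (intro continuous_intros ph_continuous amp_continuous assms)

lemma ker_eq_0:
 assumes "0 < h" "h \<le> 1" "b \<in> Basis" "norm w \<le> R0 + 1" "q \<notin> cball 0 R0 \<times> cball 0 R0"
 shows "ker h b w i q = 0"
 using amp_eq_0[OF assms] by (simp add: ker_def)

lemma ker_has_ddir:
 assumes "0 < h" "h \<le> 1" "b \<in> Basis" "norm w \<le> R0 + 1"
 shows "has_ddir (b, 0) (ker h b w i) (\<lambda>q. ker h b w (Suc i) q /\<^sub>R h)"
proof -
 have slice_lin: "linear (\<lambda>q::(real^'n) \<times> (real^'n). (fst q, 0::real^'n))" by (auto intro!: linearI)
 have d: "has_ddir (b, 0) S (gx b)" unfolding gx_def by (rule smooth_has_ddir[OF S_smooth])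
 then have d2: "has_ddir (b, 0) (\<lambda>q::(real^'n) \<times> (real^'n). S (fst q, w)) (\<lambda>q. gx b (fst q, w))"
  using has_ddir_affine[where L = "\<lambda>q. (fst q, 0)" and c = "(0, w)" and v = "(b, 0)" and f = S and f' = "gx b", OF _ slice_lin] by simp
 have "has_ddir (b, 0) (\<lambda>q. inverse (h\<^sup>2) * (S q + (- 1) * S (fst q, w))) (\<lambda>q. inverse (h\<^sup>2) * (gx b q + (- 1) * gx b (fst q, w)))"
  by (intro has_ddir_cmult has_ddir_add d d2)
 moreover have "(\<lambda>q. inverse (h\<^sup>2) * (S q + (- 1) * S (fst q, w))) = ph h w" by (simp add: ph_def[abs_def] divide_inverse mult.commute)
 moreover have "(\<lambda>q. inverse (h\<^sup>2) * (gx b q + (- 1) * gx b (fst q, w))) = (\<lambda>q. pp h b w q / h)"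
  by (simp add: pp_def[abs_def] divide_inverse mult.commute power2_eq_square fun_eq_iff)
 ultimately have dph: "has_ddir (b, 0) (ph h w) (\<lambda>q. pp h b w q / h)" by simp
 have "has_ddir (b, 0) (ker h b w i) (\<lambda>q. expi (ph h w q) * ddir (b, 0) (amp h b w i) q +
   ((\<i> * complex_of_real (pp h b w q / h)) * expi (ph h w q)) * amp h b w i q)"
  unfolding ker_def[abs_def] by (intro has_ddir_mult has_ddir_exp has_ddir_cmult has_ddir_of_real dph amp_ddir assms)
 moreover have "expi (ph h w q) * ddir (b, 0) (amp h b w i) q +
   ((\<i> * complex_of_real (pp h b w q / h)) * expi (ph h w q)) * amp h b w i q = ker h b w (Suc i) q /\<^sub>R h" for q
  using assms(1) by (simp add: ker_def scaleR_conv_of_real field_simps)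
 ultimately show ?thesis by simp
qed

end

text \<open>The estimate in one direction is applied in a coordinate where the gradient difference
  is at least its norm divided by the dimension. The gradient map \<open>G\<close> is a parameter so
  that either variable of the phase can become the integration variable.\<close>

lemma osc_estimate:
 fixes S :: "'a::euclidean_space \<times> 'a \<Rightarrow> real" and G :: "'a \<times> 'a \<Rightarrow> 'a"
 assumes smooth: "smooth_on UNIV S" and G: "\<And>b q. b \<in> Basis \<Longrightarrow> G q \<bullet> b = FD S q (b, 0)"
 obtains C where "C \<ge> 0" "\<And>h y w w' a B. \<lbrakk>0 < h; h \<le> 1; cball y h \<subseteq> cball 0 R;
   w \<in> cball 0 R; w' \<in> cball 0 R; (\<And>b. b \<in> Basis \<Longrightarrow> symb h {b} (cball y h) B M a);
   (\<And>x. x \<notin> cball y h \<Longrightarrow> a x = 0); continuous_on UNIV B; (\<And>x. 0 \<le> B x)\<rbrakk> \<Longrightarrow>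
   norm (LI x. expi ((S (x, w) - S (x, w')) / h\<^sup>2) * a x)
   \<le> C * inverse ((1 + norm (G (y, w) - G (y, w')) / h) ^ M) * (LI x. indicator (cball y h) x * B x)"
proof -
 obtain C where C: "C \<ge> 0" "\<And>h y w w' b a B. \<lbrakk>0 < h; h \<le> 1; b \<in> Basis; cball y h \<subseteq> cball 0 R;
   w \<in> cball 0 R; w' \<in> cball 0 R; symb h {b} (cball y h) B M a; (\<And>x. x \<notin> cball y h \<Longrightarrow> a x = 0);
   continuous_on UNIV B; (\<And>x. 0 \<le> B x)\<rbrakk> \<Longrightarrow>
   (1 + \<bar>FD S (y, w) (b, 0) - FD S (y, w') (b, 0)\<bar> / h) ^ M *
    norm (LI x. expi ((S (x, w) - S (x, w')) / h\<^sup>2) * a x)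
   \<le> C * (LI x. indicator (cball y h) x * B x)"
  by (rule osc_estimate_direction[OF smooth, of R M]) blast
 define N where "N = real DIM('a)"
 have N1: "N \<ge> 1" using DIM_positive[where 'a='a] by (simp add: N_def)
 show ?thesis
 proof (rule that[of "N ^ M * C"])
  show "N ^ M * C \<ge> 0" using N1 C(1) by simp
  fix h :: real and y w w' :: 'a and a :: "'a \<Rightarrow> complex" and B
  assume h: "0 < h" "h \<le> 1" and y: "cball y h \<subseteq> cball 0 R" and w: "w \<in> cball 0 R" "w' \<in> cball 0 R"
   and a: "\<And>b. b \<in> Basis \<Longrightarrow> symb h {b} (cball y h) B M a" "\<And>x. x \<notin> cball y h \<Longrightarrow> a x = 0"
   and B: "continuous_on UNIV B" "\<And>x. 0 \<le> B x"
  define D where "D = G (y, w) - G (y, w')"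
  define I where "I = norm (LI x. expi ((S (x, w) - S (x, w')) / h\<^sup>2) * a x)"
  define J where "J = (LI x. indicator (cball y h) x * B x)"
  have "\<exists>b\<in>Basis. norm D \<le> N * \<bar>D \<bullet> b\<bar>"
  proof (rule ccontr)
   assume "\<not> ?thesis"
   then have "\<bar>D \<bullet> b\<bar> < norm D / N" if "b \<in> Basis" for b
    using that N1 by (auto simp: less_divide_eq mult.commute not_le)
   then have "(\<Sum>b\<in>Basis. \<bar>D \<bullet> b\<bar>) < real (card (Basis :: 'a set)) * (norm D / N)"
    by (intro sum_bounded_above_strict) (auto simp: DIM_positive)
   also have "\<dots> = norm D" using N1 by (simp add: N_def)
   finally show False using norm_le_l1[of D] by simp
  qed
  then obtain b where b: "b \<in> Basis" "norm D \<le> N * \<bar>D \<bullet> b\<bar>" by blast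
  have "1 + norm D / h \<le> N * (1 + \<bar>D \<bullet> b\<bar> / h)"
   using divide_right_mono[OF b(2), of h] N1 h(1) by (simp add: distrib_left)
  then have "(1 + norm D / h) ^ M \<le> (N * (1 + \<bar>D \<bullet> b\<bar> / h)) ^ M" using h(1) by (intro power_mono) auto
  then have "(1 + norm D / h) ^ M * I \<le> (N * (1 + \<bar>D \<bullet> b\<bar> / h)) ^ M * I"
   by (rule mult_right_mono) (simp add: I_def)
  also have "\<dots> = N ^ M * ((1 + \<bar>D \<bullet> b\<bar> / h) ^ M * I)" by (simp only: power_mult_distrib mult.assoc)
  also have "(1 + \<bar>D \<bullet> b\<bar> / h) ^ M * I \<le> C * J"
   using C(2)[OF h b(1) y w a(1)[OF b(1)] a(2) B] G[OF b(1)] by (simp add: D_def I_def J_def inner_diff_left)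
  finally have le: "(1 + norm D / h) ^ M * I \<le> N ^ M * (C * J)" using N1 by simp
  have pos: "(1 + norm D / h) ^ M > 0" using h(1) by (simp add: add_pos_nonneg)
  have "I \<le> N ^ M * (C * J) * inverse ((1 + norm D / h) ^ M)"
   using le pos by (simp only: divide_inverse[symmetric] pos_le_divide_eq mult.commute)
  then show "I \<le> N ^ M * C * inverse ((1 + norm (G (y, w) - G (y, w')) / h) ^ M) * J"
   by (simp only: D_def mult_ac)
 qed
qed

context damped_oscillation
begin

section \<open>Decay of integrals and cell sums, and the weighted L2 bound for one packet\<close>

lemma gx_grad_x: "b \<in> Basis \<Longrightarrow> grad_x S q \<bullet> b = FD S q (b, 0)"
 by (auto simp: grad_x_def Basis_vec_def inner_axis)

lemma grad_theta_inner: "b \<in> Basis \<Longrightarrow> grad_theta S q \<bullet> b = FD S q (0, b)"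
 by (auto simp: grad_theta_def Basis_vec_def inner_axis)

lemma continuous_grads: "continuous_on UNIV (\<lambda>t. grad_x S (y, t))" "continuous_on UNIV (\<lambda>x. grad_theta S (x, w))"
 by (intro continuous_on_compose2[OF smooth_on_continuous[OF grad_x_smooth]]
   continuous_on_compose2[OF smooth_on_continuous[OF grad_theta_smooth]] continuous_intros; auto)+

lemma swap_phase: "smooth_on UNIV (\<lambda>q. S (prod.swap q))"
 "b \<in> Basis \<Longrightarrow> grad_theta S (prod.swap q) \<bullet> b = FD (\<lambda>q. S (prod.swap q)) q (b, 0)"
proof -
 have bl: "bounded_linear (prod.swap :: (real^'n) \<times> (real^'n) \<Rightarrow> _)"
  unfolding prod.swap_def by (intro bounded_linear_Pair bounded_linear_fst bounded_linear_snd)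
 show "smooth_on UNIV (\<lambda>q. S (prod.swap q))"
  by (rule smooth_on_compose_linear[OF bl S_smooth])
 assume b: "b \<in> Basis"
 have "(S has_derivative FD S (prod.swap q)) (at (prod.swap q))"
  by (rule smooth_on_has_derivative[OF S_smooth]) simp
 from has_derivative_compose[OF bounded_linear_imp_has_derivative[OF bl] this]
 have "FD (\<lambda>q. S (prod.swap q)) q = (\<lambda>v. FD S (prod.swap q) (prod.swap v))"
  by (rule frechet_derivative_at[symmetric])
 then show "grad_theta S (prod.swap q) \<bullet> b = FD (\<lambda>q. S (prod.swap q)) q (b, 0)"
  using grad_theta_inner[OF b] by simp
qed

definition zeta where "zeta = (\<Sum>k. inverse (real (Suc k) ^ 2))"

lemma zeta_pos: "zeta > 0"
proof -
 have "summable (\<lambda>k. inverse (real k ^ 2))" using inverse_power_summable[of 2, where ?'a = real] by simp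
 then have "summable (\<lambda>k. inverse (real (Suc k) ^ 2))" by (subst summable_Suc_iff)
 then show ?thesis unfolding zeta_def by (rule suminf_pos) simp
qed

lemma decay_t:
 assumes "0 < h" "h \<le> 1" "norm w \<le> R"
 shows "(NN x. ennreal (wt h x w) * indicator (cball 0 R) x *
   ennreal (inverse ((1 + norm (grad_theta S (x, w) - \<xi>) / h) ^ (CARD('n) + 2)))) \<le> ennreal (CR * zeta * h ^ CARD('n))"
 unfolding zeta_def
proof (rule decay_from_sublevel)
 show "(\<lambda>x. wt h x w) \<in> borel_measurable borel" by (rule borel_measurable_continuous_onI[OF wt_continuous(1)])
 show "(\<lambda>x. grad_theta S (x, w)) \<in> borel_measurable borel" by (rule borel_measurable_continuous_onI[OF continuous_grads(2)])
 show "(NN t. ennreal (wt h t w) * indicator {t \<in> cball 0 R. norm (grad_theta S (t, w) - \<xi>) \<le> r} t) \<le> ennreal (CR * r ^ CARD('n))"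
  if "h \<le> r" for r
  using sublevel_t[of w h r \<xi>] assms that by (simp add: wt_def Delta_def R_def)
qed (use assms CLR in auto)

lemma decay_x:
 assumes "0 < h" "h \<le> 1" "norm y \<le> R"
 shows "(NN t. ennreal (wt h y t) * indicator (cball 0 R) t *
   ennreal (inverse ((1 + norm (grad_x S (y, t) - \<xi>) / h) ^ (CARD('n) + 2)))) \<le> ennreal (CL * zeta * h ^ CARD('n))"
 unfolding zeta_def
proof (rule decay_from_sublevel)
 show "(\<lambda>t. wt h y t) \<in> borel_measurable borel" by (rule borel_measurable_continuous_onI[OF wt_continuous(2)])
 show "(\<lambda>t. grad_x S (y, t)) \<in> borel_measurable borel" by (rule borel_measurable_continuous_onI[OF continuous_grads(1)])
 show "(NN t. ennreal (wt h y t) * indicator {t \<in> cball 0 R. norm (grad_x S (y, t) - \<xi>) \<le> r} t) \<le> ennreal (CL * r ^ CARD('n))"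
  if "h \<le> r" for r
  using sublevel_x[of y h r \<xi>] assms that by (simp add: wt_def Delta_def R_def)
qed (use assms CLR in auto)

text \<open>A discrete form of \<open>decay_x\<close>: passing from a point of a cell to its corner
  changes the gradient by O(h) and hence the weight and the decay factor by bounded factors
  only.\<close>

lemma sum_cells_decay:
 obtains C where "C \<ge> 0" "\<And>h y \<xi>. \<lbrakk>0 < h; h \<le> 1; norm y \<le> R\<rbrakk> \<Longrightarrow>
  (\<Sum>w\<in>cell (h / (2 * real CARD('n))) ` cball 0 R0. wt h y w * inverse ((1 + norm (grad_x S (y, w) - \<xi>) / h) ^ (CARD('n) + 2))) \<le> C"
proof -
 obtain C0 where C0: "C0 \<ge> 1"
  "\<And>h x t x' t'. \<lbrakk>0 < h; norm x \<le> R; norm t \<le> R; norm x' \<le> R; norm t' \<le> R;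
   norm ((x, t) - (x', t')) \<le> h\<rbrakk> \<Longrightarrow> wt h x t \<le> C0 * wt h x' t'"
  using wt_comparable by blast
 obtain L where L: "L \<ge> 0" "\<And>q q'. q \<in> box \<Longrightarrow> q' \<in> box \<Longrightarrow> norm (grad_x S q - grad_x S q') \<le> L * norm (q - q')"
  by (rule smooth_lipschitz[OF grad_x_smooth box_props]) blast
 define A where "A = C0 * (1 + L) ^ (CARD('n) + 2)"
 have A: "A \<ge> 0" using C0(1) L(1) by (simp add: A_def)
 define C where "C = A * (CL * zeta) * (2 * real CARD('n)) ^ CARD('n)"
 have C: "C \<ge> 0" using A CLR zeta_pos by (simp add: C_def)
 show ?thesis
 proof (rule that[OF C])
  fix h :: real and y \<xi> :: "real^'n" assume h: "0 < h" "h \<le> 1" and y: "norm y \<le> R"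
  \<comment> \<open>A point of a cube of side \<open>\<delta>\<close> is within n times
    \<open>\<delta>\<close> of its corner, which is \<open>h / 2\<close> for this choice.\<close>
  define \<delta> where "\<delta> = h / (2 * real CARD('n))"
  have \<delta>: "\<delta> > 0" using h by (simp add: \<delta>_def)
  define W where "W = cell \<delta> ` (cball 0 R0 :: (real^'n) set)"
  define K where "K w = inverse ((1 + norm (grad_x S (y, w) - \<xi>) / h) ^ (CARD('n) + 2))" for w
  have K0: "K w \<ge> 0" for w using h by (simp add: K_def)
  define F where "F w = ennreal (wt h y w * K w)" for w
  define H where "H t = ennreal A * (ennreal (wt h y t) * indicator (cball 0 R) t * ennreal (K t))" for t
  have cd: "norm (t - cell \<delta> t) \<le> h / 2" for t :: "real^'n"
   using cell_dist[OF \<delta>, of t] h by (simp add: \<delta>_def field_simps)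
  have KH: "K \<in> borel_measurable borel" unfolding K_def
   using borel_measurable_continuous_onI[OF continuous_grads(1), of y] by measurable
  have cb [measurable]: "cball 0 R \<in> sets (borel :: (real^'n) measure)" by simp
  note [measurable] = measurable_compose[OF KH measurable_ennreal] borel_measurable_continuous_onI[OF wt_continuous(2), of h y]
  have "ennreal (\<delta> ^ DIM(real^'n)) * (\<Sum>w\<in>cell \<delta> ` cball 0 R0. F w) \<le> (NN t. H t)"
  proof (rule sum_cells_le[OF \<delta> finite_cells[OF \<delta>]])
   show "H \<in> borel_measurable borel" unfolding H_def
    by measurable
   fix t assume "cell \<delta> t \<in> cell \<delta> ` (cball 0 R0 :: (real^'n) set)"
   then obtain s where s: "cell \<delta> t = cell \<delta> s" "norm s \<le> R0" by auto
   define w where "w = cell \<delta> t"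
   have w1: "norm (t - w) \<le> h / 2" using cd by (simp add: w_def)
   have w2: "norm (s - w) \<le> h / 2" using cd[of s] s(1) by (simp add: w_def)
   have nw: "norm w \<le> R0 + 1" using norm_triangle_ineq4[of s "s - w"] w2 s(2) h by simp
   have nt: "norm t \<le> R" using norm_triangle_ineq[of w "t - w"] w1 nw h by (simp add: R_def)
   have nwR: "norm w \<le> R" using nw by (simp add: R_def)
   have d: "norm ((y, w) - (y, t)) = norm (t - w)" by (simp add: norm_Pair norm_minus_commute)
   have wt: "wt h y w \<le> C0 * wt h y t" by (rule C0(2)[OF h(1) y nwR y nt]) (use d w1 h in simp)
   have "norm (grad_x S (y, t) - grad_x S (y, w)) \<le> L * norm ((y, t) - (y, w))"
    by (rule L(2)) (use y nt nwR in \<open>auto simp: box_def\<close>)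
   also have "\<dots> \<le> L * h" using d w1 h L(1) by (intro mult_left_mono) (auto simp: norm_minus_commute)
   finally have "norm (grad_x S (y, t) - \<xi>) \<le> norm (grad_x S (y, w) - \<xi>) + L * h"
    using norm_triangle_ineq[of "grad_x S (y, t) - grad_x S (y, w)" "grad_x S (y, w) - \<xi>"] by simp
   then have "norm (grad_x S (y, t) - \<xi>) / h \<le> norm (grad_x S (y, w) - \<xi>) / h + L"
    using h by (simp add: field_simps)
   moreover have "0 \<le> L * (norm (grad_x S (y, w) - \<xi>) / h)" using L(1) h by simp
   ultimately have "1 + norm (grad_x S (y, t) - \<xi>) / h \<le> (1 + L) * (1 + norm (grad_x S (y, w) - \<xi>) / h)"
    by (simp add: algebra_simps add_divide_distrib)
   then have "(1 + norm (grad_x S (y, t) - \<xi>) / h) ^ (CARD('n) + 2) \<le> ((1 + L) * (1 + norm (grad_x S (y, w) - \<xi>) / h)) ^ (CARD('n) + 2)"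
    using h by (intro power_mono) auto
   then have *: "(1 + norm (grad_x S (y, t) - \<xi>) / h) ^ (CARD('n) + 2) \<le> (1 + L) ^ (CARD('n) + 2) * (1 + norm (grad_x S (y, w) - \<xi>) / h) ^ (CARD('n) + 2)"
    by (simp only: power_mult_distrib)
   have p: "(1 + norm (grad_x S (y, t) - \<xi>) / h) ^ (CARD('n) + 2) > 0" "(1 + norm (grad_x S (y, w) - \<xi>) / h) ^ (CARD('n) + 2) > 0"
    using h by (simp_all add: add_pos_nonneg)
   have "K w \<le> (1 + L) ^ (CARD('n) + 2) * K t"
    unfolding K_def using * p by (simp only: divide_inverse[symmetric] inverse_eq_divide pos_divide_le_eq times_divide_eq_right mult_1_right times_divide_eq_left pos_le_divide_eq mult_1_left)
   then have "wt h y w * K w \<le> (C0 * wt h y t) * ((1 + L) ^ (CARD('n) + 2) * K t)"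
    using wt wt_pos[OF h(1), of y w] K0 C0(1) wt_pos[OF h(1), of y t] by (intro mult_mono) auto
   also have "\<dots> = A * (wt h y t * K t)" by (simp add: A_def mult_ac)
   finally have "F w \<le> ennreal (A * (wt h y t * K t))" unfolding F_def by (rule ennreal_leI)
   also have "\<dots> = H t" using A K0 wt_pos[OF h(1), of y t] nt by (simp add: H_def ennreal_mult)
   finally show "F (cell \<delta> t) \<le> H t" by (simp add: w_def)
  qed
  also have "(NN t. H t) = ennreal A * (NN t. ennreal (wt h y t) * indicator (cball 0 R) t * ennreal (K t))"
   unfolding H_def by (intro nn_integral_cmult) measurable
  also have "\<dots> \<le> ennreal A * ennreal (CL * zeta * h ^ CARD('n))"
   unfolding K_def by (intro mult_left_mono decay_x h y) auto
  also have "(\<Sum>w\<in>cell \<delta> ` cball 0 R0. F w) = ennreal (\<Sum>w\<in>W. wt h y w * K w)"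
   unfolding F_def W_def using wt_pos[OF h(1), of y] K0 by (intro sum_ennreal) (simp add: less_imp_le)
  finally have "ennreal (\<delta> ^ CARD('n) * (\<Sum>w\<in>W. wt h y w * K w)) \<le> ennreal (A * (CL * zeta * h ^ CARD('n)))"
   using \<delta> A by (simp add: ennreal_mult')
  then have "\<delta> ^ CARD('n) * (\<Sum>w\<in>W. wt h y w * K w) \<le> A * (CL * zeta * h ^ CARD('n))"
   using A CLR zeta_pos h by (subst (asm) ennreal_le_iff) auto
  also have "A * (CL * zeta * h ^ CARD('n)) = \<delta> ^ CARD('n) * C"
  proof -
   have "h = \<delta> * (2 * real CARD('n))" by (simp add: \<delta>_def)
   then have e: "h ^ CARD('n) = \<delta> ^ CARD('n) * (2 * real CARD('n)) ^ CARD('n)" by (simp only: power_mult_distrib)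
   show ?thesis by (simp only: C_def e mult_ac)
  qed
  finally have "(\<Sum>w\<in>W. wt h y w * K w) \<le> C" using \<delta> by simp
  then show "(\<Sum>w\<in>cell (h / (2 * real CARD('n))) ` cball 0 R0. wt h y w * inverse ((1 + norm (grad_x S (y, w) - \<xi>) / h) ^ (CARD('n) + 2))) \<le> C"
   by (simp add: W_def K_def \<delta>_def)
 qed
qed


lemma Fop_continuous:
 assumes "0 < h" "h \<le> 1" "b \<in> Basis" "norm w \<le> R0 + 1"
  and u: "u \<in> borel_measurable borel" "\<And>t. norm (u t) \<le> Mu" "compact Y" "\<And>t. t \<notin> Y \<Longrightarrow> u t = 0"
 shows "continuous_on UNIV (Fop h b w i u)"
 unfolding Fop_def[abs_def] by (rule integral_param_continuous[OF ker_continuous[OF assms(1-4)] u])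

lemma Fop_has_ddir:
 assumes "0 < h" "h \<le> 1" "b \<in> Basis" "norm w \<le> R0 + 1"
  and u: "u \<in> borel_measurable borel" "\<And>t. norm (u t) \<le> Mu" "compact Y" "\<And>t. t \<notin> Y \<Longrightarrow> u t = 0"
 shows "has_ddir b (Fop h b w i u) (\<lambda>x. Fop h b w (Suc i) u x /\<^sub>R h)"
proof -
 have "has_ddir b (\<lambda>x. (LI t. ker h b w i (x, t) * u t)) (\<lambda>x. (LI t. (ker h b w (Suc i) (x, t) /\<^sub>R h) * u t))"
  by (rule integral_has_ddir[OF ker_has_ddir[OF assms(1-4)] ker_continuous[OF assms(1-4)] _ u])
   (intro continuous_intros ker_continuous assms(1-4))
 moreover have "(LI t. (ker h b w (Suc i) (x, t) /\<^sub>R h) * u t) = Fop h b w (Suc i) u x /\<^sub>R h" for x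
  unfolding Fop_def by (simp only: mult_scaleR_left integral_scaleR_right)
 ultimately show ?thesis by (simp add: Fop_def[abs_def])
qed

lemma Fop_eq_0:
 assumes "0 < h" "h \<le> 1" "b \<in> Basis" "norm w \<le> R0 + 1" "norm x > R0"
 shows "Fop h b w i u x = 0"
proof -
 have "ker h b w i (x, t) = 0" for t by (rule ker_eq_0[OF assms(1-4)]) (use assms(5) in simp)
 then show ?thesis by (simp add: Fop_def)
qed

lemma integral_indicator_cball_const:
 fixes y :: "'a::euclidean_space"
 shows "0 \<le> h \<Longrightarrow> (LI x. indicator (cball y h) x * k) = unit_ball_vol (DIM('a)) * h ^ DIM('a) * k"
 by (simp add: content_cball)

text \<open>The integration variable is t, so the phase is used with its arguments swapped. The
  terms frozen at \<open>w\<close> are constant in t and contribute a factor of modulus one. Each of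
  the two amplitudes brings its own factor \<open>wt\<close>.\<close>

lemma kernel_TT_bound:
 obtains C where "C \<ge> 0"
  "\<And>h b w x x'. \<lbrakk>0 < h; h \<le> 1; b \<in> Basis; norm w \<le> R0 + 1; norm x \<le> R0; norm x' \<le> R0\<rbrakk> \<Longrightarrow>
   norm (LI t. ker h b w i (x, t) * cnj (ker h b w i (x', t)) * complex_of_real (bump w h (Suc (CARD('n) + 2)) t))
   \<le> C * h ^ CARD('n) * wt h x w * (wt h x' w * inverse ((1 + norm (grad_theta S (x', w) - grad_theta S (x, w)) / h) ^ (CARD('n) + 2)))"
proof -
 define M where "M = CARD('n) + 2"
 obtain C1 where C1: "C1 \<ge> 0" "\<And>h y w w' a B. \<lbrakk>0 < h; h \<le> 1; cball y h \<subseteq> cball 0 R;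
   w \<in> cball 0 R; w' \<in> cball 0 R; (\<And>b. b \<in> Basis \<Longrightarrow> symb h {b} (cball y h) B M a);
   (\<And>x. x \<notin> cball y h \<Longrightarrow> a x = 0); continuous_on UNIV B; (\<And>x. 0 \<le> B x)\<rbrakk> \<Longrightarrow>
   norm (LI x. expi ((S (prod.swap (x, w)) - S (prod.swap (x, w'))) / h\<^sup>2) * a x)
   \<le> C1 * inverse ((1 + norm (grad_theta S (prod.swap (y, w)) - grad_theta S (prod.swap (y, w'))) / h) ^ M) * (LI x. indicator (cball y h) x * B x)"
  using osc_estimate[OF swap_phase(1), of "\<lambda>q. grad_theta S (prod.swap q)" R M, OF swap_phase(2)] by blast
 obtain Ca where Ca: "Ca \<ge> 0" "\<And>h b w. \<lbrakk>0 < h; h \<le> 1; b \<in> Basis; norm w \<le> R0 + 1\<rbrakk> \<Longrightarrow>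
  symb h Basis (Xw h w) (\<lambda>q. Ca * wt h (fst q) w) M (amp h b w i)" using amp_symb[of M i] by blast
 define Cb where "Cb = 2 ^ M * (2 ^ M * (Ca * Ca) * bump_const M)"
 have Cb: "Cb \<ge> 0" using Ca(1) bump_const_ge_1[of M] by (simp add: Cb_def)
 define V where "V = unit_ball_vol (CARD('n))"
 have V: "V \<ge> 0" by (simp add: V_def unit_ball_vol_nonneg)
 show ?thesis
 proof (rule that[of "C1 * V * Cb"])
  show "0 \<le> C1 * V * Cb" using C1(1) V Cb by simp
  fix h :: real and b w x x' :: "real^'n"
  assume h: "0 < h" "h \<le> 1" and b: "b \<in> Basis" and w: "norm w \<le> R0 + 1" and x: "norm x \<le> R0" "norm x' \<le> R0"
  define a where "a t = amp h b w i (x, t) * cnj (amp h b w i (x', t)) * complex_of_real (bump w h (Suc M) t)" for t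
  have slice: "symb h Basis (cball w h) (\<lambda>_. Ca * wt h x w) M (\<lambda>t. amp h b w i (x, t))" if "norm x \<le> R0" for x
  proof -
   have "symb h Basis (cball w h) (\<lambda>_. Ca * wt h x w) M (\<lambda>t. amp h b w i ((0, t) + (x, 0)))"
   proof (rule symb_affine[OF _ _ _ _ _ _ Ca(2)[OF h b w]])
    show "linear (\<lambda>t::real^'n. (0::real^'n, t))" by (auto intro!: linearI)
    show "continuous_on UNIV (\<lambda>t::real^'n. (0::real^'n, t))" by (intro continuous_intros)
    show "(0, v) \<in> Basis \<or> (0, v) = (0::(real^'n) \<times> (real^'n))" if "v \<in> Basis" for v :: "real^'n"
     using that by (simp add: Basis_prod_def)
    show "(0, t) + (x, 0) \<in> Xw h w" if "t \<in> cball w h" for t using that \<open>norm x \<le> R0\<close> by (simp add: Xw_def R_def)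
    show "0 \<le> Ca * wt h x w" using Ca(1) wt_pos[OF h(1), of x w] by simp
   qed simp
   then show ?thesis by simp
  qed
  have "symb h Basis (cball w h) (\<lambda>_. 2 ^ M * (2 ^ M * ((Ca * wt h x w) * (Ca * wt h x' w)) * bump_const M)) M a"
   unfolding a_def by (intro symb_mult symb_cnj slice x symb_bump h) simp
  then have sa: "symb h {b'} (cball w h) (\<lambda>_. Cb * (wt h x w * wt h x' w)) M a" if "b' \<in> Basis" for b'
   by (rule symb_weaken) (use that in \<open>auto simp: Cb_def\<close>)
  define I where "I = (LI t. expi ((S (prod.swap (t, x)) - S (prod.swap (t, x'))) / h\<^sup>2) * a t)"
  have "norm I \<le> C1 * inverse ((1 + norm (grad_theta S (prod.swap (w, x)) - grad_theta S (prod.swap (w, x'))) / h) ^ M) *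
   (LI t. indicator (cball w h) t * (Cb * (wt h x w * wt h x' w)))"
   unfolding I_def
  proof (rule C1(2)[OF h _ _ _ sa])
   show "cball w h \<subseteq> cball 0 R"
   proof
    fix t assume "t \<in> cball w h"
    then show "t \<in> cball 0 R" using norm_triangle_ineq[of w "t - w"] w h by (simp add: R_def dist_norm norm_minus_commute)
   qed
   show "a t = 0" if "t \<notin> cball w h" for t using bump_eq_0[OF h(1) zero_less_Suc that] by (simp add: a_def)
  qed (use x Cb wt_pos[OF h(1)] in \<open>auto simp: R_def less_imp_le\<close>)
  also have "(LI t. indicator (cball w h) t * (Cb * (wt h x w * wt h x' w))) = V * h ^ CARD('n) * (Cb * (wt h x w * wt h x' w))"
   using integral_indicator_cball_const[of h w "Cb * (wt h x w * wt h x' w)"] h by (simp add: V_def)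
  finally have "norm I \<le> C1 * inverse ((1 + norm (grad_theta S (x', w) - grad_theta S (x, w)) / h) ^ M) *
   (V * h ^ CARD('n) * (Cb * (wt h x w * wt h x' w)))" by (simp add: norm_minus_commute)
  also have "\<dots> = C1 * V * Cb * h ^ CARD('n) * wt h x w * (wt h x' w * inverse ((1 + norm (grad_theta S (x', w) - grad_theta S (x, w)) / h) ^ M))"
   by (simp only: mult_ac)
  finally have bound: "norm I \<le> \<dots>" .
  define \<gamma> where "\<gamma> = expi ((S (x', w) - S (x, w)) / h\<^sup>2)"
  have "ker h b w i (x, t) * cnj (ker h b w i (x', t)) * complex_of_real (bump w h (Suc M) t)
   = \<gamma> * (expi ((S (prod.swap (t, x)) - S (prod.swap (t, x'))) / h\<^sup>2) * a t)" for t
  proof -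
   have e: "expi p * cnj (expi q) = expi r * expi s"
    if "p - q = r + s" for p q r s
   proof -
    have "expi p * cnj (expi q) = expi (p - q)"
     by (simp add: exp_cnj exp_add[symmetric] algebra_simps)
    then show ?thesis by (simp add: that exp_add[symmetric] algebra_simps)
   qed
   have "ph h w (x, t) - ph h w (x', t) = (S (x', w) - S (x, w)) / h\<^sup>2 + (S (prod.swap (t, x)) - S (prod.swap (t, x'))) / h\<^sup>2"
    by (simp add: ph_def diff_divide_distrib)
   from e[OF this] have e': "expi (ph h w (x, t)) * cnj (expi (ph h w (x', t)))
    = \<gamma> * expi ((S (prod.swap (t, x)) - S (prod.swap (t, x'))) / h\<^sup>2)" by (simp only: \<gamma>_def)
   have "ker h b w i (x, t) * cnj (ker h b w i (x', t)) * complex_of_real (bump w h (Suc M) t)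
    = (expi (ph h w (x, t)) * cnj (expi (ph h w (x', t)))) * a t"
    by (simp only: ker_def a_def complex_cnj_mult mult_ac)
   then show ?thesis by (simp only: e' mult.assoc)
  qed
  then have "(LI t. ker h b w i (x, t) * cnj (ker h b w i (x', t)) * complex_of_real (bump w h (Suc M) t)) = \<gamma> * I"
   unfolding I_def by (simp only: integral_mult_right_zero)
  moreover have "norm \<gamma> = 1" by (simp add: \<gamma>_def)
  ultimately show "norm (LI t. ker h b w i (x, t) * cnj (ker h b w i (x', t)) * complex_of_real (bump w h (Suc (CARD('n) + 2)) t))
   \<le> C1 * V * Cb * h ^ CARD('n) * wt h x w * (wt h x' w * inverse ((1 + norm (grad_theta S (x', w) - grad_theta S (x, w)) / h) ^ (CARD('n) + 2)))"
   using bound by (simp only: M_def norm_mult mult_1_left)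
 qed
qed

text \<open>Of the two weights in the kernel bound, the one at x' is integrated against the decay by
  \<open>decay_t\<close>, and the one at x becomes the weight in Schur's test. One factor h^n comes
  from the ball in t, the other from the integral over x'.\<close>

lemma Fop_L2:
 obtains C where "C > 0"
  "\<And>h b w u Mu. \<lbrakk>0 < h; h \<le> 1; b \<in> Basis; norm w \<le> R0 + 1; u \<in> borel_measurable borel;
   (\<And>t. norm (u t) \<le> Mu); (\<And>t. u t \<noteq> 0 \<Longrightarrow> norm (t - w) \<le> h / 2)\<rbrakk> \<Longrightarrow>
   (LI x. (norm (Fop h b w i u x))\<^sup>2 / wt h x w) \<le> C * h ^ (2 * CARD('n)) * (LI t. (norm (u t))\<^sup>2)"
proof -
 define M where "M = CARD('n) + 2"
 obtain C where C: "C \<ge> 0"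
  "\<And>h b w x x'. \<lbrakk>0 < h; h \<le> 1; b \<in> Basis; norm w \<le> R0 + 1; norm x \<le> R0; norm x' \<le> R0\<rbrakk> \<Longrightarrow>
   norm (LI t. ker h b w i (x, t) * cnj (ker h b w i (x', t)) * complex_of_real (bump w h (Suc M) t))
   \<le> C * h ^ CARD('n) * wt h x w * (wt h x' w * inverse ((1 + norm (grad_theta S (x', w) - grad_theta S (x, w)) / h) ^ M))"
  unfolding M_def by (rule kernel_TT_bound[of i]) blast
 \<comment> \<open>A lower bound for the cut-off on half of its radius, where \<open>u\<close> is
   supported.\<close>
 define c0 :: real where "c0 = (3/4) ^ Suc M"
 have c0: "c0 > 0" by (simp add: c0_def)
 define C' where "C' = C * (CR * zeta) + 1"
 have C': "C' > 0" using C(1) CLR zeta_pos by (simp add: C'_def add_nonneg_pos)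
 show ?thesis
 proof (rule that[of "C' / c0"])
  show "C' / c0 > 0" using C' c0 by simp
  fix h :: real and b w :: "real^'n" and u Mu
  assume h: "0 < h" "h \<le> 1" and b: "b \<in> Basis" and w: "norm w \<le> R0 + 1" and u: "u \<in> borel_measurable borel"
   "\<And>t. norm (u t) \<le> (Mu::real)" "\<And>t. u t \<noteq> (0::complex) \<Longrightarrow> norm (t - w) \<le> h / 2"
  have "(LI x. (norm (LI t. ker h b w i (x, t) * u t))\<^sup>2 / wt h x w) \<le> ((C' * h ^ (2 * CARD('n))) / c0) * (LI t. (norm (u t))\<^sup>2)"
  proof (rule schur_TT_star[where X = "cball 0 R0" and Y = "cball w h" and \<kappa> = "bump w h (Suc M)"])
   show "continuous_on UNIV (ker h b w i)" by (rule ker_continuous[OF h b w])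
   show "ker h b w i (x, t) = 0" if "x \<notin> cball 0 R0" for x t
    by (rule ker_eq_0[OF h b w]) (use that in auto)
   show "bump w h (Suc M) \<in> borel_measurable borel" by (rule borel_measurable_continuous_onI[OF continuous_bump])
   show "bump w h (Suc M) t = 0" if "t \<notin> cball w h" for t by (rule bump_eq_0[OF h(1) zero_less_Suc that])
   show "c0 \<le> bump w h (Suc M) t" if "u t \<noteq> 0" for t unfolding c0_def by (rule bump_lower[OF h(1) u(3)[OF that]])
   show "0 < C' * h ^ (2 * CARD('n))" using C' h by simp
   fix x :: "real^'n" assume "x \<in> cball 0 R0"
   then have x: "norm x \<le> R0" by simp
   define \<xi> where "\<xi> = grad_theta S (x, w)"
   define A where "A = C * h ^ CARD('n) * wt h x w"
   have A: "A \<ge> 0" using C(1) h wt_pos[OF h(1), of x w] by (simp add: A_def)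
   define I where "I x' = norm (LI t. ker h b w i (x, t) * cnj (ker h b w i (x', t)) * complex_of_real (bump w h (Suc M) t))" for x'
   have bd: "I x' \<le> A * (wt h x' w * indicator (cball 0 R) x' * inverse ((1 + norm (grad_theta S (x', w) - \<xi>) / h) ^ M))" for x'
   proof (cases "norm x' \<le> R0")
    case True
    then show ?thesis using C(2)[OF h b w x True] by (simp add: I_def A_def \<xi>_def R_def)
   next
    case False
    then have "ker h b w i (x', t) = 0" for t by (intro ker_eq_0[OF h b w]) simp
    then have "I x' = 0" by (simp add: I_def)
    moreover have "0 \<le> A * (wt h x' w * indicator (cball 0 R) x' * inverse ((1 + norm (grad_theta S (x', w) - \<xi>) / h) ^ M))"
     using A wt_pos[OF h(1), of x' w] h by (intro mult_nonneg_nonneg) auto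
    ultimately show ?thesis by simp
   qed
   have "(NN x'. ennreal (I x')) \<le> (NN x'. ennreal A * (ennreal (wt h x' w) * indicator (cball 0 R) x' * ennreal (inverse ((1 + norm (grad_theta S (x', w) - \<xi>) / h) ^ M))))"
   proof (rule nn_integral_mono)
    fix x'
    have "ennreal (I x') \<le> ennreal (A * (wt h x' w * indicator (cball 0 R) x' * inverse ((1 + norm (grad_theta S (x', w) - \<xi>) / h) ^ M)))"
     by (rule ennreal_leI[OF bd])
    also have "\<dots> = ennreal A * (ennreal (wt h x' w) * indicator (cball 0 R) x' * ennreal (inverse ((1 + norm (grad_theta S (x', w) - \<xi>) / h) ^ M)))"
     using A wt_pos[OF h(1), of x' w] h by (simp add: ennreal_mult' ennreal_indicator[symmetric] less_imp_le)
    finally show "ennreal (I x') \<le> \<dots>" .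
   qed
   also have "\<dots> = ennreal A * (NN x'. ennreal (wt h x' w) * indicator (cball 0 R) x' * ennreal (inverse ((1 + norm (grad_theta S (x', w) - \<xi>) / h) ^ M)))"
   proof (rule nn_integral_cmult)
    note [measurable] = borel_measurable_continuous_onI[OF wt_continuous(1), of h w] borel_measurable_continuous_onI[OF continuous_grads(2), of w]
    have [measurable]: "cball 0 R \<in> sets (borel :: (real^'n) measure)" by simp
    show "(\<lambda>x'. ennreal (wt h x' w) * indicator (cball 0 R) x' * ennreal (inverse ((1 + norm (grad_theta S (x', w) - \<xi>) / h) ^ M))) \<in> borel_measurable lborel"
     by measurable
   qed
   also have "\<dots> \<le> ennreal A * ennreal (CR * zeta * h ^ CARD('n))"
    unfolding M_def using w by (intro mult_left_mono decay_t h) (auto simp: R_def)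
   also have "\<dots> = ennreal (A * (CR * zeta * h ^ CARD('n)))" using A by (simp add: ennreal_mult')
   finally have "(LI x'. I x') \<le> A * (CR * zeta * h ^ CARD('n))"
    by (rule integral_le_of_nn_integral) (use A CLR zeta_pos h in \<open>auto simp: I_def\<close>)
   also have "\<dots> = (C * (CR * zeta)) * (h ^ (2 * CARD('n)) * wt h x w)"
    by (simp only: A_def mult_2 power_add) (simp only: mult_ac)
   also have "\<dots> \<le> C' * (h ^ (2 * CARD('n)) * wt h x w)"
    using h wt_pos[OF h(1), of x w] by (intro mult_right_mono) (auto simp: C'_def)
   finally show "(LI x'. norm (LI t. ker h b w i (x, t) * cnj (ker h b w i (x', t)) * complex_of_real (bump w h (Suc M) t)))
    \<le> C' * h ^ (2 * CARD('n)) * wt h x w"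
    by (simp add: I_def mult.assoc)
  qed (use u wt_continuous(1) wt_pos[OF h(1)] bump_nonneg bump_le_1 c0 in auto)
  then show "(LI x. (norm (Fop h b w i u x))\<^sup>2 / wt h x w) \<le> C' / c0 * h ^ (2 * CARD('n)) * (LI t. (norm (u t))\<^sup>2)"
   by (simp add: Fop_def)
 qed
qed

end

text \<open>By symmetry of \<open>k\<close> both halves of the weighted AM-GM splitting have the
  same sum, and the row bound contains exactly the weight that this splitting produces.\<close>

lemma weighted_schur_sum:
 fixes k :: "'i \<Rightarrow> 'i \<Rightarrow> real"
 assumes \<beta>: "\<And>w. w \<in> W \<Longrightarrow> \<beta> w > 0" and Q: "\<And>w. w \<in> W \<Longrightarrow> Q w \<ge> 0" and k: "\<And>w w'. k w w' = k w' w"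
  and row: "\<And>w. w \<in> W \<Longrightarrow> (\<Sum>w'\<in>W. \<beta> w' * k w' w) \<le> C"
 shows "(\<Sum>w\<in>W. \<Sum>w'\<in>W. k w w' * ((\<beta> w' / \<beta> w * Q w + \<beta> w / \<beta> w' * Q w') / 2)) \<le> C * (\<Sum>w\<in>W. Q w / \<beta> w)"
proof -
 define X where "X = (\<Sum>w\<in>W. \<Sum>w'\<in>W. k w w' * (\<beta> w' / \<beta> w * Q w))"
 have "(\<Sum>w\<in>W. \<Sum>w'\<in>W. k w w' * (\<beta> w / \<beta> w' * Q w')) = (\<Sum>w'\<in>W. \<Sum>w\<in>W. k w w' * (\<beta> w / \<beta> w' * Q w'))"
  by (rule sum.swap)
 also have "\<dots> = X" unfolding X_def using k by simp
 finally have X2: "(\<Sum>w\<in>W. \<Sum>w'\<in>W. k w w' * (\<beta> w / \<beta> w' * Q w')) = X" .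
 have "(\<Sum>w\<in>W. \<Sum>w'\<in>W. k w w' * ((\<beta> w' / \<beta> w * Q w + \<beta> w / \<beta> w' * Q w') / 2))
  = (\<Sum>w\<in>W. \<Sum>w'\<in>W. k w w' * (\<beta> w' / \<beta> w * Q w) / 2 + k w w' * (\<beta> w / \<beta> w' * Q w') / 2)"
  by (simp only: distrib_left add_divide_distrib times_divide_eq_right)
 also have "\<dots> = X / 2 + (\<Sum>w\<in>W. \<Sum>w'\<in>W. k w w' * (\<beta> w / \<beta> w' * Q w')) / 2"
  by (simp only: sum.distrib sum_divide_distrib X_def)
 also have "\<dots> = X" unfolding X2 by simp
 also have "X = (\<Sum>w\<in>W. Q w / \<beta> w * (\<Sum>w'\<in>W. \<beta> w' * k w' w))"
  unfolding X_def sum_distrib_left by (intro sum.cong refl) (subst k, simp)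
 also have "\<dots> \<le> (\<Sum>w\<in>W. Q w / \<beta> w * C)"
  using \<beta> Q by (intro sum_mono mult_left_mono row) (auto intro: divide_nonneg_pos)
 finally show ?thesis by (simp add: sum_distrib_left mult.commute)
qed

lemma weighted_amgm:
 fixes a b p q :: real
 assumes "p > 0" "q > 0" shows "a * b \<le> (q / p * a\<^sup>2 + p / q * b\<^sup>2) / 2"
proof -
 have "0 \<le> (q * a - p * b)\<^sup>2 / (p * q)" using assms by simp
 also have "\<dots> = (q / p * a\<^sup>2 + p / q * b\<^sup>2) - 2 * (a * b)"
  using assms by (simp add: field_simps power2_eq_square)
 finally show ?thesis by simp
qed

context damped_oscillation
begin

section \<open>Almost orthogonality of the packets on balls of radius h\<close>

definition Top where "Top h u x = (LI t. expi (S (x, t) / h\<^sup>2) * \<psi> (x, t) * u t)"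
definition cells where "cells h = cell (h / (2 * real CARD('n))) ` (cball 0 R0 :: (real^'n) set)"
definition piece :: "real \<Rightarrow> (real^'n \<Rightarrow> complex) \<Rightarrow> real^'n \<Rightarrow> real^'n \<Rightarrow> complex" where
 "piece h u w t = (if cell (h / (2 * real CARD('n))) t = w then u t else 0)"
text \<open>A common pointwise majorant for the scaled derivatives of one packet, in every basis
  direction and up to order n + 2. It serves as bound function of a symbol, while its square still
  obeys the weighted L2 bound.\<close>

definition Bsum where "Bsum h u w x = (\<Sum>(b, i)\<in>Basis \<times> {..CARD('n) + 2}. norm (Fop h b w i (piece h u w) x))"

lemma finite_cells_h: "h > 0 \<Longrightarrow> finite (cells h)"
 unfolding cells_def by (rule finite_cells) simp

lemma cells_dist: "h > 0 \<Longrightarrow> norm (t - cell (h / (2 * real CARD('n))) t) \<le> h / 2" for t :: "real^'n"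
 using cell_dist[of "h / (2 * real CARD('n))" t] by simp

lemma cells_norm:
 assumes "0 < h" "h \<le> 1" "w \<in> cells h" shows "norm w \<le> R0 + 1"
proof -
 obtain t where "norm t \<le> R0" "w = cell (h / (2 * real CARD('n))) t" using assms(3) by (auto simp: cells_def)
 then show ?thesis using cells_dist[OF assms(1), of t] norm_triangle_ineq4[of t "t - w"] assms by simp
qed

lemma piece_props:
 assumes "h > 0" and u: "u \<in> borel_measurable borel" "\<And>t. norm (u t) \<le> Mu"
 shows "piece h u w \<in> borel_measurable borel" "norm (piece h u w t) \<le> Mu"
  "piece h u w t \<noteq> 0 \<Longrightarrow> norm (t - w) \<le> h / 2" "t \<notin> cball w h \<Longrightarrow> piece h u w t = 0"
proof -
 note [measurable] = u(1)
 show "piece h u w \<in> borel_measurable borel" unfolding piece_def[abs_def] by measurable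
 show "norm (piece h u w t) \<le> Mu" using u(2)[of t] norm_ge_zero[of "u t"] by (auto simp: piece_def simp del: norm_ge_zero)
 show *: "norm (t - w) \<le> h / 2" if "piece h u w t \<noteq> 0" using that cells_dist[OF assms(1), of t] by (auto simp: piece_def split: if_splits)
 show "piece h u w t = 0" if "t \<notin> cball w h" using * that assms(1) by (cases "piece h u w t = 0") (auto simp: dist_norm norm_minus_commute)
qed

lemma sum_piece:
 assumes "h > 0" "\<And>t. norm t > R0 \<Longrightarrow> u t = 0" shows "(\<Sum>w\<in>cells h. piece h u w t) = u t"
proof (cases "norm t \<le> R0")
 case True
 then have "cell (h / (2 * real CARD('n))) t \<in> cells h" by (auto simp: cells_def)
 then show ?thesis using finite_cells_h[OF assms(1)] by (simp add: piece_def sum.delta)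
next
 case False
 then have "u t = 0" using assms(2)[of t] by simp
 then have "piece h u w t = 0" for w by (simp add: piece_def)
 then show ?thesis using \<open>u t = 0\<close> by simp
qed

text \<open>The factors in front of the packets restore the phases at the corners that were split
  off in \<open>ph\<close>; they carry the oscillation in x that distinguishes different
  cells.\<close>

lemma Top_decomp:
 assumes h: "0 < h" "h \<le> 1" and b: "b \<in> Basis"
  and u: "u \<in> borel_measurable borel" "\<And>t. norm (u t) \<le> Mu" "\<And>t. norm t > R0 \<Longrightarrow> u t = 0"
 shows "Top h u x = (\<Sum>w\<in>cells h. expi (S (x, w) / h\<^sup>2) * Fop h b w 0 (piece h u w) x)"
proof -
 define k where "k t = expi (S (x, t) / h\<^sup>2) * \<psi> (x, t)" for t
 have kc: "continuous_on UNIV k" unfolding k_def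
  by (intro continuous_intros continuous_on_compose2[OF smooth_on_continuous[OF S_smooth]]
    continuous_on_compose2[OF smooth_on_continuous[OF psi_smooth]]) (use h in auto)
 have "bounded (k ` cball 0 R)"
  by (intro compact_imp_bounded compact_continuous_image continuous_on_subset[OF kc]) auto
 then obtain Ck where Ck: "\<And>t. t \<in> cball 0 R \<Longrightarrow> norm (k t) \<le> Ck" unfolding bounded_iff by blast
 note [measurable] = borel_measurable_continuous_onI[OF kc] u(1)
 have int: "integrable lborel (\<lambda>t. k t * piece h u w t)" if w: "w \<in> cells h" for w
 proof (rule integrable_bounded_compact_support[where X = "cball w h" and C = "Ck * Mu"])
  note [measurable] = piece_props(1)[OF h(1) u(1,2), of w]
  show "(\<lambda>t. k t * piece h u w t) \<in> borel_measurable borel" by measurable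
  fix t
  have Mu: "Mu \<ge> 0" using u(2)[of 0] norm_ge_zero[of "u 0"] by linarith
  have R: "0 \<in> cball 0 R" using R0 by (simp add: R_def)
  have Ck0: "Ck \<ge> 0" using Ck[OF R] norm_ge_zero[of "k 0"] by linarith
  show "norm (k t * piece h u w t) \<le> Ck * Mu"
  proof (cases "piece h u w t = 0")
   case True then show ?thesis using Mu Ck0 by simp
  next
   case False
   then have "norm (t - w) \<le> h / 2" by (rule piece_props(3)[OF h(1) u(1,2)])
   then have "t \<in> cball 0 R" using cells_norm[OF h w] norm_triangle_ineq[of w "t - w"] h by (simp add: R_def)
   then show ?thesis unfolding norm_mult by (intro mult_mono Ck piece_props(2)[OF h(1) u(1,2)] Ck0) auto
  qed
 qed (use piece_props(4)[OF h(1) u(1,2)] in auto)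
 have "Top h u x = (LI t. (\<Sum>w\<in>cells h. k t * piece h u w t))"
  by (simp only: Top_def sum_distrib_left[symmetric] sum_piece[of h u, OF h(1) u(3)] k_def)
 also have "\<dots> = (\<Sum>w\<in>cells h. (LI t. k t * piece h u w t))"
  by (rule Bochner_Integration.integral_sum[OF int])
 also have "\<dots> = (\<Sum>w\<in>cells h. expi (S (x, w) / h\<^sup>2) * Fop h b w 0 (piece h u w) x)"
 proof (rule sum.cong[OF refl])
  fix w
  have "k t = expi (S (x, w) / h\<^sup>2) * ker h b w 0 (x, t)" for t
   by (simp add: k_def ker_def ph_def diff_divide_distrib exp_add[symmetric] algebra_simps)
  then show "(LI t. k t * piece h u w t) = expi (S (x, w) / h\<^sup>2) * Fop h b w 0 (piece h u w) x"
   unfolding Fop_def by (simp only: mult.assoc integral_mult_right_zero)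
 qed
 finally show ?thesis .
qed

lemma Fop_piece_continuous:
 assumes h: "0 < h" "h \<le> 1" and b: "b \<in> Basis" and w: "w \<in> cells h"
  and u: "u \<in> borel_measurable borel" "\<And>t. norm (u t) \<le> Mu"
 shows "continuous_on UNIV (Fop h b w i (piece h u w))"
 by (rule Fop_continuous[OF h b cells_norm[OF h w] piece_props(1,2)[OF h(1) u] compact_cball piece_props(4)[OF h(1) u]])

lemma Bsum_continuous:
 assumes h: "0 < h" "h \<le> 1" and w: "w \<in> cells h"
  and u: "u \<in> borel_measurable borel" "\<And>t. norm (u t) \<le> Mu"
 shows "continuous_on UNIV (Bsum h u w)"
 unfolding Bsum_def[abs_def] split_beta by (intro continuous_intros Fop_piece_continuous[OF h _ w u]) auto

lemma Bsum_nonneg: "Bsum h u w x \<ge> 0"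
 unfolding Bsum_def by (intro sum_nonneg) auto

lemma Fop_0_eq: "Fop h b w 0 = Fop h b' w 0"
 by (simp add: Fop_def[abs_def] ker_def[abs_def])

text \<open>Scaled derivatives of a packet belong to the same family \<open>Fop\<close> with a
  higher index, so each of them is one summand of \<open>Bsum\<close>. At order 0 the family does
  not depend on the direction.\<close>

lemma Fop_symb:
 assumes h: "0 < h" "h \<le> 1" and b: "b \<in> Basis" "b' \<in> Basis" and w: "w \<in> cells h"
  and u: "u \<in> borel_measurable borel" "\<And>t. norm (u t) \<le> Mu"
 shows "symb h {b'} X (Bsum h u w) (CARD('n) + 2) (Fop h b w 0 (piece h u w))"
proof -
 have "symb h {b'} X (Bsum h u w) (CARD('n) + 2) (Fop h b' w 0 (piece h u w))"
 proof (rule symb_of_sequence[OF h(1), where G = "\<lambda>i. Fop h b' w i (piece h u w)"])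
  show "continuous_on UNIV (Fop h b' w i (piece h u w))" for i by (rule Fop_piece_continuous[OF h b(2) w u])
  show "norm (Fop h b' w i (piece h u w) x) \<le> Bsum h u w x" if "i \<le> CARD('n) + 2" for i x
   unfolding Bsum_def
   using member_le_sum[of "(b', i)" "Basis \<times> {..CARD('n) + 2}" "\<lambda>(b, i). norm (Fop h b w i (piece h u w) x)"] b(2) that by auto
  show "has_ddir b' (Fop h b' w i (piece h u w)) (\<lambda>x. Fop h b' w (Suc i) (piece h u w) x /\<^sub>R h)" for i
   by (rule Fop_has_ddir[OF h b(2) cells_norm[OF h w] piece_props(1,2)[OF h(1) u] compact_cball piece_props(4)[OF h(1) u]])
 qed
 then show ?thesis by (simp only: Fop_0_eq[of h b w b'])
qed

text \<open>When the square is expanded, the cross term of cells w and w' oscillates with phase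
  (S(x,w) - S(x,w')) / h^2, while the packets are symbols at scale \<open>h\<close>. Integration by
  parts in x gives decay in the difference of the x-gradients at the centre \<open>y\<close>, and
  the cell sum of this decay against the weight at \<open>y\<close> provides the row bound. The
  weight reappears as the divisor in the norms of the packets.\<close>

lemma local_bound:
 obtains C where "C \<ge> 0"
  "\<And>h y u Mu. \<lbrakk>0 < h; h \<le> 1; norm y \<le> R0 + 1; u \<in> borel_measurable borel;
   (\<And>t. norm (u t) \<le> Mu); (\<And>t. norm t > R0 \<Longrightarrow> u t = 0)\<rbrakk> \<Longrightarrow>
   (LI x. bump y h (Suc (CARD('n) + 2)) x * (norm (Top h u x))\<^sup>2)
   \<le> C * (\<Sum>w\<in>cells h. (LI x. indicator (cball y h) x * ((Bsum h u w x)\<^sup>2 / wt h x w)))"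
proof -
 define M where "M = CARD('n) + 2"
 obtain C1 where C1: "C1 \<ge> 0" "\<And>h y w w' a B. \<lbrakk>0 < h; h \<le> 1; cball y h \<subseteq> cball 0 R;
   w \<in> cball 0 R; w' \<in> cball 0 R; (\<And>b. b \<in> Basis \<Longrightarrow> symb h {b} (cball y h) B M a);
   (\<And>x. x \<notin> cball y h \<Longrightarrow> a x = 0); continuous_on UNIV B; (\<And>x. 0 \<le> B x)\<rbrakk> \<Longrightarrow>
   norm (LI x. expi ((S (x, w) - S (x, w')) / h\<^sup>2) * a x)
   \<le> C1 * inverse ((1 + norm (grad_x S (y, w) - grad_x S (y, w')) / h) ^ M) * (LI x. indicator (cball y h) x * B x)"
  using osc_estimate[OF S_smooth, of "grad_x S" R M, OF gx_grad_x] by blast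
 obtain C2 where C2: "C2 \<ge> 0" "\<And>h y \<xi>. \<lbrakk>0 < h; h \<le> 1; norm y \<le> R\<rbrakk> \<Longrightarrow>
  (\<Sum>w\<in>cells h. wt h y w * inverse ((1 + norm (grad_x S (y, w) - \<xi>) / h) ^ M)) \<le> C2"
  unfolding M_def cells_def using sum_cells_decay by blast
 obtain C0 where C0: "C0 \<ge> 1"
  "\<And>h x t x' t'. \<lbrakk>0 < h; norm x \<le> R; norm t \<le> R; norm x' \<le> R; norm t' \<le> R;
   norm ((x, t) - (x', t')) \<le> h\<rbrakk> \<Longrightarrow> wt h x t \<le> C0 * wt h x' t'"
  using wt_comparable by blast
 define Cb where "Cb = 2 ^ M * (2 ^ M * bump_const M)"
 have Cb: "Cb \<ge> 0" using bump_const_ge_1[of M] by (simp add: Cb_def)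
 show ?thesis
 proof (rule that[of "C1 * Cb * C2 * C0"])
  show "0 \<le> C1 * Cb * C2 * C0" using C1(1) C2(1) C0(1) Cb by simp
  fix h :: real and y :: "real^'n" and u :: "real^'n \<Rightarrow> complex" and Mu
  assume h: "0 < h" "h \<le> 1" and y: "norm y \<le> R0 + 1" and u: "u \<in> borel_measurable borel"
   "\<And>t. norm (u t) \<le> (Mu::real)" "\<And>t. norm t > R0 \<Longrightarrow> u t = (0::complex)"
  obtain b :: "real^'n" where b: "b \<in> Basis" using nonempty_Basis by blast
  define W where "W = cells h"
  define F where "F w = Fop h b w 0 (piece h u w)" for w
  define B where "B w = Bsum h u w" for w
  define \<beta> where "\<beta> w = wt h y w" for w
  define e where "e w x = expi (S (x, w) / h\<^sup>2)" for w x
  define bm where "bm x = bump y h (Suc M) x" for x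
  have yR: "norm y \<le> R" and cb: "cball y h \<subseteq> cball 0 R"
  proof -
   show "norm y \<le> R" using y by (simp add: R_def)
   show "cball y h \<subseteq> cball 0 R"
   proof
    fix t assume "t \<in> cball y h"
    then show "t \<in> cball 0 R" using norm_triangle_ineq[of y "t - y"] y h by (simp add: R_def dist_norm norm_minus_commute)
   qed
  qed
  have wR: "norm w \<le> R" if "w \<in> W" for w using cells_norm[OF h] that by (fastforce simp: W_def R_def)
  have Fc: "continuous_on UNIV (F w)" and Bc: "continuous_on UNIV (B w)" if "w \<in> W" for w
   using that unfolding F_def B_def W_def by (auto intro: Fop_piece_continuous[OF h b _ u(1,2)] Bsum_continuous[OF h _ u(1,2)])
  have ec: "continuous_on UNIV (e w)" for w unfolding e_def
   by (intro continuous_intros continuous_on_compose2[OF smooth_on_continuous[OF S_smooth]]) (use h in auto)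
  have bmc: "continuous_on UNIV bm" unfolding bm_def by (rule continuous_bump)
  have bm0: "bm x = 0" if "x \<notin> cball y h" for x unfolding bm_def by (rule bump_eq_0[OF h(1) zero_less_Suc that])
  define a where "a w w' x = F w x * cnj (F w' x) * complex_of_real (bm x)" for w w' x
  define I where "I w w' = (LI x. expi ((S (x, w) - S (x, w')) / h\<^sup>2) * a w w' x)" for w w'
  define k where "k w w' = inverse ((1 + norm (grad_x S (y, w) - grad_x S (y, w')) / h) ^ M)" for w w'
  define Q where "Q w = (LI x. indicator (cball y h) x * (B w x)\<^sup>2)" for w
  have k0: "k w w' \<ge> 0" for w w' using h by (simp add: k_def)
  have cint: "integrable lborel (\<lambda>x. indicator (cball y h) x * f x)" if "continuous_on UNIV f" for f :: "real^'n \<Rightarrow> real"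
   using borel_integrable_compact[OF compact_cball continuous_on_subset[OF that], of y h] by simp
  have cint': "integrable lborel f" if "continuous_on UNIV f" "\<And>x. x \<notin> cball y h \<Longrightarrow> f x = 0" for f :: "real^'n \<Rightarrow> complex"
  proof -
   have "integrable lborel (\<lambda>x. indicator (cball y h) x *\<^sub>R f x)"
    using borel_integrable_compact[OF compact_cball continuous_on_subset[OF that(1)], of y h] by simp
   moreover have "(\<lambda>x. indicator (cball y h) x *\<^sub>R f x) = f" using that(2) by (auto simp: indicator_def fun_eq_iff)
   ultimately show ?thesis by simp
  qed
  \<comment> \<open>The weights in AM-GM are adapted to the row bound, which controls the sum of
    \<open>\<beta> w' * k w' w\<close> rather than of \<open>k w' w\<close> alone.\<close>
  have Ibd: "norm (I w w') \<le> C1 * Cb * (k w w' * ((\<beta> w' / \<beta> w * Q w + \<beta> w / \<beta> w' * Q w') / 2))"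
   if w: "w \<in> W" "w' \<in> W" for w w'
  proof -
   have s: "symb h {b'} (cball y h) (\<lambda>x. Cb * (B w x * B w' x)) M (a w w')" if "b' \<in> Basis" for b'
   proof -
    have "symb h {b'} (cball y h) (\<lambda>x. 2 ^ M * (2 ^ M * (B w x * B w' x) * bump_const M)) M (a w w')"
     unfolding a_def bm_def F_def B_def M_def
     by (intro symb_mult symb_cnj Fop_symb[OF h b that _ u(1,2)] symb_bump h) (use w that in \<open>auto simp: W_def\<close>)
    then show ?thesis by (rule symb_weaken) (auto simp: Cb_def mult_ac)
   qed
   have "norm (I w w') \<le> C1 * inverse ((1 + norm (grad_x S (y, w) - grad_x S (y, w')) / h) ^ M) *
     (LI x. indicator (cball y h) x * (Cb * (B w x * B w' x)))"
    unfolding I_def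
    by (rule C1(2)[OF h cb _ _ s])
     (use w wR bm0 Cb Bsum_nonneg Bc in \<open>auto simp: a_def B_def intro!: continuous_intros mult_nonneg_nonneg\<close>)
   also have "(LI x. indicator (cball y h) x * (Cb * (B w x * B w' x))) = Cb * (LI x. indicator (cball y h) x * (B w x * B w' x))"
    by (subst integral_mult_right_zero[symmetric]) (simp only: mult_ac)
   also have "(LI x. indicator (cball y h) x * (B w x * B w' x))
    \<le> (LI x. (\<beta> w' / \<beta> w / 2) * (indicator (cball y h) x * (B w x)\<^sup>2) + (\<beta> w / \<beta> w' / 2) * (indicator (cball y h) x * (B w' x)\<^sup>2))"
   proof (rule integral_mono)
    show "integrable lborel (\<lambda>x. indicator (cball y h) x * (B w x * B w' x))"
     by (intro cint continuous_intros Bc w)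
    show "integrable lborel (\<lambda>x. (\<beta> w' / \<beta> w / 2) * (indicator (cball y h) x * (B w x)\<^sup>2) + (\<beta> w / \<beta> w' / 2) * (indicator (cball y h) x * (B w' x)\<^sup>2))"
     by (intro Bochner_Integration.integrable_add integrable_mult_right cint continuous_intros Bc w)
    show "indicator (cball y h) x * (B w x * B w' x) \<le> (\<beta> w' / \<beta> w / 2) * (indicator (cball y h) x * (B w x)\<^sup>2) + (\<beta> w / \<beta> w' / 2) * (indicator (cball y h) x * (B w' x)\<^sup>2)" for x
     using weighted_amgm[of "\<beta> w" "\<beta> w'" "B w x" "B w' x"] wt_pos[OF h(1)] by (auto simp: indicator_def \<beta>_def add_divide_distrib)
   qed
   also have "\<dots> = (\<beta> w' / \<beta> w * Q w + \<beta> w / \<beta> w' * Q w') / 2"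
    by (subst Bochner_Integration.integral_add)
     (use w in \<open>auto simp: Q_def add_divide_distrib intro!: integrable_mult_right cint continuous_intros Bc\<close>)
   finally show ?thesis using C1(1) Cb k0[of w w']
    by (simp add: k_def mult_left_mono mult.assoc mult.left_commute)
  qed
  have expand: "complex_of_real (bm x * (norm (Top h u x))\<^sup>2)
   = (\<Sum>w\<in>W. \<Sum>w'\<in>W. expi ((S (x, w) - S (x, w')) / h\<^sup>2) * a w w' x)" for x
  proof -
   have T: "Top h u x = (\<Sum>w\<in>W. e w x * F w x)"
    unfolding W_def e_def F_def by (rule Top_decomp[OF h b u])
   have ee: "e w x * cnj (e w' x) = expi ((S (x, w) - S (x, w')) / h\<^sup>2)" for w w'
    by (simp add: e_def exp_cnj exp_add[symmetric] diff_divide_distrib algebra_simps)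
   have "complex_of_real ((norm (Top h u x))\<^sup>2) = Top h u x * cnj (Top h u x)" by (simp only: complex_norm_square)
   also have "\<dots> = (\<Sum>w\<in>W. \<Sum>w'\<in>W. (e w x * F w x) * cnj (e w' x * F w' x))"
    unfolding T cnj_sum sum_product ..
   finally have "complex_of_real (bm x * (norm (Top h u x))\<^sup>2) = complex_of_real (bm x) * (\<Sum>w\<in>W. \<Sum>w'\<in>W. (e w x * F w x) * cnj (e w' x * F w' x))"
    by simp
   also have "\<dots> = (\<Sum>w\<in>W. \<Sum>w'\<in>W. (e w x * cnj (e w' x)) * a w w' x)"
    by (simp only: sum_distrib_left a_def complex_cnj_mult mult_ac)
   finally show ?thesis by (simp only: ee)
  qed
  have intI: "integrable lborel (\<lambda>x. expi ((S (x, w) - S (x, w')) / h\<^sup>2) * a w w' x)" if "w \<in> W" "w' \<in> W" for w w'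
  proof (rule cint')
   show "continuous_on UNIV (\<lambda>x. expi ((S (x, w) - S (x, w')) / h\<^sup>2) * a w w' x)"
    unfolding a_def by (intro continuous_intros continuous_on_compose2[OF smooth_on_continuous[OF S_smooth]] Fc bmc that) (use h in auto)
  qed (simp add: a_def bm0)
  have "complex_of_real (LI x. bm x * (norm (Top h u x))\<^sup>2) = (LI x. complex_of_real (bm x * (norm (Top h u x))\<^sup>2))"
   by (rule integral_complex_of_real[symmetric])
  also have "\<dots> = (\<Sum>w\<in>W. \<Sum>w'\<in>W. I w w')"
   unfolding expand I_def
   by (subst Bochner_Integration.integral_sum, intro Bochner_Integration.integrable_sum intI, assumption, assumption, intro sum.cong refl Bochner_Integration.integral_sum intI)
  finally have eq: "complex_of_real (LI x. bm x * (norm (Top h u x))\<^sup>2) = (\<Sum>w\<in>W. \<Sum>w'\<in>W. I w w')" .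
  have "(LI x. bm x * (norm (Top h u x))\<^sup>2) \<le> norm (complex_of_real (LI x. bm x * (norm (Top h u x))\<^sup>2))"
   unfolding norm_of_real by (rule abs_ge_self)
  also have "\<dots> \<le> (\<Sum>w\<in>W. \<Sum>w'\<in>W. norm (I w w'))"
   unfolding eq by (intro order_trans[OF norm_sum] sum_mono) simp
  also have "\<dots> \<le> (\<Sum>w\<in>W. \<Sum>w'\<in>W. C1 * Cb * (k w w' * ((\<beta> w' / \<beta> w * Q w + \<beta> w / \<beta> w' * Q w') / 2)))"
   by (intro sum_mono Ibd)
  also have "\<dots> = C1 * Cb * (\<Sum>w\<in>W. \<Sum>w'\<in>W. k w w' * ((\<beta> w' / \<beta> w * Q w + \<beta> w / \<beta> w' * Q w') / 2))"
   by (simp only: sum_distrib_left)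
  also have "\<dots> \<le> C1 * Cb * (C2 * (\<Sum>w\<in>W. Q w / \<beta> w))"
  proof (intro mult_left_mono weighted_schur_sum)
   show "(\<Sum>w'\<in>W. \<beta> w' * k w' w) \<le> C2" for w
    unfolding \<beta>_def k_def W_def by (rule C2(2)[OF h yR])
   show "0 \<le> Q w" for w unfolding Q_def by (intro Bochner_Integration.integral_nonneg) simp
   show "k w w' = k w' w" for w w' by (simp add: k_def norm_minus_commute)
  qed (use C1(1) Cb wt_pos[OF h(1)] in \<open>auto simp: \<beta>_def\<close>)
  \<comment> \<open>The weight at the centre is exchanged for the weight at x, comparable on the
    ball, to match the bound for single packets.\<close>
  also have "(\<Sum>w\<in>W. Q w / \<beta> w) \<le> (\<Sum>w\<in>W. C0 * (LI x. indicator (cball y h) x * ((B w x)\<^sup>2 / wt h x w)))"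
  proof (rule sum_mono)
   fix w assume w: "w \<in> W"
   have "Q w / \<beta> w = (LI x. indicator (cball y h) x * ((B w x)\<^sup>2 / \<beta> w))"
    unfolding Q_def by (simp only: divide_inverse mult.assoc[symmetric] integral_mult_left_zero)
   also have "\<dots> \<le> (LI x. indicator (cball y h) x * (C0 * ((B w x)\<^sup>2 / wt h x w)))"
   proof (rule integral_mono)
    have ne: "wt h x w \<noteq> 0" for x using wt_pos[OF h(1), of x w] by simp
    show "integrable lborel (\<lambda>x. indicator (cball y h) x * ((B w x)\<^sup>2 / \<beta> w))"
     using wt_pos[OF h(1), of y w] by (intro cint continuous_intros Bc w) (auto simp: \<beta>_def)
    show "integrable lborel (\<lambda>x. indicator (cball y h) x * (C0 * ((B w x)\<^sup>2 / wt h x w)))"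
     by (intro cint continuous_intros Bc w wt_continuous) (use ne in auto)
    fix x
    show "indicator (cball y h) x * ((B w x)\<^sup>2 / \<beta> w) \<le> indicator (cball y h) x * (C0 * ((B w x)\<^sup>2 / wt h x w))"
    proof (cases "x \<in> cball y h")
     case True
     then have "norm x \<le> R" using cb by auto
     moreover have "norm ((x, w) - (y, w)) \<le> h" using True by (simp add: norm_Pair dist_norm norm_minus_commute)
     ultimately have "wt h x w \<le> C0 * \<beta> w" unfolding \<beta>_def using C0(2)[OF h(1)] wR[OF w] yR by blast
     then have "(B w x)\<^sup>2 * wt h x w \<le> (B w x)\<^sup>2 * (C0 * \<beta> w)" by (intro mult_left_mono) auto
     then have "(B w x)\<^sup>2 / \<beta> w \<le> C0 * ((B w x)\<^sup>2 / wt h x w)"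
      using wt_pos[OF h(1), of x w] wt_pos[OF h(1), of y w] by (simp add: \<beta>_def divide_simps mult_ac)
     then show ?thesis by (simp add: indicator_def)
    qed simp
   qed
   also have "\<dots> = C0 * (LI x. indicator (cball y h) x * ((B w x)\<^sup>2 / wt h x w))"
    by (subst integral_mult_right_zero[symmetric]) (simp only: mult.left_commute)
   finally show "Q w / \<beta> w \<le> C0 * (LI x. indicator (cball y h) x * ((B w x)\<^sup>2 / wt h x w))" .
  qed
  finally have "(LI x. bm x * (norm (Top h u x))\<^sup>2) \<le> C1 * Cb * (C2 * (\<Sum>w\<in>W. C0 * (LI x. indicator (cball y h) x * ((B w x)\<^sup>2 / wt h x w))))"
   using C1(1) C2(1) Cb by (simp add: mult_left_mono)
  then show "(LI x. bump y h (Suc (CARD('n) + 2)) x * (norm (Top h u x))\<^sup>2)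
   \<le> C1 * Cb * C2 * C0 * (\<Sum>w\<in>cells h. (LI x. indicator (cball y h) x * ((Bsum h u w x)\<^sup>2 / wt h x w)))"
   by (simp only: bm_def M_def W_def B_def sum_distrib_left[symmetric] mult.assoc)
 qed
qed


lemma Bsum_L2:
 obtains C where "C \<ge> 0"
  "\<And>h w u Mu. \<lbrakk>0 < h; h \<le> 1; w \<in> cells h; u \<in> borel_measurable borel; (\<And>t. norm (u t) \<le> Mu)\<rbrakk> \<Longrightarrow>
   (NN x. ennreal ((Bsum h u w x)\<^sup>2 / wt h x w)) \<le> ennreal (C * h ^ (2 * CARD('n)) * (LI t. (norm (piece h u w t))\<^sup>2))"
proof -
 define J where "J = (Basis :: (real^'n) set) \<times> {..CARD('n) + 2}"
 have fJ: "finite J" by (simp add: J_def)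
 have "\<forall>i. \<exists>C>0. \<forall>h b w u Mu. 0 < h \<longrightarrow> h \<le> 1 \<longrightarrow> b \<in> Basis \<longrightarrow> norm w \<le> R0 + 1 \<longrightarrow> u \<in> borel_measurable borel \<longrightarrow>
   (\<forall>t. norm (u t) \<le> Mu) \<longrightarrow> (\<forall>t. u t \<noteq> 0 \<longrightarrow> norm (t - w) \<le> h / 2) \<longrightarrow>
   (LI x. (norm (Fop h b w i u x))\<^sup>2 / wt h x w) \<le> C * h ^ (2 * CARD('n)) * (LI t. (norm (u t))\<^sup>2)"
 proof
  fix i
  show "\<exists>C>0. \<forall>h b w u Mu. 0 < h \<longrightarrow> h \<le> 1 \<longrightarrow> b \<in> Basis \<longrightarrow> norm w \<le> R0 + 1 \<longrightarrow> u \<in> borel_measurable borel \<longrightarrow>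
   (\<forall>t. norm (u t) \<le> Mu) \<longrightarrow> (\<forall>t. u t \<noteq> 0 \<longrightarrow> norm (t - w) \<le> h / 2) \<longrightarrow>
   (LI x. (norm (Fop h b w i u x))\<^sup>2 / wt h x w) \<le> C * h ^ (2 * CARD('n)) * (LI t. (norm (u t))\<^sup>2)"
   by (rule Fop_L2[of i]) blast
 qed
 from choice[OF this] obtain C where C: "\<And>i. C i > 0" "\<And>i h b w u Mu. \<lbrakk>0 < h; h \<le> 1; b \<in> Basis; norm w \<le> R0 + 1;
   u \<in> borel_measurable borel; (\<And>t. norm (u t) \<le> Mu); (\<And>t. u t \<noteq> 0 \<Longrightarrow> norm (t - w) \<le> h / 2)\<rbrakk> \<Longrightarrow>
   (LI x. (norm (Fop h b w i u x))\<^sup>2 / wt h x w) \<le> C i * h ^ (2 * CARD('n)) * (LI t. (norm (u t))\<^sup>2)" by blast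
 define D where "D = real (card J) * (\<Sum>j\<in>J. C (snd j))"
 have D: "D \<ge> 0" using C(1) by (auto simp: D_def less_imp_le intro!: mult_nonneg_nonneg sum_nonneg)
 show ?thesis
 proof (rule that[OF D])
  fix h :: real and w :: "real^'n" and u :: "real^'n \<Rightarrow> complex" and Mu
  assume h: "0 < h" "h \<le> 1" and w: "w \<in> cells h" and u: "u \<in> borel_measurable borel" "\<And>t. norm (u t) \<le> (Mu::real)"
  define G where "G j x = (norm (Fop h (fst j) w (snd j) (piece h u w) x))\<^sup>2 / wt h x w" for j x
  define U where "U = (LI t. (norm (piece h u w t))\<^sup>2)"
  have U: "U \<ge> 0" unfolding U_def by (intro Bochner_Integration.integral_nonneg) simp
  have wp: "wt h x w > 0" for x by (rule wt_pos[OF h(1)])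
  have G0: "G j x \<ge> 0" for j x unfolding G_def using wp[of x] by (intro divide_nonneg_pos) auto
  have Gc: "continuous_on UNIV (G j)" if "j \<in> J" for j
   unfolding G_def using wp that
   by (intro continuous_intros Fop_piece_continuous[OF h _ w u] wt_continuous) (auto simp: J_def less_le)
  have G_out: "G j x = 0" if "j \<in> J" "x \<notin> cball 0 R0" for j x
   using Fop_eq_0[OF h _ cells_norm[OF h w], of "fst j" x "snd j" "piece h u w"] that by (auto simp: G_def J_def)
  have Gint: "integrable lborel (G j)" if "j \<in> J" for j
  proof -
   have "integrable lborel (\<lambda>x. indicator (cball 0 R0) x *\<^sub>R G j x)"
    using borel_integrable_compact[OF compact_cball continuous_on_subset[OF Gc[OF that]], of 0 R0] by simp
   moreover have "(\<lambda>x. indicator (cball 0 R0) x *\<^sub>R G j x) = G j" using G_out[OF that] by (auto simp: indicator_def fun_eq_iff)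
   ultimately show ?thesis by simp
  qed
  have Gb: "(NN x. ennreal (G j x)) \<le> ennreal (C (snd j) * h ^ (2 * CARD('n)) * U)" if "j \<in> J" for j
  proof -
   have "(NN x. ennreal (G j x)) = ennreal (LI x. G j x)"
    by (rule nn_integral_eq_integral[OF Gint[OF that]]) (simp add: G0)
   also have "\<dots> \<le> ennreal (C (snd j) * h ^ (2 * CARD('n)) * U)"
    unfolding G_def U_def
    by (intro ennreal_leI C(2)[OF h _ cells_norm[OF h w] piece_props(1,2)[OF h(1) u] piece_props(3)[OF h(1) u]])
     (use that in \<open>auto simp: J_def\<close>)
   finally show ?thesis .
  qed
  have Bb: "(Bsum h u w x)\<^sup>2 / wt h x w \<le> real (card J) * (\<Sum>j\<in>J. G j x)" for x
  proof -
   have "Bsum h u w x = (\<Sum>j\<in>J. norm (Fop h (fst j) w (snd j) (piece h u w) x))"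
    by (simp add: Bsum_def J_def split_beta)
   then have "(Bsum h u w x)\<^sup>2 \<le> (\<Sum>j\<in>J. (norm (Fop h (fst j) w (snd j) (piece h u w) x))\<^sup>2) * card J"
    using sum_squared_le_sum_of_squares[of "\<lambda>j. norm (Fop h (fst j) w (snd j) (piece h u w) x)" J] by simp
   then have "(Bsum h u w x)\<^sup>2 / wt h x w \<le> ((\<Sum>j\<in>J. (norm (Fop h (fst j) w (snd j) (piece h u w) x))\<^sup>2) * card J) / wt h x w"
    using wp[of x] by (intro divide_right_mono) auto
   also have "\<dots> = real (card J) * (\<Sum>j\<in>J. G j x)"
    unfolding G_def by (simp only: sum_divide_distrib[symmetric] mult.commute times_divide_eq_right)
   finally show ?thesis .
  qed
  have "(NN x. ennreal ((Bsum h u w x)\<^sup>2 / wt h x w)) \<le> (NN x. ennreal (real (card J)) * (\<Sum>j\<in>J. ennreal (G j x)))"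
  proof (rule nn_integral_mono)
   fix x
   have "ennreal ((Bsum h u w x)\<^sup>2 / wt h x w) \<le> ennreal (real (card J) * (\<Sum>j\<in>J. G j x))" by (rule ennreal_leI[OF Bb])
   also have "\<dots> = ennreal (real (card J)) * (\<Sum>j\<in>J. ennreal (G j x))"
    using G0 by (simp add: ennreal_mult' sum_ennreal)
   finally show "ennreal ((Bsum h u w x)\<^sup>2 / wt h x w) \<le> \<dots>" .
  qed
  also have "\<dots> = ennreal (real (card J)) * (\<Sum>j\<in>J. (NN x. ennreal (G j x)))"
  proof -
   have m: "(\<lambda>x. ennreal (G j x)) \<in> borel_measurable lborel" if "j \<in> J" for j
    using borel_measurable_continuous_onI[OF Gc[OF that]] by simp
   have "(NN x. ennreal (real (card J)) * (\<Sum>j\<in>J. ennreal (G j x))) = ennreal (real (card J)) * (NN x. (\<Sum>j\<in>J. ennreal (G j x)))"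
    by (intro nn_integral_cmult borel_measurable_sum m)
   also have "(NN x. (\<Sum>j\<in>J. ennreal (G j x))) = (\<Sum>j\<in>J. (NN x. ennreal (G j x)))"
    by (intro nn_integral_sum m)
   finally show ?thesis .
  qed
  also have "\<dots> \<le> ennreal (real (card J)) * (\<Sum>j\<in>J. ennreal (C (snd j) * h ^ (2 * CARD('n)) * U))"
   by (intro mult_left_mono sum_mono Gb) auto
  also have "\<dots> = ennreal (real (card J) * (\<Sum>j\<in>J. C (snd j) * h ^ (2 * CARD('n)) * U))"
   using C(1) h U by (subst sum_ennreal) (auto simp: ennreal_mult' less_imp_le)
  also have "real (card J) * (\<Sum>j\<in>J. C (snd j) * h ^ (2 * CARD('n)) * U) = D * h ^ (2 * CARD('n)) * U"
   by (simp only: D_def sum_distrib_right mult.assoc)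
  finally show "(NN x. ennreal ((Bsum h u w x)\<^sup>2 / wt h x w)) \<le> ennreal (D * h ^ (2 * CARD('n)) * (LI t. (norm (piece h u w t))\<^sup>2))"
   by (simp only: U_def)
 qed
qed

section \<open>The global L2 bound\<close>

lemma Top_eq_0: "norm x > R0 \<Longrightarrow> Top h u x = 0"
proof -
 assume "norm x > R0"
 then have "\<psi> (x, t) = 0" for t using psi_supp[of "(x, t)"] by fastforce
 then show ?thesis by (simp add: Top_def)
qed

lemma Top_continuous:
 assumes h: "0 < h" "h \<le> 1" and u: "u \<in> borel_measurable borel" "\<And>t. norm (u t) \<le> Mu" "\<And>t. norm t > R0 \<Longrightarrow> u t = 0"
 shows "continuous_on UNIV (Top h u)"
 unfolding Top_def[abs_def]
proof (rule integral_param_continuous[where Y = "cball 0 R0" and \<phi> = "\<lambda>q. expi (S q / h\<^sup>2) * \<psi> q", OF _ u(1,2)])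
 show "continuous_on UNIV (\<lambda>q. expi (S q / h\<^sup>2) * \<psi> q)"
  by (intro continuous_intros smooth_on_continuous[OF S_smooth] smooth_on_continuous[OF psi_smooth]) (use h in auto)
qed (use u(3) in auto)

text \<open>Cells are disjoint, so one summand survives at each point; formally,
  \<open>sum_piece\<close> is applied to the square of the modulus of \<open>u\<close>.\<close>

lemma integral_piece_sum:
 assumes h: "0 < h" "h \<le> 1" and u: "u \<in> borel_measurable borel" "\<And>t. norm (u t) \<le> Mu" "\<And>t. norm t > R0 \<Longrightarrow> u t = 0"
 shows "(\<Sum>w\<in>cells h. (LI t. (norm (piece h u w t))\<^sup>2)) = (LI t. (norm (u t))\<^sup>2)"
proof -
 have "integrable lborel (\<lambda>t. (norm (piece h u w t))\<^sup>2)" for w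
 proof (rule integrable_bounded_compact_support[where X = "cball w h" and C = "Mu\<^sup>2"])
  show "(\<lambda>t. (norm (piece h u w t))\<^sup>2) \<in> borel_measurable borel" using piece_props(1)[OF h(1) u(1,2)] by simp
  show "norm ((norm (piece h u w t))\<^sup>2) \<le> Mu\<^sup>2" for t
   using piece_props(2)[OF h(1) u(1,2), of w t] by (simp add: power_mono)
 qed (use piece_props(4)[OF h(1) u(1,2)] in auto)
 then have "(\<Sum>w\<in>cells h. (LI t. (norm (piece h u w t))\<^sup>2)) = (LI t. (\<Sum>w\<in>cells h. (norm (piece h u w t))\<^sup>2))"
  by (rule Bochner_Integration.integral_sum[symmetric])
 also have "\<dots> = (LI t. (norm (u t))\<^sup>2)"
 proof (rule Bochner_Integration.integral_cong[OF refl])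
  fix t
  have "(\<Sum>w\<in>cells h. (norm (piece h u w t))\<^sup>2) = (\<Sum>w\<in>cells h. Re (piece h (\<lambda>t. complex_of_real ((norm (u t))\<^sup>2)) w t))"
   by (rule sum.cong) (auto simp: piece_def)
  also have "\<dots> = Re (complex_of_real ((norm (u t))\<^sup>2))"
   unfolding Re_sum[symmetric] by (subst sum_piece[OF h(1)]) (use u(3) in auto)
  finally show "(\<Sum>w\<in>cells h. (norm (piece h u w t))\<^sup>2) = (norm (u t))\<^sup>2" by simp
 qed
 finally show ?thesis .
qed

text \<open>The local bounds are averaged over the centres. The integral of the cut-off over its
  centre is at least \<open>\<kappa> * h ^ CARD('n)\<close> at every point of the support, while
  each point of a packet is counted for a set of centres of volume \<open>V * h ^ CARD('n)\<close>.
  These powers cancel, and the bounds for the packets add up because the pieces of \<open>u\<close>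
  have disjoint supports.\<close>

lemma Top_L2_bounded:
 obtains C where "C \<ge> 0"
  "\<And>h u Mu. \<lbrakk>0 < h; h \<le> 1; u \<in> borel_measurable borel; (\<And>t. norm (u t) \<le> Mu); (\<And>t. norm t > R0 \<Longrightarrow> u t = 0)\<rbrakk> \<Longrightarrow>
   (NN x. ennreal ((norm (Top h u x))\<^sup>2)) \<le> ennreal (C * h ^ (2 * CARD('n)) * (LI t. (norm (u t))\<^sup>2))"
proof -
 define M where "M = Suc (CARD('n) + 2)"
 obtain C1 where C1: "C1 \<ge> 0"
  "\<And>h y u Mu. \<lbrakk>0 < h; h \<le> 1; norm y \<le> R0 + 1; u \<in> borel_measurable borel;
   (\<And>t. norm (u t) \<le> Mu); (\<And>t. norm t > R0 \<Longrightarrow> u t = 0)\<rbrakk> \<Longrightarrow>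
   (LI x. bump y h M x * (norm (Top h u x))\<^sup>2)
   \<le> C1 * (\<Sum>w\<in>cells h. (LI x. indicator (cball y h) x * ((Bsum h u w x)\<^sup>2 / wt h x w)))"
  unfolding M_def by (rule local_bound) blast
 obtain C2 where C2: "C2 \<ge> 0"
  "\<And>h w u Mu. \<lbrakk>0 < h; h \<le> 1; w \<in> cells h; u \<in> borel_measurable borel; (\<And>t. norm (u t) \<le> Mu)\<rbrakk> \<Longrightarrow>
   (NN x. ennreal ((Bsum h u w x)\<^sup>2 / wt h x w)) \<le> ennreal (C2 * h ^ (2 * CARD('n)) * (LI t. (norm (piece h u w t))\<^sup>2))"
  by (rule Bsum_L2) blast
 define V where "V = unit_ball_vol (real CARD('n))"
 have V: "V > 0" by (simp add: V_def)
 \<comment> \<open>The power of 3/4 bounds the cut-off from below on half of its radius; the rest is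
   the volume of that smaller ball divided by \<open>h ^ CARD('n)\<close>.\<close>
 define \<kappa> where "\<kappa> = (3/4) ^ M * V / 2 ^ CARD('n)"
 have \<kappa>: "\<kappa> > 0" using V by (simp add: \<kappa>_def)
 define C where "C = C1 * V * C2 / \<kappa>"
 have C: "C \<ge> 0" using C1(1) C2(1) V \<kappa> by (simp add: C_def)
 show ?thesis
 proof (rule that[OF C])
  fix h :: real and u :: "real^'n \<Rightarrow> complex" and Mu
  assume h: "0 < h" "h \<le> 1" and u: "u \<in> borel_measurable borel" "\<And>t. norm (u t) \<le> (Mu::real)" "\<And>t. norm t > R0 \<Longrightarrow> u t = 0"
  define g where "g x = (norm (Top h u x))\<^sup>2" for x
  define G where "G w x = (Bsum h u w x)\<^sup>2 / wt h x w" for w x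
  have Tc: "continuous_on UNIV (Top h u)" by (rule Top_continuous[OF h u])
  have wp: "wt h x w > 0" for x w by (rule wt_pos[OF h(1)])
  have gc: "continuous_on UNIV g" unfolding g_def by (intro continuous_intros Tc)
  have Gc: "continuous_on UNIV (G w)" if "w \<in> cells h" for w
   unfolding G_def using wp that by (intro continuous_intros Bsum_continuous[OF h _ u(1,2)] wt_continuous) (auto simp: less_le)
  have g0: "g x \<ge> 0" and G0: "G w x \<ge> 0" for x w using wp[of x w] by (auto simp: g_def G_def)
  have [measurable]: "g \<in> borel_measurable borel" by (rule borel_measurable_continuous_onI[OF gc])
  have bump_meas: "(\<lambda>z. ennreal (bump (snd z) h M (fst z))) \<in> borel_measurable borel"
   "(\<lambda>z. ennreal (bump (snd z) h M (fst z))) \<in> borel_measurable (lborel \<Otimes>\<^sub>M lborel)"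
  proof -
   show *: "(\<lambda>z. ennreal (bump (snd z) h M (fst z))) \<in> borel_measurable borel"
    unfolding bump_def by (intro measurable_compose[OF _ measurable_ennreal] borel_measurable_continuous_onI continuous_intros) (use h in auto)
   show "(\<lambda>z. ennreal (bump (snd z) h M (fst z))) \<in> borel_measurable (lborel \<Otimes>\<^sub>M lborel)"
    using * unfolding lborel_prod by simp
  qed
  have dist_meas: "(\<lambda>z::(real^'n) \<times> (real^'n). indicator (cball (snd z) h) (fst z) :: ennreal) \<in> borel_measurable (lborel \<Otimes>\<^sub>M lborel)"
  proof -
   have "{z::(real^'n) \<times> (real^'n). dist (snd z) (fst z) \<le> h} \<in> sets borel"
    by (intro borel_closed closed_Collect_le continuous_intros)
   then have "(\<lambda>z. indicator {z::(real^'n) \<times> (real^'n). dist (snd z) (fst z) \<le> h} z :: ennreal) \<in> borel_measurable borel" by simp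
   then show ?thesis unfolding lborel_prod by (simp add: indicator_def)
  qed
  \<comment> \<open>Every centre within \<open>h / 2\<close> of a point of norm at most
    \<open>R0\<close> lies in this ball, on which the local bound is available.\<close>
  define Y where "Y = (cball 0 (R0 + 1) :: (real^'n) set)"
  have Ym [measurable]: "Y \<in> sets borel" by (simp add: Y_def)
  have vol: "(NN y. indicator (cball x r) y) = ennreal (V * r ^ CARD('n))" if "r \<ge> 0" for x :: "real^'n" and r
   using that by (simp add: emeasure_cball V_def)
  have lower: "ennreal (\<kappa> * h ^ CARD('n)) * ennreal (g x) \<le> (NN y. indicator Y y * ennreal (bump y h M x) * ennreal (g x))" for x
  proof (cases "norm x \<le> R0")
   case False
   then have "g x = 0" by (simp add: g_def Top_eq_0)
   then show ?thesis by simp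
  next
   case True
   have "ennreal (\<kappa> * h ^ CARD('n)) = ennreal ((3/4) ^ M) * ennreal (V * (h / 2) ^ CARD('n))"
    using V by (simp add: \<kappa>_def ennreal_mult'[symmetric] power_divide mult_ac)
   also have "\<dots> = (NN y. ennreal ((3/4) ^ M) * indicator (cball x (h / 2)) y)"
    using vol[of "h / 2" x] h by (subst nn_integral_cmult) (auto intro: borel_measurable_indicator)
   also have "\<dots> \<le> (NN y. indicator Y y * ennreal (bump y h M x))"
   proof (rule nn_integral_mono)
    fix y
    show "ennreal ((3/4) ^ M) * indicator (cball x (h / 2)) y \<le> indicator Y y * ennreal (bump y h M x)"
    proof (cases "y \<in> cball x (h / 2)")
     case y: True
     then have d: "norm (x - y) \<le> h / 2" by (simp add: dist_norm)
     have "norm y \<le> R0 + 1" using norm_triangle_ineq4[of x "x - y"] d True h by simp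
     then have "indicator Y y = (1::ennreal)" by (simp add: Y_def)
     then show ?thesis using y bump_lower[OF h(1) d, of M] by (simp add: ennreal_leI)
    qed simp
   qed
   finally have "ennreal (\<kappa> * h ^ CARD('n)) * ennreal (g x) \<le> (NN y. indicator Y y * ennreal (bump y h M x)) * ennreal (g x)"
    by (rule mult_right_mono) simp
   also have "\<dots> = (NN y. indicator Y y * ennreal (bump y h M x) * ennreal (g x))"
   proof (rule nn_integral_multc[symmetric])
    have [measurable]: "(\<lambda>y. bump y h M x) \<in> borel_measurable borel"
     unfolding bump_def by (intro borel_measurable_continuous_onI continuous_intros) (use h in auto)
    show "(\<lambda>y. indicator Y y * ennreal (bump y h M x)) \<in> borel_measurable lborel" by measurable
   qed
   finally show ?thesis .
  qed
  have "ennreal (\<kappa> * h ^ CARD('n)) * (NN x. ennreal (g x)) = (NN x. ennreal (\<kappa> * h ^ CARD('n)) * ennreal (g x))"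
   by (rule nn_integral_cmult[symmetric]) measurable
  also have "\<dots> \<le> (NN x. (NN y. indicator Y y * ennreal (bump y h M x) * ennreal (g x)))"
   by (rule nn_integral_mono[OF lower])
  also have "\<dots> = (NN y. (NN x. indicator Y y * ennreal (bump y h M x) * ennreal (g x)))"
  proof (rule lborel_pair.Fubini'[symmetric])
   note [measurable] = bump_meas(2)
   show "(\<lambda>(x, y). indicator Y y * ennreal (bump y h M x) * ennreal (g x)) \<in> borel_measurable (lborel \<Otimes>\<^sub>M lborel)"
    unfolding split_beta by measurable
  qed
  also have "\<dots> \<le> (NN y. ennreal C1 * (\<Sum>w\<in>cells h. (NN x. indicator (cball y h) x * ennreal (G w x))))"
  proof (rule nn_integral_mono)
   fix y :: "real^'n"
   show "(NN x. indicator Y y * ennreal (bump y h M x) * ennreal (g x))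
    \<le> ennreal C1 * (\<Sum>w\<in>cells h. (NN x. indicator (cball y h) x * ennreal (G w x)))"
   proof (cases "y \<in> Y")
    case False then show ?thesis by simp
   next
    case True
    then have y: "norm y \<le> R0 + 1" by (simp add: Y_def)
    have bc: "continuous_on UNIV (\<lambda>x. bump y h M x * g x)" by (intro continuous_intros continuous_bump gc)
    have cint: "integrable lborel (\<lambda>x. indicator (cball y h) x * f x)" if "continuous_on UNIV f" for f :: "real^'n \<Rightarrow> real"
     using borel_integrable_compact[OF compact_cball continuous_on_subset[OF that], of y h] by simp
    have "(\<lambda>x. bump y h M x * g x) = (\<lambda>x. indicator (cball y h) x * (bump y h M x * g x))"
    proof
     fix x show "bump y h M x * g x = indicator (cball y h) x * (bump y h M x * g x)"
      using bump_eq_0[OF h(1), of M x y] by (cases "x \<in> cball y h") (simp_all add: M_def)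
    qed
    then have bi: "integrable lborel (\<lambda>x. bump y h M x * g x)" using cint[OF bc] by simp
    have "(NN x. indicator Y y * ennreal (bump y h M x) * ennreal (g x)) = (NN x. ennreal (bump y h M x * g x))"
     using True g0 bump_nonneg[of y h M] by (simp add: ennreal_mult)
    also have "\<dots> = ennreal (LI x. bump y h M x * g x)"
     by (rule nn_integral_eq_integral[OF bi]) (simp add: bump_nonneg g0)
    also have "\<dots> \<le> ennreal (C1 * (\<Sum>w\<in>cells h. (LI x. indicator (cball y h) x * G w x)))"
     unfolding g_def G_def by (intro ennreal_leI C1(2)[OF h y u])
    also have "\<dots> = ennreal C1 * (\<Sum>w\<in>cells h. ennreal (LI x. indicator (cball y h) x * G w x))"
     using C1(1) G0 by (subst sum_ennreal) (auto simp: ennreal_mult' intro!: Bochner_Integration.integral_nonneg)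
    also have "\<dots> = ennreal C1 * (\<Sum>w\<in>cells h. (NN x. indicator (cball y h) x * ennreal (G w x)))"
    proof -
     have "ennreal (LI x. indicator (cball y h) x * G w x) = (NN x. indicator (cball y h) x * ennreal (G w x))"
      if "w \<in> cells h" for w
     proof -
      have "(NN x. indicator (cball y h) x * ennreal (G w x)) = (NN x. ennreal (indicator (cball y h) x * G w x))"
       using G0 by (intro nn_integral_cong) (auto simp: indicator_def)
      also have "\<dots> = ennreal (LI x. indicator (cball y h) x * G w x)"
       by (rule nn_integral_eq_integral[OF cint[OF Gc[OF that]]]) (simp add: G0)
      finally show ?thesis ..
     qed
     then show ?thesis by simp
    qed
    finally show ?thesis .
   qed
  qed
  also have "\<dots> = ennreal C1 * (\<Sum>w\<in>cells h. ennreal (V * h ^ CARD('n)) * (NN x. ennreal (G w x)))"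
  proof -
   have m2: "(\<lambda>z. indicator (cball (snd z) h) (fst z) * ennreal (G w (fst z))) \<in> borel_measurable (lborel \<Otimes>\<^sub>M lborel)"
    if w: "w \<in> cells h" for w
   proof -
    note [measurable] = borel_measurable_continuous_onI[OF Gc[OF w]] dist_meas
    show ?thesis by measurable
   qed
   have m1: "(\<lambda>y. (NN x. indicator (cball y h) x * ennreal (G w x))) \<in> borel_measurable lborel" if w: "w \<in> cells h" for w
   proof -
    have "(\<lambda>(y, x). indicator (cball y h) x * ennreal (G w x)) \<in> borel_measurable (lborel \<Otimes>\<^sub>M lborel)"
     using measurable_pair_swap[OF m2[OF w]] by (simp add: split_beta)
    then show ?thesis using lborel.borel_measurable_nn_integral by blast
   qed
   have sw: "(NN y. (NN x. indicator (cball y h) x * ennreal (G w x))) = ennreal (V * h ^ CARD('n)) * (NN x. ennreal (G w x))"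
    if w: "w \<in> cells h" for w
   proof -
    note [measurable] = borel_measurable_continuous_onI[OF Gc[OF w]]
    have "(NN y. (NN x. indicator (cball y h) x * ennreal (G w x))) = (NN x. (NN y. indicator (cball y h) x * ennreal (G w x)))"
     by (rule lborel_pair.Fubini') (use m2[OF w] in \<open>simp add: split_beta\<close>)
    also have "\<dots> = (NN x. ennreal (V * h ^ CARD('n)) * ennreal (G w x))"
    proof (rule nn_integral_cong)
     fix x
     have "(NN y. indicator (cball y h) x * ennreal (G w x)) = (NN y. indicator (cball x h) y * ennreal (G w x))"
      by (intro nn_integral_cong) (simp add: indicator_def dist_commute)
     also have "\<dots> = (NN y. indicator (cball x h) y) * ennreal (G w x)"
      by (rule nn_integral_multc) (auto intro: borel_measurable_indicator)
     also have "\<dots> = ennreal (V * h ^ CARD('n)) * ennreal (G w x)" using vol[of h x] h by simp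
     finally show "(NN y. indicator (cball y h) x * ennreal (G w x)) = ennreal (V * h ^ CARD('n)) * ennreal (G w x)" .
    qed
    also have "\<dots> = ennreal (V * h ^ CARD('n)) * (NN x. ennreal (G w x))" by (rule nn_integral_cmult) measurable
    finally show ?thesis .
   qed
   have "(NN y. ennreal C1 * (\<Sum>w\<in>cells h. (NN x. indicator (cball y h) x * ennreal (G w x))))
    = ennreal C1 * (NN y. (\<Sum>w\<in>cells h. (NN x. indicator (cball y h) x * ennreal (G w x))))"
    by (intro nn_integral_cmult borel_measurable_sum m1)
   also have "(NN y. (\<Sum>w\<in>cells h. (NN x. indicator (cball y h) x * ennreal (G w x))))
    = (\<Sum>w\<in>cells h. (NN y. (NN x. indicator (cball y h) x * ennreal (G w x))))"
    by (intro nn_integral_sum m1)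
   also have "\<dots> = (\<Sum>w\<in>cells h. ennreal (V * h ^ CARD('n)) * (NN x. ennreal (G w x)))"
    by (intro sum.cong refl sw)
   finally show ?thesis .
  qed
  also have "\<dots> \<le> ennreal C1 * (\<Sum>w\<in>cells h. ennreal (V * h ^ CARD('n)) * ennreal (C2 * h ^ (2 * CARD('n)) * (LI t. (norm (piece h u w t))\<^sup>2)))"
   unfolding G_def by (intro mult_left_mono sum_mono C2(2)[OF h _ u(1,2)]) auto
  also have "\<dots> = ennreal (C1 * (\<Sum>w\<in>cells h. (V * h ^ CARD('n)) * (C2 * h ^ (2 * CARD('n)) * (LI t. (norm (piece h u w t))\<^sup>2))))"
  proof -
   have i0: "(LI t. (norm (piece h u w t))\<^sup>2) \<ge> 0" for w by (intro Bochner_Integration.integral_nonneg) simp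
   have "ennreal (V * h ^ CARD('n)) * ennreal (C2 * h ^ (2 * CARD('n)) * (LI t. (norm (piece h u w t))\<^sup>2))
    = ennreal ((V * h ^ CARD('n)) * (C2 * h ^ (2 * CARD('n)) * (LI t. (norm (piece h u w t))\<^sup>2)))" for w
    using V h by (intro ennreal_mult'[symmetric]) auto
   moreover have "(\<Sum>w\<in>cells h. ennreal ((V * h ^ CARD('n)) * (C2 * h ^ (2 * CARD('n)) * (LI t. (norm (piece h u w t))\<^sup>2))))
    = ennreal (\<Sum>w\<in>cells h. (V * h ^ CARD('n)) * (C2 * h ^ (2 * CARD('n)) * (LI t. (norm (piece h u w t))\<^sup>2)))"
    using V h C2(1) i0 by (intro sum_ennreal) auto
   ultimately show ?thesis using C1(1) by (simp only: ennreal_mult')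
  qed
  also have "(\<Sum>w\<in>cells h. (V * h ^ CARD('n)) * (C2 * h ^ (2 * CARD('n)) * (LI t. (norm (piece h u w t))\<^sup>2)))
   = (V * h ^ CARD('n)) * (C2 * h ^ (2 * CARD('n)) * (LI t. (norm (u t))\<^sup>2))"
   by (simp only: sum_distrib_left[symmetric] integral_piece_sum[OF h u])
  also have "C1 * ((V * h ^ CARD('n)) * (C2 * h ^ (2 * CARD('n)) * (LI t. (norm (u t))\<^sup>2)))
   = (\<kappa> * h ^ CARD('n)) * (C * h ^ (2 * CARD('n)) * (LI t. (norm (u t))\<^sup>2))"
   using \<kappa> by (simp add: C_def)
  also have "ennreal \<dots> = ennreal (\<kappa> * h ^ CARD('n)) * ennreal (C * h ^ (2 * CARD('n)) * (LI t. (norm (u t))\<^sup>2))"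
   using \<kappa> h by (intro ennreal_mult') auto
  finally have fin: "ennreal (\<kappa> * h ^ CARD('n)) * (NN x. ennreal (g x))
   \<le> ennreal (\<kappa> * h ^ CARD('n)) * ennreal (C * h ^ (2 * CARD('n)) * (LI t. (norm (u t))\<^sup>2))" .
  have pos: "\<kappa> * h ^ CARD('n) > 0" using \<kappa> h by (intro mult_pos_pos zero_less_power)
  have "ennreal (\<kappa> * h ^ CARD('n)) \<noteq> 0" using pos by (simp only: ennreal_eq_0_iff not_le)
  then show "(NN x. ennreal ((norm (Top h u x))\<^sup>2)) \<le> ennreal (C * h ^ (2 * CARD('n)) * (LI t. (norm (u t))\<^sup>2))"
   using fin ennreal_mult_le_mult_iff[OF _ ennreal_neq_top] unfolding g_def by blast
 qed
qed

end

lemma nn_integral_le_of_tendsto: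
 fixes f :: "nat \<Rightarrow> 'a \<Rightarrow> ennreal"
 assumes "\<And>k. f k \<in> borel_measurable M" "\<And>x. (\<lambda>k. f k x) \<longlonglongrightarrow> g x" "\<And>k. (\<integral>\<^sup>+x. f k x \<partial>M) \<le> A"
 shows "(\<integral>\<^sup>+x. g x \<partial>M) \<le> A"
proof -
 have "(\<integral>\<^sup>+x. g x \<partial>M) = (\<integral>\<^sup>+x. liminf (\<lambda>k. f k x) \<partial>M)"
  using lim_imp_Liminf[OF sequentially_bot assms(2)] by simp
 also have "\<dots> \<le> liminf (\<lambda>k. \<integral>\<^sup>+x. f k x \<partial>M)" by (rule nn_integral_liminf[OF assms(1)])
 also have "\<dots> \<le> liminf (\<lambda>k::nat. A)" by (rule Liminf_mono) (simp add: assms(3))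
 also have "\<dots> = A" by (rule Liminf_const) simp
 finally show ?thesis .
qed

context damped_oscillation
begin

text \<open>General \<open>u\<close> is reached by truncating both its size and its support: the
  images converge pointwise by dominated convergence, and Fatou's lemma preserves the bound.\<close>

lemma Top_L2:
 obtains C where "C > 0"
  "\<And>h u. \<lbrakk>0 < h; h \<le> 1; u \<in> borel_measurable borel\<rbrakk> \<Longrightarrow>
   (NN x. ennreal ((norm (Top h u x))\<^sup>2)) \<le> ennreal (C * h ^ (2 * CARD('n))) * (NN t. ennreal ((norm (u t))\<^sup>2))"
proof -
 obtain C where C: "C \<ge> 0"
  "\<And>h u Mu. \<lbrakk>0 < h; h \<le> 1; u \<in> borel_measurable borel; (\<And>t. norm (u t) \<le> Mu); (\<And>t. norm t > R0 \<Longrightarrow> u t = 0)\<rbrakk> \<Longrightarrow>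
   (NN x. ennreal ((norm (Top h u x))\<^sup>2)) \<le> ennreal (C * h ^ (2 * CARD('n)) * (LI t. (norm (u t))\<^sup>2))"
  by (rule Top_L2_bounded) blast
 show ?thesis
 \<comment> \<open>A strictly positive constant keeps the right-hand side infinite when the norm of
   \<open>u\<close> is infinite.\<close>
 proof (rule that[of "C + 1"])
  show "C + 1 > 0" using C(1) by simp
  fix h :: real and u :: "real^'n \<Rightarrow> complex"
  assume h: "0 < h" "h \<le> 1" and u: "u \<in> borel_measurable borel"
  note [measurable] = u
  define N where "N = (NN t. ennreal ((norm (u t))\<^sup>2))"
  have "(NN x. ennreal ((norm (Top h u x))\<^sup>2)) \<le> ennreal ((C + 1) * h ^ (2 * CARD('n))) * N"
  proof (cases "N = \<infinity>")
   case True
   define X where "X = (C + 1) * h ^ (2 * CARD('n))"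
   have "X > 0" using C(1) h by (simp add: X_def)
   then show ?thesis unfolding X_def[symmetric] using True by (simp add: ennreal_mult_eq_top_iff ennreal_mult_top)
  next
   case False
   define uk where "uk k t = (if norm t \<le> R0 \<and> norm (u t) \<le> real k then u t else 0)" for k t
   have ukm [measurable]: "uk k \<in> borel_measurable borel" for k unfolding uk_def[abs_def] by measurable
   have ukb: "norm (uk k t) \<le> real k" "norm t > R0 \<Longrightarrow> uk k t = 0" for k t by (auto simp: uk_def)
   have uk2: "(norm (uk k t))\<^sup>2 \<le> (norm (u t))\<^sup>2" for k t by (simp add: uk_def)
   have intu: "integrable lborel (\<lambda>t. (norm (u t))\<^sup>2)"
   proof (rule integrableI_nonneg)
    have "N < \<infinity>" using False by (simp add: less_top)
    then show "(NN t. ennreal ((norm (u t))\<^sup>2)) < \<infinity>" by (simp only: N_def)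
   qed auto
   have intu1: "integrable lborel (\<lambda>t. indicator (cball 0 R0) t * (1 + (norm (u t))\<^sup>2))"
   proof -
    have "integrable lborel (\<lambda>t. indicator (cball 0 R0) t + indicator (cball 0 R0) t *\<^sub>R (norm (u t))\<^sup>2)"
     using emeasure_bounded_finite[OF bounded_cball, of 0 R0]
     by (intro Bochner_Integration.integrable_add integrable_mult_indicator intu integrable_real_indicator) auto
    then show ?thesis by (simp add: distrib_left)
   qed
   show ?thesis
   proof (rule nn_integral_le_of_tendsto[where f = "\<lambda>k x. ennreal ((norm (Top h (uk k) x))\<^sup>2)"])
    show "(\<lambda>x. ennreal ((norm (Top h (uk k) x))\<^sup>2)) \<in> borel_measurable lborel" for k
     using borel_measurable_continuous_onI[OF Top_continuous[OF h ukm ukb]] by simp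
    have "(NN x. ennreal ((norm (Top h (uk k) x))\<^sup>2)) \<le> ennreal (C * h ^ (2 * CARD('n)) * (LI t. (norm (uk k t))\<^sup>2))" for k
     by (rule C(2)[OF h ukm ukb])
    also have "\<dots> k \<le> ennreal ((C + 1) * h ^ (2 * CARD('n)) * (LI t. (norm (u t))\<^sup>2))" for k
    proof (intro ennreal_leI mult_mono)
     show "(LI t. (norm (uk k t))\<^sup>2) \<le> (LI t. (norm (u t))\<^sup>2)"
      by (rule integral_mono[OF Bochner_Integration.integrable_bound[OF intu] intu])
       (use uk2 in \<open>auto\<close>)
    qed (use C(1) h in \<open>auto intro!: Bochner_Integration.integral_nonneg\<close>)
    also have "ennreal ((C + 1) * h ^ (2 * CARD('n)) * (LI t. (norm (u t))\<^sup>2)) = ennreal ((C + 1) * h ^ (2 * CARD('n))) * N"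
     unfolding N_def using C(1) h by (subst nn_integral_eq_integral[OF intu]) (auto intro!: ennreal_mult')
    finally show "(NN x. ennreal ((norm (Top h (uk k) x))\<^sup>2)) \<le> ennreal ((C + 1) * h ^ (2 * CARD('n))) * N" for k .
    fix x
    define k where "k t = expi (S (x, t) / h\<^sup>2) * \<psi> (x, t)" for t
    have kc: "continuous_on UNIV k" unfolding k_def
     by (intro continuous_intros continuous_on_compose2[OF smooth_on_continuous[OF S_smooth]]
       continuous_on_compose2[OF smooth_on_continuous[OF psi_smooth]]) (use h in auto)
    note [measurable] = borel_measurable_continuous_onI[OF kc]
    have "bounded (k ` cball 0 R0)"
     by (intro compact_imp_bounded compact_continuous_image continuous_on_subset[OF kc]) auto
    then obtain Ck where Ck: "\<And>t. t \<in> cball 0 R0 \<Longrightarrow> norm (k t) \<le> Ck" unfolding bounded_iff by blast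
    have k0: "k t = 0" if "norm t > R0" for t
    proof -
     have "\<psi> (x, t) = 0" using psi_supp[of "(x, t)"] that by fastforce
     then show ?thesis by (simp add: k_def)
    qed
    have "(\<lambda>i. (LI t. k t * uk i t)) \<longlonglongrightarrow> (LI t. k t * u t)"
    proof (rule integral_dominated_convergence[where w = "\<lambda>t. \<bar>Ck\<bar> * (indicator (cball 0 R0) t * (1 + (norm (u t))\<^sup>2))"])
     show "integrable lborel (\<lambda>t. \<bar>Ck\<bar> * (indicator (cball 0 R0) t * (1 + (norm (u t))\<^sup>2)))"
      by (rule integrable_mult_right[OF intu1])
     show "AE t in lborel. (\<lambda>i. k t * uk i t) \<longlonglongrightarrow> k t * u t"
     proof (rule AE_I2)
      fix t
      show "(\<lambda>i. k t * uk i t) \<longlonglongrightarrow> k t * u t"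
      proof (cases "norm t \<le> R0")
       case True
       obtain m where "norm (u t) \<le> real m" using real_arch_simple by blast
       then have "\<forall>i\<ge>m. uk i t = u t" using True by (auto simp: uk_def)
       then have "\<forall>\<^sub>F i in sequentially. k t * uk i t = k t * u t" by (auto simp: eventually_sequentially)
       then show ?thesis by (rule tendsto_eventually)
      next
       case False
       then show ?thesis using k0 by simp
      qed
     qed
     show "AE t in lborel. norm (k t * uk i t) \<le> \<bar>Ck\<bar> * (indicator (cball 0 R0) t * (1 + (norm (u t))\<^sup>2))" for i
     proof (rule AE_I2)
      fix t
      show "norm (k t * uk i t) \<le> \<bar>Ck\<bar> * (indicator (cball 0 R0) t * (1 + (norm (u t))\<^sup>2))"
      proof (cases "norm t \<le> R0")
       case True
       have "norm (uk i t) \<le> norm (u t)" by (simp add: uk_def)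
       also have "\<dots> \<le> 1 + (norm (u t))\<^sup>2"
       proof -
        have "2 * norm (u t) \<le> 1 + (norm (u t))\<^sup>2" using zero_le_power2[of "norm (u t) - 1"] by (simp add: power2_diff)
        then show ?thesis using norm_ge_zero[of "u t"] by linarith
       qed
       finally have "norm (uk i t) \<le> 1 + (norm (u t))\<^sup>2" .
       moreover have "norm (k t) \<le> \<bar>Ck\<bar>" using Ck[of t] True by simp
       ultimately show ?thesis using True by (simp add: norm_mult mult_mono)
      next
       case False
       then show ?thesis using ukb(2)[of t i] by simp
      qed
     qed
    qed measurable
    then have "(\<lambda>i. Top h (uk i) x) \<longlonglongrightarrow> Top h u x" by (simp add: Top_def k_def)
    then show "(\<lambda>i. ennreal ((norm (Top h (uk i) x))\<^sup>2)) \<longlonglongrightarrow> ennreal ((norm (Top h u x))\<^sup>2)"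
     by (intro tendsto_ennrealI tendsto_intros)
   qed
  qed
  then show "(NN x. ennreal ((norm (Top h u x))\<^sup>2)) \<le> ennreal ((C + 1) * h ^ (2 * CARD('n))) * (NN t. ennreal ((norm (u t))\<^sup>2))"
   by (simp only: N_def)
 qed
qed

end

section \<open>Interpolation between L1, L2 and L-infinity\<close>

lemma nn_integral_of_has_integral_on:
 fixes f :: "real \<Rightarrow> real"
 assumes [measurable]: "f \<in> borel_measurable borel" "X \<in> sets borel"
  and "\<And>x. 0 \<le> f x" "(f has_integral I) X"
 shows "(NN x. indicator X x * ennreal (f x)) = ennreal I"
proof -
 have "integral\<^sup>N lborel (\<lambda>x. ennreal (if x \<in> X then f x else 0)) = ennreal I"
  by (rule nn_integral_has_integral_lborel) (use assms in \<open>auto simp: has_integral_restrict_UNIV\<close>)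
 moreover have "indicator X x * ennreal (f x) = ennreal (if x \<in> X then f x else 0)" for x by (simp add: indicator_def)
 ultimately show ?thesis by (simp only:)
qed

lemma nn_integral_powr_below:
 assumes "a > -1" "z \<ge> 0"
 shows "(NN s. indicator {0..z} s * ennreal (s powr a)) = ennreal (z powr (a + 1) / (a + 1))"
 by (rule nn_integral_of_has_integral_on[OF _ _ _ has_integral_powr_from_0[OF assms]]) auto

lemma nn_integral_powr_above:
 assumes "a < -1" "z > 0"
 shows "(NN s. indicator {z..} s * ennreal (s powr a)) = ennreal (z powr (a + 1) / (- a - 1))"
proof -
 have "- (z powr (a + 1)) / (a + 1) = z powr (a + 1) / (- a - 1)" using assms(1) by (simp add: field_simps)
 then show ?thesis using nn_integral_of_has_integral_on[OF _ _ _ has_integral_powr_to_inf[OF assms]] by simp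
qed

text \<open>If \<open>a\<close> is the larger summand the linear branch is used, otherwise the
  quadratic one. The function min(z^2, z) stands in for the distribution function of the
  Marcinkiewicz argument and lets the strong bounds on L1 and L2 enter directly.\<close>

lemma min_square_add_le:
 fixes a b :: real
 assumes "a \<ge> 0" "b \<ge> 0" "0 \<le> z" "z \<le> a + b" shows "min (z\<^sup>2) z \<le> 2 * a + 4 * b\<^sup>2"
proof (cases "b \<le> a")
 case True then show ?thesis using assms by (auto simp: min_le_iff_disj intro: add_increasing2)
next
 case False
 then have "z\<^sup>2 \<le> (2 * b)\<^sup>2" using assms by (intro power_mono) auto
 also have "\<dots> \<le> 2 * a + 4 * b\<^sup>2" using assms by (simp add: power2_eq_square)
 finally show ?thesis by simp
qed

text \<open>Additivity at the truncations of one function, the form in which linearity enters the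
  interpolation. For operators given by integrals it can fail when these diverge, so it is a
  condition on \<open>f\<close>.\<close>

definition splits :: "(('a \<Rightarrow> complex) \<Rightarrow> 'a \<Rightarrow> complex) \<Rightarrow> ('a \<Rightarrow> complex) \<Rightarrow> bool" where
 "splits T f \<longleftrightarrow> (\<forall>\<sigma> x. T f x = T (\<lambda>t. if norm (f t) > \<sigma> then f t else 0) x + T (\<lambda>t. if norm (f t) \<le> \<sigma> then f t else 0) x)"

locale bounded_L1_L2 =
 fixes T :: "('a::euclidean_space \<Rightarrow> complex) \<Rightarrow> 'a \<Rightarrow> complex" and A D :: real
 assumes A: "A > 0" and D: "D > 0"
  and T_meas: "\<And>g. g \<in> borel_measurable borel \<Longrightarrow> T g \<in> borel_measurable borel"
  and T_L2: "\<And>g. g \<in> borel_measurable borel \<Longrightarrow>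
   (NN x. ennreal ((norm (T g x))\<^sup>2)) \<le> ennreal D * (NN x. ennreal ((norm (g x))\<^sup>2))"
  and T_L1: "\<And>g. g \<in> borel_measurable borel \<Longrightarrow>
   (NN x. ennreal (norm (T g x))) \<le> ennreal A * (NN x. ennreal (norm (g x)))"
  and T_Linf: "\<And>g M x. g \<in> borel_measurable borel \<Longrightarrow> (AE t in lborel. norm (g t) \<le> M) \<Longrightarrow> norm (T g x) \<le> A * M"
begin

text \<open>Integrating s^(p-1) min((z/s)^2, z/s) over s gives z^p divided by (p-1)(2-p). Truncating
  \<open>f\<close> at height \<open>\<tau> * s\<close> and integrating the two endpoint bounds
  produces the same denominator on the other side. The two occurrences cancel through
  \<open>cp\<close>, so the constant stays bounded as \<open>p\<close> approaches 1 or 2.\<close>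

lemma interp_low:
 assumes p: "1 < p" "p < 2" and f: "f \<in> borel_measurable borel" "splits T f"
 shows "(NN x. ennreal (norm (T f x) powr p))
  \<le> ennreal (4 * A powr (2 - p) * D powr (p - 1)) * (NN x. ennreal (norm (f x) powr p))"
proof -
 define cp where "cp = (p - 1) * (2 - p)"
 have cp: "cp > 0" using p by (simp add: cp_def)
 \<comment> \<open>This ratio balances the truncation: both endpoint contributions become multiples
   of the same number \<open>E\<close>.\<close>
 define \<tau> where "\<tau> = A / D"
 have \<tau>: "\<tau> > 0" using A D by (simp add: \<tau>_def)
 define g where "g x = norm (T f x)" for x
 define f1 where "f1 s t = (if norm (f t) > \<tau> * s then f t else 0)" for s t
 define f2 where "f2 s t = (if norm (f t) \<le> \<tau> * s then f t else 0)" for s t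
 note [measurable] = f(1) T_meas[OF f(1)]
 have gm [measurable]: "g \<in> borel_measurable borel" unfolding g_def by measurable
 have f12m [measurable]: "f1 s \<in> borel_measurable borel" "f2 s \<in> borel_measurable borel" for s
  unfolding f1_def[abs_def] f2_def[abs_def] by measurable
 note [measurable] = T_meas[OF f12m(1)] T_meas[OF f12m(2)]
 define \<Phi> where "\<Phi> s z = ennreal (s powr (p - 1) * min ((z / s)\<^sup>2) (z / s))" for s z :: real
 have low: "ennreal (z powr p) \<le> ennreal cp * (NN s. indicator {0<..} s * \<Phi> s z)" if z: "z \<ge> 0" for z
 proof (cases "z = 0")
  case False
  then have z: "z > 0" using that by simp
  have "ennreal (z powr p) = ennreal cp * (ennreal (z powr p / (p - 1)) + ennreal (z powr p / (2 - p)))"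
  proof -
   have "cp * (z powr p / (p - 1)) = (2 - p) * z powr p" "cp * (z powr p / (2 - p)) = (p - 1) * z powr p"
    using p by (simp_all add: cp_def)
   then have "cp * (z powr p / (p - 1) + z powr p / (2 - p)) = z powr p" by (simp only: distrib_left) (simp add: algebra_simps)
   moreover have "ennreal (z powr p / (p - 1)) + ennreal (z powr p / (2 - p)) = ennreal (z powr p / (p - 1) + z powr p / (2 - p))"
    using p by (intro ennreal_plus[symmetric]) auto
   ultimately show ?thesis using cp by (simp add: ennreal_mult'[symmetric])
  qed
  also have "ennreal (z powr p / (p - 1)) = ennreal z * ennreal (z powr (p - 2 + 1) / (p - 2 + 1))"
   using z by (simp add: ennreal_mult'[symmetric] powr_mult_base)
  also have "\<dots> = ennreal z * (NN s. indicator {0..z} s * ennreal (s powr (p - 2)))"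
   using p z by (subst nn_integral_powr_below) auto
  also have "\<dots> = (NN s. ennreal z * (indicator {0..z} s * ennreal (s powr (p - 2))))"
   by (subst nn_integral_cmult) auto
  also have "ennreal (z powr p / (2 - p)) = ennreal (z\<^sup>2) * ennreal (z powr (p - 3 + 1) / (- (p - 3) - 1))"
  proof -
   have "z\<^sup>2 * z powr (p - 3 + 1) = z powr p" using z by (simp add: powr_add[symmetric] flip: powr_numeral)
   then show ?thesis by (simp add: ennreal_mult'[symmetric])
  qed
  also have "\<dots> = ennreal (z\<^sup>2) * (NN s. indicator {z..} s * ennreal (s powr (p - 3)))"
   using p z by (subst nn_integral_powr_above) auto
  also have "\<dots> = (NN s. ennreal (z\<^sup>2) * (indicator {z..} s * ennreal (s powr (p - 3))))"
   by (subst nn_integral_cmult) auto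
  also have "(NN s. ennreal z * (indicator {0..z} s * ennreal (s powr (p - 2)))) +
   (NN s. ennreal (z\<^sup>2) * (indicator {z..} s * ennreal (s powr (p - 3))))
   = (NN s. ennreal z * (indicator {0..z} s * ennreal (s powr (p - 2))) + ennreal (z\<^sup>2) * (indicator {z..} s * ennreal (s powr (p - 3))))"
   by (subst nn_integral_add) auto
  also have "\<dots> \<le> (NN s. indicator {0<..} s * \<Phi> s z)"
  proof (rule nn_integral_mono_AE)
   \<comment> \<open>The two ranges of integration overlap at \<open>s = z\<close>, and the
     right-hand side leaves out \<open>s = 0\<close>; both are null sets.\<close>
   have "AE s in lborel. s \<noteq> z" by (rule AE_lborel_singleton)
   moreover have "AE s in lborel. s \<noteq> (0::real)" by (rule AE_lborel_singleton)
   ultimately show "AE s in lborel. ennreal z * (indicator {0..z} s * ennreal (s powr (p - 2))) + ennreal (z\<^sup>2) * (indicator {z..} s * ennreal (s powr (p - 3)))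
    \<le> indicator {0<..} s * \<Phi> s z"
   proof eventually_elim
    fix s assume s: "s \<noteq> z" "s \<noteq> 0"
    consider "s < 0" | "0 < s" "s < z" | "z < s" using s by linarith
    then show "ennreal z * (indicator {0..z} s * ennreal (s powr (p - 2))) + ennreal (z\<^sup>2) * (indicator {z..} s * ennreal (s powr (p - 3)))
     \<le> indicator {0<..} s * \<Phi> s z"
    proof cases
     case 2
     have "z / s \<ge> 1" using 2 by simp
     then have "min ((z / s)\<^sup>2) (z / s) = z / s" using power_increasing[of 1 2 "z / s"] by (simp only: power_one_right) simp
     moreover have "s powr (p - 1) * (z / s) = z * s powr (p - 2)"
      using 2 powr_diff[of s "p - 1" 1] by (simp add: field_simps)
     ultimately show ?thesis using 2 z by (simp add: \<Phi>_def ennreal_mult')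
    next
     case 3
     then have "z / s \<le> 1" "0 \<le> z / s" using z by simp_all
     then have "min ((z / s)\<^sup>2) (z / s) = (z / s)\<^sup>2" using power_decreasing[of 1 2 "z / s"] by (simp only: power_one_right) simp
     moreover have "s powr (p - 1) * (z / s)\<^sup>2 = z\<^sup>2 * s powr (p - 3)"
      using 3 z powr_diff[of s "p - 1" 2] by (simp add: field_simps)
     ultimately show ?thesis using 3 z by (simp add: \<Phi>_def ennreal_mult')
    qed (use z in auto)
   qed
  qed
  finally show ?thesis by (simp add: mult_left_mono)
 qed simp
 have inner: "(NN x. \<Phi> s (g x)) \<le> (NN t. ennreal (2 * A) * (ennreal (s powr (p - 2)) * ennreal (norm (f1 s t)))
   + ennreal (4 * D) * (ennreal (s powr (p - 3)) * ennreal ((norm (f2 s t))\<^sup>2)))" if s: "s > 0" for s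
 proof -
  have e1: "s powr (p - 1) * (2 * (a / s) + 4 * (b / s)\<^sup>2) = s powr (p - 2) * (2 * a) + s powr (p - 3) * (4 * b\<^sup>2)" for a b
  proof -
   have d: "s powr (p - 1) / s = s powr (p - 2)" "s powr (p - 1) / s\<^sup>2 = s powr (p - 3)"
    using s powr_diff[of s "p - 1" 1] powr_diff[of s "p - 1" 2] by simp_all
   have "s powr (p - 1) * (2 * (a / s) + 4 * (b / s)\<^sup>2) = (s powr (p - 1) / s) * (2 * a) + (s powr (p - 1) / s\<^sup>2) * (4 * b\<^sup>2)"
    by (simp add: distrib_left power_divide)
   then show ?thesis by (simp only: d)
  qed
  have "(NN x. \<Phi> s (g x)) \<le> (NN x. ennreal (2 * s powr (p - 2)) * ennreal (norm (T (f1 s) x)) + ennreal (4 * s powr (p - 3)) * ennreal ((norm (T (f2 s) x))\<^sup>2))"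
  proof (rule nn_integral_mono)
   fix x
   have "T f x = T (f1 s) x + T (f2 s) x" using f(2) unfolding splits_def f1_def f2_def by blast
   then have "g x \<le> norm (T (f1 s) x) + norm (T (f2 s) x)" by (simp add: g_def norm_triangle_ineq)
   then have "g x / s \<le> norm (T (f1 s) x) / s + norm (T (f2 s) x) / s" using s by (simp add: divide_right_mono flip: add_divide_distrib)
   then have "min ((g x / s)\<^sup>2) (g x / s) \<le> 2 * (norm (T (f1 s) x) / s) + 4 * (norm (T (f2 s) x) / s)\<^sup>2"
    by (intro min_square_add_le) (use s in \<open>auto simp: g_def\<close>)
   then have "s powr (p - 1) * min ((g x / s)\<^sup>2) (g x / s) \<le> s powr (p - 2) * (2 * norm (T (f1 s) x)) + s powr (p - 3) * (4 * (norm (T (f2 s) x))\<^sup>2)"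
    unfolding e1[symmetric] by (intro mult_left_mono) auto
   then have "\<Phi> s (g x) \<le> ennreal (s powr (p - 2) * (2 * norm (T (f1 s) x)) + s powr (p - 3) * (4 * (norm (T (f2 s) x))\<^sup>2))"
    unfolding \<Phi>_def by (rule ennreal_leI)
   also have "\<dots> = ennreal (2 * s powr (p - 2)) * ennreal (norm (T (f1 s) x)) + ennreal (4 * s powr (p - 3)) * ennreal ((norm (T (f2 s) x))\<^sup>2)"
    by (simp add: ennreal_mult'[symmetric] mult_ac)
   finally show "\<Phi> s (g x) \<le> \<dots>" .
  qed
  also have "\<dots> = ennreal (2 * s powr (p - 2)) * (NN x. ennreal (norm (T (f1 s) x))) + ennreal (4 * s powr (p - 3)) * (NN x. ennreal ((norm (T (f2 s) x))\<^sup>2))"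
   by (subst nn_integral_add, measurable, subst (1 2) nn_integral_cmult, measurable)
  also have "\<dots> \<le> ennreal (2 * s powr (p - 2)) * (ennreal A * (NN t. ennreal (norm (f1 s t)))) + ennreal (4 * s powr (p - 3)) * (ennreal D * (NN t. ennreal ((norm (f2 s t))\<^sup>2)))"
   by (intro add_mono mult_left_mono T_L1 T_L2) auto
  also have "\<dots> = (NN t. (ennreal (2 * s powr (p - 2)) * ennreal A) * ennreal (norm (f1 s t)) + (ennreal (4 * s powr (p - 3)) * ennreal D) * ennreal ((norm (f2 s t))\<^sup>2))"
   by (subst nn_integral_add, measurable, subst (1 2) nn_integral_cmult, measurable, simp only: mult.assoc)
  also have "\<dots> = (NN t. ennreal (2 * A) * (ennreal (s powr (p - 2)) * ennreal (norm (f1 s t)))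
   + ennreal (4 * D) * (ennreal (s powr (p - 3)) * ennreal ((norm (f2 s t))\<^sup>2)))"
   using A D by (intro nn_integral_cong) (simp add: ennreal_mult'[symmetric] mult_ac)
  finally show ?thesis .
 qed
 define E where "E = A powr (2 - p) * D powr (p - 1)"
 have E: "E > 0" using A D by (simp add: E_def)
 have E1: "A * \<tau> powr (1 - p) = E"
 proof -
  have "A * (A / D) powr (1 - p) = (A powr 1 * A powr (1 - p)) / D powr (1 - p)" using A D by (simp add: powr_divide)
  also have "\<dots> = A powr (2 - p) * D powr (p - 1)" using A D
   by (simp only: powr_add[symmetric]) (simp add: powr_minus_divide[of D "1 - p"] divide_inverse powr_minus[symmetric])
  finally show ?thesis by (simp add: \<tau>_def E_def)
 qed
 have E2: "D * \<tau> powr (2 - p) = E"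
 proof -
  have "D * (A / D) powr (2 - p) = A powr (2 - p) * (D powr 1 / D powr (2 - p))" using A D by (simp add: powr_divide)
  also have "\<dots> = A powr (2 - p) * D powr (p - 1)" by (simp only: powr_diff[symmetric]) simp
  finally show ?thesis by (simp add: \<tau>_def E_def)
 qed
 have up: "(NN s. indicator {0<..} s * (ennreal (2 * A) * (ennreal (s powr (p - 2)) * ennreal (norm (f1 s t)))
   + ennreal (4 * D) * (ennreal (s powr (p - 3)) * ennreal ((norm (f2 s t))\<^sup>2))))
  \<le> ennreal (4 * E / cp) * ennreal (norm (f t) powr p)" for t
 proof (cases "f t = 0")
  case True
  then have "f1 s t = 0" "f2 s t = 0" for s by (simp_all add: f1_def f2_def)
  then show ?thesis by simp
 next
  case False
  define a where "a = norm (f t)"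
  have a: "a > 0" using False by (simp add: a_def)
  have quot: "(a / \<tau>) powr r = a powr r * \<tau> powr (- r)" for r
   using a \<tau> by (simp add: powr_divide powr_minus_divide)
  have "(NN s. indicator {0<..} s * (ennreal (2 * A) * (ennreal (s powr (p - 2)) * ennreal (norm (f1 s t)))
   + ennreal (4 * D) * (ennreal (s powr (p - 3)) * ennreal ((norm (f2 s t))\<^sup>2))))
   \<le> (NN s. ennreal (2 * A * a) * (indicator {0..a / \<tau>} s * ennreal (s powr (p - 2))) + ennreal (4 * D * a\<^sup>2) * (indicator {a / \<tau>..} s * ennreal (s powr (p - 3))))"
  proof (rule nn_integral_mono)
   fix s :: real
   show "indicator {0<..} s * (ennreal (2 * A) * (ennreal (s powr (p - 2)) * ennreal (norm (f1 s t)))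
    + ennreal (4 * D) * (ennreal (s powr (p - 3)) * ennreal ((norm (f2 s t))\<^sup>2)))
    \<le> ennreal (2 * A * a) * (indicator {0..a / \<tau>} s * ennreal (s powr (p - 2))) + ennreal (4 * D * a\<^sup>2) * (indicator {a / \<tau>..} s * ennreal (s powr (p - 3)))"
   proof (cases "s > 0")
    case s: True
    show ?thesis
    proof (cases "a > \<tau> * s")
     case True
     then have "s \<le> a / \<tau>" using \<tau> by (simp add: pos_le_divide_eq mult.commute)
     then show ?thesis using True s A a by (simp add: f1_def f2_def a_def ennreal_mult'[symmetric] mult_ac)
    next
     case False
     then have "a / \<tau> \<le> s" using \<tau> by (simp add: pos_divide_le_eq mult.commute)
     then show ?thesis using False s D a by (simp add: f1_def f2_def a_def ennreal_mult'[symmetric] mult_ac)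
    qed
   qed simp
  qed
  also have "\<dots> = ennreal (2 * A * a) * ennreal ((a / \<tau>) powr (p - 2 + 1) / (p - 2 + 1)) + ennreal (4 * D * a\<^sup>2) * ennreal ((a / \<tau>) powr (p - 3 + 1) / (- (p - 3) - 1))"
   using p a \<tau> by (subst nn_integral_add, simp, simp, subst (1 2) nn_integral_cmult, simp, simp,
    subst nn_integral_powr_below, simp, simp, subst nn_integral_powr_above) simp_all
  also have "\<dots> = ennreal (2 * A * a * ((a / \<tau>) powr (p - 1) / (p - 1)) + 4 * D * a\<^sup>2 * ((a / \<tau>) powr (p - 2) / (2 - p)))"
   using p A D a by (subst ennreal_plus) (simp_all add: ennreal_mult'[symmetric])
  also have "2 * A * a * ((a / \<tau>) powr (p - 1) / (p - 1)) = 2 * E * a powr p / (p - 1)"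
  proof -
   have "a * (a / \<tau>) powr (p - 1) = a powr p * \<tau> powr (1 - p)"
    using a powr_mult_base[of a "p - 1"] by (simp add: quot mult.assoc[symmetric])
   then have "A * a * (a / \<tau>) powr (p - 1) = E * a powr p" by (simp add: E1[symmetric])
   then show ?thesis by simp
  qed
  also have "4 * D * a\<^sup>2 * ((a / \<tau>) powr (p - 2) / (2 - p)) = 4 * E * a powr p / (2 - p)"
  proof -
   have "a\<^sup>2 * a powr (p - 2) = a powr p" using a by (simp add: powr_add[symmetric] flip: powr_numeral)
   then have "a\<^sup>2 * (a / \<tau>) powr (p - 2) = a powr p * \<tau> powr (2 - p)"
    by (simp add: quot mult.assoc[symmetric])
   then have "D * a\<^sup>2 * (a / \<tau>) powr (p - 2) = E * a powr p" by (simp add: E2[symmetric])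
   then show ?thesis by simp
  qed
  also have "2 * E * a powr p / (p - 1) + 4 * E * a powr p / (2 - p) \<le> 4 * E / cp * a powr p"
  proof -
   have "2 / (p - 1) + 4 / (2 - p) = 2 * p / cp" using p by (simp add: cp_def divide_simps)
   also have "\<dots> \<le> 4 / cp" using p cp by (intro divide_right_mono) auto
   finally have "2 / (p - 1) + 4 / (2 - p) \<le> 4 / cp" .
   then have "(2 / (p - 1) + 4 / (2 - p)) * (E * a powr p) \<le> 4 / cp * (E * a powr p)" using E by (intro mult_right_mono) auto
   then show ?thesis by (simp add: distrib_right)
  qed
  also have "ennreal (4 * E / cp * a powr p) = ennreal (4 * E / cp) * ennreal (norm (f t) powr p)"
   unfolding a_def by (rule ennreal_mult') (use E cp in simp)
  finally show ?thesis by (simp add: ennreal_leI)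
 qed
 have m1: "(\<lambda>(x, s). indicator {0<..} s * \<Phi> s (g x)) \<in> borel_measurable (lborel \<Otimes>\<^sub>M lborel)"
  unfolding \<Phi>_def by measurable
 have m2: "(\<lambda>(t, s). indicator {0<..} s * (ennreal (2 * A) * (ennreal (s powr (p - 2)) * ennreal (norm (f1 s t)))
   + ennreal (4 * D) * (ennreal (s powr (p - 3)) * ennreal ((norm (f2 s t))\<^sup>2)))) \<in> borel_measurable (lborel \<Otimes>\<^sub>M lborel)"
  unfolding f1_def f2_def by measurable
 have "(NN x. ennreal (g x powr p)) \<le> (NN x. ennreal cp * (NN s. indicator {0<..} s * \<Phi> s (g x)))"
  by (intro nn_integral_mono low) (simp add: g_def)
 also have "\<dots> = ennreal cp * (NN x. (NN s. indicator {0<..} s * \<Phi> s (g x)))"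
  by (rule nn_integral_cmult) (use lborel.borel_measurable_nn_integral[OF m1] in simp)
 also have "(NN x. (NN s. indicator {0<..} s * \<Phi> s (g x))) = (NN s. (NN x. indicator {0<..} s * \<Phi> s (g x)))"
  by (rule lborel_pair.Fubini'[OF m1, symmetric])
 also have "\<dots> \<le> (NN s. (NN t. indicator {0<..} s * (ennreal (2 * A) * (ennreal (s powr (p - 2)) * ennreal (norm (f1 s t)))
   + ennreal (4 * D) * (ennreal (s powr (p - 3)) * ennreal ((norm (f2 s t))\<^sup>2)))))"
 proof (rule nn_integral_mono)
  fix s :: real
  show "(NN x. indicator {0<..} s * \<Phi> s (g x)) \<le> (NN t. indicator {0<..} s * (ennreal (2 * A) * (ennreal (s powr (p - 2)) * ennreal (norm (f1 s t)))
   + ennreal (4 * D) * (ennreal (s powr (p - 3)) * ennreal ((norm (f2 s t))\<^sup>2))))"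
   using inner[of s] by (cases "s > 0") simp_all
 qed
 also have "\<dots> = (NN t. (NN s. indicator {0<..} s * (ennreal (2 * A) * (ennreal (s powr (p - 2)) * ennreal (norm (f1 s t)))
   + ennreal (4 * D) * (ennreal (s powr (p - 3)) * ennreal ((norm (f2 s t))\<^sup>2)))))"
  by (rule lborel_pair.Fubini'[OF m2])
 also have "\<dots> \<le> (NN t. ennreal (4 * E / cp) * ennreal (norm (f t) powr p))"
  by (rule nn_integral_mono[OF up])
 also have "\<dots> = ennreal (4 * E / cp) * (NN t. ennreal (norm (f t) powr p))"
  by (rule nn_integral_cmult) measurable
 finally have "(NN x. ennreal (g x powr p)) \<le> ennreal cp * (ennreal (4 * E / cp) * (NN t. ennreal (norm (f t) powr p)))"
  by (simp add: mult_left_mono)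
 also have "\<dots> = ennreal (4 * E) * (NN t. ennreal (norm (f t) powr p))"
  using cp E by (simp add: mult.assoc[symmetric] ennreal_mult'[symmetric])
 finally show ?thesis by (simp add: g_def E_def mult.assoc)
qed

text \<open>The part of \<open>f\<close> below \<open>s / A\<close> is mapped to a function bounded
  by \<open>s\<close>, so where half of the modulus of \<open>T f\<close> exceeds \<open>s\<close>
  the image of the large part dominates and the L2 bound applies. The factor \<open>p - 2\<close> of
  the layer formula cancels against the last integral, which keeps the constant uniform as
  \<open>p\<close> decreases to 2.\<close>

lemma interp_high:
 assumes p: "p > 2" and f: "f \<in> borel_measurable borel" "splits T f"
 shows "(NN x. ennreal (norm (T f x) powr p))
  \<le> ennreal (2 powr p * D * A powr (p - 2)) * (NN x. ennreal (norm (f x) powr p))"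
proof -
 \<comment> \<open>Halving makes room for the bounded part: if \<open>s \<le> g x\<close>, then
   subtracting \<open>s\<close> from \<open>2 * g x\<close> leaves at least \<open>g x\<close>. This
   costs the factor \<open>2 powr p\<close>.\<close>
 define g where "g x = norm (T f x) / 2" for x
 define f1 where "f1 s t = (if norm (f t) > s / A then f t else 0)" for s t
 define f2 where "f2 s t = (if norm (f t) \<le> s / A then f t else 0)" for s t
 note [measurable] = f(1) T_meas[OF f(1)]
 have gm [measurable]: "g \<in> borel_measurable borel" unfolding g_def by measurable
 have f12m [measurable]: "f1 s \<in> borel_measurable borel" "f2 s \<in> borel_measurable borel" for s
  unfolding f1_def[abs_def] f2_def[abs_def] by measurable
 define H where "H s z = indicator {0..} s * (ennreal (s powr (p - 3)) * (if s \<le> z then ennreal (z\<^sup>2) else 0))" for s z :: real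
 define G where "G s t = indicator {0..} s * (ennreal (s powr (p - 3)) * ennreal ((norm (f1 s t))\<^sup>2))" for s t
 have low: "ennreal (z powr p) = ennreal (p - 2) * (NN s. H s z)" if z: "z \<ge> 0" for z
 proof (cases "z = 0")
  case True
  then have "(NN s. H s z) = (\<integral>\<^sup>+s. 0 \<partial>(lborel :: real measure))" unfolding H_def by (intro nn_integral_cong) (simp add: indicator_def)
  then show ?thesis using True by simp
 next
  case False
  then have z: "z > 0" using that by simp
  have "(NN s. H s z) = (NN s. ennreal (z\<^sup>2) * (indicator {0..z} s * ennreal (s powr (p - 3))))"
   by (intro nn_integral_cong) (simp add: H_def indicator_def mult.commute)
  also have "\<dots> = ennreal (z\<^sup>2) * ennreal (z powr (p - 3 + 1) / (p - 3 + 1))"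
   using p z by (subst nn_integral_cmult, simp, subst nn_integral_powr_below) simp_all
  also have "\<dots> = ennreal (z powr p / (p - 2))"
  proof -
   have "z\<^sup>2 * z powr (p - 3 + 1) = z powr p" using z by (simp add: powr_add[symmetric] flip: powr_numeral)
   then show ?thesis by (simp add: ennreal_mult'[symmetric])
  qed
  finally show ?thesis using p by (simp add: ennreal_mult'[symmetric])
 qed
 have inner: "(NN x. H s (g x)) \<le> ennreal D * (NN t. G s t)" for s
 proof (cases "s \<ge> 0")
  case s: True
  have "(NN x. H s (g x)) \<le> (NN x. ennreal (s powr (p - 3)) * ennreal ((norm (T (f1 s) x))\<^sup>2))"
  proof (rule nn_integral_mono)
   fix x
   have "T f x = T (f1 s) x + T (f2 s) x" using f(2) unfolding splits_def f1_def f2_def by blast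
   then have "norm (T f x) \<le> norm (T (f1 s) x) + norm (T (f2 s) x)" by (simp add: norm_triangle_ineq)
   moreover have "norm (T (f2 s) x) \<le> A * (s / A)"
    by (rule T_Linf[OF f12m(2)], rule AE_I2) (use s A in \<open>auto simp: f2_def\<close>)
   ultimately have "s \<le> g x \<Longrightarrow> g x \<le> norm (T (f1 s) x)" using A by (simp add: g_def)
   moreover have "0 \<le> g x" by (simp add: g_def)
   ultimately show "H s (g x) \<le> ennreal (s powr (p - 3)) * ennreal ((norm (T (f1 s) x))\<^sup>2)"
    using s by (auto simp: H_def intro!: mult_left_mono ennreal_leI power_mono)
  qed
  also have "\<dots> = ennreal (s powr (p - 3)) * (NN x. ennreal ((norm (T (f1 s) x))\<^sup>2))"
   using T_meas[OF f12m(1)[of s]] by (intro nn_integral_cmult) simp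
  also have "\<dots> \<le> ennreal (s powr (p - 3)) * (ennreal D * (NN t. ennreal ((norm (f1 s t))\<^sup>2)))"
   by (intro mult_left_mono T_L2) auto
  also have "\<dots> = ennreal D * (ennreal (s powr (p - 3)) * (NN t. ennreal ((norm (f1 s t))\<^sup>2)))" by (simp only: mult.left_commute)
  also have "ennreal (s powr (p - 3)) * (NN t. ennreal ((norm (f1 s t))\<^sup>2)) = (NN t. G s t)"
   unfolding G_def using s by (subst nn_integral_cmult[symmetric]) simp_all
  finally show ?thesis .
 qed (simp add: H_def)
 have up: "(NN s. G s t) \<le> ennreal (A powr (p - 2) / (p - 2)) * ennreal (norm (f t) powr p)" for t
 proof (cases "f t = 0")
  case True
  then have "f1 s t = 0" for s by (simp add: f1_def)
  then show ?thesis by (simp add: G_def)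
 next
  case False
  define a where "a = norm (f t)"
  have a: "a > 0" using False by (simp add: a_def)
  have "(NN s. G s t) \<le> (NN s. ennreal (a\<^sup>2) * (indicator {0..A * a} s * ennreal (s powr (p - 3))))"
  proof (rule nn_integral_mono)
   fix s :: real
   show "G s t \<le> ennreal (a\<^sup>2) * (indicator {0..A * a} s * ennreal (s powr (p - 3)))"
   proof (cases "0 \<le> s \<and> a > s / A")
    case True
    then have "s \<le> A * a" using A by (simp add: pos_divide_less_eq mult.commute)
    then show ?thesis using True by (simp add: G_def f1_def a_def mult.commute)
   next
    case False
    then have "G s t = 0" by (auto simp: G_def f1_def a_def indicator_def)
    then show ?thesis by simp
   qed
  qed
  also have "\<dots> = ennreal (a\<^sup>2) * ennreal ((A * a) powr (p - 3 + 1) / (p - 3 + 1))"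
   using p A a by (subst nn_integral_cmult, simp, subst nn_integral_powr_below) simp_all
  also have "\<dots> = ennreal (A powr (p - 2) / (p - 2)) * ennreal (a powr p)"
  proof -
   have "a\<^sup>2 * a powr (p - 2) = a powr p" using a by (simp add: powr_add[symmetric] flip: powr_numeral)
   then have "a\<^sup>2 * ((A * a) powr (p - 2) / (p - 2)) = A powr (p - 2) / (p - 2) * a powr p"
    using A a by (simp add: powr_mult mult.left_commute)
   then show ?thesis using p by (simp add: ennreal_mult'[symmetric])
  qed
  finally show ?thesis by (simp add: a_def)
 qed
 have m1: "(\<lambda>(x, s). H s (g x)) \<in> borel_measurable (lborel \<Otimes>\<^sub>M lborel)" unfolding H_def by measurable
 have m2: "(\<lambda>(t, s). G s t) \<in> borel_measurable (lborel \<Otimes>\<^sub>M lborel)" unfolding G_def f1_def by measurable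
 have "(NN x. ennreal (g x powr p)) = (NN x. ennreal (p - 2) * (NN s. H s (g x)))"
  by (intro nn_integral_cong low) (simp add: g_def)
 also have "\<dots> = ennreal (p - 2) * (NN x. (NN s. H s (g x)))"
  by (rule nn_integral_cmult) (use lborel.borel_measurable_nn_integral[OF m1] in simp)
 also have "(NN x. (NN s. H s (g x))) = (NN s. (NN x. H s (g x)))"
  by (rule lborel_pair.Fubini'[OF m1, symmetric])
 also have "\<dots> \<le> (NN s. ennreal D * (NN t. G s t))" by (rule nn_integral_mono[OF inner])
 also have "\<dots> = ennreal D * (NN s. (NN t. G s t))"
 proof (rule nn_integral_cmult)
  have "(\<lambda>(s, t). G s t) \<in> borel_measurable (lborel \<Otimes>\<^sub>M lborel)"
   using measurable_pair_swap[OF m2] by (simp add: split_beta)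
  then show "(\<lambda>s. (NN t. G s t)) \<in> borel_measurable lborel" by (rule lborel.borel_measurable_nn_integral)
 qed
 also have "(NN s. (NN t. G s t)) = (NN t. (NN s. G s t))"
  by (rule lborel_pair.Fubini'[OF m2])
 also have "\<dots> \<le> (NN t. ennreal (A powr (p - 2) / (p - 2)) * ennreal (norm (f t) powr p))"
  by (rule nn_integral_mono[OF up])
 also have "\<dots> = ennreal (A powr (p - 2) / (p - 2)) * (NN t. ennreal (norm (f t) powr p))"
  by (rule nn_integral_cmult) measurable
 finally have le: "(NN x. ennreal (g x powr p)) \<le> ennreal (p - 2) * (ennreal D * (ennreal (A powr (p - 2) / (p - 2)) * (NN t. ennreal (norm (f t) powr p))))"
  by (simp add: mult_left_mono)
 have "(NN x. ennreal (norm (T f x) powr p)) = (NN x. ennreal (2 powr p) * ennreal (g x powr p))"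
  by (intro nn_integral_cong) (simp add: g_def ennreal_mult'[symmetric] powr_mult[symmetric])
 also have "\<dots> = ennreal (2 powr p) * (NN x. ennreal (g x powr p))" by (rule nn_integral_cmult) measurable
 also have "\<dots> \<le> ennreal (2 powr p) * (ennreal (p - 2) * (ennreal D * (ennreal (A powr (p - 2) / (p - 2)) * (NN t. ennreal (norm (f t) powr p)))))"
  using le by (rule mult_left_mono) simp
 also have "\<dots> = ennreal (2 powr p * D * A powr (p - 2)) * (NN x. ennreal (norm (f x) powr p))"
  using p A D by (simp add: mult.assoc[symmetric] ennreal_mult'[symmetric])
 finally show ?thesis .
qed

end

section \<open>From integrals of p-th powers to operator norms\<close>

lemma Lp_norm_finite_eq:
 assumes "p \<noteq> \<infinity>" "(\<integral>\<^sup>+x. ennreal (norm (f x) powr enn2real p) \<partial>M) = ennreal i" "i \<ge> 0"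
 shows "Lp_norm p M f = ennreal (i powr (1 / enn2real p))"
 using assms by (simp add: Lp_norm_def)

lemma Lp_space_finite:
 assumes "p \<noteq> \<infinity>" "f \<in> Lp_space p M"
 obtains i where "i \<ge> 0" "(\<integral>\<^sup>+x. ennreal (norm (f x) powr enn2real p) \<partial>M) = ennreal i"
proof (cases "\<integral>\<^sup>+x. ennreal (norm (f x) powr enn2real p) \<partial>M")
 case (real i) then show ?thesis using that by blast
next
 case top then show ?thesis using assms by (simp add: Lp_space_def Lp_norm_def)
qed

lemma Lp_bound_of_nn_integral:
 assumes p: "1 \<le> p" "p \<noteq> \<infinity>" and f: "f \<in> Lp_space p M" and g: "g \<in> borel_measurable M" and E: "E > 0"
  and le: "(\<integral>\<^sup>+x. ennreal (norm (g x) powr enn2real p) \<partial>M) \<le> ennreal (E powr enn2real p) * (\<integral>\<^sup>+x. ennreal (norm (f x) powr enn2real p) \<partial>M)"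
 shows "g \<in> Lp_space p M \<and> Lp_norm p M g \<le> ennreal E * Lp_norm p M f"
proof -
 define q where "q = enn2real p"
 have q: "q \<ge> 1" unfolding q_def using p by (cases p) (auto simp: one_ennreal.rep_eq ennreal_1[symmetric] simp del: ennreal_1)
 obtain i where i: "i \<ge> 0" "(\<integral>\<^sup>+x. ennreal (norm (f x) powr enn2real p) \<partial>M) = ennreal i" using Lp_space_finite[OF p(2) f] .
 have le': "(\<integral>\<^sup>+x. ennreal (norm (g x) powr enn2real p) \<partial>M) \<le> ennreal (E powr q * i)"
  using le i by (simp add: q_def ennreal_mult')
 then have "(\<integral>\<^sup>+x. ennreal (norm (g x) powr enn2real p) \<partial>M) < top" using le_less_trans ennreal_less_top by blast
 then obtain j where j: "j \<ge> 0" "(\<integral>\<^sup>+x. ennreal (norm (g x) powr enn2real p) \<partial>M) = ennreal j"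
  by (cases "\<integral>\<^sup>+x. ennreal (norm (g x) powr enn2real p) \<partial>M") auto
 have "j \<le> E powr q * i" using le' i(1) unfolding j(2) by (simp add: ennreal_le_iff)
 then have "j powr (1 / q) \<le> (E powr q * i) powr (1 / q)" using j(1) q by (intro powr_mono2) auto
 also have "\<dots> = E * i powr (1 / q)" using E i(1) q by (simp add: powr_mult powr_powr)
 finally have "ennreal (j powr (1 / q)) \<le> ennreal E * ennreal (i powr (1 / q))"
  using E by (simp add: ennreal_mult'[symmetric] ennreal_leI)
 then show ?thesis
  using Lp_norm_finite_eq[OF p(2) j(2,1)] Lp_norm_finite_eq[OF p(2) i(2,1)] g by (simp add: Lp_space_def q_def)
qed

lemma norm_integral_le_nn_integral:
 fixes f :: "'a \<Rightarrow> complex"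
 shows "ennreal (norm (\<integral>x. f x \<partial>M)) \<le> (\<integral>\<^sup>+x. ennreal (norm (f x)) \<partial>M)"
 by (cases "integrable M f") (auto simp: integral_norm_bound_ennreal not_integrable_integral_eq)

context damped_oscillation
begin

lemma psi_bounded: obtains P where "P \<ge> 0" "\<And>x t. norm (\<psi> (x, t)) \<le> P * (indicator (cball 0 R0) x * indicator (cball 0 R0) t)"
proof -
 have "bounded (\<psi> ` (cball 0 R0 \<times> cball 0 R0))"
  by (intro compact_imp_bounded compact_continuous_image continuous_on_subset[OF smooth_on_continuous[OF psi_smooth]] compact_Times) auto
 then obtain P where P: "\<And>q. q \<in> cball 0 R0 \<times> cball 0 R0 \<Longrightarrow> norm (\<psi> q) \<le> P" unfolding bounded_iff by blast
 show ?thesis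
 proof (rule that[of "\<bar>P\<bar>"])
  show "norm (\<psi> (x, t)) \<le> \<bar>P\<bar> * (indicator (cball 0 R0) x * indicator (cball 0 R0) t)" for x t
  proof (cases "(x, t) \<in> cball 0 R0 \<times> cball 0 R0")
   case True then show ?thesis using P[OF True] by (simp add: indicator_def)
  next
   case False
   then have "\<psi> (x, t) = 0" using psi_supp[of "(x, t)"] by blast
   then show ?thesis by simp
  qed
 qed simp
qed

text \<open>Boundedness and compact support of the kernel give the endpoints L1 and L-infinity with
  one constant independent of \<open>h\<close>; oscillation enters through the L2 constant
  alone.\<close>

lemma Top_bounded_L1_L2:
 obtains A C where "A \<ge> 1" "C \<ge> 1" "\<And>h. 0 < h \<Longrightarrow> h \<le> 1 \<Longrightarrow> bounded_L1_L2 (Top h) A (C * h ^ (2 * CARD('n)))"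
  "\<And>h f. \<lbrakk>0 < h; f \<in> borel_measurable borel; (NN t. indicator (cball 0 R0) t * ennreal (norm (f t))) < \<infinity>\<rbrakk> \<Longrightarrow> splits (Top h) f"
proof -
 obtain C where C: "C > 0"
  "\<And>h u. \<lbrakk>0 < h; h \<le> 1; u \<in> borel_measurable borel\<rbrakk> \<Longrightarrow>
   (NN x. ennreal ((norm (Top h u x))\<^sup>2)) \<le> ennreal (C * h ^ (2 * CARD('n))) * (NN t. ennreal ((norm (u t))\<^sup>2))"
  by (rule Top_L2) blast
 obtain P where P: "P \<ge> 0" "\<And>x t. norm (\<psi> (x, t)) \<le> P * (indicator (cball 0 R0) x * indicator (cball 0 R0) t)"
  by (rule psi_bounded) blast
 define v where "v = measure lborel (cball 0 R0 :: (real^'n) set)"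
 have v: "v \<ge> 0" by (simp add: v_def)
 have ve: "(\<integral>\<^sup>+t. indicator (cball 0 R0) t \<partial>(lborel :: (real^'n) measure)) = ennreal v"
 proof -
  have "emeasure lborel (cball 0 R0 :: (real^'n) set) \<noteq> top" using emeasure_bounded_finite[OF bounded_cball[of "0::real^'n" R0]] by auto
  from emeasure_eq_ennreal_measure[OF this] show ?thesis by (simp add: v_def)
 qed
 have [measurable]: "cball 0 R0 \<in> sets (borel :: (real^'n) measure)" by simp
 define A where "A = P * v + 1"
 have A: "A \<ge> 1" using P(1) v by (simp add: A_def)
 define k where "k h x t = expi (S (x, t) / h\<^sup>2) * \<psi> (x, t)" for h x t
 have Tk: "Top h g x = (LI t. k h x t * g t)" for h g x by (simp add: Top_def k_def)
 have kb: "norm (k h x t) \<le> P * (indicator (cball 0 R0) x * indicator (cball 0 R0) t)" for h x t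
  using P(2)[of x t] by (simp add: k_def norm_mult)
 have kc: "(\<lambda>z. k h (fst z) (snd z)) \<in> borel_measurable borel" if "h > 0" for h
  unfolding k_def
  by (intro borel_measurable_continuous_onI continuous_intros continuous_on_compose2[OF smooth_on_continuous[OF S_smooth]]
    continuous_on_compose2[OF smooth_on_continuous[OF psi_smooth]]) (use that in auto)
 have kx: "(\<lambda>t. k h x t) \<in> borel_measurable borel" if "h > 0" for h x
  unfolding k_def
  by (intro borel_measurable_continuous_onI continuous_intros continuous_on_compose2[OF smooth_on_continuous[OF S_smooth]]
    continuous_on_compose2[OF smooth_on_continuous[OF psi_smooth]]) (use that in auto)
 have T_meas: "Top h g \<in> borel_measurable borel" if h: "h > 0" and g: "g \<in> borel_measurable borel" for h g
  unfolding Tk[abs_def]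
 proof (rule borel_measurable_param_integral)
  note [measurable] = kc[OF h] g
  show "(\<lambda>z. k h (fst z) (snd z) * g (snd z)) \<in> borel_measurable borel" by measurable
 qed
 have T_le: "ennreal (norm (Top h g x)) \<le> ennreal P * indicator (cball 0 R0) x * (NN t. indicator (cball 0 R0) t * ennreal (norm (g t)))"
  if g: "g \<in> borel_measurable borel" for h g x
 proof -
  note [measurable] = g
  have "ennreal (norm (Top h g x)) \<le> (NN t. ennreal (norm (k h x t * g t)))" unfolding Tk by (rule norm_integral_le_nn_integral)
  also have "\<dots> \<le> (NN t. (ennreal P * indicator (cball 0 R0) x) * (indicator (cball 0 R0) t * ennreal (norm (g t))))"
  proof (rule nn_integral_mono)
   fix t
   have "norm (k h x t * g t) \<le> P * (indicator (cball 0 R0) x * indicator (cball 0 R0) t) * norm (g t)"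
    unfolding norm_mult by (intro mult_right_mono kb) simp
   from ennreal_leI[OF this] show "ennreal (norm (k h x t * g t)) \<le> (ennreal P * indicator (cball 0 R0) x) * (indicator (cball 0 R0) t * ennreal (norm (g t)))"
    using P(1) by (auto simp: indicator_def ennreal_mult' split: if_splits)
  qed
  also have "\<dots> = (ennreal P * indicator (cball 0 R0) x) * (NN t. indicator (cball 0 R0) t * ennreal (norm (g t)))"
   by (rule nn_integral_cmult) measurable
  finally show ?thesis .
 qed
 show ?thesis
 proof (rule that[of A "C + 1"])
  fix h :: real assume h: "0 < h" "h \<le> 1"
  show "bounded_L1_L2 (Top h) A ((C + 1) * h ^ (2 * CARD('n)))"
  proof
   show "0 < A" using A by simp
   show "0 < (C + 1) * h ^ (2 * CARD('n))" using C(1) h by simp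
   fix g :: "real^'n \<Rightarrow> complex" assume g [measurable]: "g \<in> borel_measurable borel"
   show "Top h g \<in> borel_measurable borel" by (rule T_meas[OF h(1) g])
   have "(NN x. ennreal ((norm (Top h g x))\<^sup>2)) \<le> ennreal (C * h ^ (2 * CARD('n))) * (NN t. ennreal ((norm (g t))\<^sup>2))"
    by (rule C(2)[OF h g])
   also have "\<dots> \<le> ennreal ((C + 1) * h ^ (2 * CARD('n))) * (NN t. ennreal ((norm (g t))\<^sup>2))"
    using h by (intro mult_right_mono ennreal_leI) auto
   finally show "(NN x. ennreal ((norm (Top h g x))\<^sup>2)) \<le> ennreal ((C + 1) * h ^ (2 * CARD('n))) * (NN t. ennreal ((norm (g t))\<^sup>2))" .
   have "(NN x. ennreal (norm (Top h g x))) \<le> (\<integral>\<^sup>+x. (ennreal P * indicator (cball 0 R0) x) * (NN t. ennreal (norm (g t))) \<partial>(lborel :: (real^'n) measure))"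
   proof (rule nn_integral_mono)
    fix x
    have "(NN t. indicator (cball 0 R0) t * ennreal (norm (g t))) \<le> (NN t. ennreal (norm (g t)))"
     by (intro nn_integral_mono) (simp add: indicator_def)
    then show "ennreal (norm (Top h g x)) \<le> (ennreal P * indicator (cball 0 R0) x) * (NN t. ennreal (norm (g t)))"
     by (rule order_trans[OF T_le[OF g] mult_left_mono]) simp
   qed
   also have "\<dots> = (\<integral>\<^sup>+x. ennreal P * indicator (cball 0 R0) x \<partial>(lborel :: (real^'n) measure)) * (NN t. ennreal (norm (g t)))"
    by (rule nn_integral_multc) measurable
   also have "(\<integral>\<^sup>+x. ennreal P * indicator (cball 0 R0) x \<partial>(lborel :: (real^'n) measure)) = ennreal (P * v)"
    using P(1) ve by (subst nn_integral_cmult) (auto simp: ennreal_mult')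
   also have "ennreal (P * v) * (NN t. ennreal (norm (g t))) \<le> ennreal A * (NN t. ennreal (norm (g t)))"
    by (intro mult_right_mono ennreal_leI) (auto simp: A_def)
   finally show "(NN x. ennreal (norm (Top h g x))) \<le> ennreal A * (NN t. ennreal (norm (g t)))" .
   fix M x assume M: "AE t in lborel. norm (g t) \<le> M"
   \<comment> \<open>A negative bound for a norm would hold nowhere, while Lebesgue measure is not
     the zero measure.\<close>
   have M0: "M \<ge> 0"
   proof (rule ccontr)
    assume "\<not> M \<ge> 0"
    have "AE t in (lborel :: (real^'n) measure). False"
     using M
    proof eventually_elim
     case (elim t)
     show ?case using elim \<open>\<not> M \<ge> 0\<close> norm_ge_zero[of "g t"] by linarith
    qed
    then show False by (simp add: eventually_False ae_filter_eq_bot_iff)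
   qed
   have "ennreal (norm (Top h g x)) \<le> ennreal P * indicator (cball 0 R0) x * (NN t. indicator (cball 0 R0) t * ennreal (norm (g t)))"
    by (rule T_le[OF g])
   also have "\<dots> \<le> ennreal P * 1 * (\<integral>\<^sup>+t. indicator (cball 0 R0) t * ennreal M \<partial>(lborel :: (real^'n) measure))"
    using M by (intro mult_mono nn_integral_mono_AE) (auto simp: indicator_def intro!: ennreal_leI elim!: AE_mp)
   also have "\<dots> = ennreal (P * v * M)"
    using ve P(1) v M0 by (subst nn_integral_multc) (auto simp: ennreal_mult' mult.assoc)
   also have "\<dots> \<le> ennreal (A * M)" using M0 by (intro ennreal_leI mult_right_mono) (auto simp: A_def)
   finally show "norm (Top h g x) \<le> A * M" using A M0 by (simp add: ennreal_le_iff)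
  qed
 next
  fix h :: real and f :: "real^'n \<Rightarrow> complex" assume h: "0 < h" and f: "f \<in> borel_measurable borel"
   and fin: "(NN t. indicator (cball 0 R0) t * ennreal (norm (f t))) < \<infinity>"
  have int: "integrable lborel (\<lambda>t. k h x t * f' t)" if f': "f' \<in> borel_measurable borel" "\<And>t. norm (f' t) \<le> norm (f t)" for x and f' :: "real^'n \<Rightarrow> complex"
  proof (rule integrableI_bounded)
   note [measurable] = kx[OF h] f'(1) f
   show "(\<lambda>t. k h x t * f' t) \<in> borel_measurable lborel" by measurable
   have "(NN t. ennreal (norm (k h x t * f' t))) \<le> (NN t. ennreal P * (indicator (cball 0 R0) t * ennreal (norm (f t))))"
   proof (rule nn_integral_mono)
    fix t
    have "norm (k h x t) \<le> P * indicator (cball 0 R0) t" 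
     by (rule order_trans[OF kb mult_left_mono[OF _ P(1)]]) (simp add: indicator_def)
    then have "norm (k h x t * f' t) \<le> P * indicator (cball 0 R0) t * norm (f t)"
     unfolding norm_mult using f'(2)[of t] P(1) by (intro mult_mono) auto
    from ennreal_leI[OF this] show "ennreal (norm (k h x t * f' t)) \<le> ennreal P * (indicator (cball 0 R0) t * ennreal (norm (f t)))"
     using P(1) by (auto simp: indicator_def ennreal_mult' split: if_splits)
   qed
   also have "\<dots> = ennreal P * (NN t. indicator (cball 0 R0) t * ennreal (norm (f t)))"
    by (rule nn_integral_cmult) measurable
   also have "\<dots> < \<infinity>" using fin by (simp add: ennreal_mult_less_top)
   finally show "(NN t. ennreal (norm (k h x t * f' t))) < \<infinity>" .
  qed
  show "splits (Top h) f"
   unfolding splits_def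
  proof (intro allI)
   fix \<sigma> x
   note [measurable] = f
   have "Top h f x = (LI t. k h x t * (if norm (f t) > \<sigma> then f t else 0) + k h x t * (if norm (f t) \<le> \<sigma> then f t else 0))"
    unfolding Tk by (rule Bochner_Integration.integral_cong) auto
   also have "\<dots> = Top h (\<lambda>t. if norm (f t) > \<sigma> then f t else 0) x + Top h (\<lambda>t. if norm (f t) \<le> \<sigma> then f t else 0) x"
    unfolding Tk
   proof (rule Bochner_Integration.integral_add[OF int int])
    show "(\<lambda>t. if norm (f t) > \<sigma> then f t else 0) \<in> borel_measurable borel" by measurable
    show "(\<lambda>t. if norm (f t) \<le> \<sigma> then f t else 0) \<in> borel_measurable borel" by measurable
   qed simp_all
   finally show "Top h f x = \<dots>" .
  qed
 qed (use A C(1) in auto)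
qed

text \<open>This supplies the convergence on which \<open>splits\<close> rests, for every
  \<open>f\<close> in the space. For finite exponents q it follows from
  \<open>norm (f t) \<le> 1 + norm (f t) powr q\<close> on a ball of finite measure.\<close>

lemma Lp_space_locally_integrable:
 assumes p: "1 \<le> p" and f: "f \<in> Lp_space p lborel"
 shows "(\<integral>\<^sup>+t. indicator (cball 0 R0) t * ennreal (norm (f t)) \<partial>(lborel :: (real^'n) measure)) < \<infinity>"
proof -
 have fm [measurable]: "f \<in> borel_measurable borel" using f by (simp add: Lp_space_def)
 have [measurable]: "cball 0 R0 \<in> sets (borel :: (real^'n) measure)" by simp
 have v: "emeasure lborel (cball 0 R0 :: (real^'n) set) < \<infinity>" by (rule emeasure_bounded_finite[OF bounded_cball])
 show ?thesis
 proof (cases "p = \<infinity>")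
  case True
  define s where "s = esssup lborel (\<lambda>x. ennreal (norm (f x)))"
  have s: "s < \<infinity>" using f True by (simp add: Lp_space_def Lp_norm_def s_def)
  have "(NN t. indicator (cball 0 R0) t * ennreal (norm (f t))) \<le> (\<integral>\<^sup>+t. indicator (cball 0 R0) t * s \<partial>(lborel :: (real^'n) measure))"
  proof (rule nn_integral_mono_AE)
   show "AE t in lborel. indicator (cball 0 R0) t * ennreal (norm (f t)) \<le> indicator (cball 0 R0) t * s"
    using esssup_AE[of "\<lambda>x. ennreal (norm (f x))" lborel] by (auto simp: s_def elim!: AE_mp intro!: mult_left_mono)
  qed
  also have "\<dots> = emeasure lborel (cball 0 R0 :: (real^'n) set) * s" by (simp add: nn_integral_multc)
  also have "\<dots> < \<infinity>" using v s by (simp add: ennreal_mult_less_top)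
  finally show ?thesis .
 next
  case False
  have q: "enn2real p \<ge> 1" using p False by (cases p) (auto simp: ennreal_1[symmetric] simp del: ennreal_1)
  obtain i where i: "i \<ge> 0" "(NN x. ennreal (norm (f x) powr enn2real p)) = ennreal i" using Lp_space_finite[OF False f] .
  have "(NN t. indicator (cball 0 R0) t * ennreal (norm (f t))) \<le> (NN t. indicator (cball 0 R0) t + ennreal (norm (f t) powr enn2real p))"
  proof (rule nn_integral_mono)
   fix t
   have "norm (f t) \<le> 1 + norm (f t) powr enn2real p"
   proof (cases "norm (f t) \<le> 1")
    case False
    then have "norm (f t) powr 1 \<le> norm (f t) powr enn2real p" using q by (intro powr_mono) auto
    then show ?thesis using False by simp
   qed (simp add: add_increasing2)
   from ennreal_leI[OF this] show "indicator (cball 0 R0) t * ennreal (norm (f t)) \<le> indicator (cball 0 R0) t + ennreal (norm (f t) powr enn2real p)"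
    by (simp add: indicator_def)
  qed
  also have "\<dots> = emeasure lborel (cball 0 R0 :: (real^'n) set) + ennreal i" using i(2) by (subst nn_integral_add) auto
  also have "\<dots> < \<infinity>" using v by simp
  finally show ?thesis .
 qed
qed

lemma osc_op_Lp_bound:
 "\<exists>K::real. \<forall>lam\<ge>1. \<forall>p::ennreal. 1 \<le> p \<longrightarrow> Lp_opnorm p lborel (osc_op S \<psi> lam)
  \<le> ennreal (K * lam powr (- real CARD('n) / 2 + real CARD('n) * \<bar>enn2real (1 / p) - 1 / 2\<bar>))"
proof -
 obtain A C where AC: "A \<ge> 1" "C \<ge> 1" "\<And>h. 0 < h \<Longrightarrow> h \<le> 1 \<Longrightarrow> bounded_L1_L2 (Top h) A (C * h ^ (2 * CARD('n)))"
  "\<And>h f. \<lbrakk>0 < h; f \<in> borel_measurable borel; (NN t. indicator (cball 0 R0) t * ennreal (norm (f t))) < \<infinity>\<rbrakk> \<Longrightarrow> splits (Top h) f"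
  using Top_bounded_L1_L2 by blast
 \<comment> \<open>Strictly between exponents 1 and 2 the interpolation constant is at most
   \<open>4 * A * C\<close>, above 2 at most the q-th power of this number. As
   \<open>K \<ge> 1\<close>, its q-th power covers both, and the endpoint constants as well.\<close>
 define K where "K = 4 * A * C"
 have K: "K \<ge> 4" "A \<le> K" "C \<le> K" using AC(1,2) mult_mono[of 1 A 1 C] mult_left_mono[of 1 C A] mult_right_mono[of 1 A C] by (simp_all add: K_def)
 show ?thesis
 proof (intro exI[of _ K] allI impI)
  fix lam :: real and p :: ennreal assume lam: "lam \<ge> 1" and p: "1 \<le> p"
  define n where "n = real CARD('n)"
  \<comment> \<open>With \<open>h\<^sup>2 = 1 / lam\<close> the oscillating factor of
    \<open>osc_op\<close> becomes that of \<open>Top\<close>.\<close>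
  define h where "h = lam powr (- 1 / 2)"
  have h: "0 < h" "h \<le> 1" using lam powr_mono[of "- 1 / 2" 0 lam] by (auto simp: h_def)
  have h2: "h\<^sup>2 = 1 / lam" using lam by (simp only: h_def power2_eq_square powr_add[symmetric]) (simp add: powr_minus_divide)
  have "h ^ (2 * CARD('n)) = lam powr (- n)" using lam by (simp add: h_def powr_power n_def)
  then have b: "bounded_L1_L2 (Top h) A (C * lam powr (- n))" using AC(3)[OF h] by simp
  have T: "osc_op S \<psi> lam = Top h" by (simp add: osc_op_def Top_def fun_eq_iff h2 mult.commute)
  interpret bounded_L1_L2 "Top h" A "C * lam powr (- n)" by (rule b)
  have le: "Lp_opnorm p lborel (osc_op S \<psi> lam) \<le> ennreal E"
   if "\<And>f. f \<in> Lp_space p lborel \<Longrightarrow> Top h f \<in> Lp_space p lborel \<and> Lp_norm p lborel (Top h f) \<le> ennreal E * Lp_norm p lborel f" for E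
   unfolding Lp_opnorm_def T using that by (intro Inf_lower) auto
  show "Lp_opnorm p lborel (osc_op S \<psi> lam)
   \<le> ennreal (K * lam powr (- real CARD('n) / 2 + real CARD('n) * \<bar>enn2real (1 / p) - 1 / 2\<bar>))"
  proof (cases "p = \<infinity>")
   case True
   have "Lp_opnorm p lborel (osc_op S \<psi> lam) \<le> ennreal K"
   proof (rule le)
    fix f :: "real^'n \<Rightarrow> complex" assume f: "f \<in> Lp_space p lborel"
    have fm: "f \<in> borel_measurable borel" using f by (simp add: Lp_space_def)
    note [measurable] = T_meas[OF fm] fm
    have "Lp_norm p lborel f < \<infinity>" using f by (simp add: Lp_space_def)
    then obtain s where s: "s \<ge> 0" "Lp_norm p lborel f = ennreal s" by (cases "Lp_norm p lborel f") auto
    then have es: "esssup lborel (\<lambda>x. ennreal (norm (f x))) = ennreal s" using True by (simp add: Lp_norm_def)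
    have "AE x in lborel. norm (f x) \<le> s"
     using esssup_AE[of "\<lambda>x. ennreal (norm (f x))" lborel] unfolding es by (elim AE_mp) (intro AE_I2 impI, simp add: s(1))
    then have "norm (Top h f x) \<le> A * s" for x by (rule T_Linf[OF fm])
    also have "A * s \<le> K * s" using K(2) s(1) by (rule mult_right_mono)
    finally have "ennreal (norm (Top h f x)) \<le> ennreal K * ennreal s" for x using K(1) by (simp add: ennreal_mult'[symmetric] ennreal_leI)
    then have "Lp_norm p lborel (Top h f) \<le> ennreal K * Lp_norm p lborel f"
     unfolding s(2) using True by (simp add: Lp_norm_def) (rule esssup_I, simp, rule AE_I2, simp)
    moreover have "\<dots> < \<infinity>" unfolding s(2) by (simp add: ennreal_mult_less_top)
    ultimately show "Top h f \<in> Lp_space p lborel \<and> Lp_norm p lborel (Top h f) \<le> ennreal K * Lp_norm p lborel f"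
     by (auto simp: Lp_space_def)
   qed
   \<comment> \<open>\<open>1 / p\<close> is 0 for \<open>p = \<infinity>\<close>, so the exponent
     of \<open>lam\<close> vanishes.\<close>
   then show ?thesis using True lam by simp
  next
   case False
   define q where "q = enn2real p"
   have pq: "p = ennreal q" using False by (cases p) (auto simp: q_def)
   have q: "q \<ge> 1" using p unfolding pq by (simp add: ennreal_1[symmetric] ennreal_le_iff2 del: ennreal_1)
   \<comment> \<open>The power of \<open>lam powr (- n)\<close> that interpolation leaves in the
     integral of q-th powers: \<open>q - 1\<close> between L1 and L2, and 1 beyond. In both ranges
     \<open>m / q = 1 / 2 - \<bar>1 / q - 1 / 2\<bar>\<close>, which gives the exponent
     claimed.\<close>
   define m where "m = (if q \<le> 2 then q - 1 else 1)"
   define E where "E = K * lam powr (- n * m / q)"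
   have E: "E > 0" using K(1) lam by (simp add: E_def)
   have Eq: "E powr q = K powr q * lam powr (- n * m)" using K(1) lam q by (simp add: E_def powr_mult powr_powr)
   have "enn2real (1 / p) = 1 / q" using q unfolding pq by (simp add: divide_ennreal ennreal_1[symmetric] del: ennreal_1)
   moreover have "m / q = 1 / 2 - \<bar>1 / q - 1 / 2\<bar>"
    using q by (cases "q \<le> 2") (simp_all add: m_def abs_if field_simps)
   then have "n * (m / q) = n / 2 - n * \<bar>1 / q - 1 / 2\<bar>" by (simp add: right_diff_distrib)
   then have "- n * m / q = - n / 2 + n * \<bar>1 / q - 1 / 2\<bar>" by simp
   ultimately have goal: "K * lam powr (- real CARD('n) / 2 + real CARD('n) * \<bar>enn2real (1 / p) - 1 / 2\<bar>) = E"
    by (simp add: E_def n_def)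
   show ?thesis unfolding goal
   proof (rule le)
    fix f :: "real^'n \<Rightarrow> complex" assume f: "f \<in> Lp_space p lborel"
    have fm: "f \<in> borel_measurable borel" using f by (simp add: Lp_space_def)
    have sp: "splits (Top h) f" by (rule AC(4)[OF h(1) fm Lp_space_locally_integrable[OF p f]])
    have "\<exists>B. (NN x. ennreal (norm (Top h f x) powr q)) \<le> ennreal B * (NN x. ennreal (norm (f x) powr q)) \<and> B \<le> E powr q"
    proof -
     have K1: "K powr 1 \<le> K powr q" using K(1) q by (intro powr_mono) auto
     consider "q = 1" | "1 < q" "q < 2" | "q = 2" | "q > 2" using q by linarith
     then show ?thesis
     proof cases
      case 1
      then show ?thesis using T_L1[OF fm] K lam Eq by (intro exI[of _ A]) (simp add: m_def)
     next
      case 2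
      have "4 * A powr (2 - q) * (C * lam powr (- n)) powr (q - 1) = (4 * A powr (2 - q) * C powr (q - 1)) * lam powr (- n * m)"
       using 2 AC(2) lam by (simp add: m_def powr_mult powr_powr)
      also have "\<dots> \<le> K powr q * lam powr (- n * m)"
      proof (rule mult_right_mono)
       have "4 * A powr (2 - q) * C powr (q - 1) \<le> 4 * A powr 1 * C powr 1"
        using 2 AC by (intro mult_mono powr_mono) auto
       also have "\<dots> = K powr 1" using AC(1,2) K(1) by (simp add: K_def)
       finally show "4 * A powr (2 - q) * C powr (q - 1) \<le> K powr q" using K1 by simp
      qed simp
      finally show ?thesis using interp_low[OF 2 fm sp] Eq by auto
     next
      case 3
      have "C * lam powr (- n) \<le> K powr q * lam powr (- n)" using K K1 by (intro mult_right_mono) auto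
      moreover have "(NN x. ennreal (norm (Top h f x) powr q)) \<le> ennreal (C * lam powr (- n)) * (NN x. ennreal (norm (f x) powr q))"
       using T_L2[OF fm] 3 by simp
      ultimately show ?thesis using Eq 3 by (auto simp: m_def)
     next
      case 4
      have "2 powr q * (C * lam powr (- n)) * A powr (q - 2) = (2 powr q * C powr 1 * A powr (q - 2)) * lam powr (- n * m)"
       using 4 AC(2) by (simp add: m_def)
      also have "\<dots> \<le> K powr q * lam powr (- n * m)"
      proof (rule mult_right_mono)
       have "2 powr q * C powr 1 * A powr (q - 2) \<le> 4 powr q * C powr q * A powr q"
        using 4 AC by (intro mult_mono powr_mono powr_mono2) auto
       also have "\<dots> = K powr q" using AC by (simp add: K_def powr_mult)
       finally show "2 powr q * C powr 1 * A powr (q - 2) \<le> K powr q" .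
      qed simp
      finally show ?thesis using interp_high[OF 4 fm sp] Eq by auto
     qed
    qed
    then obtain B where B: "(NN x. ennreal (norm (Top h f x) powr q)) \<le> ennreal B * (NN x. ennreal (norm (f x) powr q))" "B \<le> E powr q"
     by blast
    have "(NN x. ennreal (norm (Top h f x) powr q)) \<le> ennreal (E powr q) * (NN x. ennreal (norm (f x) powr q))"
     by (rule order_trans[OF B(1)]) (intro mult_right_mono ennreal_leI B(2), simp)
    then show "Top h f \<in> Lp_space p lborel \<and> Lp_norm p lborel (Top h f) \<le> ennreal E * Lp_norm p lborel f"
     unfolding q_def using T_meas[OF fm] by (intro Lp_bound_of_nn_integral[OF p False f _ E]) simp_all
   qed
  qed
 qed
qed

end

section \<open>From rank and finite type to the sublevel bounds\<close>

lemma bij_axis_pairs: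
 "bij_betw (case_sum (\<lambda>i. (axis i 1, 0)) (\<lambda>j. (0, axis j 1))) (UNIV :: ('n + 'n) set) (Basis :: ((real^'n::finite) \<times> (real^'n)) set)"
 unfolding bij_betw_def
proof
 show "inj (case_sum (\<lambda>i. (axis i 1, 0)) (\<lambda>j. (0, axis j 1)) :: 'n + 'n \<Rightarrow> (real^'n) \<times> (real^'n))"
  by (rule injI) (auto simp: axis_eq_axis axis_eq_0_iff split: sum.splits)
 show "range (case_sum (\<lambda>i. (axis i 1, 0)) (\<lambda>j. (0, axis j 1))) = (Basis :: ((real^'n) \<times> (real^'n)) set)"
  by (auto simp: Basis_prod_def Basis_vec_def UNIV_Plus_UNIV[symmetric] image_Un image_image Plus_def split: sum.splits)
qed

text \<open>The second identity rests on the symmetry of second derivatives. Since rank and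
  determinant are invariant under transposition, the single weight given by the mixed Hessian serves
  both projections.\<close>

lemma mixed_hessian_eq_matrix:
 fixes S :: "(real^'n) \<times> (real^'n) \<Rightarrow> real"
 assumes S: "smooth_on UNIV S"
 shows "matrix (\<lambda>v. FD (grad_x S) q (0, v)) = mixed_hessian S q"
  and "matrix (\<lambda>v. FD (\<lambda>r. grad_theta S (prod.swap r)) q (0, v)) = transpose (mixed_hessian S (prod.swap q))"
proof -
 have comp: "FD G q v $ i = FD (\<lambda>r. G r $ i) q v"
  if "smooth_on UNIV G" for G :: "(real^'n) \<times> (real^'n) \<Rightarrow> real^'n" and q v i
 proof -
  have "(G has_derivative FD G q) (at q)" by (rule smooth_on_has_derivative[OF that]) simp
  from bounded_linear.has_derivative[OF bounded_linear_vec_nth this, of i]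
  have "FD (\<lambda>r. G r $ i) q = (\<lambda>v. FD G q v $ i)"
   by (rule frechet_derivative_at[symmetric])
  then show ?thesis by simp
 qed
 have gx: "smooth_on UNIV (grad_x S)" and gt: "smooth_on UNIV (grad_theta S)"
  unfolding grad_x_def[abs_def] grad_theta_def[abs_def] by (intro smooth_on_vec smooth_intros S open_UNIV)+
 show "matrix (\<lambda>v. FD (grad_x S) q (0, v)) = mixed_hessian S q"
  by (simp add: vec_eq_iff matrix_def mixed_hessian_def comp[OF gx])
 have bl: "bounded_linear (prod.swap :: (real^'n) \<times> (real^'n) \<Rightarrow> _)"
  unfolding prod.swap_def by (intro bounded_linear_Pair bounded_linear_fst bounded_linear_snd)
 have "(grad_theta S has_derivative FD (grad_theta S) (prod.swap q)) (at (prod.swap q))"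
  by (rule smooth_on_has_derivative[OF gt]) simp
 from has_derivative_compose[OF bounded_linear_imp_has_derivative[OF bl] this]
 have sw: "FD (\<lambda>r. grad_theta S (prod.swap r)) q = (\<lambda>v. FD (grad_theta S) (prod.swap q) (prod.swap v))"
  by (rule frechet_derivative_at[symmetric])
 show "matrix (\<lambda>v. FD (\<lambda>r. grad_theta S (prod.swap r)) q (0, v)) = transpose (mixed_hessian S (prod.swap q))"
  unfolding sw
  by (simp add: vec_eq_iff matrix_def transpose_def mixed_hessian_def comp[OF gt])
   (simp add: grad_theta_def grad_x_def mixed_derivatives_symmetric[OF S])
qed

lemma rank_matrix_partial:
 fixes g :: "(real^'n) \<times> (real^'n) \<Rightarrow> real^'n"
 assumes "smooth_on UNIV g"
 shows "rank (matrix (\<lambda>v. FD g q (0, v))) = dim (range (\<lambda>v. FD g q (0, v)))"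
proof -
 have "linear (\<lambda>v. FD g q (0, v))"
 proof -
  have "(g has_derivative FD g q) (at q)" by (rule smooth_on_has_derivative[OF assms]) simp
  then have l: "linear (FD g q)" by (rule has_derivative_linear)
  have "linear (\<lambda>v::real^'n. (0::real^'n, v))" by (auto intro!: linearI)
  from linear_compose[OF this l] show ?thesis by (simp add: o_def)
 qed
 then show ?thesis unfolding rank_dim_range by (simp add: matrix_vector_mul)
qed

text \<open>Allows the sublevel estimate, stated for the second variable, to be used with the roles
  of x and theta exchanged.\<close>

lemma fibres_swap:
 assumes "\<And>z. finite {q \<in> B \<times> A. f q = z}" "\<And>z. card {q \<in> B \<times> A. f q = z} \<le> N"
 shows "finite {q \<in> A \<times> B. f (prod.swap q) = z}" "card {q \<in> A \<times> B. f (prod.swap q) = z} \<le> N"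
proof -
 have eq: "{q \<in> A \<times> B. f (prod.swap q) = z} = prod.swap ` {q \<in> B \<times> A. f q = z}" by (auto simp: image_iff)
 show "finite {q \<in> A \<times> B. f (prod.swap q) = z}" unfolding eq using assms(1) by (rule finite_imageI)
 show "card {q \<in> A \<times> B. f (prod.swap q) = z} \<le> N" unfolding eq using card_image_le[OF assms(1)] assms(2) by (rule order_trans)
qed

theorem corollary2:
  fixes S :: "(real^'n) \<times> (real^'n) \<Rightarrow> real"
    and \<psi> :: "(real^'n) \<times> (real^'n) \<Rightarrow> complex"
    and c :: real
  assumes S_smooth: "smooth_on UNIV S"
    and psi_smooth: "smooth_on UNIV \<psi>"
    and psi_supp: "compact (closure {q. \<psi> q \<noteq> 0})"
    and rank: "\<And>q. rank (mixed_hessian S q) \<ge> CARD('n) - 1"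
    and type_L: "\<exists>k. type_at_most (proj_L S) k"
    and type_R: "\<exists>k. type_at_most (proj_R S) k"
    and psi_bound: "\<And>q. cmod (\<psi> q) \<le> c * \<bar>det (mixed_hessian S q)\<bar>"
  shows "\<exists>C::real. \<forall>lam\<ge>1. \<forall>p::ennreal. 1 \<le> p \<longrightarrow>
    Lp_opnorm p lborel (osc_op S \<psi> lam)
      \<le> ennreal (C * lam powr (- real CARD('n) / 2 + real CARD('n) * \<bar>enn2real (1 / p) - 1 / 2\<bar>))"
proof -
 obtain R0 where R0: "R0 \<ge> 0" "\<And>q. \<psi> q \<noteq> 0 \<Longrightarrow> norm q \<le> R0"
 proof -
  have "bounded {q. \<psi> q \<noteq> 0}" using compact_imp_bounded[OF psi_supp] bounded_subset[OF _ closure_subset] by blast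
  then obtain r where r: "\<And>q. q \<in> {q. \<psi> q \<noteq> 0} \<Longrightarrow> norm q \<le> r" unfolding bounded_iff by blast
  show ?thesis by (rule that[of "\<bar>r\<bar>"]) (use r in force)+
 qed
 define Q where "Q = (cball 0 (R0 + 2) :: (real^'n) set)"
 have Q: "compact Q" by (simp add: Q_def)
 have QQ: "compact (Q \<times> Q)" using Q by (intro compact_Times)
 have gx: "smooth_on UNIV (grad_x S)" and gt: "smooth_on UNIV (grad_theta S)"
  unfolding grad_x_def[abs_def] grad_theta_def[abs_def] by (intro smooth_on_vec smooth_intros S_smooth open_UNIV)+
 have bl: "bounded_linear (prod.swap :: (real^'n) \<times> (real^'n) \<Rightarrow> _)"
  unfolding prod.swap_def by (intro bounded_linear_Pair bounded_linear_fst bounded_linear_snd)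
 have gts: "smooth_on UNIV (\<lambda>r. grad_theta S (prod.swap r))" by (rule smooth_on_compose_linear[OF bl gt])
 obtain kL where kL: "type_at_most (proj_L S) kL" using type_L by blast
 obtain kR where kR: "type_at_most (proj_R S) kR" using type_R by blast
 obtain NL where NL: "\<And>z. finite {q \<in> Q \<times> Q. proj_L S q = z}" "\<And>z. card {q \<in> Q \<times> Q. proj_L S q = z} \<le> NL"
  by (rule type_at_most_bounded_fibres[OF bij_axis_pairs kL QQ]) blast
 obtain NR where NR: "\<And>z. finite {q \<in> Q \<times> Q. proj_R S q = z}" "\<And>z. card {q \<in> Q \<times> Q. proj_R S q = z} \<le> NR"
  by (rule type_at_most_bounded_fibres[OF bij_axis_pairs kR QQ]) blast
 have rkL: "CARD('n) \<le> dim (range (\<lambda>v. frechet_derivative (grad_x S) (at q) (0, v))) + 1" for q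
  using rank[of q] unfolding rank_matrix_partial[OF gx, symmetric] mixed_hessian_eq_matrix(1)[OF S_smooth] by linarith
 have rkR: "CARD('n) \<le> dim (range (\<lambda>v. frechet_derivative (\<lambda>r. grad_theta S (prod.swap r)) (at q) (0, v))) + 1" for q
  using rank[of "prod.swap q"]
  unfolding rank_matrix_partial[OF gts, symmetric] mixed_hessian_eq_matrix(2)[OF S_smooth] rank_transpose by linarith
 \<comment> \<open>\<open>proj_L S q\<close> is the pair of \<open>fst q\<close> and
   \<open>grad_x S q\<close>, so its fibre bound is literally the multiplicity hypothesis of the
   sublevel estimate.\<close>
 obtain CL where CL: "CL \<ge> 0" "\<And>x \<xi> r h. x \<in> Q \<Longrightarrow> 0 < h \<Longrightarrow> h \<le> 1 \<Longrightarrow> h \<le> r \<Longrightarrow>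
   (NN t. ennreal (\<bar>det (mixed_hessian S (x, t))\<bar> + h) *
     indicator {t \<in> Q. norm (grad_x S (x, t) - \<xi>) \<le> r} t) \<le> ennreal (CL * r ^ CARD('n))"
  using weighted_sublevel[OF gx rkL Q Q NL[unfolded proj_L_def], unfolded mixed_hessian_eq_matrix(1)[OF S_smooth]] by blast
 obtain CR where CR: "CR \<ge> 0" "\<And>t \<xi> r h. t \<in> Q \<Longrightarrow> 0 < h \<Longrightarrow> h \<le> 1 \<Longrightarrow> h \<le> r \<Longrightarrow>
   (NN x. ennreal (\<bar>det (mixed_hessian S (x, t))\<bar> + h) *
     indicator {x \<in> Q. norm (grad_theta S (x, t) - \<xi>) \<le> r} x) \<le> ennreal (CR * r ^ CARD('n))"
  using weighted_sublevel[OF gts rkR Q Q fibres_swap[of Q Q "proj_R S" NR, OF NR, unfolded proj_R_def snd_swap],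
    unfolded mixed_hessian_eq_matrix(2)[OF S_smooth] det_transpose swap_simp] by blast
 interpret damped_oscillation S \<psi> R0 c CL CR
 proof
  show "q \<in> cball 0 R0 \<times> cball 0 R0" if "\<psi> q \<noteq> 0" for q
   using R0(2)[OF that] norm_fst_le[of "fst q" "snd q"] norm_snd_le[of "snd q" "fst q"] by (auto simp: mem_Times_iff)
  show "(NN t. ennreal (\<bar>det (mixed_hessian S (x, t))\<bar> + h) *
     indicator {t \<in> cball 0 (R0 + 2). norm (grad_x S (x, t) - \<xi>) \<le> r} t) \<le> ennreal (CL * r ^ CARD('n))"
   if "norm x \<le> R0 + 2" "0 < h" "h \<le> 1" "h \<le> r" for x \<xi> r h
   by (rule CL(2)[unfolded Q_def]) (use that in auto)
  show "(NN x. ennreal (\<bar>det (mixed_hessian S (x, t))\<bar> + h) *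
     indicator {x \<in> cball 0 (R0 + 2). norm (grad_theta S (x, t) - \<xi>) \<le> r} x) \<le> ennreal (CR * r ^ CARD('n))"
   if "norm t \<le> R0 + 2" "0 < h" "h \<le> 1" "h \<le> r" for t \<xi> r h
   by (rule CR(2)[unfolded Q_def]) (use that in auto)
 qed (rule S_smooth psi_smooth R0(1) psi_bound CL(1) CR(1))+
 show ?thesis by (rule osc_op_Lp_bound)
qed

end
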